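(* Let $I\subseteq\mathbb{R}$ be an open interval (bounded or unbounded), let $\gamma\in C^2(\overline{I};\mathbb{R}^2)$ be a unit-speed curve whose curvature $\kappa:=\det(\dot\gamma,\ddot\gamma)$ is bounded and uniformly continuous on $I$ and has weak derivative $\kappa'\in L^\infty(I)$, and assume that the strip map $\mathcal{L}_\varepsilon(s,t):=\gamma(s)+\varepsilon t\,n(s)$, $n:=(-\dot\gamma^2,\dot\gamma^1)$, is injective on $\overline{I}\times[0,1]$ for the values of $\varepsilon>0$ under consideration. Fix a number $k>-\inf_I\kappa$. Let $\hat H_\varepsilon$ and $\hat H_0$ be the self-adjoint operators in $L^2(I\times(0,1))$ defined in the context. Then there exist positive constants $\varepsilon_0$ and $C_0$, depending uniquely on $k$ and the supremum norms of $\kappa$ and $\kappa'$, such that for all $\varepsilon\in(0,\varepsilon_0)$, $$\left\|\left[\hat H_\varepsilon-\left(\frac{\pi}{2\varepsilon}\right)^2+\frac{k}{\varepsilon}\right]^{-1}-\left[\hat H_0-\left(\frac{\pi}{2\varepsilon}\right)^2+\frac{k}{\varepsilon}\right]^{-1}\right\|\le C_0\,\varepsilon^{3/2},$$ where $\|\cdot\|$ is the operator norm in $L^2(I\times(0,1))$.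
   Context: It is assumed that $\varepsilon\sup_I|\kappa|<1$. Put $h_\varepsilon(s,t):=1-\kappa(s)\,\varepsilon\,t$ and $\Omega_\varepsilon:=\mathcal{L}_\varepsilon(I\times(0,1))$; then $\mathcal{L}_\varepsilon$ is a diffeomorphism of $I\times(0,1)$ onto $\Omega_\varepsilon$ with Jacobian $\varepsilon h_\varepsilon$. Let $-\Delta_{DN}^{\Omega_\varepsilon}$ be the self-adjoint operator in $L^2(\Omega_\varepsilon)$ associated with the form $\Psi\mapsto\int_{\Omega_\varepsilon}|\nabla\Psi|^2$ with domain $\{\Psi\in W^{1,2}(\Omega_\varepsilon):\Psi=0\text{ on }\partial\Omega_\varepsilon\setminus\mathcal{L}_\varepsilon(I\times\{1\})\}$ (traces). It is unitarily equivalent, via $\Psi\mapsto\sqrt{\varepsilon}\,\Psi\circ\mathcal{L}_\varepsilon$, to the operator $H_\varepsilon$ in $\mathcal{H}_\varepsilon:=L^2(I\times(0,1),h_\varepsilon\,ds\,dt)$ associated with the form $$Q_\varepsilon[\psi]=\int_{I\times(0,1)}\frac{|\partial_1\psi|^2}{h_\varepsilon}\,ds\,dt+\int_{I\times(0,1)}\frac{|\partial_2\psi|^2}{\varepsilon^2}\,h_\varepsilon\,ds\,dt,$$ with domain $\mathcal{Q}:=\{\psi\in W^{1,2}(I\times(0,1)):\psi=0\text{ on }\partial(I\times(0,1))\setminus(I\times\{1\})\}$. With the unitary map $\hat U_\varepsilon:\mathcal{H}_\varepsilon\to L^2(I\times(0,1))$, $\hat U_\varepsilon\psi:=\sqrt{h_\varepsilon}\,\psi$,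 set $\hat H_\varepsilon:=\hat U_\varepsilon H_\varepsilon\hat U_\varepsilon^{-1}$; i.e. $\hat H_\varepsilon$ is the self-adjoint operator in $L^2(I\times(0,1))$ associated with the form $\hat Q_\varepsilon[\psi]:=Q_\varepsilon[h_\varepsilon^{-1/2}\psi]$, $\psi\in\mathcal{Q}$. The comparison operator (which still depends on $\varepsilon$; the subscript $0$ is only notation) is $$\hat H_0:=\Big(-\Delta_D^I+\frac{\kappa}{\varepsilon}\Big)\otimes1+1\otimes\Big(-\frac1{\varepsilon^2}\Delta_{DN}^{(0,1)}\Big)\quad\text{in }L^2(I)\otimes L^2((0,1))\cong L^2(I\times(0,1)),$$ where $-\Delta_D^I$ is the Dirichlet Laplacian in $L^2(I)$ and $-\Delta_{DN}^{(0,1)}$ is the Laplacian in $L^2((0,1))$ with Dirichlet condition at $0$ and Neumann condition at $1$. For $k>-\inf_I\kappa$, the operators $\hat H_\varepsilon-\pi^2/(2\varepsilon)^2+k/\varepsilon$ and $\hat H_0-\pi^2/(2\varepsilon)^2+k/\varepsilon$ are positive for all sufficiently small $\varepsilon$.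
   Formalization: The constants may depend, besides k and the supremum norms of κ and κ', on a lower bound m > -k of κ (e.g. m = inf κ); constants independent of the gap k + inf κ cannot exist, since the resolvent difference need not tend to 0 uniformly as inf κ tends to -k. *)

theory Defs
  imports "HOL-Probability.Essential_Supremum"
begin

section \<open>Square-integrable functions and unbounded operators\<close>

text \<open>
  Elements of the complex Hilbert space \<open>L2 M\<close> are represented by functions; functions that agree
  almost everywhere stand for the same element.  An (unbounded) operator is represented by its graph,
  a set of pairs of functions closed under almost-everywhere equality.
\<close>

definition L2 :: "'a measure \<Rightarrow> ('a \<Rightarrow> complex) set" where
  "L2 M = {u \<in> borel_measurable M. integrable M (\<lambda>x. (norm (u x))\<^sup>2)}"

definition L2_inner :: "'a measure \<Rightarrow> ('a \<Rightarrow> complex) \<Rightarrow> ('a \<Rightarrow> complex) \<Rightarrow> complex" where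
  "L2_inner M u v = (LINT x|M. u x * cnj (v x))"

definition L2_norm :: "'a measure \<Rightarrow> ('a \<Rightarrow> complex) \<Rightarrow> real" where
  "L2_norm M u = sqrt (LINT x|M. (norm (u x))\<^sup>2)"

type_synonym 'a operator = "(('a \<Rightarrow> complex) \<times> ('a \<Rightarrow> complex)) set"

text \<open>The operator associated with the sesquilinear form \<open>q\<close> with domain \<open>Q\<close>
  (first representation theorem).\<close>

definition form_operator ::
  "'a measure \<Rightarrow> ('a \<Rightarrow> complex) set \<Rightarrow> (('a \<Rightarrow> complex) \<Rightarrow> ('a \<Rightarrow> complex) \<Rightarrow> complex) \<Rightarrow> 'a operator"
  where
  "form_operator M Q q = {(u, f). u \<in> Q \<and> f \<in> L2 M \<and> (\<forall>v\<in>Q. q u v = L2_inner M f v)}"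

definition op_add_mult :: "'a operator \<Rightarrow> ('a \<Rightarrow> real) \<Rightarrow> 'a operator" where
  "op_add_mult A V = (\<lambda>(u, f). (u, \<lambda>x. f x + of_real (V x) * u x)) ` A"

definition op_scale :: "real \<Rightarrow> 'a operator \<Rightarrow> 'a operator" where
  "op_scale c A = (\<lambda>(u, f). (u, \<lambda>x. of_real c * f x)) ` A"

definition op_diff :: "'a operator \<Rightarrow> 'a operator \<Rightarrow> 'a operator" where
  "op_diff S T = {(f, \<lambda>x. u x - v x) | f u v. (f, u) \<in> S \<and> (f, v) \<in> T}"

definition op_closure :: "'a measure \<Rightarrow> 'a operator \<Rightarrow> 'a operator" where
  "op_closure M T = {(u, f). u \<in> L2 M \<and> f \<in> L2 M \<and>
     (\<exists>U F. (\<forall>n. (U n, F n) \<in> T) \<and>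
        (\<lambda>n. L2_norm M (\<lambda>x. U n x - u x)) \<longlonglongrightarrow> 0 \<and>
        (\<lambda>n. L2_norm M (\<lambda>x. F n x - f x)) \<longlonglongrightarrow> 0)}"

text \<open>Linear, everywhere defined and bounded; with linearity, the bound also makes the operator
  single-valued up to almost-everywhere equality.\<close>

definition bounded_operator :: "'a measure \<Rightarrow> 'a operator \<Rightarrow> bool" where
  "bounded_operator M T \<longleftrightarrow>
     T \<subseteq> L2 M \<times> L2 M \<and> Domain T = L2 M \<and>
     (\<forall>f u g v a b. (f, u) \<in> T \<longrightarrow> (g, v) \<in> T \<longrightarrow>
        (\<lambda>x. a * f x + b * g x, \<lambda>x. a * u x + b * v x) \<in> T) \<and>
     (\<exists>C. \<forall>(f, u)\<in>T. L2_norm M u \<le> C * L2_norm M f)"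

definition operator_norm :: "'a measure \<Rightarrow> 'a operator \<Rightarrow> ennreal" where
  "operator_norm M T = (SUP (f, u)\<in>{(f, u)\<in>T. L2_norm M f \<le> 1}. ennreal (L2_norm M u))"

text \<open>\<open>A \<otimes> 1 + 1 \<otimes> B\<close>: the closure of the operator defined on the algebraic tensor product of
  the domains, under the identification of \<open>f \<otimes> g\<close> with \<open>(s, t) \<mapsto> f s * g t\<close>.\<close>

definition algebraic_tensor_sum :: "'a operator \<Rightarrow> 'b operator \<Rightarrow> ('a \<times> 'b) operator" where
  "algebraic_tensor_sum A B =
     {(\<lambda>(s, t). \<Sum>i<n. f i s * g i t,
       \<lambda>(s, t). \<Sum>i<n. F i s * g i t + f i s * G i t) | (n::nat) f F g G.
       (\<forall>i<n. (f i, F i) \<in> A) \<and> (\<forall>i<n. (g i, G i) \<in> B)}"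

definition tensor_sum :: "('a \<times> 'b) measure \<Rightarrow> 'a operator \<Rightarrow> 'b operator \<Rightarrow> ('a \<times> 'b) operator" where
  "tensor_sum M A B = op_closure M (algebraic_tensor_sum A B)"

section \<open>Weak derivatives, Sobolev spaces and traces\<close>

text \<open>Lebesgue measure on the Borel subsets of \<open>U\<close>; every Lebesgue measurable function has a Borel
  representative.\<close>

abbreviation lebesgue_on_open :: "'a::euclidean_space set \<Rightarrow> 'a measure" where
  "lebesgue_on_open U \<equiv> restrict_space lborel U"

text \<open>\<open>D [h\<^sub>1, \<dots>, h\<^sub>m]\<close> is the iterated directional derivative of \<open>\<phi>\<close> along \<open>h\<^sub>m, \<dots>, h\<^sub>1\<close>.\<close>

definition smooth :: "('a::euclidean_space \<Rightarrow> 'b::real_normed_vector) \<Rightarrow> bool" where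
  "smooth \<phi> \<longleftrightarrow> (\<exists>D. D [] = \<phi> \<and> (\<forall>l x. (D l has_derivative (\<lambda>h. D (h # l) x)) (at x)))"

definition test_functions :: "'a::euclidean_space set \<Rightarrow> ('a \<Rightarrow> 'b::real_normed_vector) set" where
  "test_functions U =
     {\<phi>. smooth \<phi> \<and> compact (closure {x. \<phi> x \<noteq> 0}) \<and> closure {x. \<phi> x \<noteq> 0} \<subseteq> U}"

text \<open>To be used for locally integrable \<open>u\<close> and \<open>g\<close> only.\<close>

definition is_weak_deriv ::
  "'a::euclidean_space set \<Rightarrow> 'a \<Rightarrow> ('a \<Rightarrow> 'b::{banach, second_countable_topology}) \<Rightarrow> ('a \<Rightarrow> 'b) \<Rightarrow> bool"
  where
  "is_weak_deriv U e u g \<longleftrightarrow>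
     (\<forall>\<phi>\<in>test_functions U :: ('a \<Rightarrow> real) set.
        (LINT x|lebesgue_on_open U. frechet_derivative \<phi> (at x) e *\<^sub>R u x)
        = - (LINT x|lebesgue_on_open U. \<phi> x *\<^sub>R g x))"

definition W12 :: "'a::euclidean_space set \<Rightarrow> ('a \<Rightarrow> complex) set" where
  "W12 U = {u \<in> L2 (lebesgue_on_open U).
     \<forall>e\<in>Basis. \<exists>g\<in>L2 (lebesgue_on_open U). is_weak_deriv U e u g}"

definition weak_deriv :: "'a::euclidean_space set \<Rightarrow> 'a \<Rightarrow> ('a \<Rightarrow> complex) \<Rightarrow> 'a \<Rightarrow> complex" where
  "weak_deriv U e u = (SOME g. g \<in> L2 (lebesgue_on_open U) \<and> is_weak_deriv U e u g)"

definition W12_norm :: "'a::euclidean_space set \<Rightarrow> ('a \<Rightarrow> complex) \<Rightarrow> real" where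
  "W12_norm U u = sqrt ((L2_norm (lebesgue_on_open U) u)\<^sup>2
     + (\<Sum>e\<in>Basis. (L2_norm (lebesgue_on_open U) (weak_deriv U e u))\<^sup>2))"

text \<open>The trace of \<open>u \<in> W12 U\<close> on a part of the boundary with surface measure \<open>\<nu>\<close> is \<open>g \<in> L2 \<nu>\<close>.
  Traces are the continuous extension of restriction to the boundary, defined first for functions
  that are smooth up to the boundary.\<close>

definition has_trace ::
  "'a::euclidean_space set \<Rightarrow> 'a measure \<Rightarrow> ('a \<Rightarrow> complex) \<Rightarrow> ('a \<Rightarrow> complex) \<Rightarrow> bool" where
  "has_trace U \<nu> u g \<longleftrightarrow> u \<in> W12 U \<and> g \<in> L2 \<nu> \<and>
     (\<exists>\<psi>. (\<forall>n::nat. \<psi> n \<in> test_functions UNIV) \<and>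
        (\<lambda>n. W12_norm U (\<lambda>x. \<psi> n x - u x)) \<longlonglongrightarrow> 0 \<and>
        (\<lambda>n. L2_norm \<nu> (\<lambda>x. \<psi> n x - g x)) \<longlonglongrightarrow> 0)"

section \<open>One-dimensional Laplacians\<close>

text \<open>The Laplacian on an interval \<open>J\<close>, with Dirichlet conditions on the set \<open>\<Gamma>\<close> of boundary points and
  Neumann conditions on the others.  Surface measure on a zero-dimensional boundary is counting
  measure.\<close>

definition neg_laplacian_1d :: "real set \<Rightarrow> real set \<Rightarrow> real operator" where
  "neg_laplacian_1d J \<Gamma> = form_operator (lebesgue_on_open J)
     {u \<in> W12 J. has_trace J (count_space \<Gamma>) u (\<lambda>_. 0)}
     (\<lambda>u v. LINT s|lebesgue_on_open J. weak_deriv J 1 u s * cnj (weak_deriv J 1 v s))"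

section \<open>The strip\<close>

definition velocity :: "real set \<Rightarrow> (real \<Rightarrow> real \<times> real) \<Rightarrow> real \<Rightarrow> real \<times> real" where
  "velocity I \<gamma> s = vector_derivative \<gamma> (at s within closure I)"

definition acceleration :: "real set \<Rightarrow> (real \<Rightarrow> real \<times> real) \<Rightarrow> real \<Rightarrow> real \<times> real" where
  "acceleration I \<gamma> = velocity I (velocity I \<gamma>)"

definition C2_closure :: "real set \<Rightarrow> (real \<Rightarrow> real \<times> real) \<Rightarrow> bool" where
  "C2_closure I \<gamma> \<longleftrightarrow> \<gamma> differentiable_on closure I \<and> velocity I \<gamma> differentiable_on closure I \<and>
     continuous_on (closure I) (acceleration I \<gamma>)"

definition curvature :: "real set \<Rightarrow> (real \<Rightarrow> real \<times> real) \<Rightarrow> real \<Rightarrow> real" where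
  "curvature I \<gamma> s = fst (velocity I \<gamma> s) * snd (acceleration I \<gamma> s)
     - snd (velocity I \<gamma> s) * fst (acceleration I \<gamma> s)"

definition normal_vector :: "real set \<Rightarrow> (real \<Rightarrow> real \<times> real) \<Rightarrow> real \<Rightarrow> real \<times> real" where
  "normal_vector I \<gamma> s = (- snd (velocity I \<gamma> s), fst (velocity I \<gamma> s))"

definition strip_map :: "real set \<Rightarrow> (real \<Rightarrow> real \<times> real) \<Rightarrow> real \<Rightarrow> real \<times> real \<Rightarrow> real \<times> real" where
  "strip_map I \<gamma> \<epsilon> = (\<lambda>(s, t). \<gamma> s + (\<epsilon> * t) *\<^sub>R normal_vector I \<gamma> s)"

definition admissible_curve :: "real set \<Rightarrow> (real \<Rightarrow> real \<times> real) \<Rightarrow> (real \<Rightarrow> real) \<Rightarrow> bool" where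
  "admissible_curve I \<gamma> \<kappa>' \<longleftrightarrow>
     open I \<and> is_interval I \<and> I \<noteq> {} \<and>
     C2_closure I \<gamma> \<and> (\<forall>s\<in>closure I. norm (velocity I \<gamma> s) = 1) \<and>
     bounded (curvature I \<gamma> ` I) \<and> uniformly_continuous_on I (curvature I \<gamma>) \<and>
     \<kappa>' \<in> borel_measurable (lebesgue_on_open I) \<and>
     esssup (lebesgue_on_open I) (\<lambda>s. ereal \<bar>\<kappa>' s\<bar>) < \<infinity> \<and>
     is_weak_deriv I 1 (curvature I \<gamma>) \<kappa>'"

text \<open>From here on \<open>\<kappa>\<close> is the curvature function of the strip.\<close>

abbreviation strip :: "real set \<Rightarrow> (real \<times> real) set" where
  "strip I \<equiv> I \<times> {0<..<1}"

definition h_eps :: "(real \<Rightarrow> real) \<Rightarrow> real \<Rightarrow> real \<times> real \<Rightarrow> real" where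
  "h_eps \<kappa> \<epsilon> = (\<lambda>(s, t). 1 - \<kappa> s * \<epsilon> * t)"

definition strip_measure :: "real set \<Rightarrow> (real \<times> real) measure" where
  "strip_measure I = lebesgue_on_open (strip I)"

definition weighted_strip_measure ::
  "real set \<Rightarrow> (real \<Rightarrow> real) \<Rightarrow> real \<Rightarrow> (real \<times> real) measure" where
  "weighted_strip_measure I \<kappa> \<epsilon> = density (strip_measure I) (\<lambda>x. ennreal (h_eps \<kappa> \<epsilon> x))"

text \<open>The Dirichlet part of the boundary consists of the side \<open>I \<times> {0}\<close> and, for every finite
  endpoint \<open>a\<close> of \<open>I\<close>, of the side \<open>{a} \<times> (0, 1)\<close>.\<close>

definition form_domain :: "real set \<Rightarrow> (real \<times> real \<Rightarrow> complex) set" where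
  "form_domain I = {u \<in> W12 (strip I).
     has_trace (strip I) (distr (lebesgue_on_open I) borel (\<lambda>s. (s, 0))) u (\<lambda>_. 0) \<and>
     (\<forall>a\<in>frontier I.
        has_trace (strip I) (distr (lebesgue_on_open {0<..<1}) borel (\<lambda>t. (a, t))) u (\<lambda>_. 0))}"

text \<open>The sesquilinear form obtained from the quadratic form \<open>Q\<^sub>\<epsilon>\<close> by polarization.\<close>

definition Q_form :: "real set \<Rightarrow> (real \<Rightarrow> real) \<Rightarrow> real \<Rightarrow>
    (real \<times> real \<Rightarrow> complex) \<Rightarrow> (real \<times> real \<Rightarrow> complex) \<Rightarrow> complex" where
  "Q_form I \<kappa> \<epsilon> u v =
     (LINT x|strip_measure I.
        weak_deriv (strip I) (1, 0) u x * cnj (weak_deriv (strip I) (1, 0) v x) / of_real (h_eps \<kappa> \<epsilon> x))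
   + (LINT x|strip_measure I.
        weak_deriv (strip I) (0, 1) u x * cnj (weak_deriv (strip I) (0, 1) v x) / of_real (\<epsilon>\<^sup>2)
          * of_real (h_eps \<kappa> \<epsilon> x))"

definition H_eps :: "real set \<Rightarrow> (real \<Rightarrow> real) \<Rightarrow> real \<Rightarrow> (real \<times> real) operator" where
  "H_eps I \<kappa> \<epsilon> = form_operator (weighted_strip_measure I \<kappa> \<epsilon>) (form_domain I) (Q_form I \<kappa> \<epsilon>)"

text \<open>Conjugation of \<open>H_eps\<close> by the unitary map \<open>\<psi> \<mapsto> sqrt h\<^sub>\<epsilon> * \<psi>\<close>.\<close>

definition H_hat_eps :: "real set \<Rightarrow> (real \<Rightarrow> real) \<Rightarrow> real \<Rightarrow> (real \<times> real) operator" where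
  "H_hat_eps I \<kappa> \<epsilon> = {(v, g). v \<in> L2 (strip_measure I) \<and> g \<in> L2 (strip_measure I) \<and>
     (\<exists>(u, f)\<in>H_eps I \<kappa> \<epsilon>.
        (AE x in strip_measure I. v x = of_real (sqrt (h_eps \<kappa> \<epsilon> x)) * u x) \<and>
        (AE x in strip_measure I. g x = of_real (sqrt (h_eps \<kappa> \<epsilon> x)) * f x))}"

definition H_hat_0 :: "real set \<Rightarrow> (real \<Rightarrow> real) \<Rightarrow> real \<Rightarrow> (real \<times> real) operator" where
  "H_hat_0 I \<kappa> \<epsilon> = tensor_sum (strip_measure I)
     (op_add_mult (neg_laplacian_1d I (frontier I)) (\<lambda>s. \<kappa> s / \<epsilon>))
     (op_scale (1 / \<epsilon>\<^sup>2) (neg_laplacian_1d {0<..<1} {0}))"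

text \<open>\<open>[H - (\<pi> / (2 * \<epsilon>))\<^sup>2 + k / \<epsilon>]\<^sup>-\<^sup>1\<close>\<close>

definition shifted_inverse :: "real \<Rightarrow> real \<Rightarrow> 'a operator \<Rightarrow> 'a operator" where
  "shifted_inverse k \<epsilon> H = (op_add_mult H (\<lambda>_. - (pi / (2 * \<epsilon>))\<^sup>2 + k / \<epsilon>))\<inverse>"

end

theory Submission
  imports Defs
begin

text \<open>
  Solving \<open>(H - (\<pi> / (2 * \<epsilon>))\<^sup>2 + k / \<epsilon>) u = f\<close> for the operator in the weighted space and for the comparison
  operator amounts to two variational problems with sesquilinear forms \<open>q1\<close> and \<open>q0\<close> on the same domain.
  Splitting off the first transversal mode \<open>\<Theta> t = sqrt 2 * sin (\<pi> * t / 2)\<close>, \<open>u = a \<Theta> + u_perp\<close>, the form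
  \<open>q0\<close> dominates \<open>\<parallel>\<partial>\<^sub>1 u\<parallel>\<^sup>2 + \<parallel>\<partial>\<^sub>2 u_perp\<parallel>\<^sup>2 / \<epsilon>\<^sup>2 + \<parallel>u\<parallel>\<^sup>2 / \<epsilon>\<close>: the spectral gap of the
  transversal operator controls \<open>u_perp\<close>, and \<open>k + \<kappa> > 0\<close> controls \<open>a\<close>. In this energy norm \<open>q1 - q0\<close> has size
  \<open>sqrt \<epsilon>\<close>, because the terms of order \<open>1 / \<epsilon>\<close> cancel on the first mode:
  \<open>\<integral> t * (\<Theta>'\<^sup>2 - \<pi>\<^sup>2 / 4 * \<Theta>\<^sup>2) = - 1\<close>. The solutions have energy norm at most of order \<open>sqrt \<epsilon> * \<parallel>f\<parallel>\<close>, so their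
  difference has energy norm of order \<open>\<epsilon> * \<parallel>f\<parallel>\<close>, hence \<open>L2\<close> norm of order \<open>\<epsilon> * sqrt \<epsilon> * \<parallel>f\<parallel>\<close>.
  Self-adjointness of the closure of the algebraic tensor sum is replaced by surjectivity of its shift,
  which follows from the completeness of the transversal modes.
\<close>

section \<open>Square integrable functions\<close>

text \<open>The two operators are given in different ways, one by a form in a weighted space, the
  other as the closure of an algebraic tensor sum. The unknown of the curved problem is taken to be
  \<open>w = u / sqrt h\<close>: then both forms live on the same domain, no derivative of
  \<open>h\<close> appears, and \<open>sqrt h\<close> enters only as a multiplier on data and
  solutions. Domains are described by traces, that is, by test functions whose boundary values tend
  to zero without being zero. Hence identities are proved for arbitrary test functions with their
  boundary terms kept (or with boundary values subtracted), and the limit removes these terms. After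
  the cancellation on the first mode, every term of order 1 / \<epsilon> in the form difference
  contains a factor orthogonal to that mode. Such a factor costs \<epsilon> in the energy norm,
  whereas the full function only costs sqrt \<epsilon>; after division by \<epsilon> a mixed product
  is left with sqrt \<epsilon>.\<close>

lemma L2_measurable: "u \<in> L2 M \<Longrightarrow> u \<in> borel_measurable M"
  by (simp add: L2_def)

lemma L2_integrable: "u \<in> L2 M \<Longrightarrow> integrable M (\<lambda>x. (norm (u x))\<^sup>2)"
  by (simp add: L2_def)

lemma borel_measurable_cnj [measurable]:
  "u \<in> borel_measurable M \<Longrightarrow> (\<lambda>x. cnj (u x)) \<in> borel_measurable M"
  by (rule borel_measurable_continuous_on[of cnj]) (auto intro: continuous_intros)

lemma L2_bound:
  assumes "u \<in> borel_measurable M" "integrable M g" "AE x in M. (norm (u x))\<^sup>2 \<le> g x"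
  shows "u \<in> L2 M"
  unfolding L2_def using assms by (auto intro!: Bochner_Integration.integrable_bound[OF assms(2)])

lemma L2_lincomb:
  assumes "u \<in> L2 M" "v \<in> L2 M"
  shows "(\<lambda>x. a * u x + b * v x) \<in> L2 M"
proof (rule L2_bound)
  show "(\<lambda>x. a * u x + b * v x) \<in> borel_measurable M"
    using assms[THEN L2_measurable] by measurable
  show "integrable M (\<lambda>x. 2 * (norm a)\<^sup>2 * (norm (u x))\<^sup>2 + 2 * (norm b)\<^sup>2 * (norm (v x))\<^sup>2)"
    using assms[THEN L2_integrable] by (intro Bochner_Integration.integrable_add integrable_mult_right) auto
  have "(norm (a * u x + b * v x))\<^sup>2 \<le> 2 * (norm a)\<^sup>2 * (norm (u x))\<^sup>2 + 2 * (norm b)\<^sup>2 * (norm (v x))\<^sup>2" for x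
  proof -
    have "(norm (a * u x + b * v x))\<^sup>2 \<le> (norm a * norm (u x) + norm b * norm (v x))\<^sup>2"
      by (intro power_mono) (auto intro: norm_triangle_le simp: norm_mult)
    also have "\<dots> \<le> 2 * (norm a * norm (u x))\<^sup>2 + 2 * (norm b * norm (v x))\<^sup>2"
      using sum_squares_ge_zero[of "norm a * norm (u x) - norm b * norm (v x)" 0]
      by (simp add: power2_eq_square algebra_simps)
    finally show ?thesis by (simp add: power_mult_distrib algebra_simps)
  qed
  then show "AE x in M. (norm (a * u x + b * v x))\<^sup>2 \<le> 2 * (norm a)\<^sup>2 * (norm (u x))\<^sup>2 + 2 * (norm b)\<^sup>2 * (norm (v x))\<^sup>2"
    by simp
qed

lemma L2_zero [simp]: "(\<lambda>_. 0) \<in> L2 M"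
  by (simp add: L2_def)

lemma L2_diff: "u \<in> L2 M \<Longrightarrow> v \<in> L2 M \<Longrightarrow> (\<lambda>x. u x - v x) \<in> L2 M"
  using L2_lincomb[of u M v 1 "-1"] by simp

lemma L2_add: "u \<in> L2 M \<Longrightarrow> v \<in> L2 M \<Longrightarrow> (\<lambda>x. u x + v x) \<in> L2 M"
  using L2_lincomb[of u M v 1 1] by simp

lemma L2_scale: "u \<in> L2 M \<Longrightarrow> (\<lambda>x. a * u x) \<in> L2 M"
  using L2_lincomb[of u M u a 0] by simp

lemma L2_bounded_mult:
  assumes "u \<in> L2 M" "w \<in> borel_measurable M" "\<And>x. x \<in> space M \<Longrightarrow> norm (w x) \<le> B"
  shows "(\<lambda>x. w x * u x) \<in> L2 M"
proof (rule L2_bound)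
  show "(\<lambda>x. w x * u x) \<in> borel_measurable M"
    using assms(2) L2_measurable[OF assms(1)] by measurable
  show "integrable M (\<lambda>x. B\<^sup>2 * (norm (u x))\<^sup>2)"
    using L2_integrable[OF assms(1)] by simp
  show "AE x in M. (norm (w x * u x))\<^sup>2 \<le> B\<^sup>2 * (norm (u x))\<^sup>2"
    by (rule AE_I2) (auto simp: norm_mult power_mult_distrib intro!: mult_right_mono power_mono assms)
qed

lemma L2_cnj: "u \<in> L2 M \<Longrightarrow> (\<lambda>x. cnj (u x)) \<in> L2 M"
  by (auto simp: L2_def)

lemma L2_prod_integrable:
  assumes "u \<in> L2 M" "v \<in> L2 M"
  shows "integrable M (\<lambda>x. u x * v x)"
proof (rule Bochner_Integration.integrable_bound)
  show "integrable M (\<lambda>x. (norm (u x))\<^sup>2 + (norm (v x))\<^sup>2)"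
    using assms[THEN L2_integrable] by simp
  show "(\<lambda>x. u x * v x) \<in> borel_measurable M"
    using assms[THEN L2_measurable] by measurable
  have "a * b \<le> a\<^sup>2 + b\<^sup>2" if "a \<ge> 0" "b \<ge> 0" for a b :: real
    using sum_squares_bound[of a b] that mult_nonneg_nonneg[of a b] by linarith
  then show "AE x in M. norm (u x * v x) \<le> norm ((norm (u x))\<^sup>2 + (norm (v x))\<^sup>2)"
    by (simp add: norm_mult)
qed

lemma L2_inner_integrable:
  "u \<in> L2 M \<Longrightarrow> v \<in> L2 M \<Longrightarrow> integrable M (\<lambda>x. u x * cnj (v x))"
  by (rule L2_prod_integrable) (auto intro: L2_cnj)

lemma L2_inner_lincomb_left:
  assumes "u \<in> L2 M" "v \<in> L2 M" "w \<in> L2 M"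
  shows "L2_inner M (\<lambda>x. a * u x + b * v x) w = a * L2_inner M u w + b * L2_inner M v w"
  using assms[THEN L2_inner_integrable] assms
  by (simp add: L2_inner_def distrib_right mult.assoc L2_inner_integrable)

lemma L2_inner_commute: "L2_inner M v u = cnj (L2_inner M u v)"
  by (simp add: L2_inner_def mult.commute flip: Bochner_Integration.integral_cnj)

lemma L2_norm_nonneg [simp]: "0 \<le> L2_norm M u"
  by (simp add: L2_norm_def)

lemma L2_norm_sq: "(L2_norm M u)\<^sup>2 = (LINT x|M. (norm (u x))\<^sup>2)"
  by (simp add: L2_norm_def)

lemma L2_inner_self: "L2_inner M u u = of_real ((L2_norm M u)\<^sup>2)"
  unfolding L2_norm_sq L2_inner_def complex_norm_square[symmetric] integral_complex_of_real ..

lemma L2_inner_AE_cong: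
  assumes "AE x in M. u x = u' x" "AE x in M. v x = v' x"
    "u \<in> borel_measurable M" "v \<in> borel_measurable M" "u' \<in> borel_measurable M" "v' \<in> borel_measurable M"
  shows "L2_inner M u v = L2_inner M u' v'"
  unfolding L2_inner_def using assms by (intro integral_cong_AE) auto

lemma L2_norm_AE_cong:
  assumes "AE x in M. u x = u' x" "u \<in> borel_measurable M" "u' \<in> borel_measurable M"
  shows "L2_norm M u = L2_norm M u'"
proof -
  have "(LINT x|M. (norm (u x))\<^sup>2) = (LINT x|M. (norm (u' x))\<^sup>2)"
    using assms by (intro integral_cong_AE) auto
  then show ?thesis by (simp add: L2_norm_def)
qed

lemma L2_norm_cong: "(\<And>x. x \<in> space M \<Longrightarrow> u x = v x) \<Longrightarrow> L2_norm M u = L2_norm M v"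
  unfolding L2_norm_def by (auto cong: Bochner_Integration.integral_cong)

lemma L2_norm_eq_0_iff:
  assumes "u \<in> L2 M"
  shows "L2_norm M u = 0 \<longleftrightarrow> (AE x in M. u x = 0)"
proof -
  have "L2_norm M u = 0 \<longleftrightarrow> (LINT x|M. (norm (u x))\<^sup>2) = 0"
    by (simp add: L2_norm_def)
  also have "\<dots> \<longleftrightarrow> (AE x in M. (norm (u x))\<^sup>2 = 0)"
    using integral_nonneg_eq_0_iff_AE[OF L2_integrable[OF assms]] by simp
  finally show ?thesis by simp
qed

text \<open>A semi-inner product on a complex vector space of functions; it need not be definite, because
  functions that agree almost everywhere are not identified.\<close>

locale semi_inner =
  fixes V :: "('a \<Rightarrow> complex) set" and q :: "('a \<Rightarrow> complex) \<Rightarrow> ('a \<Rightarrow> complex) \<Rightarrow> complex"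
  assumes lincomb: "u \<in> V \<Longrightarrow> v \<in> V \<Longrightarrow> (\<lambda>x. a * u x + b * v x) \<in> V"
    and q_lincomb: "u \<in> V \<Longrightarrow> v \<in> V \<Longrightarrow> w \<in> V \<Longrightarrow> q (\<lambda>x. a * u x + b * v x) w = a * q u w + b * q v w"
    and q_commute: "u \<in> V \<Longrightarrow> v \<in> V \<Longrightarrow> q v u = cnj (q u v)"
    and q_nonneg: "u \<in> V \<Longrightarrow> 0 \<le> Re (q u u)"
begin

lemma diff_mem: "u \<in> V \<Longrightarrow> v \<in> V \<Longrightarrow> (\<lambda>x. u x - v x) \<in> V"
  using lincomb[of u v 1 "-1"] by simp

lemma q_lincomb_right:
  assumes "u \<in> V" "v \<in> V" "w \<in> V"
  shows "q w (\<lambda>x. a * u x + b * v x) = cnj a * q w u + cnj b * q w v"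
  using q_commute[of "\<lambda>x. a * u x + b * v x" w] q_lincomb[OF assms, of a b] assms
    q_commute[of u w] q_commute[of v w]
  by (simp add: lincomb)

lemma q_diff: 
  assumes "u \<in> V" "v \<in> V" "w \<in> V"
  shows "q (\<lambda>x. u x - v x) w = q u w - q v w"
  using q_lincomb[OF assms, of 1 "-1"] by simp

lemma Re_expand:
  assumes "u \<in> V" "v \<in> V"
  shows "Re (q (\<lambda>x. a * u x + b * v x) (\<lambda>x. a * u x + b * v x))
    = (norm a)\<^sup>2 * Re (q u u) + 2 * Re (a * cnj b * q u v) + (norm b)\<^sup>2 * Re (q v v)"
proof -
  have l: "(\<lambda>x. a * u x + b * v x) \<in> V" using assms lincomb by blast
  have "q (\<lambda>x. a * u x + b * v x) (\<lambda>x. a * u x + b * v x)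
     = a * (cnj a * q u u + cnj b * q u v) + b * (cnj a * q v u + cnj b * q v v)"
    using assms l by (simp add: q_lincomb q_lincomb_right)
  also have "\<dots> = (a * cnj a) * q u u + (a * cnj b * q u v + cnj (a * cnj b * q u v)) + (b * cnj b) * q v v"
    using q_commute[of u v] assms by (simp add: algebra_simps)
  finally show ?thesis
    by (simp add: complex_add_cnj algebra_simps flip: complex_norm_square)
qed

lemma Re_cauchy_schwarz:
  assumes "u \<in> V" "v \<in> V"
  shows "(Re (q u v))\<^sup>2 \<le> Re (q u u) * Re (q v v)"
proof -
  have *: "0 \<le> t\<^sup>2 * Re (q u u) + 2 * t * Re (q u v) + Re (q v v)" for t :: real
    using q_nonneg[OF lincomb[OF assms, of "of_real t" 1]] Re_expand[OF assms, of "of_real t" 1]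
    by (simp add: algebra_simps)
  show ?thesis
  proof (cases "Re (q u u) = 0")
    case True
    have "Re (q u v) = 0"
    proof (rule ccontr)
      assume n: "Re (q u v) \<noteq> 0"
      \<comment> \<open>The quadratic in \<open>t\<close> is affine here because the form may be
        degenerate; this value of \<open>t\<close> makes it equal to -1.\<close>
      show False using *[of "-(Re (q v v) + 1) / (2 * Re (q u v))"] True n by (simp add: field_simps)
    qed
    then show ?thesis using True by simp
  next
    case False
    then have p: "Re (q u u) > 0" using q_nonneg[OF assms(1)] by simp
    have "0 \<le> Re (q u u) * ((Re (q u v) / Re (q u u))\<^sup>2 * Re (q u u) - 2 * (Re (q u v) / Re (q u u)) * Re (q u v) + Re (q v v))"
      using *[of "- Re (q u v) / Re (q u u)"] p by (intro mult_nonneg_nonneg) auto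
    also have "\<dots> = Re (q u u) * Re (q v v) - (Re (q u v))\<^sup>2"
      using p by (simp add: field_simps power2_eq_square)
    finally show ?thesis by simp
  qed
qed

lemma cauchy_schwarz:
  assumes "u \<in> V" "v \<in> V"
  shows "norm (q u v) \<le> sqrt (Re (q u u)) * sqrt (Re (q v v))"
proof (cases "q u v = 0")
  case False
  \<comment> \<open>A phase that turns \<open>q u v\<close> into its modulus reduces the claim to
    real parts.\<close>
  define c where "c = cnj (q u v) / of_real (norm (q u v))"
  have c: "norm c = 1" "c * q u v = of_real (norm (q u v))"
    using False complex_norm_square[of "q u v"]
    by (auto simp: c_def norm_divide field_simps power2_eq_square)
  have cu: "(\<lambda>x. c * u x + 0 * u x) \<in> V" using lincomb assms by blast
  have "(Re (q (\<lambda>x. c * u x + 0 * u x) v))\<^sup>2 \<le> Re (q (\<lambda>x. c * u x + 0 * u x) (\<lambda>x. c * u x + 0 * u x)) * Re (q v v)"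
    by (rule Re_cauchy_schwarz[OF cu assms(2)])
  then have "(norm (q u v))\<^sup>2 \<le> Re (q u u) * Re (q v v)"
    unfolding q_lincomb[OF assms(1) assms(1) assms(2)] Re_expand[OF assms(1) assms(1)]
    using c by simp
  then show ?thesis
    by (metis norm_ge_zero real_le_rsqrt real_sqrt_mult)
qed (simp add: q_nonneg assms)

lemma triangle:
  assumes "u \<in> V" "v \<in> V"
  shows "sqrt (Re (q (\<lambda>x. u x + v x) (\<lambda>x. u x + v x))) \<le> sqrt (Re (q u u)) + sqrt (Re (q v v))"
proof (rule real_le_lsqrt)
  have "Re (q (\<lambda>x. u x + v x) (\<lambda>x. u x + v x)) = Re (q u u) + 2 * Re (q u v) + Re (q v v)"
    using Re_expand[OF assms, of 1 1] by simp
  also have "\<dots> \<le> Re (q u u) + 2 * (sqrt (Re (q u u)) * sqrt (Re (q v v))) + Re (q v v)"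
    using cauchy_schwarz[OF assms] complex_Re_le_cmod[of "q u v"] by linarith
  also have "\<dots> = (sqrt (Re (q u u)) + sqrt (Re (q v v)))\<^sup>2"
    by (simp add: power2_sum q_nonneg assms)
  finally show "Re (q (\<lambda>x. u x + v x) (\<lambda>x. u x + v x)) \<le> (sqrt (Re (q u u)) + sqrt (Re (q v v)))\<^sup>2" .
qed (auto simp: q_nonneg assms)

text \<open>The functional is represented by the minimiser of
  \<open>J v = q v v - 2 Re (l v)\<close>: a minimising sequence is Cauchy, and the vanishing first
  variation of \<open>J\<close> is the claim. Completeness is a hypothesis because the lemma serves
  different pairs of a space and a form: Sobolev spaces with coercive forms, and the range of an
  operator with the \<open>L2\<close> inner product.\<close>

lemma riesz:
  fixes l :: "('a \<Rightarrow> complex) \<Rightarrow> complex"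
  assumes ne: "(\<lambda>_. 0) \<in> V"
    and complete: "\<And>U. (\<And>n. U n \<in> V) \<Longrightarrow>
      (\<And>e. e > 0 \<Longrightarrow> \<exists>N. \<forall>m\<ge>N. \<forall>n\<ge>N. Re (q (\<lambda>x. U m x - U n x) (\<lambda>x. U m x - U n x)) < e) \<Longrightarrow>
      \<exists>u\<in>V. (\<lambda>n. Re (q (\<lambda>x. U n x - u x) (\<lambda>x. U n x - u x))) \<longlonglongrightarrow> 0"
    and l_lincomb: "\<And>u v a b. u \<in> V \<Longrightarrow> v \<in> V \<Longrightarrow> l (\<lambda>x. a * u x + b * v x) = a * l u + b * l v"
    and l_bound: "\<And>u. u \<in> V \<Longrightarrow> norm (l u) \<le> C * sqrt (Re (q u u))"
  shows "\<exists>u\<in>V. \<forall>v\<in>V. q v u = l v"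
proof -
  define N where "N v = Re (q v v)" for v
  define J where "J v = N v - 2 * Re (l v)" for v
  have N0: "N v \<ge> 0" if "v \<in> V" for v using q_nonneg that by (simp add: N_def)
  have Jlow: "J v \<ge> - C\<^sup>2" if "v \<in> V" for v
  proof -
    have "Re (l v) \<le> C * sqrt (N v)"
      using l_bound[OF that] complex_Re_le_cmod[of "l v"] by (simp add: N_def)
    moreover have "0 \<le> (sqrt (N v) - C)\<^sup>2" by simp
    moreover have "(sqrt (N v) - C)\<^sup>2 = N v - 2 * (C * sqrt (N v)) + C\<^sup>2"
      using N0[OF that] by (simp add: power2_diff)
    ultimately show ?thesis by (simp add: J_def)
  qed
  define d where "d = (INF v\<in>V. J v)"
  have bdd: "bdd_below (J ` V)" using Jlow by (intro bdd_belowI2) auto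
  have dle: "d \<le> J v" if "v \<in> V" for v
    unfolding d_def using bdd that by (rule cINF_lower)
  have Jexp: "J (\<lambda>x. a * u x + b * v x) = (norm a)\<^sup>2 * N u + 2 * Re (a * cnj b * q u v) + (norm b)\<^sup>2 * N v
       - 2 * Re (a * l u) - 2 * Re (b * l v)" if "u \<in> V" "v \<in> V" for u v a b
    using Re_expand[OF that] l_lincomb[OF that] by (simp add: J_def N_def algebra_simps)
  have "\<exists>v\<in>V. J v < d + inverse (Suc n)" for n
    using cINF_less_iff[OF _ bdd, of "d + inverse (Suc n)"] ne by (auto simp: d_def)
  then obtain U where U: "\<And>n. U n \<in> V" "\<And>n. J (U n) < d + inverse (Suc n)" by metis
  \<comment> \<open>Parallelogram identity; the linear part of \<open>J\<close> cancels. Two almost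
    minimisers are close because their midpoint cannot fall below \<open>d\<close>.\<close>
  have NU: "N (\<lambda>x. u x - v x) = 2 * J u + 2 * J v - 4 * J (\<lambda>x. (1/2) * u x + (1/2) * v x)"
    if "u \<in> V" "v \<in> V" for u v
    using Re_expand[OF that, of 1 "-1"] Jexp[OF that, of "1/2" "1/2"]
    by (simp add: J_def N_def power2_eq_square)
  have "\<exists>u\<in>V. (\<lambda>n. Re (q (\<lambda>x. U n x - u x) (\<lambda>x. U n x - u x))) \<longlonglongrightarrow> 0"
  proof (rule complete)
    fix e :: real assume e: "e > 0"
    obtain K where K: "inverse (Suc K) < e / 4" using reals_Archimedean[of "e / 4"] e by auto
    have "N (\<lambda>x. U m x - U n x) < e" if "m \<ge> K" "n \<ge> K" for m n
    proof -
      have i: "inverse (real (Suc m)) \<le> inverse (Suc K)" "inverse (real (Suc n)) \<le> inverse (Suc K)"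
        using that by (auto simp: field_simps)
      have "d \<le> J (\<lambda>x. (1/2) * U m x + (1/2) * U n x)"
        by (intro dle lincomb U)
      then show ?thesis
        using NU[OF U(1)[of m] U(1)[of n]] U(2)[of m] U(2)[of n] i K by linarith
    qed
    then show "\<exists>K. \<forall>m\<ge>K. \<forall>n\<ge>K. Re (q (\<lambda>x. U m x - U n x) (\<lambda>x. U m x - U n x)) < e"
      unfolding N_def by blast
  qed (rule U)
  then obtain u where u: "u \<in> V" and lim: "(\<lambda>n. N (\<lambda>x. U n x - u x)) \<longlonglongrightarrow> 0"
    unfolding N_def by blast
  have Re_eq: "Re (q v u) = Re (l v)" if v: "v \<in> V" for v
  proof -
    have bnd: "\<bar>Re (q (U n) v) - Re (l v)\<bar> \<le> sqrt (inverse (Suc n) * (N v + 1))" for n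
    proof -
      define r where "r = Re (q (U n) v) - Re (l v)"
      \<comment> \<open>Nearly the minimiser of the quadratic in \<open>t\<close>; the added 1 keeps
        the denominator positive when \<open>v\<close> has norm zero.\<close>
      define t where "t = - r / (N v + 1)"
      have p: "N v + 1 > 0" using N0[OF v] by linarith
      have "d \<le> J (\<lambda>x. 1 * U n x + of_real t * v x)" by (intro dle lincomb U v)
      also have "\<dots> = J (U n) + 2 * t * r + t\<^sup>2 * N v"
        unfolding Jexp[OF U(1) v] by (simp add: J_def r_def algebra_simps)
      also have "\<dots> \<le> J (U n) + 2 * t * r + t\<^sup>2 * (N v + 1)" by (simp add: mult_left_mono)
      finally have "d \<le> J (U n) + 2 * t * r + t\<^sup>2 * (N v + 1)" .
      moreover have "2 * t * r + t\<^sup>2 * (N v + 1) = - r\<^sup>2 / (N v + 1)"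
      proof -
        have "t * (N v + 1) = - r" using p by (simp add: t_def)
        then have "2 * t * r + t\<^sup>2 * (N v + 1) = t * r"
          by (simp add: power2_eq_square mult.assoc)
        then show ?thesis by (simp add: t_def power2_eq_square)
      qed
      ultimately have "r\<^sup>2 / (N v + 1) \<le> inverse (Suc n)" using U(2)[of n] by linarith
      then have "r\<^sup>2 \<le> inverse (Suc n) * (N v + 1)" using p by (simp add: pos_divide_le_eq)
      then show ?thesis unfolding r_def using real_le_rsqrt[of "\<bar>r\<bar>"] r_def by auto
    qed
    have lim0: "(\<lambda>n. sqrt (inverse (Suc n) * (N v + 1))) \<longlonglongrightarrow> 0"
      using tendsto_real_sqrt[OF tendsto_mult_left_zero[OF LIMSEQ_inverse_real_of_nat]]
      unfolding real_sqrt_zero .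
    have l0: "(\<lambda>n. Re (q (U n) v) - Re (l v)) \<longlonglongrightarrow> 0"
      by (rule Lim_null_comparison[OF always_eventually[OF allI] lim0]) (unfold real_norm_def, rule bnd)
    have b2: "\<bar>Re (q (U n) v) - Re (q u v)\<bar> \<le> sqrt (N (\<lambda>x. U n x - u x)) * sqrt (N v)" for n
      using order_trans[OF abs_Re_le_cmod cauchy_schwarz[OF diff_mem[OF U(1) u] v]]
      unfolding q_diff[OF U(1) u v] minus_complex.simps N_def .
    have lim2: "(\<lambda>n. sqrt (N (\<lambda>x. U n x - u x)) * sqrt (N v)) \<longlonglongrightarrow> 0"
      using tendsto_mult_left_zero[OF tendsto_real_sqrt[OF lim, unfolded real_sqrt_zero]] .
    have "(\<lambda>n. Re (q (U n) v) - Re (q u v)) \<longlonglongrightarrow> 0"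
      by (rule Lim_null_comparison[OF always_eventually[OF allI] lim2]) (unfold real_norm_def, rule b2)
    from tendsto_diff[OF l0 this] have "(\<lambda>n::nat. Re (q u v) - Re (l v)) \<longlonglongrightarrow> 0" by simp
    then have "Re (q u v) = Re (l v)" by (simp add: LIMSEQ_const_iff)
    then show ?thesis using q_commute[OF u v] by simp
  qed
  have "q v u = l v" if v: "v \<in> V" for v
  proof (rule complex_eqI)
    show "Re (q v u) = Re (l v)" by (rule Re_eq[OF v])
    \<comment> \<open>Up to sign, real parts at \<open>\<i> * v\<close> are imaginary parts at
      \<open>v\<close>.\<close>
    have "(\<lambda>x. \<i> * v x + 0 * v x) \<in> V" by (intro lincomb v)
    from Re_eq[OF this] show "Im (q v u) = Im (l v)"
      unfolding q_lincomb[OF v v u] l_lincomb[OF v v] by simp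
  qed
  then show ?thesis using u by blast
qed

end

interpretation L2: semi_inner "L2 M" "L2_inner M" for M :: "'a measure"
proof
  show "L2_inner M v u = cnj (L2_inner M u v)" for u v by (rule L2_inner_commute)
qed (auto simp: L2_inner_self L2_lincomb L2_inner_lincomb_left)

lemma L2_norm_eq: "L2_norm M u = sqrt (Re (L2_inner M u u))"
  by (simp add: L2_inner_self)

lemma L2_cauchy_schwarz:
  "u \<in> L2 M \<Longrightarrow> v \<in> L2 M \<Longrightarrow> norm (L2_inner M u v) \<le> L2_norm M u * L2_norm M v"
  unfolding L2_norm_eq by (rule L2.cauchy_schwarz)

lemma L2_norm_add:
  "u \<in> L2 M \<Longrightarrow> v \<in> L2 M \<Longrightarrow> L2_norm M (\<lambda>x. u x + v x) \<le> L2_norm M u + L2_norm M v"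
  unfolding L2_norm_eq by (rule L2.triangle)

lemma L2_norm_scale: "L2_norm M (\<lambda>x. a * u x) = norm a * L2_norm M u"
  by (simp add: L2_norm_def norm_mult power_mult_distrib real_sqrt_mult)

lemma L2_norm_minus_commute: "L2_norm M (\<lambda>x. u x - v x) = L2_norm M (\<lambda>x. v x - u x)"
  by (simp add: L2_norm_def norm_minus_commute)

lemma L2_norm_triangle:
  assumes "u \<in> L2 M" "v \<in> L2 M" "w \<in> L2 M"
  shows "L2_norm M (\<lambda>x. u x - w x) \<le> L2_norm M (\<lambda>x. u x - v x) + L2_norm M (\<lambda>x. v x - w x)"
  using L2_norm_add[OF L2_diff[OF assms(1,2)] L2_diff[OF assms(2,3)]] by simp

lemma L2_norm_diff_le:
  assumes "u \<in> L2 M" "v \<in> L2 M"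
  shows "\<bar>L2_norm M u - L2_norm M v\<bar> \<le> L2_norm M (\<lambda>x. u x - v x)"
  using L2_norm_add[OF L2_diff[OF assms] assms(2)] L2_norm_add[OF L2_diff[OF assms(2,1)] assms(1)]
    L2_norm_minus_commute[of M u v] by simp

lemma L2_norm_mono:
  assumes "u \<in> borel_measurable M" "v \<in> L2 M" "AE x in M. norm (u x) \<le> norm (v x)"
  shows "L2_norm M u \<le> L2_norm M v"
  unfolding L2_norm_def
proof (intro real_sqrt_le_mono integral_mono_AE)
  show "AE x in M. (norm (u x))\<^sup>2 \<le> (norm (v x))\<^sup>2"
    using assms(3) by eventually_elim (auto intro: power_mono)
  then show "integrable M (\<lambda>x. (norm (u x))\<^sup>2)"
    using L2_bound[OF assms(1) L2_integrable[OF assms(2)]] L2_integrable by blast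
qed (use assms L2_integrable in auto)

lemma L2_norm_bounded_mult:
  assumes "u \<in> L2 M" "w \<in> borel_measurable M" "\<And>x. x \<in> space M \<Longrightarrow> norm (w x) \<le> B" "0 \<le> B"
  shows "L2_norm M (\<lambda>x. w x * u x) \<le> B * L2_norm M u"
proof -
  have "L2_norm M (\<lambda>x. w x * u x) \<le> L2_norm M (\<lambda>x. of_real B * u x)"
    using L2_measurable[OF L2_bounded_mult[OF assms(1-3)]] assms
    by (intro L2_norm_mono L2_scale AE_I2) (auto simp: norm_mult intro!: mult_right_mono)
  then show ?thesis using assms(4) by (simp add: L2_norm_scale)
qed

lemma L2_nn_integral:
  "u \<in> L2 M \<Longrightarrow> (\<integral>\<^sup>+x. ennreal ((norm (u x))\<^sup>2) \<partial>M) = ennreal ((L2_norm M u)\<^sup>2)"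
  unfolding L2_norm_sq by (rule nn_integral_eq_integral) (auto simp: L2_integrable)

lemma L2_nn_integral_le:
  assumes "u \<in> borel_measurable M" "(\<integral>\<^sup>+x. ennreal ((norm (u x))\<^sup>2) \<partial>M) \<le> ennreal (B\<^sup>2)" "0 \<le> B"
  shows "u \<in> L2 M" "L2_norm M u \<le> B"
proof -
  have fin: "(\<integral>\<^sup>+x. ennreal ((norm (u x))\<^sup>2) \<partial>M) < \<infinity>"
    using assms(2) by (metis ennreal_less_top infinity_ennreal_def order.strict_trans1)
  show u: "u \<in> L2 M" unfolding L2_def using assms(1) fin by (auto intro!: integrableI_bounded)
  show "L2_norm M u \<le> B"
    using assms(2,3) unfolding L2_nn_integral[OF u] by (simp add: power_mono_iff)
qed

section \<open>Convergence and completeness in \<open>L2\<close>\<close>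

abbreviation L2_conv :: "'a measure \<Rightarrow> (nat \<Rightarrow> 'a \<Rightarrow> complex) \<Rightarrow> ('a \<Rightarrow> complex) \<Rightarrow> bool" where
  "L2_conv M U u \<equiv> (\<lambda>n. L2_norm M (\<lambda>x. U n x - u x)) \<longlonglongrightarrow> 0"

definition L2_Cauchy :: "'a measure \<Rightarrow> (nat \<Rightarrow> 'a \<Rightarrow> complex) \<Rightarrow> bool" where
  "L2_Cauchy M U \<longleftrightarrow> (\<forall>e>0. \<exists>N. \<forall>m\<ge>N. \<forall>n\<ge>N. L2_norm M (\<lambda>x. U m x - U n x) < e)"

text \<open>Riesz-Fischer. Along a rapidly Cauchy subsequence the increments have summable norms, so
  the sum of their moduli is square integrable, hence finite almost everywhere, and the subsequence
  converges pointwise. Fatou's lemma turns this into norm convergence of the whole sequence.\<close>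

lemma L2_complete:
  assumes U: "\<And>n. U n \<in> L2 M" and C: "L2_Cauchy M U"
  shows "\<exists>u\<in>L2 M. L2_conv M U u"
proof -
  have "\<exists>N. \<forall>m\<ge>N. \<forall>n\<ge>N. L2_norm M (\<lambda>x. U m x - U n x) < (1/2) ^ k" for k :: nat
    using C unfolding L2_Cauchy_def by (simp add: zero_less_power)
  then obtain N where N: "\<And>k m n. m \<ge> N k \<Longrightarrow> n \<ge> N k \<Longrightarrow> L2_norm M (\<lambda>x. U m x - U n x) < (1/2) ^ k"
    by metis
  \<comment> \<open>Summing the thresholds gives a nondecreasing index sequence above
    \<open>N\<close>; repeated indices only produce zero increments.\<close>
  define r where "r k = (\<Sum>j\<le>k. N j)" for k
  have rN: "r j \<ge> N k" if "j \<ge> k" for j k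
    unfolding r_def using that by (intro member_le_sum) auto
  define d where "d k x = U (r (Suc k)) x - U (r k) x" for k x
  have d: "d k \<in> L2 M" "L2_norm M (d k) \<le> (1/2) ^ k" for k
    unfolding d_def using L2_diff[OF U U] N[of k "r (Suc k)" "r k"] rN[of k k] rN[of k "Suc k"]
    by (auto intro: less_imp_le)
  define f where "f n x = complex_of_real (\<Sum>k<n. norm (d k x))" for n x
  have nd: "(\<lambda>x. complex_of_real (norm (d k x))) \<in> L2 M" for k
    using L2_integrable[OF d(1)[of k]] L2_measurable[OF d(1)[of k]] unfolding L2_def by simp
  have f: "f n \<in> L2 M \<and> L2_norm M (f n) \<le> (\<Sum>k<n. (1/2) ^ k)" for n
  proof (induction n)
    case 0
    then show ?case by (simp add: f_def[abs_def] L2_norm_def)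
  next
    case (Suc n)
    have eq: "f (Suc n) = (\<lambda>x. f n x + complex_of_real (norm (d n x)))" by (simp add: f_def fun_eq_iff)
    have "L2_norm M (\<lambda>x. complex_of_real (norm (d n x))) = L2_norm M (d n)" by (simp add: L2_norm_def)
    then show ?case unfolding eq
      using L2_norm_add[OF Suc[THEN conjunct1] nd[of n]] Suc d(2)[of n] L2_add[OF Suc[THEN conjunct1] nd[of n]]
      by simp
  qed
  have geo: "(\<Sum>k<n. (1/2::real) ^ k) \<le> 2" for n
    by (simp add: sum_gp_strict)
  have "(\<integral>\<^sup>+x. (SUP n. ennreal ((norm (f n x))\<^sup>2)) \<partial>M) = (SUP n. (\<integral>\<^sup>+x. ennreal ((norm (f n x))\<^sup>2) \<partial>M))"
  proof (rule nn_integral_monotone_convergence_SUP)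
    show "incseq (\<lambda>n x. ennreal ((norm (f n x))\<^sup>2))"
    proof (intro incseq_SucI le_funI ennreal_leI power_mono)
      show "norm (f n x) \<le> norm (f (Suc n) x)" for n x
        by (simp add: f_def sum_nonneg del: of_real_add of_real_sum flip: of_real_sum of_real_add)
    qed auto
    show "(\<lambda>x. ennreal ((norm (f n x))\<^sup>2)) \<in> borel_measurable M" for n
      using L2_measurable[OF f[THEN conjunct1]] by measurable
  qed
  also have "\<dots> \<le> ennreal (2\<^sup>2)"
  proof (rule SUP_least)
    fix n
    have "(L2_norm M (f n))\<^sup>2 \<le> 2\<^sup>2"
      using order_trans[OF f[THEN conjunct2] geo] by (rule power_mono) simp
    then show "(\<integral>\<^sup>+x. ennreal ((norm (f n x))\<^sup>2) \<partial>M) \<le> ennreal (2\<^sup>2)"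
      unfolding L2_nn_integral[OF f[THEN conjunct1]] by (rule ennreal_leI)
  qed
  finally have fin: "(\<integral>\<^sup>+x. (SUP n. ennreal ((norm (f n x))\<^sup>2)) \<partial>M) < \<infinity>"
    unfolding infinity_ennreal_def by (rule le_less_trans) (rule ennreal_less_top)
  have "AE x in M. (SUP n. ennreal ((norm (f n x))\<^sup>2)) \<noteq> \<infinity>"
  proof (rule nn_integral_PInf_AE)
    show "(\<lambda>x. SUP n. ennreal ((norm (f n x))\<^sup>2)) \<in> borel_measurable M"
      using L2_measurable[OF f[THEN conjunct1]] by measurable
  qed (use fin in auto)
  then have AEc: "AE x in M. convergent (\<lambda>k. U (r k) x)"
  proof eventually_elim
    case (elim x)
    then obtain B where B: "0 \<le> B" "(SUP n. ennreal ((norm (f n x))\<^sup>2)) = ennreal B"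
      by (cases "(SUP n. ennreal ((norm (f n x))\<^sup>2))") auto
    have "(\<Sum>k<n. norm (d k x)) \<le> sqrt B" for n
    proof (rule real_le_rsqrt)
      have "ennreal ((norm (f n x))\<^sup>2) \<le> ennreal B" unfolding B(2)[symmetric] by (rule SUP_upper) simp
      then show "(\<Sum>k<n. norm (d k x))\<^sup>2 \<le> B" using B(1)
        by (simp add: f_def sum_nonneg del: of_real_sum)
    qed
    then have "summable (\<lambda>k. norm (d k x))" by (intro summableI_nonneg_bounded[of _ "sqrt B"]) auto
    then have "summable (\<lambda>k. d k x)" by (rule summable_norm_cancel)
    then have "convergent (\<lambda>n. \<Sum>k<n. d k x)" by (simp add: summable_iff_convergent)
    then have "convergent (\<lambda>n. U (r 0) x + (\<Sum>k<n. d k x))" by (intro convergent_add convergent_const)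
    moreover have "U (r 0) x + (\<Sum>k<n. d k x) = U (r n) x" for n
      by (simp add: d_def sum_lessThan_telescope[of "\<lambda>k. U (r k) x"])
    ultimately show ?case by simp
  qed
  define u where "u x = lim (\<lambda>k. U (r k) x)" for x
  have um: "u \<in> borel_measurable M"
    unfolding u_def using L2_measurable[OF U] by (intro borel_measurable_lim_metric) auto
  have est: "(\<lambda>x. U m x - u x) \<in> L2 M \<and> L2_norm M (\<lambda>x. U m x - u x) \<le> (1/2)^k" if "m \<ge> N k" for m k
  proof -
    have meas: "(\<lambda>x. U m x - u x) \<in> borel_measurable M" using um L2_measurable[OF U] by measurable
    have "(\<integral>\<^sup>+x. ennreal ((norm (U m x - u x))\<^sup>2) \<partial>M)
        \<le> (\<integral>\<^sup>+x. liminf (\<lambda>j. ennreal ((norm (U m x - U (r j) x))\<^sup>2)) \<partial>M)"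
    proof (rule nn_integral_mono_AE, use AEc in eventually_elim)
      case (elim x)
      then have "(\<lambda>k. U (r k) x) \<longlonglongrightarrow> u x" by (simp add: u_def convergent_LIMSEQ_iff)
      then have "(\<lambda>j. ennreal ((norm (U m x - U (r j) x))\<^sup>2)) \<longlonglongrightarrow> ennreal ((norm (U m x - u x))\<^sup>2)"
        by (intro tendsto_intros tendsto_ennrealI)
      then have "liminf (\<lambda>j. ennreal ((norm (U m x - U (r j) x))\<^sup>2)) = ennreal ((norm (U m x - u x))\<^sup>2)"
        by (rule lim_imp_Liminf[OF sequentially_bot])
      then show ?case by (rule eq_refl[OF sym])
    qed
    also have "\<dots> \<le> liminf (\<lambda>j. \<integral>\<^sup>+x. ennreal ((norm (U m x - U (r j) x))\<^sup>2) \<partial>M)"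
      using L2_measurable[OF U] by (intro nn_integral_liminf) measurable
    also have "\<dots> \<le> liminf (\<lambda>j. ennreal (((1/2)^k)\<^sup>2))"
    proof (rule Liminf_mono, rule eventually_sequentiallyI[of k])
      fix j assume j: "k \<le> j"
      have "L2_norm M (\<lambda>x. U m x - U (r j) x) \<le> (1/2)^k"
        using N[OF that rN[OF j]] by simp
      then show "(\<integral>\<^sup>+x. ennreal ((norm (U m x - U (r j) x))\<^sup>2) \<partial>M) \<le> ennreal (((1/2)^k)\<^sup>2)"
        unfolding L2_nn_integral[OF L2_diff[OF U U]] by (intro ennreal_leI power_mono) auto
    qed
    also have "\<dots> = ennreal (((1/2)^k)\<^sup>2)" by (simp add: Liminf_const)
    finally show ?thesis using L2_nn_integral_le[OF meas] by simp
  qed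
  have "u \<in> L2 M"
    using L2_diff[OF U[of "N 0"] est[of 0 "N 0", OF order_refl, THEN conjunct1]] by simp
  moreover have "L2_conv M U u"
  proof (rule LIMSEQ_I)
    fix e :: real assume "e > 0"
    then obtain k where "(1/2)^k < e" using real_arch_pow_inv[of e "1/2"] by auto
    then show "\<exists>no. \<forall>n\<ge>no. norm (L2_norm M (\<lambda>x. U n x - u x) - 0) < e"
      using est[of k] by (intro exI[of _ "N k"]) (smt (verit) L2_norm_nonneg real_norm_def)
  qed
  ultimately show ?thesis by blast
qed

lemma L2_conv_Cauchy:
  assumes "\<And>n. U n \<in> L2 M" "u \<in> L2 M" "L2_conv M U u"
  shows "L2_Cauchy M U"
  unfolding L2_Cauchy_def
proof safe
  fix e :: real assume e: "e > 0"
  obtain N where N: "\<And>n. n \<ge> N \<Longrightarrow> L2_norm M (\<lambda>x. U n x - u x) < e / 2"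
    using LIMSEQ_D[OF assms(3), of "e/2"] e by auto
  have "L2_norm M (\<lambda>x. U m x - U n x) < e" if "m \<ge> N" "n \<ge> N" for m n
    using L2_norm_triangle[OF assms(1)[of m] assms(2) assms(1)[of n]] N[OF that(1)] N[OF that(2)]
      L2_norm_minus_commute[of M "U n" u] by simp
  then show "\<exists>N. \<forall>m\<ge>N. \<forall>n\<ge>N. L2_norm M (\<lambda>x. U m x - U n x) < e" by blast
qed

lemma L2_conv_unique:
  assumes "\<And>n. U n \<in> L2 M" "u \<in> L2 M" "v \<in> L2 M" "L2_conv M U u" "L2_conv M U v"
  shows "AE x in M. u x = v x"
proof -
  have "(\<lambda>n. L2_norm M (\<lambda>x. U n x - u x) + L2_norm M (\<lambda>x. U n x - v x)) \<longlonglongrightarrow> 0 + 0"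
    by (intro tendsto_intros assms)
  moreover have "L2_norm M (\<lambda>x. u x - v x) \<le> L2_norm M (\<lambda>x. U n x - u x) + L2_norm M (\<lambda>x. U n x - v x)" for n
    using L2_norm_triangle[OF assms(2) assms(1)[of n] assms(3)] L2_norm_minus_commute[of M u "U n"] by simp
  ultimately have "L2_norm M (\<lambda>x. u x - v x) \<le> 0"
    using LIMSEQ_le_const by fastforce
  then have "L2_norm M (\<lambda>x. u x - v x) = 0" using L2_norm_nonneg[of M] by (simp add: order_antisym)
  then show ?thesis by (simp add: L2_norm_eq_0_iff[OF L2_diff[OF assms(2,3)]])
qed

lemma L2_conv_norm:
  assumes "\<And>n. U n \<in> L2 M" "u \<in> L2 M" "L2_conv M U u"
  shows "(\<lambda>n. L2_norm M (U n)) \<longlonglongrightarrow> L2_norm M u"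
proof -
  have "(\<lambda>n. L2_norm M (U n) - L2_norm M u) \<longlonglongrightarrow> 0"
    by (rule Lim_null_comparison[OF _ assms(3)]) (use L2_norm_diff_le[OF assms(1,2)] in auto)
  then show ?thesis by (simp add: LIM_zero_iff)
qed

lemma L2_conv_inner:
  assumes U: "\<And>n. U n \<in> L2 M" and u: "u \<in> L2 M" and c: "L2_conv M U u" 
    and V: "\<And>n. V n \<in> L2 M" and v: "v \<in> L2 M" and d: "L2_conv M V v"
  shows "(\<lambda>n. L2_inner M (U n) (V n)) \<longlonglongrightarrow> L2_inner M u v"
proof -
  have "(\<lambda>n. L2_norm M (\<lambda>x. U n x - u x) * L2_norm M (V n) + L2_norm M u * L2_norm M (\<lambda>x. V n x - v x))
     \<longlonglongrightarrow> 0 * L2_norm M v + L2_norm M u * 0"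
    by (intro tendsto_intros c d L2_conv_norm V v)
  then have lim: "(\<lambda>n. L2_norm M (\<lambda>x. U n x - u x) * L2_norm M (V n) + L2_norm M u * L2_norm M (\<lambda>x. V n x - v x))
     \<longlonglongrightarrow> 0" by simp
  have "norm (L2_inner M (U n) (V n) - L2_inner M u v)
     \<le> L2_norm M (\<lambda>x. U n x - u x) * L2_norm M (V n) + L2_norm M u * L2_norm M (\<lambda>x. V n x - v x)" for n
  proof -
    have "L2_inner M (U n) (V n) - L2_inner M u v
       = L2_inner M (\<lambda>x. U n x - u x) (V n) + L2_inner M u (\<lambda>x. V n x - v x)"
      using L2.q_diff[OF U[of n] u V[of n]] L2.q_lincomb_right[OF V[of n] v u, of 1 "-1"] by simp
    then show ?thesis
      using norm_triangle_mono[OF L2_cauchy_schwarz[OF L2_diff[OF U u] V] L2_cauchy_schwarz[OF u L2_diff[OF V v]]]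
      by simp
  qed
  then have "(\<lambda>n. L2_inner M (U n) (V n) - L2_inner M u v) \<longlonglongrightarrow> 0"
    by (intro Lim_null_comparison[OF _ lim]) auto
  then show ?thesis by (simp add: LIM_zero_iff)
qed

lemma L2_conv_const: "L2_conv M (\<lambda>_. u) u"
  by (simp add: L2_norm_def)

lemma L2_conv_lincomb:
  assumes "\<And>n. U n \<in> L2 M" "u \<in> L2 M" "L2_conv M U u" "\<And>n. V n \<in> L2 M" "v \<in> L2 M" "L2_conv M V v"
  shows "L2_conv M (\<lambda>n x. a * U n x + b * V n x) (\<lambda>x. a * u x + b * v x)"
proof (rule Lim_null_comparison)
  have "(\<lambda>n. norm a * L2_norm M (\<lambda>x. U n x - u x) + norm b * L2_norm M (\<lambda>x. V n x - v x))
     \<longlonglongrightarrow> norm a * 0 + norm b * 0" by (intro tendsto_intros assms)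
  then show "(\<lambda>n. norm a * L2_norm M (\<lambda>x. U n x - u x) + norm b * L2_norm M (\<lambda>x. V n x - v x)) \<longlonglongrightarrow> 0" by simp
  have "L2_norm M (\<lambda>x. a * U n x + b * V n x - (a * u x + b * v x))
     \<le> norm a * L2_norm M (\<lambda>x. U n x - u x) + norm b * L2_norm M (\<lambda>x. V n x - v x)" for n
    using L2_norm_add[OF L2_scale[OF L2_diff[OF assms(1,2)], of a n] L2_scale[OF L2_diff[OF assms(4,5)], of b n]]
    by (simp only: L2_norm_scale) (simp add: algebra_simps)
  then show "\<forall>\<^sub>F n in sequentially. norm (L2_norm M (\<lambda>x. a * U n x + b * V n x - (a * u x + b * v x)))
     \<le> norm a * L2_norm M (\<lambda>x. U n x - u x) + norm b * L2_norm M (\<lambda>x. V n x - v x)"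
    by simp
qed

lemma L2_conv_bounded_mult:
  assumes "\<And>n. U n \<in> L2 M" "u \<in> L2 M" "L2_conv M U u" "w \<in> borel_measurable M"
    "\<And>x. x \<in> space M \<Longrightarrow> norm (w x) \<le> B" "0 \<le> B"
  shows "L2_conv M (\<lambda>n x. w x * U n x) (\<lambda>x. w x * u x)"
proof (rule Lim_null_comparison)
  have "(\<lambda>n. B * L2_norm M (\<lambda>x. U n x - u x)) \<longlonglongrightarrow> B * 0" by (intro tendsto_intros assms)
  then show "(\<lambda>n. B * L2_norm M (\<lambda>x. U n x - u x)) \<longlonglongrightarrow> 0" by simp
  show "\<forall>\<^sub>F n in sequentially. norm (L2_norm M (\<lambda>x. w x * U n x - w x * u x)) \<le> B * L2_norm M (\<lambda>x. U n x - u x)"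
    using L2_norm_bounded_mult[OF L2_diff[OF assms(1,2)] assms(4-6)]
    by (simp add: right_diff_distrib)
qed

section \<open>Smooth functions and their closure properties\<close>

abbreviation dir_deriv :: "'a::real_normed_vector \<Rightarrow> ('a \<Rightarrow> 'b::real_normed_vector) \<Rightarrow> 'a \<Rightarrow> 'b" where
  "dir_deriv e f \<equiv> \<lambda>x. frechet_derivative f (at x) e"

lemma dir_deriv_eq: "(f has_derivative f') (at x) \<Longrightarrow> dir_deriv e f x = f' e"
  by (simp flip: frechet_derivative_at)

text \<open>Smoothness asks for one family of all iterated derivatives. If a class of functions is
  closed under differentiation, a choice of derivatives inside the class can be iterated along the
  list of directions and yields this family. Most closure properties below are obtained by naming
  such a class.\<close>

lemma smooth_coinduct:
  assumes "\<phi> \<in> S"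
    and step: "\<And>f. f \<in> S \<Longrightarrow> \<exists>f'. (\<forall>x. (f has_derivative (\<lambda>h. f' h x)) (at x)) \<and> (\<forall>h. f' h \<in> S)"
  shows "smooth \<phi>"
proof -
  obtain F where F: "\<And>f. f \<in> S \<Longrightarrow> (\<forall>x. (f has_derivative (\<lambda>h. F f h x)) (at x)) \<and> (\<forall>h. F f h \<in> S)"
    using step by metis
  define D where "D l = foldr (\<lambda>h f. F f h) l \<phi>" for l
  have S: "D l \<in> S" for l by (induction l) (auto simp: D_def assms(1) F)
  show ?thesis unfolding smooth_def
    by (rule exI[of _ D]) (use F[OF S] in \<open>auto simp: D_def\<close>)
qed

lemma smooth_derivE:
  assumes "smooth f"
  obtains f' where "\<And>x. (f has_derivative (\<lambda>h. f' h x)) (at x)" "\<And>h. smooth (f' h)"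
proof -
  obtain D where D: "D [] = f" "\<And>l x. (D l has_derivative (\<lambda>h. D (h # l) x)) (at x)"
    using assms unfolding smooth_def by blast
  show ?thesis
  proof (rule that[of "\<lambda>h. D [h]"])
    \<comment> \<open>New directions are added in front, so the direction already used sits at the
      end of the list.\<close>
    show "smooth (D [h])" for h
      unfolding smooth_def by (rule exI[of _ "\<lambda>l. D (l @ [h])"]) (use D(2) in auto)
  qed (use D in auto)
qed

lemma smooth_has_derivative: "smooth f \<Longrightarrow> (f has_derivative frechet_derivative f (at x)) (at x)"
  by (metis smooth_derivE frechet_derivative_at)

lemma smooth_dir_deriv: "smooth f \<Longrightarrow> smooth (dir_deriv e f)"
proof -
  assume "smooth f"
  then obtain f' where f': "\<And>x. (f has_derivative (\<lambda>h. f' h x)) (at x)" "\<And>h. smooth (f' h)"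
    by (rule smooth_derivE) blast
  have "dir_deriv e f = f' e" by (rule ext) (rule dir_deriv_eq[OF f'(1)])
  then show ?thesis using f'(2) by simp
qed

lemma smooth_continuous_on: "smooth f \<Longrightarrow> continuous_on A f"
  by (meson has_derivative_continuous continuous_at_imp_continuous_on smooth_has_derivative)

lemma smooth_measurable:
  fixes f :: "'a::euclidean_space \<Rightarrow> 'b::real_normed_vector"
  shows "smooth f \<Longrightarrow> f \<in> borel_measurable borel"
  by (rule borel_measurable_continuous_onI[OF smooth_continuous_on])

lemma smooth_const: "smooth (\<lambda>_. c)"
proof (rule smooth_coinduct[where S="range (\<lambda>c _. c)"])
  fix f :: "'a \<Rightarrow> 'b" assume "f \<in> range (\<lambda>c _. c)"
  then show "\<exists>f'. (\<forall>x. (f has_derivative (\<lambda>h. f' h x)) (at x)) \<and> (\<forall>h. f' h \<in> range (\<lambda>c _. c))"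
    by (intro exI[of _ "\<lambda>_ _. 0"]) auto
qed auto

lemma smooth_linear_left:
  assumes "bounded_linear L" "smooth f"
  shows "smooth (\<lambda>x. L (f x))"
proof (rule smooth_coinduct[where S="{\<lambda>x. L (f x) | f. smooth f}"])
  fix g assume "g \<in> {\<lambda>x. L (f x) | f. smooth f}"
  then obtain f where f: "g = (\<lambda>x. L (f x))" "smooth f" by blast
  from f(2) obtain f' where f': "\<And>x. (f has_derivative (\<lambda>h. f' h x)) (at x)" "\<And>h. smooth (f' h)"
    by (rule smooth_derivE) blast
  show "\<exists>g'. (\<forall>x. (g has_derivative (\<lambda>h. g' h x)) (at x)) \<and> (\<forall>h. g' h \<in> {\<lambda>x. L (f x) | f. smooth f})"
    by (rule exI[of _ "\<lambda>h x. L (f' h x)"])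
       (use f(1) f'(2) bounded_linear.has_derivative[OF assms(1) f'(1)] in auto)
qed (use assms in blast)

lemma smooth_affine_right:
  assumes L: "bounded_linear L" and "smooth f"
  shows "smooth (\<lambda>x. f (L x + c))"
proof (rule smooth_coinduct[where S="{\<lambda>x. f (L x + c) | f. smooth f}"])
  fix g assume "g \<in> {\<lambda>x. f (L x + c) | f. smooth f}"
  then obtain f where f: "g = (\<lambda>x. f (L x + c))" "smooth f" by blast
  from f(2) obtain f' where f': "\<And>x. (f has_derivative (\<lambda>h. f' h x)) (at x)" "\<And>h. smooth (f' h)"
    by (rule smooth_derivE) blast
  have l: "((\<lambda>x. L x + c) has_derivative L) (at x)" for x
    using has_derivative_add_const[OF bounded_linear_imp_has_derivative[OF L]] .
  have "(g has_derivative (\<lambda>h. f' (L h) (L x + c))) (at x)" for x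
    unfolding f(1) using has_derivative_compose[OF l f'(1)] by simp
  then show "\<exists>g'. (\<forall>x. (g has_derivative (\<lambda>h. g' h x)) (at x)) \<and> (\<forall>h. g' h \<in> {\<lambda>x. f (L x + c) | f. smooth f})"
    by (intro exI[of _ "\<lambda>h x. f' (L h) (L x + c)"]) (use f'(2) in auto)
qed (use assms in blast)

text \<open>The Leibniz rule turns one product into a sum of two, so the class closed under
  differentiation consists of finite sums of products.\<close>

inductive_set bilinear_sums :: "('b::real_normed_vector \<Rightarrow> 'c::real_normed_vector \<Rightarrow> 'd::real_normed_vector)
    \<Rightarrow> ('a::euclidean_space \<Rightarrow> 'd) set" for B where
  base: "smooth f \<Longrightarrow> smooth g \<Longrightarrow> (\<lambda>x. B (f x) (g x)) \<in> bilinear_sums B"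
| add: "u \<in> bilinear_sums B \<Longrightarrow> v \<in> bilinear_sums B \<Longrightarrow> (\<lambda>x. u x + v x) \<in> bilinear_sums B"

lemma smooth_bilinear_sums:
  assumes "bounded_bilinear B" "u \<in> bilinear_sums B"
  shows "smooth u"
proof (rule smooth_coinduct[OF assms(2)])
  fix u assume "u \<in> bilinear_sums B"
  then show "\<exists>u'. (\<forall>x. (u has_derivative (\<lambda>h. u' h x)) (at x)) \<and> (\<forall>h. u' h \<in> bilinear_sums B)"
  proof induction
    case (base f g)
    from base(1) obtain f' where f': "\<And>x. (f has_derivative (\<lambda>h. f' h x)) (at x)" "\<And>h. smooth (f' h)"
      by (rule smooth_derivE) blast
    from base(2) obtain g' where g': "\<And>x. (g has_derivative (\<lambda>h. g' h x)) (at x)" "\<And>h. smooth (g' h)"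
      by (rule smooth_derivE) blast
    show ?case
      by (intro exI[of _ "\<lambda>h x. B (f x) (g' h x) + B (f' h x) (g x)"] conjI allI
           bounded_bilinear.FDERIV[OF assms(1)] f' g' bilinear_sums.intros base)
  next
    case (add u v)
    then obtain u' v' where
      "\<And>x. (u has_derivative (\<lambda>h. u' h x)) (at x)" "\<And>h. u' h \<in> bilinear_sums B"
      "\<And>x. (v has_derivative (\<lambda>h. v' h x)) (at x)" "\<And>h. v' h \<in> bilinear_sums B"
      by blast
    then show ?case
      by (intro exI[of _ "\<lambda>h x. u' h x + v' h x"] conjI allI has_derivative_add bilinear_sums.add)
  qed
qed

lemma smooth_bilinear:
  "bounded_bilinear B \<Longrightarrow> smooth f \<Longrightarrow> smooth g \<Longrightarrow> smooth (\<lambda>x. B (f x) (g x))"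
  by (rule smooth_bilinear_sums[OF _ bilinear_sums.base])

lemma smooth_add:
  assumes "smooth f" "smooth g" shows "smooth (\<lambda>x. f x + g x)"
proof (rule smooth_coinduct[where S="{\<lambda>x. f x + g x | f g. smooth f \<and> smooth g}"])
  fix u :: "'a \<Rightarrow> 'b" assume "u \<in> {\<lambda>x. f x + g x | f g. smooth f \<and> smooth g}"
  then obtain f g where u: "u = (\<lambda>x. f x + g x)" "smooth f" "smooth g" by blast
  from u(2) obtain f' where f': "\<And>x. (f has_derivative (\<lambda>h. f' h x)) (at x)" "\<And>h. smooth (f' h)"
    by (rule smooth_derivE) blast
  from u(3) obtain g' where g': "\<And>x. (g has_derivative (\<lambda>h. g' h x)) (at x)" "\<And>h. smooth (g' h)"
    by (rule smooth_derivE) blast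
  show "\<exists>u'. (\<forall>x. (u has_derivative (\<lambda>h. u' h x)) (at x)) \<and> (\<forall>h. u' h \<in> {\<lambda>x. f x + g x | f g. smooth f \<and> smooth g})"
    by (rule exI[of _ "\<lambda>h x. f' h x + g' h x"]) (use u f' g' has_derivative_add in blast)
qed (use assms in blast)

lemmas smooth_mult = smooth_bilinear[OF bounded_bilinear_mult]
lemma smooth_prod:
  fixes f :: "'i \<Rightarrow> 'a::euclidean_space \<Rightarrow> 'b::real_normed_field"
  shows "(\<And>i. i \<in> A \<Longrightarrow> smooth (f i)) \<Longrightarrow> smooth (\<lambda>x. \<Prod>i\<in>A. f i x)"
  by (induction A rule: infinite_finite_induct) (auto intro: smooth_mult smooth_const)

text \<open>On the line the derivative in direction \<open>h\<close> is \<open>h\<close> times the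
  ordinary one; this is why the class has to be closed under scaling.\<close>

lemma smooth_real_coinduct:
  fixes \<phi> :: "real \<Rightarrow> 'b::real_normed_vector"
  assumes "\<phi> \<in> S" "\<And>c f. f \<in> S \<Longrightarrow> (\<lambda>x. c *\<^sub>R f x) \<in> S"
    and step: "\<And>f. f \<in> S \<Longrightarrow> \<exists>f'\<in>S. \<forall>x. (f has_vector_derivative f' x) (at x)"
  shows "smooth \<phi>"
proof (rule smooth_coinduct[OF assms(1)])
  fix f assume "f \<in> S"
  then obtain f' where "f' \<in> S" "\<forall>x. (f has_vector_derivative f' x) (at x)" using step by blast
  then show "\<exists>f'. (\<forall>x. (f has_derivative (\<lambda>h. f' h x)) (at x)) \<and> (\<forall>h. f' h \<in> S)"
    by (intro exI[of _ "\<lambda>h x. h *\<^sub>R f' x"]) (auto simp: has_vector_derivative_def assms(2))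
qed

lemma smooth_sin_cos: "smooth (\<lambda>x::real. a * sin (\<omega> * x) + b * cos (\<omega> * x))"
proof (rule smooth_real_coinduct[where S="range (\<lambda>(a, b) x. a * sin (\<omega> * x) + b * cos (\<omega> * x))"])
  show "(\<lambda>x. a * sin (\<omega> * x) + b * cos (\<omega> * x)) \<in> range (\<lambda>(a, b) x. a * sin (\<omega> * x) + b * cos (\<omega> * x))"
    by (rule image_eqI[of _ _ "(a, b)"]) auto
next
  fix c and f :: "real \<Rightarrow> real" assume "f \<in> range (\<lambda>(a, b) x. a * sin (\<omega> * x) + b * cos (\<omega> * x))"
  then obtain a b where f: "f = (\<lambda>x. a * sin (\<omega> * x) + b * cos (\<omega> * x))" by auto
  show "(\<lambda>x. c *\<^sub>R f x) \<in> range (\<lambda>(a, b) x. a * sin (\<omega> * x) + b * cos (\<omega> * x))"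
    by (rule image_eqI[of _ _ "(c * a, c * b)"]) (auto simp: f algebra_simps)
  show "\<exists>f'\<in>range (\<lambda>(a, b) x. a * sin (\<omega> * x) + b * cos (\<omega> * x)). \<forall>x. (f has_vector_derivative f' x) (at x)"
    by (rule bexI[OF _ image_eqI[of _ _ "(- b * \<omega>, a * \<omega>)"]], unfold f prod.case)
       (auto simp flip: has_real_derivative_iff_has_vector_derivative intro!: derivative_eq_intros)
qed

lemma poly_times_exp_minus_tendsto_0:
  fixes p :: "real poly"
  shows "((\<lambda>z. z ^ k * poly p z * exp (- z)) \<longlongrightarrow> 0) at_top"
proof (induction p arbitrary: k)
  case (pCons a p)
  have "((\<lambda>z. a * (z ^ k / exp z) + z ^ Suc k * poly p z * exp (- z)) \<longlongrightarrow> a * 0 + 0) at_top"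
    by (intro tendsto_intros tendsto_power_div_exp_0 pCons)
  then show ?case by (simp add: exp_minus field_simps)
qed simp

text \<open>For \<open>p = 1\<close> this is the standard flat function
  \<open>exp (- 1 / x)\<close>. A polynomial in \<open>1 / x\<close> is carried along because all
  derivatives of that function have this form.\<close>

definition flat :: "real poly \<Rightarrow> real \<Rightarrow> real" where
  "flat p x = (if x > 0 then poly p (inverse x) * exp (- inverse x) else 0)"

text \<open>For positive \<open>x\<close> this is the chain rule, where \<open>[:0, 0, 1:]\<close>
  stands for the square of \<open>1 / x\<close>. At 0 the difference quotient from the right is
  again a polynomial in \<open>1 / x\<close> times the exponential, which tends to 0.\<close>

lemma flat_deriv:
  "(flat p has_real_derivative flat ((p - pderiv p) * [:0, 0, 1:]) x) (at x)"
proof (cases x "0::real" rule: linorder_cases)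
  case less
  have "((\<lambda>_. 0::real) has_real_derivative 0) (at x)" by simp
  moreover have "flat ((p - pderiv p) * [:0, 0, 1:]) x = 0" using less by (simp add: flat_def)
  moreover have "eventually (\<lambda>y. y < 0) (nhds x)"
    using less by (intro eventually_nhds_in_open[of "{..<0}", simplified]) auto
  then have "eventually (\<lambda>y. (0::real) = flat p y) (nhds x)" by eventually_elim (simp add: flat_def)
  ultimately show ?thesis using DERIV_cong_ev[OF refl, of "\<lambda>_. 0" "flat p" x 0 0] by auto
next
  case greater
  have "((\<lambda>x. poly p (inverse x) * exp (- inverse x)) has_real_derivative
      flat ((p - pderiv p) * [:0, 0, 1:]) x) (at x)"
    using greater
    by (auto intro!: derivative_eq_intros DERIV_chain'[OF _ poly_DERIV]
        simp: flat_def power2_eq_square algebra_simps)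
  moreover have "eventually (\<lambda>y. y > 0) (nhds x)"
    using greater by (intro eventually_nhds_in_open[of "{0<..}", simplified]) auto
  then have ev: "eventually (\<lambda>y. poly p (inverse y) * exp (- inverse y) = flat p y) (nhds x)"
    by eventually_elim (simp add: flat_def)
  ultimately show ?thesis by (simp only: DERIV_cong_ev[OF refl ev refl])
next
  case equal
  have "((\<lambda>h. flat p h / h) \<longlongrightarrow> 0) (at 0)"
    unfolding filterlim_split_at_real[of _ _ 0] 
  proof (intro filterlim_split_at)
    have "eventually (\<lambda>h. 0 = flat p h / h) (at_left 0)"
      unfolding eventually_at_filter by (auto simp: flat_def)
    then show "((\<lambda>h. flat p h / h) \<longlongrightarrow> 0) (at_left 0)"
      by (rule Lim_transform_eventually[OF tendsto_const])
    have "((\<lambda>h. inverse h ^ 1 * poly p (inverse h) * exp (- inverse h)) \<longlongrightarrow> 0) (at_right 0)"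
      by (rule filterlim_compose[OF poly_times_exp_minus_tendsto_0 filterlim_inverse_at_top_right])
    moreover have "eventually (\<lambda>h. inverse h ^ 1 * poly p (inverse h) * exp (- inverse h) = flat p h / h) (at_right 0)"
      by (rule eventually_at_rightI[of 0 1]) (auto simp: flat_def field_simps)
    ultimately show "((\<lambda>h. flat p h / h) \<longlongrightarrow> 0) (at_right 0)"
      by (rule Lim_transform_eventually)
  qed
  then show ?thesis unfolding equal by (simp add: DERIV_def flat_def)
qed

lemma smooth_flat: "smooth (flat p)"
proof (rule smooth_real_coinduct[where S="range flat"])
  fix c f assume "f \<in> range flat"
  then obtain q where f: "f = flat q" by blast
  show "(\<lambda>x. c *\<^sub>R f x) \<in> range flat"
    by (rule image_eqI[of _ _ "smult c q"]) (auto simp: f flat_def)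
  show "\<exists>f'\<in>range flat. \<forall>x. (f has_vector_derivative f' x) (at x)"
    using flat_deriv[of q] by (auto simp: f has_real_derivative_iff_has_vector_derivative)
qed auto

lemma flat_1_nonneg: "0 \<le> flat 1 x" and flat_1_le: "flat 1 x \<le> 1" and flat_1_pos: "x > 0 \<Longrightarrow> 0 < flat 1 x"
  and flat_nonpos: "x \<le> 0 \<Longrightarrow> flat p x = 0"
  by (auto simp: flat_def)

lemma flat_1_tendsto: "(\<lambda>n. flat 1 (real n * x)) \<longlonglongrightarrow> (if x > 0 then 1 else 0)"
proof (cases "x > 0")
  case True
  have "filterlim (\<lambda>n. real n * x) at_top sequentially"
    using True by (intro filterlim_at_top_mult_tendsto_pos[OF tendsto_const _ filterlim_real_sequentially])
  then have "(\<lambda>n. exp (- inverse (real n * x))) \<longlonglongrightarrow> exp (- 0)"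
    by (intro tendsto_intros tendsto_inverse_0_at_top)
  moreover have "eventually (\<lambda>n. exp (- inverse (real n * x)) = flat 1 (real n * x)) sequentially"
    using eventually_gt_at_top[of 0] by eventually_elim (use True in \<open>simp add: flat_def\<close>)
  ultimately show ?thesis using True by (simp add: Lim_transform_eventually)
next
  case False
  then have "flat 1 (real n * x) = 0" for n
    by (intro flat_nonpos) (simp add: mult_nonneg_nonpos)
  then show ?thesis using False by simp
qed

section \<open>Test functions\<close>

lemma test_functionsI:
  assumes "smooth \<phi>" "compact C" "C \<subseteq> U" "\<And>x. x \<notin> C \<Longrightarrow> \<phi> x = 0"
  shows "\<phi> \<in> test_functions U"
proof -
  have "closure {x. \<phi> x \<noteq> 0} \<subseteq> C"
    by (rule closure_minimal) (use assms compact_imp_closed in auto)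
  moreover from this have "compact (closure {x. \<phi> x \<noteq> 0})"
    using compact_Int_closed[OF assms(2) closed_closure[of "{x. \<phi> x \<noteq> 0}"]] by (simp add: Int_absorb1)
  ultimately show ?thesis unfolding test_functions_def
    using assms(1,3) by blast
qed

lemma test_functionsE:
  assumes "\<phi> \<in> test_functions U"
  obtains C where "smooth \<phi>" "compact C" "C \<subseteq> U" "\<And>x. x \<notin> C \<Longrightarrow> \<phi> x = 0"
proof (rule that[of "closure {x. \<phi> x \<noteq> 0}"])
  show "\<phi> x = 0" if "x \<notin> closure {x. \<phi> x \<noteq> 0}" for x
    using that closure_subset[of "{x. \<phi> x \<noteq> 0}"] by auto
qed (use assms in \<open>auto simp: test_functions_def\<close>)

lemma test_smooth: "\<phi> \<in> test_functions U \<Longrightarrow> smooth \<phi>"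
  by (simp add: test_functions_def)

lemma test_mono: "\<phi> \<in> test_functions U \<Longrightarrow> U \<subseteq> V \<Longrightarrow> \<phi> \<in> test_functions V"
  by (auto simp: test_functions_def)

lemma test_zero: "(\<lambda>_. 0) \<in> test_functions U"
  by (rule test_functionsI[where C="{}"]) (auto simp: smooth_const)

lemma test_bilinear_left:
  assumes "bounded_bilinear B" "\<phi> \<in> test_functions U" "smooth \<psi>"
  shows "(\<lambda>x. B (\<phi> x) (\<psi> x)) \<in> test_functions U"
proof -
  obtain C where "smooth \<phi>" "compact C" "C \<subseteq> U" "\<And>x. x \<notin> C \<Longrightarrow> \<phi> x = 0"
    using assms(2) by (rule test_functionsE) blast
  then show ?thesis
    using assms by (intro test_functionsI[of _ C]) (auto simp: smooth_bilinear bounded_bilinear.zero_left)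
qed

lemma test_linear:
  assumes "bounded_linear L" "\<phi> \<in> test_functions U"
  shows "(\<lambda>x. L (\<phi> x)) \<in> test_functions U"
proof -
  obtain C where "smooth \<phi>" "compact C" "C \<subseteq> U" "\<And>x. x \<notin> C \<Longrightarrow> \<phi> x = 0"
    using assms(2) by (rule test_functionsE) blast
  then show ?thesis
    using assms by (intro test_functionsI[of _ C]) (auto simp: smooth_linear_left linear_0 bounded_linear.linear)
qed

lemma test_add:
  assumes "\<phi> \<in> test_functions U" "\<psi> \<in> test_functions U"
  shows "(\<lambda>x. \<phi> x + \<psi> x) \<in> test_functions U"
proof -
  obtain C where C: "smooth \<phi>" "compact C" "C \<subseteq> U" "\<And>x. x \<notin> C \<Longrightarrow> \<phi> x = 0"
    using assms(1) by (rule test_functionsE) blast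
  obtain D where D: "smooth \<psi>" "compact D" "D \<subseteq> U" "\<And>x. x \<notin> D \<Longrightarrow> \<psi> x = 0"
    using assms(2) by (rule test_functionsE) blast
  show ?thesis
    using C D by (intro test_functionsI[of _ "C \<union> D"]) (auto simp: smooth_add compact_Un)
qed

lemma test_sum: "(\<And>i. i \<in> A \<Longrightarrow> f i \<in> test_functions U) \<Longrightarrow> (\<lambda>x. \<Sum>i\<in>A. f i x) \<in> test_functions U"
  by (induction A rule: infinite_finite_induct) (auto intro: test_add test_zero)

lemma test_lincomb:
  fixes \<phi> \<psi> :: "'a::euclidean_space \<Rightarrow> complex"
  assumes "\<phi> \<in> test_functions U" "\<psi> \<in> test_functions U"
  shows "(\<lambda>x. a * \<phi> x + b * \<psi> x) \<in> test_functions U"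
  by (intro test_add test_linear[OF bounded_linear_mult_right] assms)

lemma test_dir_deriv:
  assumes "\<phi> \<in> test_functions U"
  shows "dir_deriv e \<phi> \<in> test_functions U"
proof -
  obtain C where C: "smooth \<phi>" "compact C" "C \<subseteq> U" "\<And>x. x \<notin> C \<Longrightarrow> \<phi> x = 0"
    using assms by (rule test_functionsE) blast
  have "dir_deriv e \<phi> x = 0" if "x \<notin> C" for x
  proof -
    have "open (- C)" using C(2) compact_imp_closed by blast
    then have "(\<phi> has_derivative (\<lambda>_. 0)) (at x)"
      by (rule has_derivative_transform_within_open[rotated]) (use that C(4) in auto)
    then show ?thesis by (simp add: dir_deriv_eq)
  qed
  then show ?thesis using C by (intro test_functionsI[of _ C]) (auto simp: smooth_dir_deriv)
qed

lemma test_bounded: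
  assumes "\<phi> \<in> test_functions U"
  obtains B where "0 \<le> B" "\<And>x. norm (\<phi> x) \<le> B"
proof -
  obtain C where C: "smooth \<phi>" "compact C" "C \<subseteq> U" "\<And>x. x \<notin> C \<Longrightarrow> \<phi> x = 0"
    using assms by (rule test_functionsE) blast
  have "bounded (\<phi> ` C)"
    by (intro compact_imp_bounded compact_continuous_image smooth_continuous_on C)
  then obtain B where "\<And>x. x \<in> C \<Longrightarrow> norm (\<phi> x) \<le> B" by (auto simp: bounded_iff)
  then have "norm (\<phi> x) \<le> max B 0" for x using C(4)[of x] by (cases "x \<in> C") (auto simp: le_max_iff_disj)
  then show ?thesis using that[of "max B 0"] by simp
qed

lemma test_integrable:
  fixes \<phi> :: "'a::euclidean_space \<Rightarrow> 'b::{banach, second_countable_topology}"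
  assumes "\<phi> \<in> test_functions U"
  shows "integrable lborel \<phi>"
proof -
  obtain C where C: "smooth \<phi>" "compact C" "C \<subseteq> U" "\<And>x. x \<notin> C \<Longrightarrow> \<phi> x = 0"
    using assms by (rule test_functionsE) blast
  have "integrable lborel (\<lambda>x. indicator C x *\<^sub>R \<phi> x)"
    by (rule borel_integrable_compact) (auto intro: C smooth_continuous_on)
  also have "(\<lambda>x. indicator C x *\<^sub>R \<phi> x) = \<phi>" using C(4) by (auto simp: fun_eq_iff indicator_def)
  finally show ?thesis .
qed

lemma test_L2_lborel:
  fixes \<phi> :: "'a::euclidean_space \<Rightarrow> complex"
  assumes "\<phi> \<in> test_functions U"
  shows "\<phi> \<in> L2 lborel"
proof -
  have "integrable lborel (\<lambda>x. \<phi> x * cnj (\<phi> x))"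
    by (rule test_integrable[OF test_bilinear_left[OF bounded_bilinear_mult assms
         smooth_linear_left[OF bounded_linear_cnj test_smooth[OF assms]]]])
  then have "integrable lborel (\<lambda>x. (norm (\<phi> x))\<^sup>2)"
    by (drule_tac integrable_norm) (simp add: norm_mult power2_eq_square)
  then show ?thesis using smooth_measurable[OF test_smooth[OF assms]] by (simp add: L2_def)
qed

lemma L2_restrict_space:
  assumes "u \<in> L2 M" "\<Omega> \<in> sets M"
  shows "u \<in> L2 (restrict_space M \<Omega>)"
  unfolding L2_def
proof (intro CollectI conjI)
  show "u \<in> borel_measurable (restrict_space M \<Omega>)"
    by (intro measurable_restrict_space1 L2_measurable assms)
  show "integrable (restrict_space M \<Omega>) (\<lambda>x. (norm (u x))\<^sup>2)"
    using integrable_mult_indicator[OF assms(2) L2_integrable[OF assms(1)]]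
    by (subst integrable_restrict_space) (use assms(2) in auto)
qed

lemma test_L2:
  fixes \<phi> :: "'a::euclidean_space \<Rightarrow> complex"
  shows "\<phi> \<in> test_functions V \<Longrightarrow> open U \<Longrightarrow> \<phi> \<in> L2 (lebesgue_on_open U)"
  by (intro L2_restrict_space test_L2_lborel) auto

lemma test_tensor:
  fixes \<phi> :: "'a::euclidean_space \<Rightarrow> complex" and \<psi> :: "'b::euclidean_space \<Rightarrow> complex"
  assumes "\<phi> \<in> test_functions U" "\<psi> \<in> test_functions V"
  shows "(\<lambda>x. \<phi> (fst x) * \<psi> (snd x)) \<in> test_functions (U \<times> V)"
proof -
  obtain C where C: "smooth \<phi>" "compact C" "C \<subseteq> U" "\<And>x. x \<notin> C \<Longrightarrow> \<phi> x = 0"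
    using assms(1) by (rule test_functionsE) blast
  obtain D where D: "smooth \<psi>" "compact D" "D \<subseteq> V" "\<And>x. x \<notin> D \<Longrightarrow> \<psi> x = 0"
    using assms(2) by (rule test_functionsE) blast
  show ?thesis
  proof (rule test_functionsI[of _ "C \<times> D"])
    show "smooth (\<lambda>x. \<phi> (fst x) * \<psi> (snd x))"
      using smooth_mult[OF smooth_affine_right[OF bounded_linear_fst C(1), of 0]
          smooth_affine_right[OF bounded_linear_snd D(1), of 0]] by simp
    show "\<phi> (fst x) * \<psi> (snd x) = 0" if "x \<notin> C \<times> D" for x
      using C(4)[of "fst x"] D(4)[of "snd x"] that by (cases x) auto
  qed (use C D compact_Times in auto)
qed

lemma test_slice_fst:
  assumes "\<psi> \<in> test_functions (UNIV :: ('a::euclidean_space \<times> 'b::euclidean_space) set)"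
  shows "(\<lambda>s. \<psi> (s, t)) \<in> test_functions UNIV"
proof -
  obtain C where C: "smooth \<psi>" "compact C" "\<And>x. x \<notin> C \<Longrightarrow> \<psi> x = 0"
    using assms by (rule test_functionsE) blast
  have "smooth (\<lambda>s. \<psi> ((s, 0) + (0, t)))"
    by (rule smooth_affine_right[OF _ C(1)])
       (intro bounded_linear_Pair bounded_linear_ident bounded_linear_zero)
  then show ?thesis
    using C(2) C(3)[of "(_, t)"]
    by (intro test_functionsI[of _ "fst ` C"] compact_continuous_image continuous_intros) force+
qed

lemma test_slice_snd:
  assumes "\<psi> \<in> test_functions (UNIV :: ('a::euclidean_space \<times> 'b::euclidean_space) set)"
  shows "(\<lambda>t. \<psi> (s, t)) \<in> test_functions UNIV"
proof -
  obtain C where C: "smooth \<psi>" "compact C" "\<And>x. x \<notin> C \<Longrightarrow> \<psi> x = 0"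
    using assms by (rule test_functionsE) blast
  have "smooth (\<lambda>t. \<psi> ((0, t) + (s, 0)))"
    by (rule smooth_affine_right[OF _ C(1)])
       (intro bounded_linear_Pair bounded_linear_ident bounded_linear_zero)
  then show ?thesis
    using C(2) C(3)[of "(s, _)"]
    by (intro test_functionsI[of _ "snd ` C"] compact_continuous_image continuous_intros) force+
qed

section \<open>Weak derivatives\<close>

text \<open>A smooth approximation, from inside, of the indicator of the open box with corners
  \<open>l\<close> and \<open>u\<close>: each face is cut off by one factor \<open>flat 1\<close>,
  and increasing \<open>n\<close> sharpens these factors to indicators of half-spaces.\<close>

definition box_bump :: "'a::euclidean_space \<Rightarrow> 'a \<Rightarrow> nat \<Rightarrow> 'a \<Rightarrow> real" where
  "box_bump l u n x = (\<Prod>b\<in>Basis. flat 1 (real n * ((x - l) \<bullet> b)) * flat 1 (real n * ((u - x) \<bullet> b)))"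

lemma box_bump_outside: 
  assumes "x \<notin> box l u" shows "box_bump l u n x = 0"
proof -
  obtain b where b: "b \<in> Basis" "(x - l) \<bullet> b \<le> 0 \<or> (u - x) \<bullet> b \<le> 0"
    using assms by (auto simp: mem_box not_less inner_diff_left)
  then have "flat 1 (real n * ((x - l) \<bullet> b)) * flat 1 (real n * ((u - x) \<bullet> b)) = 0"
    by (auto intro!: flat_nonpos mult_nonneg_nonpos)
  then show ?thesis unfolding box_bump_def using b(1) by (auto intro!: prod_zero)
qed

lemma smooth_flat_affine:
  fixes l :: "'a::euclidean_space"
  shows "smooth (\<lambda>x. flat 1 (c * (x \<bullet> b) + d))"
  using smooth_affine_right[OF bounded_linear_const_mult[OF bounded_linear_inner_left] smooth_flat] .

lemma test_box_bump:
  assumes "cbox l u \<subseteq> U" shows "box_bump l u n \<in> test_functions U"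
proof (rule test_functionsI)
  have "smooth (\<lambda>x. flat 1 (real n * ((x - l) \<bullet> b)) * flat 1 (real n * ((u - x) \<bullet> b)))" for b
  proof (rule smooth_mult)
    show "smooth (\<lambda>x. flat 1 (real n * ((x - l) \<bullet> b)))"
      using smooth_flat_affine[of "real n" b "- real n * (l \<bullet> b)"] by (simp add: inner_diff_left algebra_simps)
    show "smooth (\<lambda>x. flat 1 (real n * ((u - x) \<bullet> b)))"
      using smooth_flat_affine[of "- real n" b "real n * (u \<bullet> b)"] by (simp add: inner_diff_left algebra_simps)
  qed
  then show "smooth (box_bump l u n)" unfolding box_bump_def[abs_def] by (rule smooth_prod)
  show "box_bump l u n x = 0" if "x \<notin> cbox l u" for x
    using that box_subset_cbox[of l u] by (intro box_bump_outside) auto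
qed (use assms in auto)

lemma box_bump_bounded: "\<bar>box_bump l u n x\<bar> \<le> 1"
  unfolding box_bump_def abs_prod
  by (intro prod_le_1) (auto simp: abs_mult flat_1_nonneg flat_1_le intro!: mult_le_one)

lemma box_bump_tendsto: "(\<lambda>n. box_bump l u n x) \<longlonglongrightarrow> indicator (box l u) x"
proof (cases "x \<in> box l u")
  case True
  have "(\<lambda>n. box_bump l u n x) \<longlonglongrightarrow> (\<Prod>b\<in>Basis. (if (x - l) \<bullet> b > 0 then 1 else 0) * (if (u - x) \<bullet> b > 0 then 1 else 0))"
    unfolding box_bump_def by (intro tendsto_intros flat_1_tendsto)
  also have "(\<Prod>b\<in>Basis. (if (x - l) \<bullet> b > 0 then 1 else 0) * (if (u - x) \<bullet> b > 0 then 1 else (0::real))) = 1"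
    using True by (intro prod.neutral) (auto simp: mem_box inner_diff_left)
  finally show ?thesis using True by simp
qed (simp add: box_bump_outside)

text \<open>Boxes form an intersection-stable generator of the Borel sets, and the sets over which
  \<open>F\<close> integrates to zero form a Dynkin system; the vanishing total integral is what
  closes it under complements.\<close>

lemma AE_zero_if_box_integrals_zero:
  fixes F :: "'a::euclidean_space \<Rightarrow> complex"
  assumes F: "integrable lborel F" and zero: "\<And>a b. (LINT x:box a b|lborel. F x) = 0"
    and total: "(LINT x|lborel. F x) = 0"
  shows "AE x in lborel. F x = 0"
proof (rule sigma_finite_measure.density_zero[OF lborel.sigma_finite_measure_axioms F])
  have SI: "set_integrable lborel A F" if "A \<in> sets lborel" for A
    unfolding set_integrable_def by (rule integrable_mult_indicator[OF that F])
  fix A :: "'a set" assume "A \<in> sets lborel"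
  then have *: "A \<in> sigma_sets UNIV (range (\<lambda>(a, b). box a b))"
    by (simp add: borel_eq_box[THEN arg_cong[where f=sets]])
  have "Int_stable (range (\<lambda>(a, b). box a b :: 'a set))"
  proof (rule Int_stableI)
    fix A B :: "'a set" assume "A \<in> range (\<lambda>(a, b). box a b)" "B \<in> range (\<lambda>(a, b). box a b)"
    then obtain a b c d where "A = box a b" "B = box c d" by auto
    then obtain l u where "A \<inter> B = box l u" by (simp only: box_Int_box)
    then show "A \<inter> B \<in> range (\<lambda>(a, b). box a b)" by (simp only:) (rule range_eqI[of _ _ "(l, u)"], rule prod.case[symmetric])
  qed
  moreover have "range (\<lambda>(a, b). box a b :: 'a set) \<subseteq> Pow UNIV" by simp
  ultimately show "(LINT x:A|lborel. F x) = 0" using *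
  proof (induction rule: sigma_sets_induct_disjoint)
    case (compl A)
    then have A: "A \<in> sets lborel" by (simp add: borel_eq_box[THEN arg_cong[where f=sets]])
    have "(LINT x:UNIV|lborel. F x) = (LINT x:A|lborel. F x) + (LINT x:UNIV - A|lborel. F x)"
      using set_integral_Un[of A "UNIV - A" lborel F] SI A by (simp add: Compl_eq_Diff_UNIV[symmetric])
    then show ?case using compl total by (simp add: set_lebesgue_integral_def)
  next
    case (union A)
    then have A: "A i \<in> sets lborel" for i by (auto simp: borel_eq_box[THEN arg_cong[where f=sets]])
    show ?case
      by (subst lebesgue_integral_countable_add)
         (use union A SI in \<open>auto simp: disjoint_family_on_def sets.countable_UN\<close>)
  next
    case (basic A)
    then show ?case using zero by auto
  qed (simp add: set_lebesgue_integral_def)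
qed

lemma integral_lebesgue_on_open:
  fixes f :: "'a::euclidean_space \<Rightarrow> 'b::{banach, second_countable_topology}"
  shows "open U \<Longrightarrow> (LINT x|lebesgue_on_open U. f x) = (LINT x|lborel. indicator U x *\<^sub>R f x)"
  by (subst integral_restrict_space) auto

lemma space_lebesgue_on_open [simp]: "space (lebesgue_on_open U) = U"
  by (simp add: space_restrict_space)

text \<open>Test functions approximating the indicator of a box transfer the hypothesis to box
  integrals as long as the closed box lies in \<open>U\<close>. This gives the claim on each such
  box, and by the Lindelof property countably many of them cover \<open>U\<close>.\<close>

lemma fundamental_lemma:
  fixes g :: "'a::euclidean_space \<Rightarrow> complex"
  assumes U: "open U" and g: "g \<in> L2 (lebesgue_on_open U)"
    and zero: "\<And>\<phi> :: 'a \<Rightarrow> real. \<phi> \<in> test_functions U \<Longrightarrow> (LINT x|lebesgue_on_open U. \<phi> x *\<^sub>R g x) = 0"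
  shows "AE x in lebesgue_on_open U. g x = 0"
proof -
  let ?W = "lebesgue_on_open U"
  have US: "U \<inter> space lborel \<in> sets lborel" using U by simp
  have local: "AE x in lborel. x \<in> box l u \<longrightarrow> g x = 0" if lu: "cbox l u \<subseteq> U" for l u
  proof -
    have ind: "(\<lambda>x. indicator (cbox a b) x :: complex) \<in> L2 ?W" for a b :: 'a
    proof (rule L2_restrict_space)
      have "integrable lborel (\<lambda>x. indicator (cbox a b) x :: real)"
        by (rule integrable_real_indicator[OF _ emeasure_bounded_finite[OF bounded_cbox]]) simp
      then show "(\<lambda>x. indicator (cbox a b) x :: complex) \<in> L2 lborel"
        unfolding L2_def
        by (auto simp: indicator_def power2_eq_square of_bool_def if_distrib cong: if_cong)
    qed (use U in auto)
    have dom: "integrable ?W (\<lambda>x. norm (indicator (cbox l u) x * g x))"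
      by (intro integrable_norm L2_prod_integrable ind g)
    have sub0: "(LINT x|?W. indicator (box a b) x *\<^sub>R g x) = 0" if ab: "cbox a b \<subseteq> U" for a b
    proof -
      have "(\<lambda>n. LINT x|?W. box_bump a b n x *\<^sub>R g x) \<longlonglongrightarrow> (LINT x|?W. indicator (box a b) x *\<^sub>R g x)"
      proof (rule integral_dominated_convergence)
        show "integrable ?W (\<lambda>x. norm (indicator (cbox a b) x * g x))"
          by (intro integrable_norm L2_prod_integrable ind g)
        show "(\<lambda>x. indicator (box a b) x *\<^sub>R g x) \<in> borel_measurable ?W"
          by (intro borel_measurable_scaleR[OF measurable_restrict_space1 L2_measurable[OF g]]) auto
        show "(\<lambda>x. box_bump a b n x *\<^sub>R g x) \<in> borel_measurable ?W" for n
          using smooth_measurable[OF test_smooth[OF test_box_bump[OF ab]]]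
          by (intro borel_measurable_scaleR[OF measurable_restrict_space1 L2_measurable[OF g]]) auto
        show "AE x in ?W. (\<lambda>n. box_bump a b n x *\<^sub>R g x) \<longlonglongrightarrow> indicator (box a b) x *\<^sub>R g x"
          by (intro AE_I2 tendsto_intros box_bump_tendsto)
        have "norm (box_bump a b n x *\<^sub>R g x) \<le> norm (indicator (cbox a b) x * g x)" for n x
          using box_bump_bounded[of a b n x] box_bump_outside[of x a b n] box_subset_cbox[of a b]
          by (cases "x \<in> box a b") (auto simp: mult_left_le_one_le subset_iff)
        then show "AE x in ?W. norm (box_bump a b n x *\<^sub>R g x) \<le> norm (indicator (cbox a b) x * g x)" for n
          by simp
      qed
      then show ?thesis by (simp add: zero[OF test_box_bump[OF ab]] LIMSEQ_const_iff)
    qed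
    define F where "F x = indicator (box l u) x *\<^sub>R g x" for x
    have Feq: "F x = indicator U x *\<^sub>R (indicator (box l u) x *\<^sub>R g x)" for x
      using lu box_subset_cbox[of l u] by (auto simp: F_def indicator_def)
    have "integrable ?W (\<lambda>x. indicator (box l u) x *\<^sub>R g x)"
      by (intro Bochner_Integration.integrable_bound[OF dom]
            borel_measurable_scaleR[OF measurable_restrict_space1 L2_measurable[OF g]])
         (auto simp: indicator_def box_subset_cbox[THEN subsetD])
    then have F: "integrable lborel F"
      unfolding Feq[abs_def] by (simp only: integrable_restrict_space[OF US])
    have tot: "(LINT x|lborel. F x) = 0"
      using sub0[OF lu] unfolding integral_lebesgue_on_open[OF U] Feq[symmetric] .
    have "(LINT x:box a b|lborel. F x) = 0" for a b
    proof -
      obtain c d where cd: "box a b \<inter> box l u = box c d" by (simp only: box_Int_box)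
      show ?thesis
      \<comment> \<open>The closed box is the closure of the open one only if the latter is
        nonempty; otherwise it may be nonempty and lie outside \<open>U\<close>.\<close>
      proof (cases "box c d = {}")
        case True
        then have "indicator (box a b) x *\<^sub>R F x = 0" for x
          using cd by (auto simp: F_def indicator_def)
        then show ?thesis unfolding set_lebesgue_integral_def by (simp only: integral_zero)
      next
        case False
        have "cbox c d = closure (box c d)" using False by (simp add: closure_box)
        also have "\<dots> \<subseteq> cbox l u" unfolding cd[symmetric]
          by (intro closure_minimal) (use box_subset_cbox in auto)
        finally have "cbox c d \<subseteq> U" using lu by blast
        from sub0[OF this] have "(LINT x|lborel. indicator U x *\<^sub>R (indicator (box c d) x *\<^sub>R g x)) = 0"
          unfolding integral_lebesgue_on_open[OF U] .
        moreover have "indicator U x *\<^sub>R (indicator (box c d) x *\<^sub>R g x) = indicator (box a b) x *\<^sub>R F x" for x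
          using \<open>cbox c d \<subseteq> U\<close> box_subset_cbox[of c d] unfolding cd[symmetric] F_def
          by (auto simp: indicator_def)
        ultimately show ?thesis by (simp add: set_lebesgue_integral_def)
      qed
    qed
    from AE_zero_if_box_integrals_zero[OF F this tot]
    show ?thesis by eventually_elim (auto simp: F_def)
  qed
  define \<F> where "\<F> = {box l u | l u. cbox l u \<subseteq> U}"
  have "\<And>S. S \<in> \<F> \<Longrightarrow> open S" by (auto simp: \<F>_def)
  then obtain \<F>' where F': "\<F>' \<subseteq> \<F>" "countable \<F>'" "\<Union>\<F>' = \<Union>\<F>" by (rule Lindelof) blast
  have cover: "U \<subseteq> \<Union>\<F>"
  proof
    fix x assume "x \<in> U"
    then obtain e where "e > 0" "ball x e \<subseteq> U" using U open_contains_ball by blast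
    then obtain e where e: "e > 0" "cball x e \<subseteq> U"
      by (metis ball_subset_cball cball_subset_ball_iff dual_order.trans field_lbound_gt_zero open_contains_cball U \<open>x \<in> U\<close>)
    obtain l u where lu: "x \<in> box l u" "cbox l u \<subseteq> cball x e"
      using rational_boxes[of e x] e(1)
      by (metis closure_box closure_minimal closed_cball ball_subset_cball dual_order.trans equals0D)
    have "box l u \<in> \<F>" unfolding \<F>_def using lu(2) e(2) by blast
    then show "x \<in> \<Union>\<F>" using lu(1) by blast
  qed
  have "AE x in lborel. \<forall>S\<in>\<F>'. x \<in> S \<longrightarrow> g x = 0"
    by (subst AE_ball_countable[OF F'(2)]) (use F'(1) local in \<open>auto simp: \<F>_def\<close>)
  then have "AE x in lborel. x \<in> U \<longrightarrow> g x = 0"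
    by eventually_elim (use cover F'(3) in blast)
  then show ?thesis by (simp add: AE_restrict_space_iff U)
qed

text \<open>By translation invariance of Lebesgue measure every difference quotient has integral zero.\<close>

lemma integral_dir_deriv_test:
  fixes \<phi> :: "'a::euclidean_space \<Rightarrow> 'b::{banach, second_countable_topology}"
  assumes t: "\<phi> \<in> test_functions UNIV"
  shows "(LINT x|lborel. dir_deriv e \<phi> x) = 0"
proof -
  obtain C where C: "smooth \<phi>" "compact C" "\<And>x. x \<notin> C \<Longrightarrow> \<phi> x = 0"
    using t by (rule test_functionsE) blast
  obtain R where R: "C \<subseteq> cball 0 R" "R > 0"
    using compact_imp_bounded[OF C(2)] unfolding bounded_pos by (auto simp: subset_iff)
  obtain B where B: "0 \<le> B" "\<And>x. norm (dir_deriv e \<phi> x) \<le> B"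
    using test_bounded[OF test_dir_deriv[OF t]] by blast
  define h where "h n = inverse (real (Suc n))" for n
  have h: "0 < h n" "h n \<le> 1" for n by (auto simp: h_def field_simps)
  have h0: "h \<longlonglongrightarrow> 0" unfolding h_def by (rule LIMSEQ_inverse_real_of_nat)
  have "h n \<noteq> 0" for n using h(1)[of n] by simp
  then have hat: "filterlim h (at 0) sequentially"
    unfolding filterlim_at using h0 by simp
  define g where "g n x = (1 / h n) *\<^sub>R (\<phi> (x + h n *\<^sub>R e) - \<phi> x)" for n x
  have vd: "((\<lambda>t. \<phi> (x + t *\<^sub>R e)) has_vector_derivative dir_deriv e \<phi> (x + t *\<^sub>R e)) (at t)" for x t
  proof -
    have "((\<lambda>t. x + t *\<^sub>R e) has_derivative (\<lambda>s. s *\<^sub>R e)) (at t)"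
      by (auto intro!: derivative_eq_intros)
    from has_derivative_compose[OF this smooth_has_derivative[OF C(1)]]
    show ?thesis
      using linear_scale[OF has_derivative_linear[OF smooth_has_derivative[OF C(1)]]]
      by (simp add: has_vector_derivative_def)
  qed
  have "(\<lambda>n. LINT x|lborel. g n x) \<longlonglongrightarrow> (LINT x|lborel. dir_deriv e \<phi> x)"
  proof (rule integral_dominated_convergence)
    \<comment> \<open>Since \<open>h n \<le> 1\<close>, all difference quotients are supported in
      this ball, and the mean value inequality bounds them by \<open>B\<close>.\<close>
    let ?K = "cball 0 (R + norm e) :: 'a set"
    show "integrable lborel (\<lambda>x. B * indicator ?K x)"
      using emeasure_bounded_finite[of ?K] by simp
    show "dir_deriv e \<phi> \<in> borel_measurable lborel"
      using smooth_measurable[OF smooth_dir_deriv[OF C(1)]] by simp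
    show "g n \<in> borel_measurable lborel" for n
      unfolding g_def using smooth_measurable[OF C(1)] by measurable
    show "AE x in lborel. (\<lambda>n. g n x) \<longlonglongrightarrow> dir_deriv e \<phi> x"
    proof (rule AE_I2)
      fix x
      have "((\<lambda>t. (1 / t) *\<^sub>R (\<phi> (x + t *\<^sub>R e) - \<phi> x)) \<longlongrightarrow> dir_deriv e \<phi> x) (at 0)"
      proof (rule LIM_zero_cancel, rule tendsto_norm_zero_cancel, rule Lim_transform_eventually)
        show "((\<lambda>t. norm (\<phi> (x + t *\<^sub>R e) - \<phi> x - t *\<^sub>R dir_deriv e \<phi> x) / norm t) \<longlongrightarrow> 0) (at 0)"
          using vd[of x 0] by (simp add: has_vector_derivative_def has_derivative_at)
        have "norm (\<phi> (x + t *\<^sub>R e) - \<phi> x - t *\<^sub>R dir_deriv e \<phi> x) / norm t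
            = norm ((1 / t) *\<^sub>R (\<phi> (x + t *\<^sub>R e) - \<phi> x) - dir_deriv e \<phi> x)" if "t \<noteq> 0" for t
        proof -
          have "(1 / t) *\<^sub>R (\<phi> (x + t *\<^sub>R e) - \<phi> x) - dir_deriv e \<phi> x
              = (1 / t) *\<^sub>R (\<phi> (x + t *\<^sub>R e) - \<phi> x - t *\<^sub>R dir_deriv e \<phi> x)"
            using that by (simp add: scaleR_diff_right)
          then show ?thesis by (simp add: divide_inverse mult.commute)
        qed
        then show "\<forall>\<^sub>F t in at 0. norm (\<phi> (x + t *\<^sub>R e) - \<phi> x - t *\<^sub>R dir_deriv e \<phi> x) / norm t
            = norm ((1 / t) *\<^sub>R (\<phi> (x + t *\<^sub>R e) - \<phi> x) - dir_deriv e \<phi> x)"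
          unfolding eventually_at_filter by simp
      qed
      then show "(\<lambda>n. g n x) \<longlonglongrightarrow> dir_deriv e \<phi> x"
        unfolding g_def by (rule filterlim_compose[OF _ hat])
    qed
    have "norm (g n x) \<le> B * indicator ?K x" for n x
    proof (cases "x \<in> ?K")
      case True
      have "norm (\<phi> (x + h n *\<^sub>R e) - \<phi> (x + 0 *\<^sub>R e)) \<le> B * h n - B * 0"
      proof (rule differentiable_bound_general[OF h(1)])
        show "continuous_on {0..h n} (\<lambda>t. \<phi> (x + t *\<^sub>R e))"
          by (intro continuous_on_compose2[OF smooth_continuous_on[OF C(1), of UNIV]] continuous_intros) auto
        show "((*) B has_vector_derivative B) (at t)" for t
          by (auto simp: has_real_derivative_iff_has_vector_derivative[symmetric] intro!: derivative_eq_intros)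
      qed (use vd B in \<open>auto intro!: continuous_intros\<close>)
      then show ?thesis using True h(1)[of n]
        by (simp add: g_def divide_simps mult.commute flip: divide_inverse del: scaleR_diff_right)
    next
      case False
      have "x \<notin> C" "x + h n *\<^sub>R e \<notin> C"
      proof -
        have "norm x \<le> norm (x + h n *\<^sub>R e) + norm (h n *\<^sub>R e)"
          by (metis add_diff_cancel_right' norm_triangle_ineq4)
        moreover have "norm (h n *\<^sub>R e) \<le> norm e" using h[of n] by (simp add: mult_left_le_one_le)
        moreover have "norm y \<le> R" if "y \<in> C" for y using that R(1) by auto
        moreover have "norm x > R + norm e" using False by simp
        ultimately show "x \<notin> C" "x + h n *\<^sub>R e \<notin> C" using norm_ge_zero[of e] by (smt (verit))+
      qed
      then show ?thesis using False C(3) by (simp add: g_def)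
    qed
    then show "AE x in lborel. norm (g n x) \<le> B * indicator ?K x" for n by simp
  qed
  moreover have "(LINT x|lborel. g n x) = 0" for n
  proof -
    have eq: "(LINT x|lborel. \<phi> x) = (LINT x|lborel. \<phi> (h n *\<^sub>R e + x))"
      using integral_distr[of "(+) (h n *\<^sub>R e)" lborel borel \<phi>] smooth_measurable[OF C(1)]
      by (simp add: lborel_distr_plus)
    have "integrable (distr lborel borel ((+) (h n *\<^sub>R e))) \<phi>"
      using test_integrable[OF t] by (simp add: lborel_distr_plus)
    then have "integrable lborel (\<lambda>x. \<phi> (h n *\<^sub>R e + x))"
      by (subst (asm) integrable_distr_eq) (auto simp: smooth_measurable[OF C(1)])
    then show ?thesis unfolding g_def using eq test_integrable[OF t]
      by (simp add: add.commute)
  qed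
  ultimately show ?thesis by (simp add: LIMSEQ_const_iff)
qed

lemma dir_deriv_bilinear:
  assumes "bounded_bilinear B" "smooth f" "smooth g"
  shows "dir_deriv e (\<lambda>x. B (f x) (g x)) x = B (f x) (dir_deriv e g x) + B (dir_deriv e f x) (g x)"
  by (rule dir_deriv_eq[OF bounded_bilinear.FDERIV[OF assms(1) smooth_has_derivative[OF assms(2)] smooth_has_derivative[OF assms(3)]]])

lemma dir_deriv_lincomb:
  fixes f g :: "'a::euclidean_space \<Rightarrow> complex"
  assumes "smooth f" "smooth g"
  shows "dir_deriv e (\<lambda>x. a * f x + b * g x) x = a * dir_deriv e f x + b * dir_deriv e g x"
  by (rule dir_deriv_eq[OF has_derivative_add[OF has_derivative_mult_right[OF smooth_has_derivative[OF assms(1)]]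
        has_derivative_mult_right[OF smooth_has_derivative[OF assms(2)]]]])

text \<open>Integration by parts: the product of the two functions has compact support, so its
  derivative integrates to zero over the whole space, and the support of \<phi> in \<open>U\<close>
  lets integrals over \<open>U\<close> replace those over the whole space.\<close>

lemma is_weak_deriv_test:
  fixes \<psi> :: "'a::euclidean_space \<Rightarrow> complex"
  assumes "open U" "\<psi> \<in> test_functions UNIV"
  shows "is_weak_deriv U e \<psi> (dir_deriv e \<psi>)"
  unfolding is_weak_deriv_def
proof
  fix \<phi> :: "'a \<Rightarrow> real" assume t: "\<phi> \<in> test_functions U"
  note s = test_smooth[OF t] test_smooth[OF assms(2)]
  have z: "indicator U x *\<^sub>R (f x *\<^sub>R v) = f x *\<^sub>R v" if "f \<in> test_functions U" for f :: "'a \<Rightarrow> real" and x and v :: complex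
    using that by (rule test_functionsE) (auto simp: indicator_def)
  have i: "integrable lborel (\<lambda>x. f x *\<^sub>R g x)" if "f \<in> test_functions U" "smooth g"
    for f :: "'a \<Rightarrow> real" and g :: "'a \<Rightarrow> complex"
    using test_integrable[OF test_bilinear_left[OF bounded_bilinear_scaleR that]] .
  have "0 = (LINT x|lborel. \<phi> x *\<^sub>R dir_deriv e \<psi> x + dir_deriv e \<phi> x *\<^sub>R \<psi> x)"
    using integral_dir_deriv_test[OF test_mono[OF test_bilinear_left[OF bounded_bilinear_scaleR t s(2)]], of e]
    unfolding dir_deriv_bilinear[OF bounded_bilinear_scaleR s] by simp
  also have "\<dots> = (LINT x|lborel. \<phi> x *\<^sub>R dir_deriv e \<psi> x) + (LINT x|lborel. dir_deriv e \<phi> x *\<^sub>R \<psi> x)"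
    by (intro Bochner_Integration.integral_add i t test_dir_deriv smooth_dir_deriv s)
  finally show "(LINT x|lebesgue_on_open U. dir_deriv e \<phi> x *\<^sub>R \<psi> x) = - (LINT x|lebesgue_on_open U. \<phi> x *\<^sub>R dir_deriv e \<psi> x)"
    unfolding integral_lebesgue_on_open[OF assms(1)] z[OF t] z[OF test_dir_deriv[OF t]] by (simp add: add_eq_0_iff)
qed

lemma test_of_real:
  "\<phi> \<in> test_functions U \<Longrightarrow> (\<lambda>x. complex_of_real (\<phi> x)) \<in> test_functions U"
  by (rule test_linear[OF bounded_linear_of_real])

text \<open>Written with inner products, the condition is linear and continuous in \<open>u\<close>
  and \<open>g\<close> with respect to \<open>L2\<close> norms; linearity, uniqueness and closedness
  of weak derivatives are derived from this form.\<close>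

lemma is_weak_deriv_iff:
  fixes u :: "'a::euclidean_space \<Rightarrow> complex"
  shows "is_weak_deriv U e u g \<longleftrightarrow> (\<forall>\<phi>\<in>test_functions U.
     L2_inner (lebesgue_on_open U) u (\<lambda>x. complex_of_real (dir_deriv e \<phi> x))
      = - L2_inner (lebesgue_on_open U) g (\<lambda>x. complex_of_real (\<phi> x)))"
  by (simp add: is_weak_deriv_def L2_inner_def scaleR_conv_of_real mult.commute)

lemma is_weak_deriv_lincomb:
  assumes U: "open U" and u: "u \<in> L2 (lebesgue_on_open U)" "v \<in> L2 (lebesgue_on_open U)"
    and g: "g \<in> L2 (lebesgue_on_open U)" "h \<in> L2 (lebesgue_on_open U)"
    and d: "is_weak_deriv U e u g" "is_weak_deriv U e v h"
  shows "is_weak_deriv U e (\<lambda>x. a * u x + b * v x) (\<lambda>x. a * g x + b * h x)"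
  unfolding is_weak_deriv_iff
proof
  fix \<phi> :: "'a \<Rightarrow> real" assume t: "\<phi> \<in> test_functions U"
  show "L2_inner (lebesgue_on_open U) (\<lambda>x. a * u x + b * v x) (\<lambda>x. complex_of_real (dir_deriv e \<phi> x))
      = - L2_inner (lebesgue_on_open U) (\<lambda>x. a * g x + b * h x) (\<lambda>x. complex_of_real (\<phi> x))"
    using d t unfolding is_weak_deriv_iff
      L2_inner_lincomb_left[OF u test_L2[OF test_of_real[OF test_dir_deriv[OF t]] U]]
      L2_inner_lincomb_left[OF g test_L2[OF test_of_real[OF t] U]] by simp
qed

lemma is_weak_deriv_unique:
  assumes U: "open U" and g: "g \<in> L2 (lebesgue_on_open U)" "h \<in> L2 (lebesgue_on_open U)"
    and d: "is_weak_deriv U e u g" "is_weak_deriv U e u h"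
  shows "AE x in lebesgue_on_open U. g x = h x"
proof -
  have "AE x in lebesgue_on_open U. g x - h x = 0"
  proof (rule fundamental_lemma[OF U L2_diff[OF g]])
    fix \<phi> :: "'a \<Rightarrow> real" assume t: "\<phi> \<in> test_functions U"
    have "L2_inner (lebesgue_on_open U) g (\<lambda>x. of_real (\<phi> x)) = L2_inner (lebesgue_on_open U) h (\<lambda>x. of_real (\<phi> x))"
      using d t unfolding is_weak_deriv_iff by simp
    then have "L2_inner (lebesgue_on_open U) (\<lambda>x. g x - h x) (\<lambda>x. of_real (\<phi> x)) = 0"
      using L2.q_diff[OF g test_L2[OF test_of_real[OF t] U]] by simp
    then show "(LINT x|lebesgue_on_open U. \<phi> x *\<^sub>R (g x - h x)) = 0"
      by (simp add: L2_inner_def scaleR_conv_of_real mult.commute)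
  qed
  then show ?thesis by simp
qed

lemma is_weak_deriv_limit:
  assumes U: "open U" and u: "\<And>n. V n \<in> L2 (lebesgue_on_open U)" "v \<in> L2 (lebesgue_on_open U)"
     "L2_conv (lebesgue_on_open U) V v"
    and g: "\<And>n. G n \<in> L2 (lebesgue_on_open U)" "g \<in> L2 (lebesgue_on_open U)" "L2_conv (lebesgue_on_open U) G g"
    and d: "\<And>n. is_weak_deriv U e (V n) (G n)"
  shows "is_weak_deriv U e v g"
  unfolding is_weak_deriv_iff
proof
  fix \<phi> :: "'a \<Rightarrow> real" assume t: "\<phi> \<in> test_functions U"
  let ?W = "lebesgue_on_open U"
  note c = test_L2[OF test_of_real[OF t] U] test_L2[OF test_of_real[OF test_dir_deriv[OF t]] U, of e]
  have "(\<lambda>n. L2_inner ?W (V n) (\<lambda>x. of_real (dir_deriv e \<phi> x))) \<longlonglongrightarrow> L2_inner ?W v (\<lambda>x. of_real (dir_deriv e \<phi> x))"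
    by (rule L2_conv_inner[OF u c(2) c(2) L2_conv_const])
  moreover have "(\<lambda>n. L2_inner ?W (V n) (\<lambda>x. of_real (dir_deriv e \<phi> x))) = (\<lambda>n. - L2_inner ?W (G n) (\<lambda>x. of_real (\<phi> x)))"
    using d t unfolding is_weak_deriv_iff by simp
  moreover have "(\<lambda>n. - L2_inner ?W (G n) (\<lambda>x. of_real (\<phi> x))) \<longlonglongrightarrow> - L2_inner ?W g (\<lambda>x. of_real (\<phi> x))"
    by (intro tendsto_minus L2_conv_inner[OF g c(1) c(1) L2_conv_const])
  ultimately show "L2_inner ?W v (\<lambda>x. of_real (dir_deriv e \<phi> x)) = - L2_inner ?W g (\<lambda>x. of_real (\<phi> x))"
    using LIMSEQ_unique by metis
qed

lemma L2_norm_zero [simp]: "L2_norm M (\<lambda>_. 0) = 0"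
  by (simp add: L2_norm_def)

lemma weak_deriv_spec:
  assumes "u \<in> W12 U" "e \<in> Basis"
  shows "weak_deriv U e u \<in> L2 (lebesgue_on_open U)" "is_weak_deriv U e u (weak_deriv U e u)"
proof -
  have "\<exists>g. g \<in> L2 (lebesgue_on_open U) \<and> is_weak_deriv U e u g"
    using assms unfolding W12_def by blast
  from someI_ex[OF this] show "weak_deriv U e u \<in> L2 (lebesgue_on_open U)" "is_weak_deriv U e u (weak_deriv U e u)"
    unfolding weak_deriv_def by blast+
qed

lemma weak_deriv_eqI:
  assumes "open U" "g \<in> L2 (lebesgue_on_open U)" "is_weak_deriv U e u g"
  shows "AE x in lebesgue_on_open U. weak_deriv U e u x = g x" "weak_deriv U e u \<in> L2 (lebesgue_on_open U)"
proof -
  have "\<exists>g. g \<in> L2 (lebesgue_on_open U) \<and> is_weak_deriv U e u g"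
    using assms by blast
  from someI_ex[OF this] have *: "weak_deriv U e u \<in> L2 (lebesgue_on_open U)" "is_weak_deriv U e u (weak_deriv U e u)"
    unfolding weak_deriv_def by blast+
  show "weak_deriv U e u \<in> L2 (lebesgue_on_open U)" by (rule *)
  show "AE x in lebesgue_on_open U. weak_deriv U e u x = g x"
    by (rule is_weak_deriv_unique[OF assms(1) *(1) assms(2) *(2) assms(3)])
qed

lemma W12_L2: "u \<in> W12 U \<Longrightarrow> u \<in> L2 (lebesgue_on_open U)"
  by (simp add: W12_def)

lemma W12_lincomb:
  assumes U: "open U" and u: "u \<in> W12 U" "v \<in> W12 U"
  shows "(\<lambda>x. a * u x + b * v x) \<in> W12 U"
    and "e \<in> Basis \<Longrightarrow> AE x in lebesgue_on_open U.
      weak_deriv U e (\<lambda>x. a * u x + b * v x) x = a * weak_deriv U e u x + b * weak_deriv U e v x"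
proof -
  have *: "is_weak_deriv U e (\<lambda>x. a * u x + b * v x) (\<lambda>x. a * weak_deriv U e u x + b * weak_deriv U e v x)"
    "(\<lambda>x. a * weak_deriv U e u x + b * weak_deriv U e v x) \<in> L2 (lebesgue_on_open U)"
    if e: "e \<in> Basis" for e
    by (intro is_weak_deriv_lincomb U W12_L2 u weak_deriv_spec e L2_lincomb)+
  then show "(\<lambda>x. a * u x + b * v x) \<in> W12 U"
    unfolding W12_def using L2_lincomb[OF u[THEN W12_L2]] by blast
  show "AE x in lebesgue_on_open U.
      weak_deriv U e (\<lambda>x. a * u x + b * v x) x = a * weak_deriv U e u x + b * weak_deriv U e v x" if "e \<in> Basis"
    by (rule weak_deriv_eqI[OF U *(2,1)[OF that]])
qed

lemma W12_diff:
  assumes U: "open U" and u: "u \<in> W12 U" "v \<in> W12 U"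
  shows "(\<lambda>x. u x - v x) \<in> W12 U"
    and "e \<in> Basis \<Longrightarrow> AE x in lebesgue_on_open U.
      weak_deriv U e (\<lambda>x. u x - v x) x = weak_deriv U e u x - weak_deriv U e v x"
  using W12_lincomb[OF assms, where a=1 and b="-1"] by simp_all

lemma L2_norm_weak_deriv_diff:
  assumes U: "open U" and u: "u \<in> W12 U" "v \<in> W12 U" and e: "e \<in> Basis"
  shows "L2_norm (lebesgue_on_open U) (weak_deriv U e (\<lambda>x. u x - v x))
    = L2_norm (lebesgue_on_open U) (\<lambda>x. weak_deriv U e u x - weak_deriv U e v x)"
  by (rule L2_norm_AE_cong[OF W12_diff(2)[OF U u e]])
     (intro L2_measurable L2_diff weak_deriv_spec W12_diff U u e)+

lemma test_W12:
  assumes "open U" "\<psi> \<in> test_functions UNIV"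
  shows "\<psi> \<in> W12 U"
    and "e \<in> Basis \<Longrightarrow> AE x in lebesgue_on_open U. weak_deriv U e \<psi> x = dir_deriv e \<psi> x"
proof -
  have *: "is_weak_deriv U e \<psi> (dir_deriv e \<psi>)" "dir_deriv e \<psi> \<in> L2 (lebesgue_on_open U)" for e
    by (intro is_weak_deriv_test test_L2[OF test_dir_deriv[OF assms(2)]] assms)+
  then show "\<psi> \<in> W12 U" using test_L2[OF assms(2,1)] unfolding W12_def by blast
  show "AE x in lebesgue_on_open U. weak_deriv U e \<psi> x = dir_deriv e \<psi> x"
    by (rule weak_deriv_eqI[OF assms(1) *(2,1)])
qed

definition W12_conv :: "'a::euclidean_space set \<Rightarrow> (nat \<Rightarrow> 'a \<Rightarrow> complex) \<Rightarrow> ('a \<Rightarrow> complex) \<Rightarrow> bool" where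
  "W12_conv U V v \<longleftrightarrow> L2_conv (lebesgue_on_open U) V v \<and>
     (\<forall>e\<in>Basis. L2_conv (lebesgue_on_open U) (\<lambda>n. weak_deriv U e (V n)) (weak_deriv U e v))"

lemma W12_norm_tendsto_iff:
  assumes U: "open U" and V: "\<And>n. V n \<in> W12 U" and v: "v \<in> W12 U"
  shows "(\<lambda>n. W12_norm U (\<lambda>x. V n x - v x)) \<longlonglongrightarrow> 0 \<longleftrightarrow> W12_conv U V v"
proof -
  let ?N = "L2_norm (lebesgue_on_open U)"
  define a where "a n = ?N (\<lambda>x. V n x - v x)" for n
  define b where "b e n = ?N (\<lambda>x. weak_deriv U e (V n) x - weak_deriv U e v x)" for e n
  have N: "W12_norm U (\<lambda>x. V n x - v x) = sqrt ((a n)\<^sup>2 + (\<Sum>e\<in>Basis. (b e n)\<^sup>2))" for n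
    unfolding W12_norm_def a_def b_def by (simp add: L2_norm_weak_deriv_diff[OF U V v])
  have nn: "a n \<ge> 0" "b e n \<ge> 0" for e n by (auto simp: a_def b_def)
  show ?thesis
  proof
    assume *: "(\<lambda>n. W12_norm U (\<lambda>x. V n x - v x)) \<longlonglongrightarrow> 0"
    have "a \<longlonglongrightarrow> 0"
      by (rule Lim_null_comparison[OF _ *], rule always_eventually)
         (auto simp: N nn intro!: real_le_rsqrt sum_nonneg)
    moreover have "b e \<longlonglongrightarrow> 0" if "e \<in> Basis" for e
    proof (rule Lim_null_comparison[OF always_eventually[OF allI] *])
      fix n
      have "(b e n)\<^sup>2 \<le> (\<Sum>e\<in>Basis. (b e n)\<^sup>2)" using that by (intro member_le_sum) auto
      then show "norm (b e n) \<le> W12_norm U (\<lambda>x. V n x - v x)"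
        unfolding N using nn by (auto intro!: real_le_rsqrt add_increasing)
    qed
    ultimately show "W12_conv U V v" unfolding W12_conv_def a_def b_def by simp
  next
    assume "W12_conv U V v"
    then have "a \<longlonglongrightarrow> 0" "\<And>e. e \<in> Basis \<Longrightarrow> b e \<longlonglongrightarrow> 0" 
      unfolding W12_conv_def a_def b_def by auto
    then have "(\<lambda>n. sqrt ((a n)\<^sup>2 + (\<Sum>e\<in>Basis. (b e n)\<^sup>2))) \<longlonglongrightarrow> sqrt (0\<^sup>2 + (\<Sum>e\<in>(Basis::'a set). 0\<^sup>2))"
      by (intro tendsto_intros)
    then show "(\<lambda>n. W12_norm U (\<lambda>x. V n x - v x)) \<longlonglongrightarrow> 0" by (simp add: N)
  qed
qed

lemma zero_trace_iff:
  assumes U: "open U"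
  shows "has_trace U \<nu> u (\<lambda>_. 0) \<longleftrightarrow> u \<in> W12 U \<and>
    (\<exists>\<psi>. (\<forall>n. \<psi> n \<in> test_functions UNIV) \<and> W12_conv U \<psi> u \<and> (\<lambda>n. L2_norm \<nu> (\<psi> n)) \<longlonglongrightarrow> 0)"
  unfolding has_trace_def using W12_norm_tendsto_iff[OF U test_W12(1)[OF U]]
  by (auto simp: W12_norm_tendsto_iff[OF U test_W12(1)[OF U]])

text \<open>Weak differentiation is a closed operator: limits of the derivatives exist by
  completeness of \<open>L2\<close> and are weak derivatives of the limit, hence almost everywhere
  equal to the ones picked by \<open>weak_deriv\<close>.\<close>

lemma W12_closed:
  assumes U: "open U" and V: "\<And>n. V n \<in> W12 U" and v: "v \<in> L2 (lebesgue_on_open U)"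
    and c: "L2_conv (lebesgue_on_open U) V v"
    and d: "\<And>e. e \<in> Basis \<Longrightarrow> L2_Cauchy (lebesgue_on_open U) (\<lambda>n. weak_deriv U e (V n))"
  shows "v \<in> W12 U" "W12_conv U V v"
proof -
  have *: "\<exists>g. g \<in> L2 (lebesgue_on_open U) \<and> L2_conv (lebesgue_on_open U) (\<lambda>n. weak_deriv U e (V n)) g
      \<and> is_weak_deriv U e v g" if e: "e \<in> Basis" for e
    using L2_complete[OF weak_deriv_spec(1)[OF V e] d[OF e]]
      is_weak_deriv_limit[OF U W12_L2[OF V] v c weak_deriv_spec(1)[OF V e] _ _ weak_deriv_spec(2)[OF V e]]
    by blast
  then show w: "v \<in> W12 U" unfolding W12_def using v by blast
  have "L2_conv (lebesgue_on_open U) (\<lambda>n. weak_deriv U e (V n)) (weak_deriv U e v)" if e: "e \<in> Basis" for e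
  proof -
    obtain g where g: "g \<in> L2 (lebesgue_on_open U)" "is_weak_deriv U e v g"
      "L2_conv (lebesgue_on_open U) (\<lambda>n. weak_deriv U e (V n)) g" using *[OF e] by blast
    have "L2_norm (lebesgue_on_open U) (\<lambda>x. weak_deriv U e (V n) x - weak_deriv U e v x)
        = L2_norm (lebesgue_on_open U) (\<lambda>x. weak_deriv U e (V n) x - g x)" for n
      by (rule L2_norm_AE_cong, use weak_deriv_eqI(1)[OF U g(1,2)] in eventually_elim, simp)
         (intro L2_measurable L2_diff weak_deriv_spec V e w g)+
    then show ?thesis using g(3) by simp
  qed
  then show "W12_conv U V v" using c by (simp add: W12_conv_def)
qed

text \<open>Diagonal argument.\<close>

lemma zero_trace_closed:
  assumes U: "open U" and V: "\<And>n. has_trace U \<nu> (V n) (\<lambda>_. 0)" and v: "v \<in> W12 U" and c: "W12_conv U V v"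
  shows "has_trace U \<nu> v (\<lambda>_. 0)"
proof -
  let ?W = "lebesgue_on_open U"
  have VW: "V n \<in> W12 U" for n using V by (simp add: has_trace_def)
  have "\<forall>n. \<exists>\<psi>. \<psi> \<in> test_functions UNIV \<and> L2_norm \<nu> \<psi> < inverse (Suc n) \<and>
      L2_norm ?W (\<lambda>x. \<psi> x - V n x) < inverse (Suc n) \<and>
      (\<forall>e\<in>Basis. L2_norm ?W (\<lambda>x. weak_deriv U e \<psi> x - weak_deriv U e (V n) x) < inverse (Suc n))"
  proof
    fix n
    obtain \<psi> where \<psi>: "\<And>k. \<psi> k \<in> test_functions UNIV" "W12_conv U \<psi> (V n)" "(\<lambda>k. L2_norm \<nu> (\<psi> k)) \<longlonglongrightarrow> 0"
      using V[of n] unfolding zero_trace_iff[OF U] by blast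
    have p: "0 < inverse (real (Suc n))" by simp
    have "\<forall>\<^sub>F k in sequentially. L2_norm \<nu> (\<psi> k) < inverse (Suc n)"
      using order_tendstoD(2)[OF \<psi>(3) p] .
    moreover have "\<forall>\<^sub>F k in sequentially. L2_norm ?W (\<lambda>x. \<psi> k x - V n x) < inverse (Suc n)"
      using \<psi>(2) order_tendstoD(2)[OF _ p] unfolding W12_conv_def by blast
    moreover have "\<forall>\<^sub>F k in sequentially. \<forall>e\<in>Basis. L2_norm ?W (\<lambda>x. weak_deriv U e (\<psi> k) x - weak_deriv U e (V n) x) < inverse (Suc n)"
      using \<psi>(2) order_tendstoD(2)[OF _ p] unfolding W12_conv_def by (intro eventually_ball_finite) auto
    ultimately have "\<forall>\<^sub>F k in sequentially. L2_norm \<nu> (\<psi> k) < inverse (Suc n) \<and>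
       L2_norm ?W (\<lambda>x. \<psi> k x - V n x) < inverse (Suc n) \<and> 
       (\<forall>e\<in>Basis. L2_norm ?W (\<lambda>x. weak_deriv U e (\<psi> k) x - weak_deriv U e (V n) x) < inverse (Suc n))"
      by eventually_elim blast
    then show "\<exists>\<psi>. \<psi> \<in> test_functions UNIV \<and> L2_norm \<nu> \<psi> < inverse (Suc n) \<and>
      L2_norm ?W (\<lambda>x. \<psi> x - V n x) < inverse (Suc n) \<and>
      (\<forall>e\<in>Basis. L2_norm ?W (\<lambda>x. weak_deriv U e \<psi> x - weak_deriv U e (V n) x) < inverse (Suc n))"
      using \<psi>(1) eventually_happens'[OF sequentially_bot] by blast
  qed
  from choice[OF this]
  obtain \<psi> where \<psi>: "\<And>n. \<psi> n \<in> test_functions UNIV" "\<And>n. L2_norm \<nu> (\<psi> n) < inverse (Suc n)"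
    "\<And>n. L2_norm ?W (\<lambda>x. \<psi> n x - V n x) < inverse (Suc n)"
    "\<And>n e. e \<in> Basis \<Longrightarrow> L2_norm ?W (\<lambda>x. weak_deriv U e (\<psi> n) x - weak_deriv U e (V n) x) < inverse (Suc n)"
    by blast
  have comb: "L2_conv ?W A z" if "\<And>n. A n \<in> L2 ?W" "\<And>n. Z n \<in> L2 ?W" "z \<in> L2 ?W"
    "\<And>n. L2_norm ?W (\<lambda>x. A n x - Z n x) < inverse (Suc n)" "L2_conv ?W Z z" for A Z z
  proof (rule Lim_null_comparison[OF always_eventually[OF allI]])
    show "norm (L2_norm ?W (\<lambda>x. A n x - z x)) \<le> inverse (Suc n) + L2_norm ?W (\<lambda>x. Z n x - z x)" for n
      using L2_norm_triangle[OF that(1)[of n] that(2)[of n] that(3)] that(4)[of n] by simp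
    show "(\<lambda>n. inverse (real (Suc n)) + L2_norm ?W (\<lambda>x. Z n x - z x)) \<longlonglongrightarrow> 0"
      using tendsto_add[OF LIMSEQ_inverse_real_of_nat that(5)] by simp
  qed
  have tW: "\<psi> n \<in> W12 U" for n by (rule test_W12[OF U \<psi>(1)])
  have "L2_conv ?W \<psi> v"
    by (rule comb[OF _ _ _ \<psi>(3)]) (use c in \<open>auto simp: W12_L2 tW VW v W12_conv_def\<close>)
  moreover have "L2_conv ?W (\<lambda>n. weak_deriv U e (\<psi> n)) (weak_deriv U e v)" if e: "e \<in> Basis" for e
    by (rule comb[OF _ _ _ \<psi>(4)[OF e]]) (use c e in \<open>auto simp: weak_deriv_spec tW VW v W12_conv_def\<close>)
  moreover have "(\<lambda>n. L2_norm \<nu> (\<psi> n)) \<longlonglongrightarrow> 0"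
    by (rule Lim_null_comparison[OF always_eventually[OF allI] LIMSEQ_inverse_real_of_nat])
       (use \<psi>(2) in \<open>simp add: less_imp_le\<close>)
  ultimately show ?thesis unfolding zero_trace_iff[OF U] W12_conv_def using v \<psi>(1) by blast
qed

lemma W12_conv_lincomb:
  assumes U: "open U" and u: "\<And>n. V n \<in> W12 U" "v \<in> W12 U" "W12_conv U V v"
    and w: "\<And>n. Y n \<in> W12 U" "y \<in> W12 U" "W12_conv U Y y"
  shows "W12_conv U (\<lambda>n x. a * V n x + b * Y n x) (\<lambda>x. a * v x + b * y x)"
  unfolding W12_conv_def
proof safe
  let ?W = "lebesgue_on_open U"
  show "L2_conv ?W (\<lambda>n x. a * V n x + b * Y n x) (\<lambda>x. a * v x + b * y x)"
    using u(3) w(3) unfolding W12_conv_def by (intro L2_conv_lincomb W12_L2 u(1,2) w(1,2)) auto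
  fix e :: 'a assume e: "e \<in> Basis"
  have "L2_norm ?W (\<lambda>x. weak_deriv U e (\<lambda>x. a * V n x + b * Y n x) x - weak_deriv U e (\<lambda>x. a * v x + b * y x) x)
     = L2_norm ?W (\<lambda>x. a * weak_deriv U e (V n) x + b * weak_deriv U e (Y n) x - (a * weak_deriv U e v x + b * weak_deriv U e y x))" for n
    by (rule L2_norm_AE_cong, use W12_lincomb(2)[OF U u(1)[of n] w(1)[of n] e, of a b] W12_lincomb(2)[OF U u(2) w(2) e, of a b] in eventually_elim, simp)
       (intro L2_measurable L2_diff L2_lincomb weak_deriv_spec W12_lincomb U u w e)+
  moreover have "L2_conv ?W (\<lambda>n x. a * weak_deriv U e (V n) x + b * weak_deriv U e (Y n) x) (\<lambda>x. a * weak_deriv U e v x + b * weak_deriv U e y x)"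
    using u(3) w(3) e unfolding W12_conv_def by (intro L2_conv_lincomb weak_deriv_spec u(1,2) w(1,2)) auto
  ultimately show "L2_conv ?W (\<lambda>n. weak_deriv U e (\<lambda>x. a * V n x + b * Y n x)) (weak_deriv U e (\<lambda>x. a * v x + b * y x))"
    by simp
qed

lemma zero_trace_lincomb:
  assumes U: "open U" and nu: "test_functions UNIV \<subseteq> L2 \<nu>"
    and u: "has_trace U \<nu> u (\<lambda>_. 0)" "has_trace U \<nu> v (\<lambda>_. 0)"
  shows "has_trace U \<nu> (\<lambda>x. a * u x + b * v x) (\<lambda>_. 0)"
proof -
  obtain \<psi> where \<psi>: "\<And>n. \<psi> n \<in> test_functions UNIV" "W12_conv U \<psi> u" "(\<lambda>k. L2_norm \<nu> (\<psi> k)) \<longlonglongrightarrow> 0"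
    using u(1) unfolding zero_trace_iff[OF U] by blast
  obtain \<eta> where \<eta>: "\<And>n. \<eta> n \<in> test_functions UNIV" "W12_conv U \<eta> v" "(\<lambda>k. L2_norm \<nu> (\<eta> k)) \<longlonglongrightarrow> 0"
    using u(2) unfolding zero_trace_iff[OF U] by blast
  have w: "u \<in> W12 U" "v \<in> W12 U" using u by (auto simp: has_trace_def)
  have "L2_conv \<nu> (\<lambda>n x. a * \<psi> n x + b * \<eta> n x) (\<lambda>x. a * 0 + b * 0)"
    by (rule L2_conv_lincomb) (use \<psi> \<eta> nu in auto)
  then show ?thesis unfolding zero_trace_iff[OF U]
    by (intro conjI exI[of _ "\<lambda>n x. a * \<psi> n x + b * \<eta> n x"] W12_lincomb W12_conv_lincomb U w allI
         test_lincomb \<psi> \<eta> test_W12) simp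
qed

section \<open>Coercive forms\<close>

text \<open>Boundary conditions are encoded by a set of boundary measures, so that intervals with
  counting measure on end points and the strip with length measure on its sides share one existence
  theory.\<close>

definition W12_zero :: "'a::euclidean_space set \<Rightarrow> 'a measure set \<Rightarrow> ('a \<Rightarrow> complex) set" where
  "W12_zero U \<N> = {u \<in> W12 U. \<forall>\<nu>\<in>\<N>. has_trace U \<nu> u (\<lambda>_. 0)}"

definition coef_form :: "'a::euclidean_space set \<Rightarrow> ('a \<Rightarrow> 'a \<Rightarrow> real) \<Rightarrow> ('a \<Rightarrow> real)
    \<Rightarrow> ('a \<Rightarrow> complex) \<Rightarrow> ('a \<Rightarrow> complex) \<Rightarrow> complex" where
  "coef_form U A B u v =
     (\<Sum>e\<in>Basis. L2_inner (lebesgue_on_open U) (\<lambda>x. of_real (A e x) * weak_deriv U e u x) (weak_deriv U e v))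
     + L2_inner (lebesgue_on_open U) (\<lambda>x. of_real (B x) * u x) v"

definition bounded_coef :: "'a::euclidean_space set \<Rightarrow> ('a \<Rightarrow> real) \<Rightarrow> bool" where
  "bounded_coef U w \<longleftrightarrow> w \<in> borel_measurable (lebesgue_on_open U) \<and> (\<exists>C. \<forall>x\<in>U. \<bar>w x\<bar> \<le> C)"

lemma bounded_coefE:
  assumes "bounded_coef U w"
  obtains C where "0 \<le> C" "\<And>x. x \<in> U \<Longrightarrow> \<bar>w x\<bar> \<le> C"
proof -
  obtain C where "\<forall>x\<in>U. \<bar>w x\<bar> \<le> C" using assms unfolding bounded_coef_def by blast
  then show ?thesis using that[of "max C 0"] by (auto simp: le_max_iff_disj)
qed

lemma bounded_coef_L2:
  assumes "bounded_coef U w" "u \<in> L2 (lebesgue_on_open U)"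
  shows "(\<lambda>x. complex_of_real (w x) * u x) \<in> L2 (lebesgue_on_open U)"
proof -
  obtain C where "0 \<le> C" "\<And>x. x \<in> U \<Longrightarrow> \<bar>w x\<bar> \<le> C" using bounded_coefE[OF assms(1)] by blast
  then show ?thesis using assms
    by (intro L2_bounded_mult[of _ _ _ C]) (auto simp: bounded_coef_def)
qed

lemma bounded_coef_L2_norm:
  assumes "bounded_coef U w"
  obtains C where "0 \<le> C" "\<And>u. u \<in> L2 (lebesgue_on_open U) \<Longrightarrow>
    L2_norm (lebesgue_on_open U) (\<lambda>x. complex_of_real (w x) * u x) \<le> C * L2_norm (lebesgue_on_open U) u"
proof -
  obtain C where "0 \<le> C" "\<And>x. x \<in> U \<Longrightarrow> \<bar>w x\<bar> \<le> C" using bounded_coefE[OF assms(1)] by blast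
  then show ?thesis using assms
    by (intro that[of C] L2_norm_bounded_mult) (auto simp: bounded_coef_def)
qed

lemma L2_inner_real_mult:
  "L2_inner M (\<lambda>x. complex_of_real (w x) * u x) v = L2_inner M u (\<lambda>x. complex_of_real (w x) * v x)"
  unfolding L2_inner_def by (simp add: mult_ac)

lemma W12_zero_lincomb:
  assumes "open U" "\<And>\<nu>. \<nu> \<in> \<N> \<Longrightarrow> test_functions UNIV \<subseteq> L2 \<nu>" "u \<in> W12_zero U \<N>" "v \<in> W12_zero U \<N>"
  shows "(\<lambda>x. a * u x + b * v x) \<in> W12_zero U \<N>"
  using assms(3,4) unfolding W12_zero_def
  by (auto intro: W12_lincomb(1)[OF assms(1)] zero_trace_lincomb[OF assms(1,2)])

lemma W12_zero_W12: "u \<in> W12_zero U \<N> \<Longrightarrow> u \<in> W12 U"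
  by (simp add: W12_zero_def)

lemma W12_zero_closed:
  assumes U: "open U" and V: "\<And>n. V n \<in> W12_zero U \<N>" and v: "v \<in> L2 (lebesgue_on_open U)"
    and c: "L2_conv (lebesgue_on_open U) V v"
    and d: "\<And>e. e \<in> Basis \<Longrightarrow> L2_Cauchy (lebesgue_on_open U) (\<lambda>n. weak_deriv U e (V n))"
  shows "v \<in> W12_zero U \<N>" "W12_conv U V v"
proof -
  note * = W12_closed[OF U W12_zero_W12[OF V] v c d]
  show "W12_conv U V v" by (rule *)
  have "has_trace U \<nu> v (\<lambda>_. 0)" if "\<nu> \<in> \<N>" for \<nu>
    by (rule zero_trace_closed[OF U _ *]) (use V that in \<open>auto simp: W12_zero_def\<close>)
  then show "v \<in> W12_zero U \<N>" using * by (simp add: W12_zero_def)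
qed

lemma coef_form_lincomb:
  assumes U: "open U" and A: "\<And>e. e \<in> Basis \<Longrightarrow> bounded_coef U (A e)" and B: "bounded_coef U B"
    and u: "u \<in> W12 U" "v \<in> W12 U" "w \<in> W12 U"
  shows "coef_form U A B (\<lambda>x. a * u x + b * v x) w = a * coef_form U A B u w + b * coef_form U A B v w"
proof -
  let ?W = "lebesgue_on_open U"
  have 1: "L2_inner ?W (\<lambda>x. of_real (A e x) * weak_deriv U e (\<lambda>x. a * u x + b * v x) x) (weak_deriv U e w)
     = a * L2_inner ?W (\<lambda>x. of_real (A e x) * weak_deriv U e u x) (weak_deriv U e w)
      + b * L2_inner ?W (\<lambda>x. of_real (A e x) * weak_deriv U e v x) (weak_deriv U e w)" if e: "e \<in> Basis" for e
  proof -
    have "L2_inner ?W (\<lambda>x. of_real (A e x) * weak_deriv U e (\<lambda>x. a * u x + b * v x) x) (weak_deriv U e w)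
       = L2_inner ?W (\<lambda>x. a * (of_real (A e x) * weak_deriv U e u x) + b * (of_real (A e x) * weak_deriv U e v x)) (weak_deriv U e w)"
      by (rule L2_inner_AE_cong, use W12_lincomb(2)[OF U u(1,2) e, of a b] in eventually_elim, simp add: algebra_simps)
         (intro AE_I2 refl L2_measurable bounded_coef_L2[OF A[OF e]] weak_deriv_spec W12_lincomb U u e L2_lincomb)+
    then show ?thesis
      by (simp add: L2_inner_lincomb_left bounded_coef_L2[OF A[OF e]] weak_deriv_spec u e)
  qed
  have 2: "L2_inner ?W (\<lambda>x. of_real (B x) * (a * u x + b * v x)) w
     = a * L2_inner ?W (\<lambda>x. of_real (B x) * u x) w + b * L2_inner ?W (\<lambda>x. of_real (B x) * v x) w"
    using L2_inner_lincomb_left[OF bounded_coef_L2[OF B W12_L2[OF u(1)]] bounded_coef_L2[OF B W12_L2[OF u(2)]] W12_L2[OF u(3)], of a b]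
    by (simp add: algebra_simps)
  show ?thesis unfolding coef_form_def 2 by (simp add: 1 sum.distrib sum_distrib_left algebra_simps)
qed

lemma coef_form_commute: "coef_form U A B v u = cnj (coef_form U A B u v)"
proof -
  have "L2_inner M (\<lambda>x. complex_of_real (w x) * p x) r = cnj (L2_inner M (\<lambda>x. complex_of_real (w x) * r x) p)"
    for M :: "'a measure" and w p r
    by (simp only: L2_inner_real_mult[of M w p r] L2_inner_commute[of M p])
  then show ?thesis
    unfolding coef_form_def complex_cnj_add cnj_sum by (intro arg_cong2[where f="(+)"] sum.cong refl)
qed

text \<open>Real coefficients make the form hermitian, so by coercivity it is itself a semi-inner
  product on the domain and the Riesz representation suffices. Completeness holds because coercivity
  turns Cauchy sequences for the form into Cauchy sequences in \<open>W12\<close>, and the domain is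
  closed under \<open>W12\<close> limits.\<close>

lemma lax_milgram:
  assumes U: "open U" and nu: "\<And>\<nu>. \<nu> \<in> \<N> \<Longrightarrow> test_functions UNIV \<subseteq> L2 \<nu>"
    and A: "\<And>e. e \<in> Basis \<Longrightarrow> bounded_coef U (A e)" and B: "bounded_coef U B" and c: "c > 0"
    and coercive: "\<And>u. u \<in> W12_zero U \<N> \<Longrightarrow> c * ((L2_norm (lebesgue_on_open U) u)\<^sup>2
       + (\<Sum>e\<in>Basis. (L2_norm (lebesgue_on_open U) (weak_deriv U e u))\<^sup>2)) \<le> Re (coef_form U A B u u)"
    and f: "f \<in> L2 (lebesgue_on_open U)"
  shows "\<exists>u\<in>W12_zero U \<N>. \<forall>v\<in>W12_zero U \<N>. coef_form U A B u v = L2_inner (lebesgue_on_open U) f v"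
proof -
  let ?W = "lebesgue_on_open U" and ?q = "coef_form U A B" and ?V = "W12_zero U \<N>"
  have co1: "(L2_norm ?W u)\<^sup>2 \<le> Re (?q u u) / c" if "u \<in> ?V" for u
  proof -
    have "c * (L2_norm ?W u)\<^sup>2 \<le> c * ((L2_norm ?W u)\<^sup>2 + (\<Sum>e\<in>Basis. (L2_norm ?W (weak_deriv U e u))\<^sup>2))"
      using c by (intro mult_left_mono) (auto intro: sum_nonneg)
    then show ?thesis using coercive[OF that] c by (simp add: field_simps)
  qed
  have co2: "(L2_norm ?W (weak_deriv U e u))\<^sup>2 \<le> Re (?q u u) / c" if "u \<in> ?V" "e \<in> Basis" for u e
  proof -
    have "(L2_norm ?W (weak_deriv U e u))\<^sup>2 \<le> (\<Sum>e\<in>Basis. (L2_norm ?W (weak_deriv U e u))\<^sup>2)"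
      using that(2) by (intro member_le_sum) auto
    then have "c * (L2_norm ?W (weak_deriv U e u))\<^sup>2 \<le> c * ((L2_norm ?W u)\<^sup>2 + (\<Sum>e\<in>Basis. (L2_norm ?W (weak_deriv U e u))\<^sup>2))"
      using c by (intro mult_left_mono) (auto intro: add_increasing)
    then show ?thesis using coercive[OF that(1)] c by (simp add: field_simps)
  qed
  have nonneg: "0 \<le> Re (?q u u)" if "u \<in> ?V" for u
  proof -
    have "0 \<le> Re (?q u u) / c" using co1[OF that] by (rule order_trans[rotated]) simp
    then show ?thesis using c by (simp add: zero_le_divide_iff)
  qed
  interpret Q: semi_inner ?V ?q
  proof
    show "(\<lambda>x. a * u x + b * v x) \<in> ?V" if "u \<in> ?V" "v \<in> ?V" for u v a b
      by (rule W12_zero_lincomb[OF U nu that])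
    show "?q (\<lambda>x. a * u x + b * v x) w = a * ?q u w + b * ?q v w" if "u \<in> ?V" "v \<in> ?V" "w \<in> ?V" for u v w a b
      using that by (intro coef_form_lincomb U A B W12_zero_W12)
  qed (rule coef_form_commute, rule nonneg)
  have "\<exists>u\<in>?V. \<forall>v\<in>?V. ?q v u = L2_inner ?W v f"
  proof (rule Q.riesz)
    show "(\<lambda>_. 0) \<in> ?V"
    proof -
      have z: "(\<lambda>_. 0) \<in> W12 U" by (rule test_W12[OF U test_zero])
      have "W12_conv U (\<lambda>n _. 0) (\<lambda>_. 0)" by (simp add: W12_conv_def L2_conv_const)
      then have "has_trace U \<nu> (\<lambda>_. 0) (\<lambda>_. 0)" for \<nu>
        unfolding zero_trace_iff[OF U] using z
        by (intro conjI exI[of _ "\<lambda>_ _. 0"]) (auto simp: test_zero L2_norm_def)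
      then show ?thesis using z by (simp add: W12_zero_def)
    qed
    show "L2_inner ?W (\<lambda>x. a * u x + b * v x) f = a * L2_inner ?W u f + b * L2_inner ?W v f"
      if "u \<in> ?V" "v \<in> ?V" for u v a b
      by (rule L2_inner_lincomb_left[OF that[THEN W12_zero_W12, THEN W12_L2] f])
    show "norm (L2_inner ?W u f) \<le> (L2_norm ?W f / sqrt c) * sqrt (Re (?q u u))" if "u \<in> ?V" for u
    proof -
      have "L2_norm ?W u \<le> sqrt (Re (?q u u) / c)" by (rule real_le_rsqrt[OF co1[OF that]])
      then have "L2_norm ?W u * L2_norm ?W f \<le> sqrt (Re (?q u u) / c) * L2_norm ?W f"
        by (rule mult_right_mono) simp
      then show ?thesis using L2_cauchy_schwarz[OF W12_L2[OF W12_zero_W12[OF that]] f]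
        by (simp add: real_sqrt_divide mult.commute)
    qed
    fix V :: "nat \<Rightarrow> 'a \<Rightarrow> complex" assume V: "\<And>n. V n \<in> ?V"
      and C: "\<And>e. e > 0 \<Longrightarrow> \<exists>N. \<forall>m\<ge>N. \<forall>n\<ge>N. Re (?q (\<lambda>x. V m x - V n x) (\<lambda>x. V m x - V n x)) < e"
    have VW: "V n \<in> W12 U" for n by (rule W12_zero_W12[OF V])
    have step: "L2_Cauchy ?W G" if b: "\<And>m n. (L2_norm ?W (\<lambda>x. G m x - G n x))\<^sup>2 \<le> Re (?q (\<lambda>x. V m x - V n x) (\<lambda>x. V m x - V n x)) / c" for G :: "nat \<Rightarrow> 'a \<Rightarrow> complex"
      unfolding L2_Cauchy_def
    proof safe
      fix e :: real assume e: "e > 0"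
      obtain N where N: "\<And>m n. m \<ge> N \<Longrightarrow> n \<ge> N \<Longrightarrow> Re (?q (\<lambda>x. V m x - V n x) (\<lambda>x. V m x - V n x)) < c * e\<^sup>2"
        using C[of "c * e\<^sup>2"] c e by auto
      have "L2_norm ?W (\<lambda>x. G m x - G n x) < e" if "m \<ge> N" "n \<ge> N" for m n
      proof (rule power2_less_imp_less)
        show "(L2_norm ?W (\<lambda>x. G m x - G n x))\<^sup>2 < e\<^sup>2"
          using b[of m n] N[OF that] c by (auto intro: le_less_trans simp: divide_less_eq mult.commute)
      qed (use e in simp)
      then show "\<exists>N. \<forall>m\<ge>N. \<forall>n\<ge>N. L2_norm ?W (\<lambda>x. G m x - G n x) < e" by blast
    qed
    have "L2_Cauchy ?W V" by (rule step, rule co1, rule Q.diff_mem[OF V V])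
    from L2_complete[OF W12_L2[OF VW] this] obtain v where v: "v \<in> L2 ?W" "L2_conv ?W V v" by blast
    have d: "L2_Cauchy ?W (\<lambda>n. weak_deriv U e (V n))" if "e \<in> Basis" for e
      by (rule step) (simp only: flip: L2_norm_weak_deriv_diff[OF U VW VW that], rule co2[OF Q.diff_mem[OF V V] that])
    note cl = W12_zero_closed[OF U V v d]
    have vW: "v \<in> W12 U" by (rule W12_zero_W12[OF cl(1)])
    have "\<exists>D. \<forall>e\<in>Basis. D e \<ge> 0 \<and> (\<forall>u\<in>L2 ?W. L2_norm ?W (\<lambda>x. of_real (A e x) * u x) \<le> D e * L2_norm ?W u)"
      using bounded_coef_L2_norm[OF A] by (intro bchoice) metis
    then obtain D where D: "\<And>e u. e \<in> Basis \<Longrightarrow> u \<in> L2 ?W \<Longrightarrow> L2_norm ?W (\<lambda>x. of_real (A e x) * u x) \<le> D e * L2_norm ?W u"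
      by blast
    obtain E where E: "\<And>u. u \<in> L2 ?W \<Longrightarrow> L2_norm ?W (\<lambda>x. of_real (B x) * u x) \<le> E * L2_norm ?W u"
      using bounded_coef_L2_norm[OF B] by blast
    have bnd: "Re (L2_inner ?W (\<lambda>x. of_real (w x) * p x) p) \<le> K * (L2_norm ?W p)\<^sup>2"
      if "bounded_coef U w" "p \<in> L2 ?W" "L2_norm ?W (\<lambda>x. of_real (w x) * p x) \<le> K * L2_norm ?W p" for w p K
    proof -
      have "Re (L2_inner ?W (\<lambda>x. of_real (w x) * p x) p) \<le> L2_norm ?W (\<lambda>x. of_real (w x) * p x) * L2_norm ?W p"
        using L2_cauchy_schwarz[OF bounded_coef_L2[OF that(1,2)] that(2)] complex_Re_le_cmod order_trans by blast
      also have "\<dots> \<le> K * L2_norm ?W p * L2_norm ?W p" by (intro mult_right_mono that) simp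
      finally show ?thesis by (simp add: power2_eq_square mult_ac)
    qed
    \<comment> \<open>Bounded coefficients give the converse of coercivity, so \<open>W12\<close>
      convergence implies convergence for the form.\<close>
    have up: "Re (?q (\<lambda>x. V n x - v x) (\<lambda>x. V n x - v x)) \<le>
        (\<Sum>e\<in>Basis. D e * (L2_norm ?W (\<lambda>x. weak_deriv U e (V n) x - weak_deriv U e v x))\<^sup>2)
         + E * (L2_norm ?W (\<lambda>x. V n x - v x))\<^sup>2" for n
    proof -
      have w: "(\<lambda>x. V n x - v x) \<in> W12 U" by (rule W12_diff[OF U VW vW])
      show ?thesis
        unfolding coef_form_def plus_complex.simps Re_sum
        by (intro add_mono sum_mono bnd B E W12_L2 w, subst L2_norm_weak_deriv_diff[OF U VW vW, symmetric], assumption)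
           (intro bnd A D weak_deriv_spec w; assumption)
    qed
    have "(\<lambda>n. (\<Sum>e\<in>Basis. D e * (L2_norm ?W (\<lambda>x. weak_deriv U e (V n) x - weak_deriv U e v x))\<^sup>2)
         + E * (L2_norm ?W (\<lambda>x. V n x - v x))\<^sup>2) \<longlonglongrightarrow> (\<Sum>e\<in>(Basis::'a set). D e * 0\<^sup>2) + E * 0\<^sup>2"
      using cl(2) unfolding W12_conv_def by (intro tendsto_intros) auto
    then have null: "(\<lambda>n. (\<Sum>e\<in>Basis. D e * (L2_norm ?W (\<lambda>x. weak_deriv U e (V n) x - weak_deriv U e v x))\<^sup>2)
         + E * (L2_norm ?W (\<lambda>x. V n x - v x))\<^sup>2) \<longlonglongrightarrow> 0" by simp
    have "(\<lambda>n. Re (?q (\<lambda>x. V n x - v x) (\<lambda>x. V n x - v x))) \<longlonglongrightarrow> 0"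
      by (rule Lim_null_comparison[OF always_eventually[OF allI] null])
         (simp only: real_norm_def abs_of_nonneg[OF Q.q_nonneg[OF Q.diff_mem[OF V cl(1)]]] up)
    then show "\<exists>u\<in>?V. (\<lambda>n. Re (?q (\<lambda>x. V n x - u x) (\<lambda>x. V n x - u x))) \<longlonglongrightarrow> 0"
      using cl(1) by blast
  qed
  then obtain u where u: "u \<in> ?V" "\<And>v. v \<in> ?V \<Longrightarrow> ?q v u = L2_inner ?W v f" by blast
  have "?q u v = L2_inner ?W f v" if "v \<in> ?V" for v
    using u(2)[OF that] coef_form_commute[of U A B u v] L2_inner_commute[of ?W f v] by simp
  then show ?thesis using u(1) by blast
qed

section \<open>Product domains\<close>

definition tensor :: "('a \<Rightarrow> complex) \<Rightarrow> ('b \<Rightarrow> complex) \<Rightarrow> 'a \<times> 'b \<Rightarrow> complex" where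
  "tensor f g x = f (fst x) * g (snd x)"

lemma tensor_Pair [simp]: "tensor f g (s, t) = f s * g t"
  by (simp add: tensor_def)

lemma sigma_finite_lebesgue_on_open:
  "open U \<Longrightarrow> sigma_finite_measure (lebesgue_on_open U)"
  by (intro sigma_finite_measure_restrict_space lborel.sigma_finite_measure_axioms) auto

text \<open>Makes Fubini's theorem available on the strip, whose measure is a restriction of
  \<open>lborel\<close> and not a product measure by definition.\<close>

lemma lebesgue_on_open_Times:
  fixes U :: "'a::euclidean_space set" and J :: "'b::euclidean_space set"
  assumes "open U" "open J"
  shows "lebesgue_on_open U \<Otimes>\<^sub>M lebesgue_on_open J = lebesgue_on_open (U \<times> J)"
proof (rule pair_measure_eqI)
  have UJ: "U \<times> J \<in> sets lborel" using assms by (simp add: open_Times)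
  show "sets (lebesgue_on_open U \<Otimes>\<^sub>M lebesgue_on_open J) = sets (lebesgue_on_open (U \<times> J))"
  proof
    have "A \<times> B \<in> sets (lebesgue_on_open (U \<times> J))"
      if "A \<in> sets (lebesgue_on_open U)" "B \<in> sets (lebesgue_on_open J)" for A B
    proof -
      have "A \<in> sets borel" "A \<subseteq> U" "B \<in> sets borel" "B \<subseteq> J"
        using that assms by (auto simp: sets_restrict_space_iff)
      then show ?thesis using UJ by (auto simp: sets_restrict_space_iff intro!: borel_Times)
    qed
    then show "sets (lebesgue_on_open U \<Otimes>\<^sub>M lebesgue_on_open J) \<subseteq> sets (lebesgue_on_open (U \<times> J))"
      unfolding sets_pair_measure
      using assms UJ by (intro sets.sigma_sets_subset') (auto simp: sets_restrict_space_iff)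
    show "sets (lebesgue_on_open (U \<times> J)) \<subseteq> sets (lebesgue_on_open U \<Otimes>\<^sub>M lebesgue_on_open J)"
    proof
      fix X assume "X \<in> sets (lebesgue_on_open (U \<times> J))"
      then have X: "X \<in> sets borel" "X \<subseteq> U \<times> J" using UJ by (auto simp: sets_restrict_space_iff)
      have "(\<lambda>x. x) \<in> lebesgue_on_open U \<Otimes>\<^sub>M lebesgue_on_open J \<rightarrow>\<^sub>M borel \<Otimes>\<^sub>M borel"
      proof (rule measurable_pair)
        have "(\<lambda>x. x) \<in> lebesgue_on_open U \<rightarrow>\<^sub>M borel" "(\<lambda>x. x) \<in> lebesgue_on_open J \<rightarrow>\<^sub>M borel"
          by (auto intro: measurable_restrict_space1)
        from this[THEN measurable_compose[rotated], OF measurable_fst] this[THEN measurable_compose[rotated], OF measurable_snd]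
        show "fst \<circ> (\<lambda>x. x) \<in> lebesgue_on_open U \<Otimes>\<^sub>M lebesgue_on_open J \<rightarrow>\<^sub>M borel"
          "snd \<circ> (\<lambda>x. x) \<in> lebesgue_on_open U \<Otimes>\<^sub>M lebesgue_on_open J \<rightarrow>\<^sub>M borel"
          by (simp_all add: comp_def)
      qed
      then have "(\<lambda>x. x) -` X \<inter> space (lebesgue_on_open U \<Otimes>\<^sub>M lebesgue_on_open J)
          \<in> sets (lebesgue_on_open U \<Otimes>\<^sub>M lebesgue_on_open J)"
        by (rule measurable_sets) (subst borel_prod, rule X(1))
      then show "X \<in> sets (lebesgue_on_open U \<Otimes>\<^sub>M lebesgue_on_open J)"
        using X(2) by (simp add: space_pair_measure Int_absorb2)
    qed
  qed
  fix A B assume "A \<in> sets (lebesgue_on_open U)" "B \<in> sets (lebesgue_on_open J)"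
  then have "A \<in> sets borel" "A \<subseteq> U" "B \<in> sets borel" "B \<subseteq> J"
    using assms by (auto simp: sets_restrict_space_iff)
  then show "emeasure (lebesgue_on_open U) A * emeasure (lebesgue_on_open J) B = emeasure (lebesgue_on_open (U \<times> J)) (A \<times> B)"
    using assms UJ lborel.emeasure_pair_measure_Times[of A lborel B]
    by (subst (1 2 3) emeasure_restrict_space) (auto simp: lborel_prod)
qed (use assms sigma_finite_lebesgue_on_open in auto)

definition partial_inner :: "'b measure \<Rightarrow> ('b \<Rightarrow> complex) \<Rightarrow> ('a \<times> 'b \<Rightarrow> complex) \<Rightarrow> 'a \<Rightarrow> complex" where
  "partial_inner N g u s = L2_inner N (\<lambda>t. u (s, t)) g"

context pair_sigma_finite
begin

lemma AE_slice_L2: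
  assumes "u \<in> L2 (M1 \<Otimes>\<^sub>M M2)"
  shows "AE s in M1. (\<lambda>t. u (s, t)) \<in> L2 M2"
  using AE_integrable_fst'[OF L2_integrable[OF assms]] AE_space
  by eventually_elim (use L2_measurable[OF assms] in \<open>auto simp: L2_def intro: measurable_compose[OF measurable_Pair1']\<close>)

lemma L2_norm_slices:
  assumes "u \<in> L2 (M1 \<Otimes>\<^sub>M M2)"
  shows "(L2_norm (M1 \<Otimes>\<^sub>M M2) u)\<^sup>2 = (LINT s|M1. (L2_norm M2 (\<lambda>t. u (s, t)))\<^sup>2)"
    and "integrable M1 (\<lambda>s. (L2_norm M2 (\<lambda>t. u (s, t)))\<^sup>2)"
  unfolding L2_norm_sq using integral_fst'[OF L2_integrable[OF assms]] integrable_fst'[OF L2_integrable[OF assms]]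
  by simp_all

lemma tensor_L2:
  assumes f: "f \<in> L2 M1" and g: "g \<in> L2 M2"
  shows "tensor f g \<in> L2 (M1 \<Otimes>\<^sub>M M2)"
  unfolding L2_def
proof (intro CollectI conjI)
  have [measurable]: "f \<in> borel_measurable M1" "g \<in> borel_measurable M2" using f g L2_measurable by auto
  show m: "tensor f g \<in> borel_measurable (M1 \<Otimes>\<^sub>M M2)"
    unfolding tensor_def[abs_def] by measurable
  show "integrable (M1 \<Otimes>\<^sub>M M2) (\<lambda>x. (norm (tensor f g x))\<^sup>2)"
    by (rule Fubini_integrable)
       (use m f g in \<open>auto simp: norm_mult power_mult_distrib L2_integrable simp del: integrable_mult_left_iff integrable_mult_right_iff\<close>)
qed

lemma L2_inner_fst:
  assumes "u \<in> L2 (M1 \<Otimes>\<^sub>M M2)" "v \<in> L2 (M1 \<Otimes>\<^sub>M M2)"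
  shows "L2_inner (M1 \<Otimes>\<^sub>M M2) u v = (LINT s|M1. L2_inner M2 (\<lambda>t. u (s, t)) (\<lambda>t. v (s, t)))"
  unfolding L2_inner_def using integral_fst'[OF L2_inner_integrable[OF assms]] by simp

lemma L2_inner_snd:
  assumes "u \<in> L2 (M1 \<Otimes>\<^sub>M M2)" "v \<in> L2 (M1 \<Otimes>\<^sub>M M2)"
  shows "L2_inner (M1 \<Otimes>\<^sub>M M2) u v = (LINT t|M2. L2_inner M1 (\<lambda>s. u (s, t)) (\<lambda>s. v (s, t)))"
  unfolding L2_inner_def
  using integral_snd[of "\<lambda>s t. u (s, t) * cnj (v (s, t))"] L2_inner_integrable[OF assms]
  by (simp add: case_prod_beta')

lemma tensor_inner:
  assumes "f \<in> L2 M1" "g \<in> L2 M2" "f' \<in> L2 M1" "g' \<in> L2 M2"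
  shows "L2_inner (M1 \<Otimes>\<^sub>M M2) (tensor f g) (tensor f' g') = L2_inner M1 f f' * L2_inner M2 g g'"
  unfolding L2_inner_fst[OF tensor_L2[OF assms(1,2)] tensor_L2[OF assms(3,4)]]
proof -
  have "L2_inner M2 (\<lambda>t. tensor f g (s, t)) (\<lambda>t. tensor f' g' (s, t)) = f s * cnj (f' s) * L2_inner M2 g g'" for s
    by (simp add: L2_inner_def mult_ac flip: integral_mult_right_zero)
  then show "(LINT s|M1. L2_inner M2 (\<lambda>t. tensor f g (s, t)) (\<lambda>t. tensor f' g' (s, t))) = L2_inner M1 f f' * L2_inner M2 g g'"
    by (simp add: L2_inner_def)
qed

lemma tensor_norm:
  assumes "f \<in> L2 M1" "g \<in> L2 M2"
  shows "L2_norm (M1 \<Otimes>\<^sub>M M2) (tensor f g) = L2_norm M1 f * L2_norm M2 g"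
proof (rule power2_eq_imp_eq)
  have "complex_of_real ((L2_norm (M1 \<Otimes>\<^sub>M M2) (tensor f g))\<^sup>2) = complex_of_real ((L2_norm M1 f)\<^sup>2 * (L2_norm M2 g)\<^sup>2)"
    unfolding of_real_mult L2_inner_self[symmetric] by (rule tensor_inner[OF assms assms])
  then show "(L2_norm (M1 \<Otimes>\<^sub>M M2) (tensor f g))\<^sup>2 = (L2_norm M1 f * L2_norm M2 g)\<^sup>2"
    unfolding of_real_eq_iff power_mult_distrib .
qed auto

lemma partial_inner_L2:
  assumes u: "u \<in> L2 (M1 \<Otimes>\<^sub>M M2)" and g: "g \<in> L2 M2"
  shows "partial_inner M2 g u \<in> L2 M1"
    and "L2_norm M1 (partial_inner M2 g u) \<le> L2_norm (M1 \<Otimes>\<^sub>M M2) u * L2_norm M2 g"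
proof -
  have [measurable]: "u \<in> borel_measurable (M1 \<Otimes>\<^sub>M M2)" "g \<in> borel_measurable M2" using u g L2_measurable by auto
  have m: "partial_inner M2 g u \<in> borel_measurable M1"
    unfolding partial_inner_def[abs_def] L2_inner_def by measurable
  have b: "AE s in M1. (norm (partial_inner M2 g u s))\<^sup>2 \<le> (L2_norm M2 (\<lambda>t. u (s, t)))\<^sup>2 * (L2_norm M2 g)\<^sup>2"
    using AE_slice_L2[OF u]
    by eventually_elim
       (use L2_cauchy_schwarz[OF _ g] in \<open>auto simp: partial_inner_def power_mult_distrib[symmetric] intro: power_mono\<close>)
  have i: "integrable M1 (\<lambda>s. (L2_norm M2 (\<lambda>t. u (s, t)))\<^sup>2 * (L2_norm M2 g)\<^sup>2)"
    using L2_norm_slices(2)[OF u] by simp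
  show p: "partial_inner M2 g u \<in> L2 M1" by (rule L2_bound[OF m i b])
  have "(L2_norm M1 (partial_inner M2 g u))\<^sup>2 \<le> (LINT s|M1. (L2_norm M2 (\<lambda>t. u (s, t)))\<^sup>2 * (L2_norm M2 g)\<^sup>2)"
    unfolding L2_norm_sq[of M1] by (rule integral_mono_AE[OF L2_integrable[OF p] i b])
  also have "\<dots> = (L2_norm (M1 \<Otimes>\<^sub>M M2) u * L2_norm M2 g)\<^sup>2"
    by (simp add: L2_norm_slices(1)[OF u] power_mult_distrib)
  finally show "L2_norm M1 (partial_inner M2 g u) \<le> L2_norm (M1 \<Otimes>\<^sub>M M2) u * L2_norm M2 g"
    by (rule power2_le_imp_le) simp
qed

text \<open>Taking coefficients along \<open>g\<close> is adjoint to tensoring with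
  \<open>g\<close>; this links mode coefficients to inner products on the product space.\<close>

lemma inner_partial_inner:
  assumes u: "u \<in> L2 (M1 \<Otimes>\<^sub>M M2)" and g: "g \<in> L2 M2" and f: "f \<in> L2 M1"
  shows "L2_inner (M1 \<Otimes>\<^sub>M M2) u (tensor f g) = L2_inner M1 (partial_inner M2 g u) f"
  unfolding L2_inner_fst[OF u tensor_L2[OF f g]]
proof -
  have "L2_inner M2 (\<lambda>t. u (s, t)) (\<lambda>t. tensor f g (s, t)) = partial_inner M2 g u s * cnj (f s)" for s
    by (simp add: L2_inner_def partial_inner_def mult_ac flip: integral_mult_right_zero)
  then show "(LINT s|M1. L2_inner M2 (\<lambda>t. u (s, t)) (\<lambda>t. tensor f g (s, t))) = L2_inner M1 (partial_inner M2 g u) f"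
    by (simp add: L2_inner_def)
qed

lemma partial_inner_lincomb:
  assumes "u \<in> L2 (M1 \<Otimes>\<^sub>M M2)" "v \<in> L2 (M1 \<Otimes>\<^sub>M M2)" "g \<in> L2 M2"
  shows "AE s in M1. partial_inner M2 g (\<lambda>x. a * u x + b * v x) s = a * partial_inner M2 g u s + b * partial_inner M2 g v s"
  using AE_slice_L2[OF assms(1)] AE_slice_L2[OF assms(2)]
  by eventually_elim (simp add: partial_inner_def L2_inner_lincomb_left assms(3))

lemma tensor_conv:
  assumes "\<And>n. F n \<in> L2 M1" "f \<in> L2 M1" "L2_conv M1 F f" "\<And>n. G n \<in> L2 M2" "g \<in> L2 M2" "L2_conv M2 G g"
  shows "L2_conv (M1 \<Otimes>\<^sub>M M2) (\<lambda>n. tensor (F n) (G n)) (tensor f g)"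
proof (rule Lim_null_comparison[OF always_eventually[OF allI]])
  let ?M = "M1 \<Otimes>\<^sub>M M2"
  fix n
  have 1: "tensor (\<lambda>x. F n x - f x) (G n) \<in> L2 ?M" "tensor f (\<lambda>x. G n x - g x) \<in> L2 ?M"
    by (intro tensor_L2 L2_diff assms)+
  have "(\<lambda>x. tensor (F n) (G n) x - tensor f g x) = (\<lambda>x. tensor (\<lambda>x. F n x - f x) (G n) x + tensor f (\<lambda>x. G n x - g x) x)"
    by (simp add: tensor_def fun_eq_iff algebra_simps)
  then have "L2_norm ?M (\<lambda>x. tensor (F n) (G n) x - tensor f g x) \<le> L2_norm ?M (tensor (\<lambda>x. F n x - f x) (G n)) + L2_norm ?M (tensor f (\<lambda>x. G n x - g x))"
    using L2_norm_add[OF 1] by simp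
  then show "norm (L2_norm ?M (\<lambda>x. tensor (F n) (G n) x - tensor f g x))
      \<le> L2_norm M1 (\<lambda>x. F n x - f x) * L2_norm M2 (G n) + L2_norm M1 f * L2_norm M2 (\<lambda>x. G n x - g x)"
    by (simp add: tensor_norm assms L2_diff)
next
  have "(\<lambda>n. L2_norm M1 (\<lambda>x. F n x - f x) * L2_norm M2 (G n) + L2_norm M1 f * L2_norm M2 (\<lambda>x. G n x - g x))
     \<longlonglongrightarrow> 0 * L2_norm M2 g + L2_norm M1 f * 0"
    by (intro tendsto_intros assms L2_conv_norm)
  then show "(\<lambda>n. L2_norm M1 (\<lambda>x. F n x - f x) * L2_norm M2 (G n) + L2_norm M1 f * L2_norm M2 (\<lambda>x. G n x - g x)) \<longlonglongrightarrow> 0" by simp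
qed

end

lemma dir_deriv_tensor:
  fixes f :: "'a::euclidean_space \<Rightarrow> complex" and g :: "'b::euclidean_space \<Rightarrow> complex"
  assumes f: "smooth f" and g: "smooth g"
  shows "dir_deriv (e, 0) (tensor f g) x = tensor (dir_deriv e f) g x"
    and "dir_deriv (0, e') (tensor f g) x = tensor f (dir_deriv e' g) x"
proof -
  have "((\<lambda>x. f (fst x)) has_derivative (\<lambda>h. frechet_derivative f (at (fst x)) (fst h))) (at x)"
    by (rule has_derivative_compose[OF has_derivative_fst[OF has_derivative_ident] smooth_has_derivative[OF f]])
  moreover have "((\<lambda>x. g (snd x)) has_derivative (\<lambda>h. frechet_derivative g (at (snd x)) (snd h))) (at x)"
    by (rule has_derivative_compose[OF has_derivative_snd[OF has_derivative_ident] smooth_has_derivative[OF g]])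
  ultimately have "(tensor f g has_derivative (\<lambda>h. f (fst x) * frechet_derivative g (at (snd x)) (snd h)
       + frechet_derivative f (at (fst x)) (fst h) * g (snd x))) (at x)"
    unfolding tensor_def[abs_def] by (rule has_derivative_mult)
  from dir_deriv_eq[OF this] show "dir_deriv (e, 0) (tensor f g) x = tensor (dir_deriv e f) g x"
    "dir_deriv (0, e') (tensor f g) x = tensor f (dir_deriv e' g) x"
    using linear_0[OF has_derivative_linear[OF smooth_has_derivative[OF f]]]
      linear_0[OF has_derivative_linear[OF smooth_has_derivative[OF g]]]
    by (simp_all add: tensor_def)
qed

lemma tensor_test:
  fixes f :: "'a::euclidean_space \<Rightarrow> complex" and g :: "'b::euclidean_space \<Rightarrow> complex"
  shows "f \<in> test_functions UNIV \<Longrightarrow> g \<in> test_functions UNIV \<Longrightarrow> tensor f g \<in> test_functions UNIV"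
  using test_tensor[of f UNIV g UNIV] by (simp add: tensor_def[abs_def])

lemma Basis_real_prod: "(Basis :: (real \<times> real) set) = {(1, 0), (0, 1)}"
  by (auto simp: Basis_prod_def)

lemma dir_deriv_slice:
  fixes \<psi> :: "real \<times> real \<Rightarrow> complex"
  assumes "smooth \<psi>"
  shows "dir_deriv 1 (\<lambda>s. \<psi> (s, t)) s = dir_deriv (1, 0) \<psi> (s, t)"
    and "dir_deriv 1 (\<lambda>t. \<psi> (s, t)) t = dir_deriv (0, 1) \<psi> (s, t)"
proof -
  have "((\<lambda>s. (s, t)) has_derivative (\<lambda>h. (h, 0))) (at s)" "((\<lambda>t. (s, t)) has_derivative (\<lambda>h. (0, h))) (at t)"
    by (auto intro!: derivative_eq_intros)
  note d = this[THEN has_derivative_compose, OF smooth_has_derivative[OF assms]]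
  show "dir_deriv 1 (\<lambda>s. \<psi> (s, t)) s = dir_deriv (1, 0) \<psi> (s, t)"
    by (rule dir_deriv_eq[OF d(1)])
  show "dir_deriv 1 (\<lambda>t. \<psi> (s, t)) t = dir_deriv (0, 1) \<psi> (s, t)"
    by (rule dir_deriv_eq[OF d(2)])
qed

text \<open>A way to compute weak derivatives: approximate by test functions whose classical
  derivatives converge in \<open>L2\<close>. The sequence is returned as a \<open>W12\<close>
  approximation, which is what trace statements ask for.\<close>

lemma W12_test_limit:
  assumes U: "open U" and \<psi>: "\<And>n. \<psi> n \<in> test_functions UNIV" and u: "u \<in> L2 (lebesgue_on_open U)"
    and c: "L2_conv (lebesgue_on_open U) \<psi> u"
    and g: "\<And>e. e \<in> Basis \<Longrightarrow> g e \<in> L2 (lebesgue_on_open U)"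
    and d: "\<And>e. e \<in> Basis \<Longrightarrow> L2_conv (lebesgue_on_open U) (\<lambda>n. dir_deriv e (\<psi> n)) (g e)"
  shows "u \<in> W12 U" "W12_conv U \<psi> u"
    and "e \<in> Basis \<Longrightarrow> AE x in lebesgue_on_open U. weak_deriv U e u x = g e x"
proof -
  have w: "is_weak_deriv U e u (g e)" if "e \<in> Basis" for e
    by (rule is_weak_deriv_limit[OF U test_L2[OF \<psi> U] u c test_L2[OF test_dir_deriv[OF \<psi>] U] g[OF that] d[OF that] is_weak_deriv_test[OF U \<psi>]])
  then show W: "u \<in> W12 U" using u g unfolding W12_def by blast
  show eq: "AE x in lebesgue_on_open U. weak_deriv U e u x = g e x" if "e \<in> Basis" for e
    by (rule weak_deriv_eqI[OF U g[OF that] w[OF that]])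
  have "L2_norm (lebesgue_on_open U) (\<lambda>x. weak_deriv U e (\<psi> n) x - weak_deriv U e u x)
      = L2_norm (lebesgue_on_open U) (\<lambda>x. dir_deriv e (\<psi> n) x - g e x)" if e: "e \<in> Basis" for e n
    by (rule L2_norm_AE_cong, use eq[OF e] test_W12(2)[OF U \<psi>[of n] e] in eventually_elim, simp)
       (intro L2_measurable L2_diff weak_deriv_spec test_W12 test_L2[OF test_dir_deriv[OF \<psi>]] g W U \<psi> e)+
  then show "W12_conv U \<psi> u" using c d unfolding W12_conv_def by simp
qed

lemma W12_conv_test:
  assumes U: "open U" and \<psi>: "\<And>n. \<psi> n \<in> test_functions UNIV" and u: "u \<in> W12 U" and c: "W12_conv U \<psi> u" and e: "e \<in> Basis"
  shows "L2_conv (lebesgue_on_open U) (\<lambda>n. dir_deriv e (\<psi> n)) (weak_deriv U e u)"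
proof -
  have "L2_norm (lebesgue_on_open U) (\<lambda>x. weak_deriv U e (\<psi> n) x - weak_deriv U e u x)
      = L2_norm (lebesgue_on_open U) (\<lambda>x. dir_deriv e (\<psi> n) x - weak_deriv U e u x)" for n
    by (rule L2_norm_AE_cong, use test_W12(2)[OF U \<psi>[of n] e] in eventually_elim, simp)
       (intro L2_measurable L2_diff weak_deriv_spec test_W12 test_L2[OF test_dir_deriv[OF \<psi>]] u U \<psi> e)+
  moreover have "L2_conv (lebesgue_on_open U) (\<lambda>n. weak_deriv U e (\<psi> n)) (weak_deriv U e u)"
    using c e unfolding W12_conv_def by blast
  ultimately show ?thesis by (simp only:)
qed

text \<open>Each shape of an interval lies between an open and a closed set that differ in at most
  two points.\<close>

lemma finite_frontier_interval:
  fixes I :: "real set"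
  assumes "is_interval I"
  shows "finite (frontier I)"
proof -
  have fin: "finite (frontier I)" if "I \<subseteq> C" "closed C" "D \<subseteq> I" "open D" "finite (C - D)" for C D
  proof (rule finite_subset[OF _ that(5)])
    show "frontier I \<subseteq> C - D"
      unfolding frontier_def using closure_minimal[OF that(1,2)] interior_maximal[OF that(3,4)] by blast
  qed
  have 1: "finite ({a..b} - {a<..<b})" for a b :: real
    by (rule finite_subset[of _ "{a, b}"]) auto
  have 2: "finite ({..b} - {..<b})" "finite ({b..} - {b<..})" for b :: real
    by (rule finite_subset[of _ "{b}"]; auto)+
  obtain a b where "I = {} \<or> I = UNIV \<or> I = {..<b} \<or> I = {..b} \<or> I = {a<..} \<or> I = {a..} \<or>
    I = {a<..<b} \<or> I = {a<..b} \<or> I = {a..<b} \<or> I = {a..b}"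
    using is_real_interval[OF assms] by blast
  then have "I = {} \<or> I = UNIV \<or> ({..<b} \<subseteq> I \<and> I \<subseteq> {..b}) \<or> ({a<..} \<subseteq> I \<and> I \<subseteq> {a..})
    \<or> ({a<..<b} \<subseteq> I \<and> I \<subseteq> {a..b})"
    by (elim disjE) (simp_all add: subset_iff)
  then consider "I = {}" | "I = UNIV" | "{..<b} \<subseteq> I" "I \<subseteq> {..b}" | "{a<..} \<subseteq> I" "I \<subseteq> {a..}"
    | "{a<..<b} \<subseteq> I" "I \<subseteq> {a..b}"
    by blast
  then show ?thesis
  proof cases
    case 3
    show ?thesis by (rule fin[OF 3(2) closed_atMost 3(1) open_lessThan 2(1)])
  next
    case 4
    show ?thesis by (rule fin[OF 4(2) closed_atLeast 4(1) open_greaterThan 2(2)])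
  next
    case 5
    show ?thesis by (rule fin[OF 5(2) closed_atLeastAtMost 5(1) open_greaterThanLessThan 1])
  qed auto
qed

section \<open>One-dimensional operators\<close>

lemma test_L2_count_space: "finite \<Gamma> \<Longrightarrow> test_functions UNIV \<subseteq> L2 (count_space \<Gamma>)"
  by (auto simp: L2_def integrable_count_space)

lemma L2_norm_count_space_zero: "finite \<Gamma> \<Longrightarrow> (\<And>a. a \<in> \<Gamma> \<Longrightarrow> u a = 0) \<Longrightarrow> L2_norm (count_space \<Gamma>) u = 0"
  by (simp add: L2_norm_def lebesgue_integral_count_space_finite)

lemma separating_test_function:
  fixes a :: real
  assumes "finite \<Gamma>"
  obtains \<theta> :: "real \<Rightarrow> complex" where "\<theta> \<in> test_functions UNIV" "\<theta> a = 1" "\<And>b. b \<in> \<Gamma> \<Longrightarrow> b \<noteq> a \<Longrightarrow> \<theta> b = 0"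
proof -
  obtain r where r: "r > 0" "\<And>b. b \<in> \<Gamma> \<Longrightarrow> b \<noteq> a \<Longrightarrow> r \<le> dist a b"
    using finite_set_avoid[OF assms, of a] by blast
  define \<beta> where "\<beta> = box_bump (a - r) (a + r) 1"
  have "\<beta> a > 0" using r(1) by (simp add: \<beta>_def box_bump_def flat_1_pos)
  moreover have "\<beta> b = 0" if "b \<in> \<Gamma>" "b \<noteq> a" for b
    unfolding \<beta>_def using r(2)[OF that] by (intro box_bump_outside) (auto simp: dist_real_def)
  moreover have "(\<lambda>x. complex_of_real (1 / \<beta> a) * complex_of_real (\<beta> x)) \<in> test_functions UNIV"
    unfolding \<beta>_def by (intro test_linear[OF bounded_linear_mult_right] test_of_real test_box_bump) simp
  ultimately show ?thesis
    by (intro that[of "\<lambda>x. complex_of_real (1 / \<beta> a) * complex_of_real (\<beta> x)"]) auto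
qed

definition dirichlet_domain :: "real set \<Rightarrow> real set \<Rightarrow> (real \<Rightarrow> complex) set" where
  "dirichlet_domain J \<Gamma> = W12_zero J {count_space \<Gamma>}"

lemma neg_laplacian_1d_iff:
  "(f, F) \<in> neg_laplacian_1d J \<Gamma> \<longleftrightarrow> f \<in> dirichlet_domain J \<Gamma> \<and> F \<in> L2 (lebesgue_on_open J) \<and>
     (\<forall>v\<in>dirichlet_domain J \<Gamma>. L2_inner (lebesgue_on_open J) (weak_deriv J 1 f) (weak_deriv J 1 v) = L2_inner (lebesgue_on_open J) F v)"
  by (auto simp: neg_laplacian_1d_def form_operator_def dirichlet_domain_def W12_zero_def L2_inner_def)

lemma dirichlet_domain_W12: "u \<in> dirichlet_domain J \<Gamma> \<Longrightarrow> u \<in> W12 J"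
  by (simp add: dirichlet_domain_def W12_zero_def)

lemma test_dirichlet_domain:
  assumes "open J" "finite \<Gamma>" "\<psi> \<in> test_functions UNIV" "\<And>a. a \<in> \<Gamma> \<Longrightarrow> \<psi> a = 0"
  shows "\<psi> \<in> dirichlet_domain J \<Gamma>"
proof -
  have "has_trace J (count_space \<Gamma>) \<psi> (\<lambda>_. 0)"
    unfolding zero_trace_iff[OF assms(1)]
    by (intro conjI exI[of _ "\<lambda>_. \<psi>"])
       (simp_all add: test_W12 assms W12_conv_def L2_norm_count_space_zero)
  then show ?thesis by (simp add: dirichlet_domain_def W12_zero_def has_trace_def)
qed

text \<open>Test functions that do not vanish on \<open>\<Gamma>\<close> only produce boundary terms.\<close>

lemma neg_laplacian_1d_test:
  assumes J: "open J" and \<Gamma>: "finite \<Gamma>" and f: "(f, F) \<in> neg_laplacian_1d J \<Gamma>"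
  obtains l where "\<And>\<zeta>. \<zeta> \<in> test_functions UNIV \<Longrightarrow>
    L2_inner (lebesgue_on_open J) (weak_deriv J 1 f) (dir_deriv 1 \<zeta>)
     = L2_inner (lebesgue_on_open J) F \<zeta> + (\<Sum>a\<in>\<Gamma>. l a * cnj (\<zeta> a))"
proof -
  let ?W = "lebesgue_on_open J"
  have B: "(1::real) \<in> Basis" by simp
  note f = f[unfolded neg_laplacian_1d_iff]
  have fL: "weak_deriv J 1 f \<in> L2 ?W" "F \<in> L2 ?W"
    using f dirichlet_domain_W12 weak_deriv_spec(1)[OF _ B] by auto
  have "\<exists>\<theta>. \<theta> \<in> test_functions UNIV \<and> \<theta> a = (1::complex) \<and> (\<forall>b\<in>\<Gamma>. b \<noteq> a \<longrightarrow> \<theta> b = 0)" for a :: real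
    by (rule separating_test_function[OF \<Gamma>, of a]) blast
  then obtain \<theta> where \<theta>: "\<And>a. \<theta> a \<in> test_functions UNIV" "\<And>a. \<theta> a a = (1::complex)"
     "\<And>a b. b \<in> \<Gamma> \<Longrightarrow> b \<noteq> a \<Longrightarrow> \<theta> a b = 0" by metis
  \<comment> \<open>The boundary term at \<open>a\<close>: the defect of the weak equation for a
    test function that is 1 at \<open>a\<close> and 0 at the other points of \<Gamma>.\<close>
  define l where "l a = L2_inner ?W (weak_deriv J 1 f) (dir_deriv 1 (\<theta> a)) - L2_inner ?W F (\<theta> a)" for a
  define d where "d \<zeta> = L2_inner ?W (weak_deriv J 1 f) (dir_deriv 1 \<zeta>) - L2_inner ?W F \<zeta>" for \<zeta>
  have d_lin: "d (\<lambda>x. a * \<zeta> x + b * \<eta> x) = cnj a * d \<zeta> + cnj b * d \<eta>"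
    if "\<zeta> \<in> test_functions UNIV" "\<eta> \<in> test_functions UNIV" for \<zeta> \<eta> a b
    unfolding d_def dir_deriv_lincomb[OF that[THEN test_smooth]]
      L2.q_lincomb_right[OF test_L2[OF test_dir_deriv[OF that(1)] J] test_L2[OF test_dir_deriv[OF that(2)] J] fL(1)]
      L2.q_lincomb_right[OF test_L2[OF that(1) J] test_L2[OF that(2) J] fL(2)]
    by (simp add: algebra_simps)
  have d_sum: "d (\<lambda>x. \<Sum>a\<in>S. c a * \<theta> a x) = (\<Sum>a\<in>S. cnj (c a) * l a)" if "finite S" for c S
    using that
  proof induction
    case empty
    show ?case using d_lin[OF test_zero test_zero, of 0 0] by simp
  next
    case (insert b S)
    have t: "(\<lambda>x. \<Sum>a\<in>S. c a * \<theta> a x) \<in> test_functions UNIV"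
      by (intro test_sum test_linear[OF bounded_linear_mult_right] \<theta>)
    show ?case using d_lin[OF \<theta>(1)[of b] t, of "c b" 1] insert by (simp add: d_def l_def)
  qed
  show ?thesis
  proof (rule that[of l])
    fix \<zeta> :: "real \<Rightarrow> complex" assume \<zeta>: "\<zeta> \<in> test_functions UNIV"
    \<comment> \<open>Interpolates \<zeta> on \<Gamma>, so that the difference satisfies the
      Dirichlet condition and has zero defect.\<close>
    define \<sigma> where "\<sigma> x = (\<Sum>a\<in>\<Gamma>. \<zeta> a * \<theta> a x)" for x
    have t: "\<sigma> \<in> test_functions UNIV"
      unfolding \<sigma>_def[abs_def] by (intro test_sum test_linear[OF bounded_linear_mult_right] \<theta>)
    have t0: "(\<lambda>x. 1 * \<zeta> x + (-1) * \<sigma> x) \<in> test_functions UNIV" by (rule test_lincomb[OF \<zeta> t])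
    have "1 * \<zeta> b + (-1) * \<sigma> b = 0" if "b \<in> \<Gamma>" for b
    proof -
      have "\<sigma> b = (\<Sum>a\<in>\<Gamma>. if a = b then \<zeta> b else 0)"
        unfolding \<sigma>_def using \<theta>(2,3) that by (intro sum.cong) auto
      then show ?thesis using that \<Gamma> by simp
    qed
    then have "(\<lambda>x. 1 * \<zeta> x + (-1) * \<sigma> x) \<in> dirichlet_domain J \<Gamma>"
      by (rule test_dirichlet_domain[OF J \<Gamma> t0])
    then have "L2_inner ?W (weak_deriv J 1 f) (weak_deriv J 1 (\<lambda>x. 1 * \<zeta> x + (-1) * \<sigma> x)) = L2_inner ?W F (\<lambda>x. 1 * \<zeta> x + (-1) * \<sigma> x)"
      using f by blast
    moreover have "L2_inner ?W (weak_deriv J 1 f) (weak_deriv J 1 (\<lambda>x. 1 * \<zeta> x + (-1) * \<sigma> x))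
        = L2_inner ?W (weak_deriv J 1 f) (dir_deriv 1 (\<lambda>x. 1 * \<zeta> x + (-1) * \<sigma> x))"
      by (rule L2_inner_AE_cong[OF AE_I2[OF refl] test_W12(2)[OF J t0 B]])
         (intro L2_measurable fL weak_deriv_spec test_W12 J t0 B test_L2[OF test_dir_deriv[OF t0]])+
    ultimately have "d (\<lambda>x. 1 * \<zeta> x + (-1) * \<sigma> x) = 0" by (simp add: d_def)
    then have "d \<zeta> = d \<sigma>" unfolding d_lin[OF \<zeta> t] by simp
    also have "\<dots> = (\<Sum>a\<in>\<Gamma>. cnj (\<zeta> a) * l a)" unfolding \<sigma>_def[abs_def] by (rule d_sum[OF \<Gamma>])
    finally show "L2_inner ?W (weak_deriv J 1 f) (dir_deriv 1 \<zeta>) = L2_inner ?W F \<zeta> + (\<Sum>a\<in>\<Gamma>. l a * cnj (\<zeta> a))"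
      by (simp add: d_def algebra_simps)
  qed
qed

lemma neg_laplacian_1d_lincomb:
  assumes J: "open J" and \<Gamma>: "finite \<Gamma>" and f: "(f, F) \<in> neg_laplacian_1d J \<Gamma>" "(g, G) \<in> neg_laplacian_1d J \<Gamma>"
  shows "(\<lambda>x. a * f x + b * g x, \<lambda>x. a * F x + b * G x) \<in> neg_laplacian_1d J \<Gamma>"
proof -
  let ?W = "lebesgue_on_open J"
  have B: "(1::real) \<in> Basis" by simp
  note f = f[unfolded neg_laplacian_1d_iff]
  have d: "f \<in> dirichlet_domain J \<Gamma>" "g \<in> dirichlet_domain J \<Gamma>" and FG: "F \<in> L2 ?W" "G \<in> L2 ?W" using f by auto
  note W = d[THEN dirichlet_domain_W12]
  have "L2_inner ?W (weak_deriv J 1 (\<lambda>x. a * f x + b * g x)) (weak_deriv J 1 v) = L2_inner ?W (\<lambda>x. a * F x + b * G x) v"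
    if v: "v \<in> dirichlet_domain J \<Gamma>" for v
  proof -
    have "L2_inner ?W (weak_deriv J 1 (\<lambda>x. a * f x + b * g x)) (weak_deriv J 1 v)
      = L2_inner ?W (\<lambda>x. a * weak_deriv J 1 f x + b * weak_deriv J 1 g x) (weak_deriv J 1 v)"
      by (rule L2_inner_AE_cong[OF W12_lincomb(2)[OF J W B] AE_I2[OF refl]])
         (intro L2_measurable weak_deriv_spec W12_lincomb J W B L2_lincomb dirichlet_domain_W12[OF v])+
    also have "\<dots> = L2_inner ?W (\<lambda>x. a * F x + b * G x) v"
      using f v by (simp add: L2_inner_lincomb_left weak_deriv_spec W B dirichlet_domain_W12[OF v] FG W12_L2)
    finally show ?thesis .
  qed
  then show ?thesis unfolding neg_laplacian_1d_iff
    using L2_lincomb[OF FG] W12_zero_lincomb[OF J _ d[unfolded dirichlet_domain_def]] test_L2_count_space[OF \<Gamma>]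
    by (simp add: dirichlet_domain_def)
qed

section \<open>The unit interval\<close>

text \<open>Differentiating \<open>g / f\<close> raises the power of \<open>f\<close> in the
  denominator; quotients by arbitrary powers of \<open>f\<close> form a class closed under
  differentiation.\<close>

lemma smooth_divide:
  fixes f g :: "real \<Rightarrow> real"
  assumes g: "smooth g" and f: "smooth f" and nz: "\<And>x. f x \<noteq> 0"
  shows "smooth (\<lambda>x. g x / f x)"
proof (rule smooth_coinduct[where S="{\<lambda>x. g x / f x ^ n | g n. smooth g}"])
  show "(\<lambda>x. g x / f x) \<in> {\<lambda>x. g x / f x ^ n | g n. smooth g}"
    using g by (intro CollectI exI[of _ g] exI[of _ 1]) auto
  fix u assume "u \<in> {\<lambda>x. g x / f x ^ n | g n. smooth g}"
  then obtain g n where u: "u = (\<lambda>x. g x / f x ^ n)" and g: "smooth g" by blast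
  let ?g = "\<lambda>h x. dir_deriv h g x * f x + (- real n) * (g x * dir_deriv h f x)"
  have "(u has_derivative (\<lambda>h. ?g h x / f x ^ Suc n)) (at x)" for x
  proof -
    have "(u has_derivative (\<lambda>h. (dir_deriv h g x * f x ^ n - g x * (of_nat n * dir_deriv h f x * f x ^ (n - 1))) / (f x ^ n * f x ^ n))) (at x)"
      unfolding u using nz[of x]
      by (intro has_derivative_divide' has_derivative_power smooth_has_derivative f g) auto
    also have "(\<lambda>h. (dir_deriv h g x * f x ^ n - g x * (of_nat n * dir_deriv h f x * f x ^ (n - 1))) / (f x ^ n * f x ^ n))
        = (\<lambda>h. ?g h x / f x ^ Suc n)"
      using nz[of x] by (cases n) (auto simp: fun_eq_iff field_simps)
    finally show ?thesis .
  qed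
  moreover have "smooth (?g h)" for h
    by (intro smooth_add smooth_mult smooth_const smooth_dir_deriv f g)
  then have "(\<lambda>x. ?g h x / f x ^ Suc n) \<in> {\<lambda>x. g x / f x ^ n | g n. smooth g}" for h
    by (intro CollectI exI[of _ "?g h"] exI[of _ "Suc n"] conjI refl)
  ultimately show "\<exists>u'. (\<forall>x. (u has_derivative (\<lambda>h. u' h x)) (at x)) \<and>
      (\<forall>h. u' h \<in> {\<lambda>x. g x / f x ^ n | g n. smooth g})"
    by (intro exI[of _ "\<lambda>h x. ?g h x / f x ^ Suc n"] conjI allI)
qed

lemma cutoff_exists:
  obtains \<eta> :: "real \<Rightarrow> real" where "\<eta> \<in> test_functions UNIV" "\<And>x. -1 \<le> x \<Longrightarrow> x \<le> 2 \<Longrightarrow> \<eta> x = 1"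
proof -
  \<comment> \<open>A smooth step from 0 on the negative axis to 1 beyond 1; the product of a
    shifted and a reflected copy has the required plateau.\<close>
  define s where "s x = flat 1 x / (flat 1 x + flat 1 (1 - x))" for x
  have pos: "flat 1 x + flat 1 (1 - x) \<noteq> 0" for x
    using flat_1_pos[of x] flat_1_pos[of "1 - x"] flat_1_nonneg[of x] flat_1_nonneg[of "1 - x"]
    by (cases "x > 0") auto
  have "smooth (\<lambda>x. flat 1 (1 - x))"
    using smooth_affine_right[OF bounded_linear_mult_right[of "-1"] smooth_flat[of 1], of 1] by simp
  then have s: "smooth s" unfolding s_def[abs_def] by (intro smooth_divide smooth_add smooth_flat pos)
  have s1: "s x = 1" if "x \<ge> 1" for x
    using that flat_1_pos[of x] by (simp add: s_def flat_nonpos)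
  have s0: "s x = 0" if "x \<le> 0" for x using that by (simp add: s_def flat_nonpos)
  show ?thesis
  proof (rule that[of "\<lambda>x. s (x + 2) * s (3 - x)"])
    show "(\<lambda>x. s (x + 2) * s (3 - x)) \<in> test_functions UNIV"
    proof (rule test_functionsI[of _ "{-2..3}"])
      show "smooth (\<lambda>x. s (x + 2) * s (3 - x))"
        using smooth_mult[OF smooth_affine_right[OF bounded_linear_ident s, of 2]
            smooth_affine_right[OF bounded_linear_mult_right[of "-1"] s, of 3]] by simp
    qed (auto simp: s0)
  qed (simp add: s1)
qed

text \<open>The plateau contains the closed unit interval in its interior, so multiplication by
  \<open>cutoff\<close> makes a mode a test function on the line without changing its values or
  derivatives on that interval, end points included.\<close>

definition cutoff :: "real \<Rightarrow> real" where
  "cutoff = (SOME \<eta>. \<eta> \<in> test_functions UNIV \<and> (\<forall>x. -1 \<le> x \<longrightarrow> x \<le> 2 \<longrightarrow> \<eta> x = 1))"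

lemma cutoff: "cutoff \<in> test_functions UNIV" "-1 \<le> x \<Longrightarrow> x \<le> 2 \<Longrightarrow> cutoff x = 1"
proof -
  have "\<exists>\<eta> :: real \<Rightarrow> real. \<eta> \<in> test_functions UNIV \<and> (\<forall>x. -1 \<le> x \<longrightarrow> x \<le> 2 \<longrightarrow> \<eta> x = 1)"
    by (rule cutoff_exists) blast
  from someI_ex[OF this] show "cutoff \<in> test_functions UNIV" "-1 \<le> x \<Longrightarrow> x \<le> 2 \<Longrightarrow> cutoff x = 1"
    unfolding cutoff_def by blast+
qed

abbreviation UI :: "real measure" where "UI \<equiv> lebesgue_on_open {0<..<1}"

lemma UI_FTC:
  fixes H :: "real \<Rightarrow> complex"
  assumes b: "0 \<le> b" "b \<le> 1" and c: "continuous_on {0..b} h"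
    and d: "\<And>x. 0 \<le> x \<Longrightarrow> x \<le> b \<Longrightarrow> (H has_vector_derivative h x) (at x)"
  shows "(LINT x|UI. indicator {0<..<b} x *\<^sub>R h x) = H b - H 0"
proof -
  have "(LINT x|UI. indicator {0<..<b} x *\<^sub>R h x) = (LINT x|lborel. indicator {0<..<b} x *\<^sub>R h x)"
    unfolding integral_lebesgue_on_open[OF open_greaterThanLessThan]
    by (rule Bochner_Integration.integral_cong) (use b in \<open>auto simp: indicator_def\<close>)
  also have "\<dots> = (LBINT x=0..b. h x)"
    using b by (simp add: interval_integral_Ioo zero_ereal_def set_lebesgue_integral_def)
  also have "\<dots> = H b - H 0"
    using interval_integral_FTC_finite[of 0 b h H] b c d
    by (simp add: min_def max_def zero_ereal_def has_vector_derivative_at_within)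
  finally show ?thesis .
qed

lemma UI_FTC_1:
  fixes H :: "real \<Rightarrow> complex"
  assumes "continuous_on {0..1} h" "\<And>x. 0 \<le> x \<Longrightarrow> x \<le> 1 \<Longrightarrow> (H has_vector_derivative h x) (at x)"
  shows "(LINT x|UI. h x) = H 1 - H 0"
proof -
  have "(LINT x|UI. h x) = (LINT x|UI. indicator {0<..<1} x *\<^sub>R h x)"
    by (rule Bochner_Integration.integral_cong) auto
  then show ?thesis using UI_FTC[of 1 h H] assms by simp
qed

lemma UI_FTC_real:
  fixes H :: "real \<Rightarrow> real"
  assumes "continuous_on {0..1} h" "\<And>x. 0 \<le> x \<Longrightarrow> x \<le> 1 \<Longrightarrow> (H has_real_derivative h x) (at x)"
  shows "(LINT x|UI. h x) = H 1 - H 0"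
proof -
  have "(LINT x|UI. complex_of_real (h x)) = of_real (H 1) - of_real (H 0)"
    using assms(2)
    by (intro UI_FTC_1 continuous_on_of_real assms(1)
        bounded_linear.has_vector_derivative[OF bounded_linear_of_real])
       (auto simp: has_real_derivative_iff_has_vector_derivative)
  then have "complex_of_real (LINT x|UI. h x) = of_real (H 1 - H 0)" by simp
  then show ?thesis unfolding of_real_eq_iff .
qed

lemma UI_const: "(\<lambda>_. c) \<in> L2 UI" and UI_const_norm: "L2_norm UI (\<lambda>_. c) = norm c"
proof -
  have fin: "emeasure UI (space UI) = 1"
    by (simp add: emeasure_restrict_space)
  then have "finite_measure UI" by (intro finite_measureI) simp
  then show "(\<lambda>_. c) \<in> L2 UI" unfolding L2_def by (simp add: finite_measure.integrable_const)
  have "measure UI (space UI) = 1" using fin by (simp add: measure_def)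
  then show "L2_norm UI (\<lambda>_. c) = norm c" by (simp add: L2_norm_def)
qed

lemma UI_bounded_L2:
  assumes "f \<in> borel_measurable UI" "\<And>x. 0 < x \<Longrightarrow> x < 1 \<Longrightarrow> norm (f x) \<le> B"
  shows "f \<in> L2 UI"
  using L2_bounded_mult[OF UI_const[of 1] assms(1), of B] assms(2) by simp

lemma UI_continuous_L2:
  assumes "continuous_on UNIV f" shows "f \<in> L2 UI"
proof -
  have "bounded (f ` {0..1})"
    by (intro compact_imp_bounded compact_continuous_image continuous_on_subset[OF assms]) auto
  then obtain B where "\<forall>x\<in>{0..1}. norm (f x) \<le> B" by (auto simp: bounded_iff)
  then show ?thesis
    using borel_measurable_continuous_onI[OF assms]
    by (intro UI_bounded_L2[of _ B] measurable_restrict_space1) auto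
qed

lemma vector_derivative_test:
  fixes f :: "real \<Rightarrow> complex"
  assumes "smooth f"
  shows "(f has_vector_derivative dir_deriv 1 f x) (at x)"
proof -
  have "frechet_derivative f (at x) = (\<lambda>h. h *\<^sub>R dir_deriv 1 f x)"
  proof
    fix h
    show "frechet_derivative f (at x) h = h *\<^sub>R dir_deriv 1 f x"
    using linear_scale[OF has_derivative_linear[OF smooth_has_derivative[OF assms, of x]], of h 1]
    unfolding real_scaleR_def mult_1_right .
  qed
  from subst[OF this, where P="\<lambda>D. (f has_derivative D) (at x)"] smooth_has_derivative[OF assms, of x]
  show ?thesis unfolding has_vector_derivative_def by blast
qed

section \<open>Transversal modes: eigenfunctions with a Dirichlet condition at 0 and a Neumann
  condition at 1\<close>

definition mode_freq :: "nat \<Rightarrow> real" where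
  "mode_freq j = (real j + 1/2) * pi"

text \<open>An eigenfunction without normalisation. The frequencies are the positive zeros of the
  cosine, which is the Neumann condition at 1.\<close>

definition unit_mode :: "nat \<Rightarrow> real \<Rightarrow> complex" where
  "unit_mode j x = of_real (cutoff x * sin (mode_freq j * x))"

lemma unit_mode_test: "unit_mode j \<in> test_functions UNIV"
  unfolding unit_mode_def[abs_def]
  using test_of_real[OF test_bilinear_left[OF bounded_bilinear_mult cutoff(1) smooth_sin_cos[of 1 "mode_freq j" 0]]]
  by simp

lemma unit_mode_eq: "-1 \<le> x \<Longrightarrow> x \<le> 2 \<Longrightarrow> unit_mode j x = of_real (sin (mode_freq j * x))"
  by (simp add: unit_mode_def cutoff)

lemma dir_deriv_unit_mode:
  assumes "-1 < x" "x < 2"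
  shows "dir_deriv 1 (unit_mode j) x = of_real (mode_freq j * cos (mode_freq j * x))"
proof -
  have "((\<lambda>x. complex_of_real (sin (mode_freq j * x))) has_vector_derivative of_real (mode_freq j * cos (mode_freq j * x))) (at x)"
    by (auto intro!: derivative_eq_intros simp: has_real_derivative_iff_has_vector_derivative[symmetric])
  then have "(unit_mode j has_vector_derivative of_real (mode_freq j * cos (mode_freq j * x))) (at x)"
    by (rule has_vector_derivative_transform_within_open[of _ _ _ "{-1<..<2}"])
       (use assms in \<open>auto simp: unit_mode_eq\<close>)
  then show ?thesis using dir_deriv_eq by (fastforce simp: has_vector_derivative_def)
qed

lemma deriv2_unit_mode:
  assumes "-1 < x" "x < 2"
  shows "(dir_deriv 1 (unit_mode j) has_vector_derivative - of_real ((mode_freq j)\<^sup>2) * unit_mode j x) (at x)"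
proof -
  have "((\<lambda>x. complex_of_real (mode_freq j * cos (mode_freq j * x))) has_vector_derivative
      of_real (- (mode_freq j)\<^sup>2 * sin (mode_freq j * x))) (at x)"
    by (auto intro!: derivative_eq_intros simp: power2_eq_square has_real_derivative_iff_has_vector_derivative[symmetric])
  then have "(dir_deriv 1 (unit_mode j) has_vector_derivative of_real (- (mode_freq j)\<^sup>2 * sin (mode_freq j * x))) (at x)"
    by (rule has_vector_derivative_transform_within_open[of _ _ _ "{-1<..<2}"])
       (use assms in \<open>auto simp: dir_deriv_unit_mode\<close>)
  then show ?thesis using assms by (simp add: unit_mode_eq)
qed

lemma mode_freq_cos: "cos (mode_freq j) = 0" and mode_freq_sin: "(sin (mode_freq j))\<^sup>2 = 1"
proof -
  have "mode_freq j = pi / 2 + real j * pi" by (simp add: mode_freq_def algebra_simps)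
  then show c: "cos (mode_freq j) = 0" by (simp add: cos_add)
  show "(sin (mode_freq j))\<^sup>2 = 1" using sin_cos_squared_add[of "mode_freq j"] c by simp
qed

lemma test_UI: "\<zeta> \<in> test_functions UNIV \<Longrightarrow> \<zeta> \<in> L2 UI"
  by (rule test_L2) auto

text \<open>The boundary term at 1 vanishes by the Neumann condition of the mode, the one at 0
  because \<open>\<zeta> 0\<close> is subtracted. The approximants behind a vanishing trace are zero
  at 0 only in the limit, so this value has to be kept.\<close>

lemma unit_mode_ibp:
  assumes z: "\<zeta> \<in> test_functions UNIV"
  shows "L2_inner UI (dir_deriv 1 (unit_mode j)) (dir_deriv 1 \<zeta>)
    = of_real ((mode_freq j)\<^sup>2) * L2_inner UI (unit_mode j) (\<lambda>t. \<zeta> t - \<zeta> 0)"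
proof -
  let ?H = "\<lambda>x. dir_deriv 1 (unit_mode j) x * cnj (\<zeta> x - \<zeta> 0)"
  let ?h1 = "\<lambda>x. dir_deriv 1 (unit_mode j) x * cnj (dir_deriv 1 \<zeta> x)"
  let ?h2 = "\<lambda>x. of_real ((mode_freq j)\<^sup>2) * (unit_mode j x * cnj (\<zeta> x - \<zeta> 0))"
  note c = smooth_continuous_on[OF test_smooth[OF unit_mode_test[of j]]]
    smooth_continuous_on[OF smooth_dir_deriv[OF test_smooth[OF unit_mode_test[of j]], of 1]]
    smooth_continuous_on[OF test_smooth[OF z]] smooth_continuous_on[OF smooth_dir_deriv[OF test_smooth[OF z], of 1]]
  have L: "(\<lambda>t. \<zeta> t - \<zeta> 0) \<in> L2 UI" by (intro L2_diff test_UI z UI_const)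
  have "(LINT x|UI. ?h1 x - ?h2 x) = ?H 1 - ?H 0"
  proof (rule UI_FTC_1)
    show "continuous_on {0..1} (\<lambda>x. ?h1 x - ?h2 x)" by (intro continuous_intros c)
    fix x :: real assume "0 \<le> x" "x \<le> 1"
    then show "(?H has_vector_derivative ?h1 x - ?h2 x) (at x)"
      using vector_derivative_test[OF test_smooth[OF z]]
      by (auto intro!: derivative_eq_intros deriv2_unit_mode simp: algebra_simps)
  qed
  also have "\<dots> = 0" by (simp add: dir_deriv_unit_mode mode_freq_cos)
  finally have a: "(LINT x|UI. ?h1 x - ?h2 x) = 0" .
  have b: "(LINT x|UI. ?h1 x - ?h2 x) = (LINT x|UI. ?h1 x) - (LINT x|UI. ?h2 x)"
    by (intro Bochner_Integration.integral_diff integrable_mult_right L2_inner_integrable test_UI unit_mode_test test_dir_deriv z L)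
  have "(LINT x|UI. ?h1 x) = (LINT x|UI. ?h2 x)"
    using b unfolding a by (simp only: eq_commute[of 0] right_minus_eq)
  also have "(LINT x|UI. ?h2 x) = of_real ((mode_freq j)\<^sup>2) * (LINT x|UI. unit_mode j x * cnj (\<zeta> x - \<zeta> 0))"
    by (rule integral_mult_right_zero)
  finally show ?thesis unfolding L2_inner_def .
qed

text \<open>The preceding integration by parts passes to the limit, since a vanishing trace says
  that the subtracted constants \<open>\<zeta> n 0\<close> tend to zero.\<close>

lemma unit_mode_neg_laplacian:
  "(unit_mode j, \<lambda>x. of_real ((mode_freq j)\<^sup>2) * unit_mode j x) \<in> neg_laplacian_1d {0<..<1} {0}"
  unfolding neg_laplacian_1d_iff
proof (intro conjI ballI)
  have op: "open {0<..<1::real}" by simp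
  have B: "(1::real) \<in> Basis" by simp
  show "unit_mode j \<in> dirichlet_domain {0<..<1} {0}"
    by (rule test_dirichlet_domain[OF op _ unit_mode_test]) (auto simp: unit_mode_eq)
  show "(\<lambda>x. of_real ((mode_freq j)\<^sup>2) * unit_mode j x) \<in> L2 UI"
    by (intro L2_scale test_UI unit_mode_test)
  fix v assume v: "v \<in> dirichlet_domain {0<..<1} {0}"
  then have "has_trace {0<..<1} (count_space {0}) v (\<lambda>_. 0)" by (simp add: dirichlet_domain_def W12_zero_def)
  then obtain \<zeta> where \<zeta>: "\<And>n. \<zeta> n \<in> test_functions UNIV" "W12_conv {0<..<1} \<zeta> v" "(\<lambda>n. L2_norm (count_space {0}) (\<zeta> n)) \<longlonglongrightarrow> 0"
    unfolding zero_trace_iff[OF op] by blast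
  have vW: "v \<in> W12 {0<..<1}" by (rule dirichlet_domain_W12[OF v])
  have c: "L2_conv UI \<zeta> v" using \<zeta>(2) by (simp add: W12_conv_def)
  have c1: "L2_conv UI (\<lambda>n. dir_deriv 1 (\<zeta> n)) (weak_deriv {0<..<1} 1 v)"
    by (rule W12_conv_test[OF op \<zeta>(1) vW \<zeta>(2) B])
  have z0: "L2_conv UI (\<lambda>n _. \<zeta> n 0) (\<lambda>_. 0)"
  proof -
    have "L2_norm (count_space {0}) (\<zeta> n) = norm (\<zeta> n 0)" for n
      by (simp add: L2_norm_def lebesgue_integral_count_space_finite)
    then show ?thesis using \<zeta>(3) by (simp add: UI_const_norm)
  qed
  have c2: "L2_conv UI (\<lambda>n t. \<zeta> n t - \<zeta> n 0) v"
    using L2_conv_lincomb[OF test_UI[OF \<zeta>(1)] W12_L2[OF vW] c UI_const UI_const z0, of 1 "-1"] by simp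
  have "(\<lambda>n. L2_inner UI (dir_deriv 1 (unit_mode j)) (dir_deriv 1 (\<zeta> n))) \<longlonglongrightarrow> L2_inner UI (dir_deriv 1 (unit_mode j)) (weak_deriv {0<..<1} 1 v)"
    by (rule L2_conv_inner[OF _ _ L2_conv_const _ _ c1]) (intro test_UI test_dir_deriv unit_mode_test \<zeta> weak_deriv_spec vW B)+
  moreover have "(\<lambda>n. of_real ((mode_freq j)\<^sup>2) * L2_inner UI (unit_mode j) (\<lambda>t. \<zeta> n t - \<zeta> n 0)) \<longlonglongrightarrow> of_real ((mode_freq j)\<^sup>2) * L2_inner UI (unit_mode j) v"
    by (intro tendsto_mult_left L2_conv_inner[OF _ _ L2_conv_const _ _ c2] test_UI unit_mode_test L2_diff UI_const \<zeta> W12_L2 vW)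
  ultimately have "L2_inner UI (dir_deriv 1 (unit_mode j)) (weak_deriv {0<..<1} 1 v) = of_real ((mode_freq j)\<^sup>2) * L2_inner UI (unit_mode j) v"
    unfolding unit_mode_ibp[OF \<zeta>(1)] by (rule LIMSEQ_unique)
  moreover have "L2_inner UI (weak_deriv {0<..<1} 1 (unit_mode j)) (weak_deriv {0<..<1} 1 v) = L2_inner UI (dir_deriv 1 (unit_mode j)) (weak_deriv {0<..<1} 1 v)"
    by (rule L2_inner_AE_cong[OF test_W12(2)[OF op unit_mode_test B] AE_I2[OF refl]])
       (intro L2_measurable test_UI test_dir_deriv unit_mode_test weak_deriv_spec vW B test_W12 op)+
  moreover have "L2_inner UI (\<lambda>x. of_real ((mode_freq j)\<^sup>2) * unit_mode j x) v = of_real ((mode_freq j)\<^sup>2) * L2_inner UI (unit_mode j) v"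
    by (simp add: L2_inner_def mult.assoc)
  ultimately show "L2_inner UI (weak_deriv {0<..<1} 1 (unit_mode j)) (weak_deriv {0<..<1} 1 v) = L2_inner UI (\<lambda>x. of_real ((mode_freq j)\<^sup>2) * unit_mode j x) v"
    by simp
qed

text \<open>Since \<open>2 * sin (\<pi> * x / 2) * cos (j * \<pi> * x)\<close> is a difference of two modes, a function orthogonal to
  all modes is, after multiplication by \<open>sin (\<pi> * x / 2)\<close>, orthogonal to all polynomials in
  \<open>cos (\<pi> * x)\<close>; these are dense in the continuous functions on \<open>[0, 1]\<close>.\<close>

lemma unit_mode_complete:
  assumes w: "w \<in> L2 UI" and orth: "\<And>j. L2_inner UI w (unit_mode j) = 0"
  shows "AE x in UI. w x = 0"
proof -
  define v where "v x = complex_of_real (sin (pi * x / 2)) * w x" for x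
  have v: "v \<in> L2 UI" unfolding v_def
    by (rule L2_bounded_mult[OF w, of _ 1]) (auto intro!: measurable_restrict_space1 borel_measurable_continuous_onI continuous_intros)
  have int: "integrable UI (\<lambda>x. v x * complex_of_real (g x))" if "continuous_on UNIV g" for g
    by (intro L2_prod_integrable v UI_continuous_L2 continuous_intros that)
  define Z where "Z g \<longleftrightarrow> continuous_on UNIV g \<and> (LINT x|UI. v x * complex_of_real (g x)) = 0" for g
  have Z_lin: "Z (\<lambda>x. a * g x + b * h x)" if "Z g" "Z h" for g h a b
  proof -
    have "(LINT x|UI. v x * complex_of_real (a * g x + b * h x))
        = (LINT x|UI. of_real a * (v x * of_real (g x)) + of_real b * (v x * of_real (h x)))"
      by (simp add: algebra_simps)
    also have "\<dots> = (LINT x|UI. of_real a * (v x * of_real (g x))) + (LINT x|UI. of_real b * (v x * of_real (h x)))"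
      using that unfolding Z_def by (intro Bochner_Integration.integral_add integrable_mult_right int) auto
    finally show ?thesis using that unfolding Z_def by (auto intro!: continuous_intros)
  qed
  have base: "Z (\<lambda>x. cos (real j * pi * x))" for j
  proof -
    define m where "m i x = w x * complex_of_real (sin (mode_freq i * x))" for i x
    have m: "(LINT x|UI. m i x) = 0" for i
    proof -
      have "(LINT x|UI. m i x) = L2_inner UI w (unit_mode i)"
        unfolding L2_inner_def m_def by (rule Bochner_Integration.integral_cong) (auto simp: unit_mode_eq)
      then show ?thesis using orth by simp
    qed
    have mi: "integrable UI (m i)" for i
      unfolding m_def[abs_def] by (intro L2_prod_integrable w UI_continuous_L2 continuous_intros)
    have "(LINT x|UI. v x * complex_of_real (cos (real j * pi * x))) = 0"
    proof (cases j)
      case 0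
      have "v x * complex_of_real (cos (real j * pi * x)) = m 0 x" for x
        by (simp add: 0 v_def m_def mode_freq_def mult.commute)
      then show ?thesis using m by simp
    next
      case (Suc i)
      have "v x * complex_of_real (cos (real j * pi * x)) = (1/2) * (m j x - m i x)" for x
      proof -
        have e: "mode_freq j * x = pi * x / 2 + real j * pi * x" "mode_freq i * x = real j * pi * x - pi * x / 2"
          by (simp_all add: Suc mode_freq_def algebra_simps)
        have "sin (mode_freq j * x) - sin (mode_freq i * x) = 2 * (sin (pi * x / 2) * cos (real j * pi * x))"
          unfolding e sin_add sin_diff by simp
        then have "sin (pi * x / 2) * cos (real j * pi * x) = (1/2) * (sin (mode_freq j * x) - sin (mode_freq i * x))"
          by simp
        from arg_cong[OF this, of complex_of_real]
        have "complex_of_real (sin (pi * x / 2)) * complex_of_real (cos (real j * pi * x))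
          = (1/2) * (complex_of_real (sin (mode_freq j * x)) - complex_of_real (sin (mode_freq i * x)))"
          unfolding of_real_mult of_real_diff by simp
        then have "w x * (complex_of_real (sin (pi * x / 2)) * complex_of_real (cos (real j * pi * x)))
          = w x * ((1/2) * (complex_of_real (sin (mode_freq j * x)) - complex_of_real (sin (mode_freq i * x))))"
          by (rule arg_cong)
        then show ?thesis unfolding v_def m_def by (simp add: mult_ac right_diff_distrib)
      qed
      then have "(LINT x|UI. v x * complex_of_real (cos (real j * pi * x))) = (LINT x|UI. (1/2) * (m j x - m i x))"
        by (simp only:)
      then show ?thesis using m mi by simp
    qed
    then show ?thesis unfolding Z_def by (auto intro!: continuous_intros)
  qed
  \<comment> \<open>The extra cosine factor carries the induction: multiplied by
    \<open>cos (pi * x)\<close> it becomes half the sum of its two neighbours, and for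
    \<open>j = 0\<close> simply the factor with index 1.\<close>
  have pow: "Z (\<lambda>x. cos (real j * pi * x) * cos (pi * x) ^ n)" for j n
  proof (induction n arbitrary: j)
    case 0
    show ?case using base[of j] by simp
  next
    case (Suc n)
    show ?case
    proof (cases j)
      case 0
      then show ?thesis using Suc[of 1] by (simp add: mult.commute)
    next
      case (Suc i)
      have "cos (real j * pi * x) * cos (pi * x) = (1/2) * cos (real (Suc j) * pi * x) + (1/2) * cos (real i * pi * x)" for x
      proof -
        have e: "real (Suc j) * pi * x = real j * pi * x + pi * x" "real i * pi * x = real j * pi * x - pi * x"
          by (simp_all add: Suc algebra_simps)
        show ?thesis unfolding e cos_add cos_diff by (simp add: field_simps)
      qed
      then have "(cos (real j * pi * x) * cos (pi * x)) * cos (pi * x) ^ n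
        = ((1/2) * cos (real (Suc j) * pi * x) + (1/2) * cos (real i * pi * x)) * cos (pi * x) ^ n" for x
        by (simp only:)
      then have "(\<lambda>x. cos (real j * pi * x) * cos (pi * x) ^ Suc n)
        = (\<lambda>x. (1/2) * (cos (real (Suc j) * pi * x) * cos (pi * x) ^ n) + (1/2) * (cos (real i * pi * x) * cos (pi * x) ^ n))"
        by (simp only: power_Suc mult.assoc[symmetric] distrib_right)
      then show ?thesis using Z_lin[OF Suc.IH[of "Suc j"] Suc.IH[of i], of "1/2" "1/2"] by simp
    qed
  qed
  have poly: "Z (\<lambda>x. \<Sum>i\<le>n. a i * cos (pi * x) ^ i)" for a :: "nat \<Rightarrow> real" and n
  proof (induction n)
    case 0
    show ?case using Z_lin[OF pow[of 0 0] pow[of 0 0], of "a 0" 0] by simp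
  next
    case (Suc n)
    show ?case using Z_lin[OF Suc pow[of 0 "Suc n"], of 1 "a (Suc n)"] by simp
  qed
  have "AE x in UI. v x = 0"
  proof (rule fundamental_lemma[OF open_greaterThanLessThan v])
    fix \<phi> :: "real \<Rightarrow> real" assume t: "\<phi> \<in> test_functions {0<..<1}"
    note c = smooth_continuous_on[OF test_smooth[OF t]]
    let ?L = "LINT x|UI. v x * complex_of_real (\<phi> x)"
    have "norm ?L \<le> e * L2_norm UI v" if e: "e > 0" for e
    proof -
      \<comment> \<open>The substitution \<open>y = cos (pi * x)\<close> moves the approximation
        problem to [-1, 1], where polynomials are dense.\<close>
      have "continuous_on {-1..1} (\<lambda>y. \<phi> (arccos y / pi))"
        by (intro continuous_on_compose2[OF c[of UNIV]] continuous_intros) auto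
      then obtain p where p: "real_polynomial_function p" "\<And>y. y \<in> {-1..1} \<Longrightarrow> \<bar>\<phi> (arccos y / pi) - p y\<bar> < e"
        using Stone_Weierstrass_real_polynomial_function[OF compact_Icc _ e] by blast
      obtain a n where p': "p = (\<lambda>x. \<Sum>i\<le>n. a i * x ^ i)"
        using p(1) unfolding real_polynomial_function_iff_sum by blast
      define g where "g x = \<phi> x - p (cos (pi * x))" for x
      have gc: "continuous_on UNIV g" unfolding g_def p' by (intro continuous_intros c)
      have gm: "(\<lambda>x. complex_of_real (g x)) \<in> borel_measurable UI"
        using borel_measurable_continuous_onI[OF continuous_on_of_real[OF gc]]
        by (intro measurable_restrict_space1) simp
      have gb: "norm (complex_of_real (g x)) \<le> e" if "x \<in> space UI" for x
      proof -
        have "arccos (cos (pi * x)) = pi * x" using that by (intro arccos_cos) auto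
        then show ?thesis unfolding norm_of_real g_def using p(2)[of "cos (pi * x)"] by simp
      qed
      have Zp: "(LINT x|UI. v x * complex_of_real (p (cos (pi * x)))) = 0"
        using poly[of a n] unfolding Z_def p' by blast
      have pc: "continuous_on UNIV (\<lambda>x. p (cos (pi * x)))" unfolding p' by (intro continuous_intros)
      have "(LINT x|UI. v x * complex_of_real (g x)) = ?L"
        using Zp Bochner_Integration.integral_diff[OF int[OF c[of UNIV]] int[OF pc]]
        by (simp add: g_def right_diff_distrib)
      then have "norm ?L = norm (L2_inner UI (\<lambda>x. complex_of_real (g x) * v x) (\<lambda>_. 1))"
        by (simp add: L2_inner_def mult.commute)
      also have "\<dots> \<le> L2_norm UI (\<lambda>x. complex_of_real (g x) * v x) * L2_norm UI (\<lambda>_. 1)"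
        by (intro L2_cauchy_schwarz UI_const L2_bounded_mult[OF v gm gb])
      also have "\<dots> \<le> e * L2_norm UI v"
        using L2_norm_bounded_mult[OF v gm gb] e by (simp add: UI_const_norm)
      finally show ?thesis .
    qed
    note bnd = this
    have "?L = 0"
    proof (rule ccontr)
      assume n: "?L \<noteq> 0"
      define e where "e = norm ?L / (L2_norm UI v + 1)"
      have p: "L2_norm UI v + 1 > 0" using L2_norm_nonneg[of UI v] by linarith
      have e: "e > 0" using n p by (simp add: e_def)
      have "e * (L2_norm UI v + 1) = norm ?L" using p by (simp add: e_def)
      then have "norm ?L = e * L2_norm UI v + e" by (simp add: distrib_left)
      then show False using bnd[OF e] e by linarith
    qed
    then show "(LINT x|UI. \<phi> x *\<^sub>R v x) = 0" by (simp add: scaleR_conv_of_real mult.commute)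
  qed
  then show ?thesis
    using AE_space
  proof eventually_elim
    case (elim x)
    then have "sin (pi * x / 2) > 0" by (intro sin_gt_zero) auto
    then show ?case using elim by (simp add: v_def)
  qed
qed

text \<open>The constant is the square of the Hilbert--Schmidt norm of \<open>g \<mapsto> \<integral>\<^sub>0\<^sup>t g\<close> on the
  orthogonal complement of the derivative of the first mode; any constant below \<open>4 / \<pi>\<^sup>2\<close> would do.\<close>

definition ground :: "real \<Rightarrow> complex" where
  "ground t = of_real (sqrt 2) * unit_mode 0 t"

abbreviation ground' :: "real \<Rightarrow> complex" where
  "ground' \<equiv> dir_deriv 1 ground"

lemma ground_test: "ground \<in> test_functions UNIV"
  unfolding ground_def[abs_def] by (rule test_linear[OF bounded_linear_mult_right unit_mode_test])

lemma ground_eq: "-1 \<le> x \<Longrightarrow> x \<le> 2 \<Longrightarrow> ground x = of_real (sqrt 2 * sin (pi * x / 2))"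
  by (simp add: ground_def unit_mode_eq mode_freq_def mult.commute)

lemma ground'_scale: "ground' x = of_real (sqrt 2) * dir_deriv 1 (unit_mode 0) x"
  unfolding ground_def[abs_def]
  by (rule dir_deriv_eq[OF has_derivative_mult_right[OF smooth_has_derivative[OF test_smooth[OF unit_mode_test]]]])

lemma ground'_eq: "-1 < x \<Longrightarrow> x < 2 \<Longrightarrow> ground' x = of_real (sqrt 2 * pi / 2 * cos (pi * x / 2))"
  by (simp add: ground'_scale dir_deriv_unit_mode mode_freq_def mult.commute)

lemma ground_L2: "ground \<in> L2 UI" "ground' \<in> L2 UI"
  by (intro test_UI ground_test test_dir_deriv)+

lemma ground_ibp:
  assumes z: "\<zeta> \<in> test_functions UNIV"
  shows "L2_inner UI (dir_deriv 1 \<zeta>) ground' = of_real (pi\<^sup>2 / 4) * L2_inner UI (\<lambda>t. \<zeta> t - \<zeta> 0) ground"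
proof -
  have "L2_inner UI ground' (dir_deriv 1 \<zeta>) = of_real (sqrt 2) * L2_inner UI (dir_deriv 1 (unit_mode 0)) (dir_deriv 1 \<zeta>)"
    unfolding ground'_scale L2_inner_def by (simp add: mult.assoc)
  also have "\<dots> = of_real (pi\<^sup>2 / 4) * L2_inner UI ground (\<lambda>t. \<zeta> t - \<zeta> 0)"
    unfolding unit_mode_ibp[OF z] unfolding ground_def L2_inner_def
    by (simp add: mult.assoc mode_freq_def power2_eq_square)
  finally show ?thesis
    using L2_inner_commute[of UI ground' "dir_deriv 1 \<zeta>"] L2_inner_commute[of UI ground "\<lambda>t. \<zeta> t - \<zeta> 0"]
    by (metis complex_cnj_cnj complex_cnj_complex_of_real complex_cnj_mult L2_inner_commute)
qed

lemma ground_norm: "L2_norm UI ground = 1"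
proof -
  have "(LINT x|UI. complex_of_real ((norm (ground x))\<^sup>2)) = (LINT x|UI. complex_of_real (1 - cos (pi * x)))"
  proof (rule Bochner_Integration.integral_cong[OF refl])
    fix x :: real assume "x \<in> space UI"
    then have "(norm (ground x))\<^sup>2 = 2 * (sin (pi * x / 2))\<^sup>2"
      by (simp add: ground_eq norm_mult power_mult_distrib)
    also have "\<dots> = 1 - cos (pi * x)" using cos_double_sin[of "pi * x / 2"] by simp
    finally show "complex_of_real ((norm (ground x))\<^sup>2) = complex_of_real (1 - cos (pi * x))" by simp
  qed
  also have "\<dots> = complex_of_real (1 - sin (pi * 1) / pi) - complex_of_real (0 - sin (pi * 0) / pi)"
    by (rule UI_FTC_1)
       (auto intro!: continuous_intros derivative_eq_intros
         simp: has_real_derivative_iff_has_vector_derivative[symmetric])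
  finally have "complex_of_real (LINT x|UI. (norm (ground x))\<^sup>2) = 1" unfolding integral_complex_of_real
    by simp
  then have "(L2_norm UI ground)\<^sup>2 = 1" unfolding of_real_eq_1_iff L2_norm_sq .
  then show ?thesis using L2_norm_nonneg[of UI ground] by (simp add: power2_eq_1_iff)
qed

lemma ground_inner: "L2_inner UI ground ground = 1"
  by (simp add: L2_inner_self ground_norm)

lemma ground_0: "ground 0 = 0"
  by (simp add: ground_eq)

lemma ground'_inner: "L2_inner UI ground' ground' = of_real (pi\<^sup>2 / 4)"
  using ground_ibp[OF ground_test] by (simp add: ground_0 ground_inner)

lemma ground'_norm_sq: "(L2_norm UI ground')\<^sup>2 = pi\<^sup>2 / 4"
  using ground'_inner unfolding L2_inner_self of_real_eq_iff .

text \<open>Let \<open>w\<close> be \<open>v\<close> without its component along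
  \<open>ground\<close>, and \<open>p\<close> its derivative. Then \<open>w t\<close> is the inner
  product of \<open>p\<close> with the indicator of (0, t). Since \<open>p\<close> is orthogonal to
  \<open>ground'\<close>, the indicator may be replaced by its component \<open>kt\<close>
  orthogonal to \<open>ground'\<close>. Cauchy-Schwarz then bounds \<open>w t\<close> by the norms
  of \<open>p\<close> and \<open>kt\<close>, and the integral over \<open>t\<close> of the squared
  norm of \<open>kt\<close> is the constant.\<close>

lemma unit_gap:
  assumes z: "\<zeta> \<in> test_functions UNIV"
  defines "a \<equiv> L2_inner UI (\<lambda>t. \<zeta> t - \<zeta> 0) ground"
  shows "(L2_norm UI (\<lambda>t. \<zeta> t - \<zeta> 0))\<^sup>2 - (norm a)\<^sup>2
     \<le> (1/2 - 4 / pi\<^sup>2) * ((L2_norm UI (dir_deriv 1 \<zeta>))\<^sup>2 - pi\<^sup>2 / 4 * (norm a)\<^sup>2)"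
proof -
  define v where "v t = \<zeta> t - \<zeta> 0" for t
  define p where "p t = 1 * dir_deriv 1 \<zeta> t + (- a) * ground' t" for t
  define w where "w t = 1 * v t + (- a) * ground t" for t
  have L: "v \<in> L2 UI" "dir_deriv 1 \<zeta> \<in> L2 UI"
    unfolding v_def[abs_def] by (intro L2_diff UI_const test_UI test_dir_deriv z)+
  have pL: "p \<in> L2 UI" "w \<in> L2 UI"
    unfolding p_def[abs_def] w_def[abs_def] by (intro L2_lincomb L ground_L2)+
  have av: "L2_inner UI v ground = a" by (simp add: a_def v_def[abs_def])
  have ap: "L2_inner UI (dir_deriv 1 \<zeta>) ground' = of_real (pi\<^sup>2 / 4) * a"
    using ground_ibp[OF z] by (simp add: a_def)
  have w2: "(L2_norm UI w)\<^sup>2 = (L2_norm UI v)\<^sup>2 - (norm a)\<^sup>2"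
    using L2.Re_expand[OF L(1) ground_L2(1), of 1 "- a"]
    by (simp add: w_def[abs_def] L2_inner_self av ground_norm cmod_power2)
       (simp add: power2_eq_square)
  have p2: "(L2_norm UI p)\<^sup>2 = (L2_norm UI (dir_deriv 1 \<zeta>))\<^sup>2 - pi\<^sup>2 / 4 * (norm a)\<^sup>2"
    using L2.Re_expand[OF L(2) ground_L2(2), of 1 "- a"]
    by (simp add: p_def[abs_def] L2_inner_self ap ground'_norm_sq cmod_power2)
       (simp add: field_simps power2_eq_square)
  have orth: "L2_inner UI p ground' = 0"
    unfolding p_def[abs_def] L2_inner_lincomb_left[OF L(2) ground_L2(2) ground_L2(2)] ap ground'_inner by simp
  have pt: "(norm (w t))\<^sup>2 \<le> (L2_norm UI p)\<^sup>2 * (t - 4 / pi\<^sup>2 * (norm (ground t))\<^sup>2)" if t: "0 < t" "t < 1" for t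
  proof -
    \<comment> \<open>The coefficient of the projection of the indicator onto
      \<open>ground'\<close>: the inner product \<open>ground t\<close> divided by the squared norm
      \<open>pi\<^sup>2 / 4\<close>.\<close>
    define c where "c = complex_of_real (4 / pi\<^sup>2 * (sqrt 2 * sin (pi * t / 2)))"
    define ind where "ind x = complex_of_real (indicator {0<..<t} x)" for x
    have indL: "ind \<in> L2 UI" unfolding ind_def[abs_def]
      by (rule UI_bounded_L2[of _ 1]) (auto intro!: measurable_restrict_space1 simp: indicator_def)
    have gt: "ground t = of_real (sqrt 2 * sin (pi * t / 2))" using t by (simp add: ground_eq)
    have ii: "L2_inner UI h ind = H t - H 0" if "continuous_on {0..t} h"
      "\<And>x. 0 \<le> x \<Longrightarrow> x \<le> t \<Longrightarrow> (H has_vector_derivative h x) (at x)" for h H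
    proof -
      have "L2_inner UI h ind = (LINT x|UI. indicator {0<..<t} x *\<^sub>R h x)"
        unfolding L2_inner_def ind_def by (rule Bochner_Integration.integral_cong) (auto simp: indicator_def)
      also have "\<dots> = H t - H 0" by (rule UI_FTC) (use t that in auto)
      finally show ?thesis .
    qed
    note sz = test_smooth[OF z] and sg = test_smooth[OF ground_test]
    have i1: "L2_inner UI p ind = w t"
    proof -
      have "L2_inner UI p ind = (1 * \<zeta> t + (-a) * ground t) - (1 * \<zeta> 0 + (-a) * ground 0)"
      proof (rule ii)
        show "continuous_on {0..t} p" unfolding p_def[abs_def]
          by (intro continuous_intros smooth_continuous_on smooth_dir_deriv sz sg)
        show "((\<lambda>t. 1 * \<zeta> t + (-a) * ground t) has_vector_derivative p x) (at x)" for x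
          unfolding p_def
          by (intro has_vector_derivative_add has_vector_derivative_mult_right vector_derivative_test sz sg)
      qed
      then show ?thesis by (simp add: w_def v_def ground_0)
    qed
    have i2: "L2_inner UI ground' ind = ground t"
      using ii[of ground' ground] vector_derivative_test[OF sg] smooth_continuous_on[OF smooth_dir_deriv[OF sg]]
      by (simp add: ground_0)
    have i3: "L2_inner UI ind ind = of_real t"
    proof -
      have "L2_inner UI ind ind = L2_inner UI (\<lambda>_. 1) ind"
        unfolding L2_inner_def ind_def by (rule Bochner_Integration.integral_cong) (auto simp: indicator_def)
      also have "\<dots> = of_real t - of_real 0"
        by (rule ii) (auto intro!: derivative_eq_intros simp: has_vector_derivative_def scaleR_conv_of_real)
      finally show ?thesis by simp
    qed
    define kt where "kt x = 1 * ind x + (- c) * ground' x" for x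
    have ktL: "kt \<in> L2 UI" unfolding kt_def[abs_def] by (intro L2_lincomb indL ground_L2)
    have "L2_inner UI p kt = w t"
      unfolding kt_def[abs_def] L2.q_lincomb_right[OF indL ground_L2(2) pL(1)] i1 orth by simp
    moreover have "(L2_norm UI kt)\<^sup>2 = t - 4 / pi\<^sup>2 * (norm (ground t))\<^sup>2"
    proof -
      have gi: "L2_inner UI ind ground' = ground t"
        using L2_inner_commute[of UI ind ground'] by (simp only: i2 gt complex_cnj_complex_of_real)
      define r where "r = sqrt 2 * sin (pi * t / 2)"
      have "(L2_norm UI kt)\<^sup>2 = t - 2 * (4 / pi\<^sup>2 * r * r) + (4 / pi\<^sup>2 * r)\<^sup>2 * (pi\<^sup>2 / 4)"
      proof -
        have "(L2_norm UI kt)\<^sup>2 = Re (L2_inner UI kt kt)" by (simp add: L2_inner_self)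
        then show ?thesis
          unfolding kt_def[abs_def] L2.Re_expand[OF indL ground_L2(2)] gi ground'_inner i3 gt c_def r_def[symmetric]
          by (simp add: norm_mult norm_divide norm_power power_mult_distrib power_divide)
      qed
      also have "\<dots> = t - 4 / pi\<^sup>2 * r\<^sup>2" by (simp add: field_simps power2_eq_square)
      finally show ?thesis by (simp add: gt r_def[symmetric] del: of_real_mult)
    qed
    moreover have "(norm (L2_inner UI p kt))\<^sup>2 \<le> (L2_norm UI p * L2_norm UI kt)\<^sup>2"
      by (intro power_mono L2_cauchy_schwarz pL ktL) simp
    ultimately show ?thesis by (simp add: power_mult_distrib)
  qed
  have it: "integrable UI (\<lambda>t. t)" "(LINT t|UI. t) = 1/2"
  proof -
    have "integrable UI (\<lambda>t. complex_of_real t * complex_of_real 1)"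
      by (intro L2_prod_integrable UI_continuous_L2 continuous_intros)
    then show "integrable UI (\<lambda>t. t)" by (simp add: complex_of_real_integrable_eq)
    have "(LINT t|UI. t) = 1\<^sup>2 / 2 - 0\<^sup>2 / 2"
      by (rule UI_FTC_real[where H="\<lambda>t. t\<^sup>2 / 2"]) (auto intro!: continuous_intros derivative_eq_intros)
    then show "(LINT t|UI. t) = 1/2" by simp
  qed
  note ig = L2_integrable[OF ground_L2(1)]
  have "(L2_norm UI w)\<^sup>2 \<le> (LINT t|UI. (L2_norm UI p)\<^sup>2 * (t - 4 / pi\<^sup>2 * (norm (ground t))\<^sup>2))"
    unfolding L2_norm_sq[of UI w]
    by (rule integral_mono[OF L2_integrable[OF pL(2)]])
       (use it(1) ig pt in \<open>auto intro!: integrable_mult_right Bochner_Integration.integrable_diff\<close>)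
  also have "\<dots> = (L2_norm UI p)\<^sup>2 * (1/2 - 4 / pi\<^sup>2)"
    using it ig ground_norm L2_norm_sq[of UI ground] by simp
  finally show ?thesis unfolding w2 p2 v_def[abs_def] by (simp add: mult.commute)
qed

text \<open>This cancellation makes the first-order term of the weighted form in \<open>\<epsilon>\<close> equal to \<open>\<kappa> / \<epsilon>\<close> on the
  first transversal mode.\<close>

lemma ground_moment:
  "L2_inner UI (\<lambda>t. of_real t * ground' t) ground' + L2_inner UI ground ground
     - of_real (pi\<^sup>2 / 4) * L2_inner UI (\<lambda>t. of_real t * ground t) ground = 0"
proof -
  have i: "integrable UI (\<lambda>t. (of_real t * u t) * cnj (u t))" if "continuous_on UNIV u" for u :: "real \<Rightarrow> complex"
    by (intro L2_inner_integrable UI_continuous_L2 continuous_intros that)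
  note cg = smooth_continuous_on[OF test_smooth[OF ground_test], of UNIV]
    smooth_continuous_on[OF test_smooth[OF test_dir_deriv[OF ground_test, of 1]], of UNIV]
  have "L2_inner UI (\<lambda>t. of_real t * ground' t) ground' - of_real (pi\<^sup>2 / 4) * L2_inner UI (\<lambda>t. of_real t * ground t) ground
     = (LINT t|UI. (of_real t * ground' t) * cnj (ground' t) - of_real (pi\<^sup>2 / 4) * ((of_real t * ground t) * cnj (ground t)))"
    unfolding L2_inner_def using i[OF cg(1)] i[OF cg(2)] by (simp add: Bochner_Integration.integral_diff)
  also have "\<dots> = (LINT t|UI. complex_of_real (pi\<^sup>2 / 2 * t * cos (pi * t)))"
  proof (rule Bochner_Integration.integral_cong[OF refl])
    fix t :: real assume "t \<in> space UI"
    then have g: "ground t = of_real (sqrt 2 * sin (pi * t / 2))" "ground' t = of_real (sqrt 2 * pi / 2 * cos (pi * t / 2))"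
      by (simp_all add: ground_eq ground'_eq)
    have "cos (pi * t) = (cos (pi * t / 2))\<^sup>2 - (sin (pi * t / 2))\<^sup>2" using cos_double[of "pi * t / 2"] by simp
    then have "pi\<^sup>2 / 2 * t * cos (pi * t) = t * (sqrt 2 * pi / 2 * cos (pi * t / 2)) * (sqrt 2 * pi / 2 * cos (pi * t / 2))
       - pi\<^sup>2 / 4 * (t * (sqrt 2 * sin (pi * t / 2)) * (sqrt 2 * sin (pi * t / 2)))"
    proof -
      have "t * (sqrt 2 * pi / 2 * x) * (sqrt 2 * pi / 2 * x) = (sqrt 2 * sqrt 2) * (pi\<^sup>2 / 4 * t * x\<^sup>2)"
        "t * (sqrt 2 * x) * (sqrt 2 * x) = (sqrt 2 * sqrt 2) * (t * x\<^sup>2)" for x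
        by (simp_all add: power2_eq_square)
      then show ?thesis using \<open>cos (pi * t) = _\<close> by (simp only:) (simp add: algebra_simps)
    qed
    then show "(of_real t * ground' t) * cnj (ground' t) - of_real (pi\<^sup>2 / 4) * ((of_real t * ground t) * cnj (ground t))
       = complex_of_real (pi\<^sup>2 / 2 * t * cos (pi * t))"
      unfolding g complex_cnj_complex_of_real by (simp only: of_real_mult of_real_diff)
  qed
  \<comment> \<open>An antiderivative, found by parts; its increment over the unit interval is -1,
    which the middle term of the claim compensates.\<close>
  also have "\<dots> = complex_of_real (pi / 2 * (1 * sin (pi * 1)) + cos (pi * 1) / 2) - complex_of_real (pi / 2 * (0 * sin (pi * 0)) + cos (pi * 0) / 2)"
    by (rule UI_FTC_1)
       (auto intro!: continuous_intros derivative_eq_intros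
         simp: has_real_derivative_iff_has_vector_derivative[symmetric] field_simps power2_eq_square)
  finally have "L2_inner UI (\<lambda>t. of_real t * ground' t) ground'
      - of_real (pi\<^sup>2 / 4) * L2_inner UI (\<lambda>t. of_real t * ground t) ground + 1 = 0"
    unfolding eq_neg_iff_add_eq_0[symmetric] by simp
  then show ?thesis unfolding ground_inner by (simp only: diff_add_eq)
qed

section \<open>The strip\<close>

text \<open>Used with a cutoff in the longitudinal variable, to treat the ends of the strip
  separately.\<close>

lemma smooth_fst_mult:
  fixes \<theta> :: "real \<Rightarrow> complex" and \<psi> :: "real \<times> real \<Rightarrow> complex"
  assumes \<theta>: "\<theta> \<in> test_functions UNIV" and \<psi>: "\<psi> \<in> test_functions UNIV"
  shows "(\<lambda>x. \<theta> (fst x) * \<psi> x) \<in> test_functions UNIV"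
    and "dir_deriv e (\<lambda>x. \<theta> (fst x) * \<psi> x) x = \<theta> (fst x) * dir_deriv e \<psi> x + fst e *\<^sub>R dir_deriv 1 \<theta> (fst x) * \<psi> x"
proof -
  have s: "smooth (\<lambda>x::real\<times>real. \<theta> (fst x))"
    using smooth_affine_right[OF bounded_linear_fst test_smooth[OF \<theta>], of 0] by simp
  show "(\<lambda>x. \<theta> (fst x) * \<psi> x) \<in> test_functions UNIV"
    using test_bilinear_left[OF bounded_bilinear_mult \<psi> s] by (simp add: mult.commute)
  have "((\<lambda>x. \<theta> (fst x)) has_derivative (\<lambda>h. fst h *\<^sub>R dir_deriv 1 \<theta> (fst x))) (at x)"
    using has_derivative_compose[OF has_derivative_fst[OF has_derivative_ident], OF vector_derivative_test[OF test_smooth[OF \<theta>], unfolded has_vector_derivative_def]] .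
  from dir_deriv_eq[OF has_derivative_mult[OF this smooth_has_derivative[OF test_smooth[OF \<psi>]]]]
  show "dir_deriv e (\<lambda>x. \<theta> (fst x) * \<psi> x) x = \<theta> (fst x) * dir_deriv e \<psi> x + fst e *\<^sub>R dir_deriv 1 \<theta> (fst x) * \<psi> x" .
qed

locale strip_domain =
  fixes I :: "real set"
  assumes open_I: "open I" and interval_I: "is_interval I"
begin

abbreviation M1 :: "real measure" where "M1 \<equiv> lebesgue_on_open I"
abbreviation M :: "(real \<times> real) measure" where "M \<equiv> lebesgue_on_open (I \<times> {0<..<1})"
abbreviation d1 :: "(real \<times> real \<Rightarrow> complex) \<Rightarrow> real \<times> real \<Rightarrow> complex" where
  "d1 \<equiv> weak_deriv (I \<times> {0<..<1}) (1, 0)"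
abbreviation d2 :: "(real \<times> real \<Rightarrow> complex) \<Rightarrow> real \<times> real \<Rightarrow> complex" where
  "d2 \<equiv> weak_deriv (I \<times> {0<..<1}) (0, 1)"

lemma open_strip: "open (strip I)"
  by (intro open_Times open_I) simp

lemma Basis2: "(1, 0) \<in> (Basis :: (real \<times> real) set)" "(0, 1) \<in> (Basis :: (real \<times> real) set)"
  by (auto simp: Basis_real_prod)

lemma prod_measure: "M1 \<Otimes>\<^sub>M UI = M"
  by (rule lebesgue_on_open_Times) (auto simp: open_I)

sublocale P: pair_sigma_finite M1 UI
  by (intro pair_sigma_finite.intro sigma_finite_lebesgue_on_open open_I) simp

lemmas tensor_L2 = P.tensor_L2[unfolded prod_measure]
lemmas tensor_norm = P.tensor_norm[unfolded prod_measure]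
lemmas tensor_conv = P.tensor_conv[unfolded prod_measure]
lemmas tensor_inner = P.tensor_inner[unfolded prod_measure]
lemmas partial_inner_L2 = P.partial_inner_L2[unfolded prod_measure]
lemmas inner_partial_inner = P.inner_partial_inner[unfolded prod_measure]
lemmas partial_inner_lincomb = P.partial_inner_lincomb[unfolded prod_measure]
lemmas L2_inner_fst = P.L2_inner_fst[unfolded prod_measure]
lemmas L2_inner_snd = P.L2_inner_snd[unfolded prod_measure]
lemmas L2_norm_slices = P.L2_norm_slices[unfolded prod_measure]
lemmas AE_slice_L2 = P.AE_slice_L2[unfolded prod_measure]

definition bottom :: "(real \<times> real) measure" where
  "bottom = distr M1 borel (\<lambda>s. (s, 0))"

definition side :: "real \<Rightarrow> (real \<times> real) measure" where
  "side a = distr UI borel (\<lambda>t. (a, t))"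

definition boundary_measures :: "(real \<times> real) measure set" where
  "boundary_measures = insert bottom (side ` frontier I)"

lemma form_domain_eq: "form_domain I = W12_zero (strip I) boundary_measures"
  by (auto simp: form_domain_def W12_zero_def bottom_def side_def boundary_measures_def)

lemma finite_frontier: "finite (frontier I)"
  by (rule finite_frontier_interval[OF interval_I])

lemma bottom_meas: "(\<lambda>s. (s, 0)) \<in> M1 \<rightarrow>\<^sub>M borel" and side_meas: "(\<lambda>t. (a, t)) \<in> UI \<rightarrow>\<^sub>M borel"
  by (auto intro!: measurable_restrict_space1 borel_measurable_continuous_onI continuous_intros)

lemma L2_bottom:
  assumes "\<psi> \<in> borel_measurable borel"
  shows "\<psi> \<in> L2 bottom \<longleftrightarrow> (\<lambda>s. \<psi> (s, 0)) \<in> L2 M1" "L2_norm bottom \<psi> = L2_norm M1 (\<lambda>s. \<psi> (s, 0))"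
  using assms measurable_compose[OF bottom_meas assms]
  by (auto simp: L2_def L2_norm_def bottom_def integrable_distr_eq[OF bottom_meas] integral_distr[OF bottom_meas])

lemma L2_side:
  assumes "\<psi> \<in> borel_measurable borel"
  shows "\<psi> \<in> L2 (side a) \<longleftrightarrow> (\<lambda>t. \<psi> (a, t)) \<in> L2 UI" "L2_norm (side a) \<psi> = L2_norm UI (\<lambda>t. \<psi> (a, t))"
  using assms measurable_compose[OF side_meas assms]
  by (auto simp: L2_def L2_norm_def side_def integrable_distr_eq[OF side_meas] integral_distr[OF side_meas])

lemma test_measurable: "\<psi> \<in> test_functions UNIV \<Longrightarrow> (\<psi> :: real \<times> real \<Rightarrow> complex) \<in> borel_measurable borel"
  by (rule smooth_measurable[OF test_smooth])

lemma test_boundary: "\<nu> \<in> boundary_measures \<Longrightarrow> test_functions UNIV \<subseteq> L2 \<nu>"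
  unfolding boundary_measures_def
  by (auto simp: L2_bottom L2_side test_measurable test_UI[OF test_slice_snd] test_L2[OF test_slice_fst open_I])

lemma form_domain_W12: "u \<in> form_domain I \<Longrightarrow> u \<in> W12 (strip I)"
  by (simp add: form_domain_def)

lemma form_domain_L2: "u \<in> form_domain I \<Longrightarrow> u \<in> L2 M" "u \<in> form_domain I \<Longrightarrow> d1 u \<in> L2 M" "u \<in> form_domain I \<Longrightarrow> d2 u \<in> L2 M"
  using W12_L2[OF form_domain_W12] weak_deriv_spec(1)[OF form_domain_W12 Basis2(1)]
    weak_deriv_spec(1)[OF form_domain_W12 Basis2(2)] by auto

lemma form_domain_lincomb:
  assumes "u \<in> form_domain I" "v \<in> form_domain I"
  shows "(\<lambda>x. a * u x + b * v x) \<in> form_domain I"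
    "AE x in M. d1 (\<lambda>x. a * u x + b * v x) x = a * d1 u x + b * d1 v x"
    "AE x in M. d2 (\<lambda>x. a * u x + b * v x) x = a * d2 u x + b * d2 v x"
  using W12_zero_lincomb[OF open_strip test_boundary assms[unfolded form_domain_eq]]
    W12_lincomb(2)[OF open_strip assms[THEN form_domain_W12] Basis2(1)]
    W12_lincomb(2)[OF open_strip assms[THEN form_domain_W12] Basis2(2)]
  by (simp_all only: form_domain_eq)

lemma form_domain_diff:
  assumes "u \<in> form_domain I" "v \<in> form_domain I"
  shows "(\<lambda>x. u x - v x) \<in> form_domain I"
    "AE x in M. d1 (\<lambda>x. u x - v x) x = d1 u x - d1 v x"
    "AE x in M. d2 (\<lambda>x. u x - v x) x = d2 u x - d2 v x"
  using form_domain_lincomb[OF assms, where a=1 and b="-1"] by simp_all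

lemma test_M: "\<psi> \<in> test_functions UNIV \<Longrightarrow> \<psi> \<in> L2 M"
  by (rule test_L2[OF _ open_strip])

lemma form_domain_conv:
  assumes "\<And>n. \<psi> n \<in> test_functions UNIV" "u \<in> form_domain I" "W12_conv (strip I) \<psi> u"
  shows "L2_conv M \<psi> u" "L2_conv M (\<lambda>n. dir_deriv (1, 0) (\<psi> n)) (d1 u)" "L2_conv M (\<lambda>n. dir_deriv (0, 1) (\<psi> n)) (d2 u)"
  using W12_conv_test[OF open_strip assms(1) form_domain_W12[OF assms(2)] assms(3)] Basis2 assms(3)
  by (auto simp: W12_conv_def)

lemma form_domain_bottom:
  assumes "v \<in> form_domain I"
  obtains \<psi> where "\<And>n. \<psi> n \<in> test_functions UNIV" "W12_conv (strip I) \<psi> v"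
    "(\<lambda>n. L2_norm M1 (\<lambda>s. \<psi> n (s, 0))) \<longlonglongrightarrow> 0"
proof -
  have "has_trace (strip I) bottom v (\<lambda>_. 0)"
    using assms by (simp add: form_domain_eq W12_zero_def boundary_measures_def)
  then obtain \<psi> where p: "\<And>n. \<psi> n \<in> test_functions UNIV" "W12_conv (strip I) \<psi> v" "(\<lambda>n. L2_norm bottom (\<psi> n)) \<longlonglongrightarrow> 0"
    unfolding zero_trace_iff[OF open_strip] by blast
  show ?thesis using that[OF p(1,2)] p(3) by (simp add: L2_bottom(2)[OF test_measurable[OF p(1)]])
qed

text \<open>The approximating sequences for the different ends of the strip are glued by a cutoff.\<close>

lemma form_domain_sides:
  assumes v: "v \<in> form_domain I" and S: "S \<subseteq> frontier I"
  shows "\<exists>\<psi>. (\<forall>n. \<psi> n \<in> test_functions UNIV) \<and> W12_conv (strip I) \<psi> v \<and>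
    (\<forall>a\<in>S. (\<lambda>n. L2_norm UI (\<lambda>t. \<psi> n (a, t))) \<longlonglongrightarrow> 0)"
proof -
  have "finite S" using finite_subset[OF S finite_frontier] .
  then show ?thesis using S
  proof (induction S)
    case empty
    obtain \<psi> where "\<And>n. \<psi> n \<in> test_functions UNIV" "W12_conv (strip I) \<psi> v" using form_domain_bottom[OF v] by blast
    then show ?case by blast
  next
    case (insert b S)
    then obtain \<psi> where \<psi>: "\<And>n. \<psi> n \<in> test_functions UNIV" "W12_conv (strip I) \<psi> v"
      "\<And>a. a \<in> S \<Longrightarrow> (\<lambda>n. L2_norm UI (\<lambda>t. \<psi> n (a, t))) \<longlonglongrightarrow> 0" by blast
    have "has_trace (strip I) (side b) v (\<lambda>_. 0)"
      using v insert.prems by (simp add: form_domain_eq W12_zero_def boundary_measures_def)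
    then obtain \<eta> where \<eta>: "\<And>n. \<eta> n \<in> test_functions UNIV" "W12_conv (strip I) \<eta> v"
      "(\<lambda>n. L2_norm (side b) (\<eta> n)) \<longlonglongrightarrow> 0"
      unfolding zero_trace_iff[OF open_strip] by blast
    obtain \<theta> :: "real \<Rightarrow> complex" where \<theta>: "\<theta> \<in> test_functions UNIV" "\<theta> b = 1" "\<And>a. a \<in> S \<Longrightarrow> a \<noteq> b \<Longrightarrow> \<theta> a = 0"
      using separating_test_function[OF insert.hyps(1), of b] by blast
    \<comment> \<open>The new sequence will be \<open>\<psi> + \<theta> * (\<eta> - \<psi>)\<close>:
      on the side over \<open>b\<close> it equals \<eta>, on the other sides it equals \<psi>, and
      the correction tends to zero in \<open>W12\<close> because both sequences converge to
      \<open>v\<close>.\<close>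
    define d where "d n x = 1 * \<eta> n x + (-1) * \<psi> n x" for n x
    have dt: "d n \<in> test_functions UNIV" for n unfolding d_def[abs_def] by (intro test_lincomb \<eta> \<psi>)
    note vL = form_domain_L2[OF v]
    note c1 = form_domain_conv[OF \<psi>(1) v \<psi>(2)] and c2 = form_domain_conv[OF \<eta>(1) v \<eta>(2)]
    have d0: "L2_conv M d (\<lambda>_. 0)"
      using L2_conv_lincomb[OF test_M[OF \<eta>(1)] vL(1) c2(1) test_M[OF \<psi>(1)] vL(1) c1(1), of 1 "-1"]
      by (simp add: d_def[abs_def])
    have dd: "L2_conv M (\<lambda>n. dir_deriv e (d n)) (\<lambda>_. 0)" if e: "e \<in> Basis" for e
    proof -
      have c: "L2_conv M (\<lambda>n. dir_deriv e (\<psi> n)) (weak_deriv (strip I) e v)" "L2_conv M (\<lambda>n. dir_deriv e (\<eta> n)) (weak_deriv (strip I) e v)"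
        using c1 c2 e by (auto simp: Basis_real_prod)
      have vl: "weak_deriv (strip I) e v \<in> L2 M" by (rule weak_deriv_spec[OF form_domain_W12[OF v] e])
      show ?thesis
        using L2_conv_lincomb[OF test_M[OF test_dir_deriv[OF \<eta>(1)]] vl c(2) test_M[OF test_dir_deriv[OF \<psi>(1)]] vl c(1), of 1 "-1"]
        unfolding d_def[abs_def] dir_deriv_lincomb[OF test_smooth[OF \<eta>(1)] test_smooth[OF \<psi>(1)]] by simp
    qed
    define g where "g n x = \<theta> (fst x) * d n x" for n x
    have gt: "g n \<in> test_functions UNIV" for n
      unfolding g_def[abs_def] by (rule smooth_fst_mult[OF \<theta>(1) dt])
    have mult: "L2_conv M (\<lambda>n x. h (fst x) * A n x) (\<lambda>_. 0)"
      "(\<lambda>x. h (fst x) * A n x) \<in> L2 M"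
      if h: "h \<in> test_functions UNIV" and A: "\<And>n. A n \<in> L2 M" "L2_conv M A (\<lambda>_. 0)" for h :: "real \<Rightarrow> complex" and A n
    proof -
      obtain B where B: "0 \<le> B" "\<And>x. norm (h x) \<le> B" using test_bounded[OF h] by blast
      have m: "(\<lambda>x. h (fst x)) \<in> borel_measurable M"
        using smooth_measurable[OF test_smooth[OF h]]
        by (intro measurable_restrict_space1 measurable_compose[OF _ _, of fst _ borel h]) (auto intro!: borel_measurable_continuous_onI continuous_intros)
      show "L2_conv M (\<lambda>n x. h (fst x) * A n x) (\<lambda>_. 0)"
        using L2_conv_bounded_mult[OF A(1) L2_zero A(2) m B(2) B(1)] by simp
      show "(\<lambda>x. h (fst x) * A n x) \<in> L2 M" by (rule L2_bounded_mult[OF A(1) m B(2)])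
    qed
    have g0: "L2_conv M g (\<lambda>_. 0)"
      unfolding g_def[abs_def] by (rule mult[OF \<theta>(1) test_M[OF dt] d0])
    have gd: "L2_conv M (\<lambda>n. dir_deriv e (g n)) (\<lambda>_. 0)" if e: "e \<in> Basis" for e
    proof -
      have eq: "dir_deriv e (g n) x = \<theta> (fst x) * dir_deriv e (d n) x + of_real (fst e) * (dir_deriv 1 \<theta> (fst x) * d n x)" for n x
        unfolding g_def[abs_def] smooth_fst_mult(2)[OF \<theta>(1) dt] by (simp add: scaleR_conv_of_real mult.assoc)
      note m1 = mult[OF \<theta>(1) test_M[OF test_dir_deriv[OF dt]] dd[OF e]]
      note m2 = mult[OF test_dir_deriv[OF \<theta>(1), of 1] test_M[OF dt] d0]
      show ?thesis unfolding eq
        using L2_conv_lincomb[OF m1(2) L2_zero m1(1) m2(2) L2_zero m2(1), of 1 "of_real (fst e)"] by simp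
    qed
    have gW: "W12_conv (strip I) g (\<lambda>_. 0)"
      by (rule W12_test_limit(2)[OF open_strip gt L2_zero g0, of "\<lambda>_ _. 0"], rule L2_zero, rule gd)
    have z: "(\<lambda>_. 0) \<in> W12 (strip I)" by (rule test_W12(1)[OF open_strip test_zero])
    have "W12_conv (strip I) (\<lambda>n x. 1 * \<psi> n x + 1 * g n x) (\<lambda>x. 1 * v x + 1 * 0)"
      by (rule W12_conv_lincomb[OF open_strip test_W12(1)[OF open_strip \<psi>(1)] form_domain_W12[OF v] \<psi>(2)
            test_W12(1)[OF open_strip gt] z gW])
    moreover have "(\<lambda>x. 1 * \<psi> n x + 1 * g n x) \<in> test_functions UNIV" for n by (intro test_lincomb \<psi> gt)
    moreover have "(\<lambda>n. L2_norm UI (\<lambda>t. 1 * \<psi> n (a, t) + 1 * g n (a, t))) \<longlonglongrightarrow> 0" if "a \<in> insert b S" for a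
    proof (cases "a = b")
      case True
      then show ?thesis using \<eta>(3) \<theta>(2)
        by (simp add: g_def d_def L2_side(2)[OF test_measurable[OF \<eta>(1)]])
    next
      case False
      then show ?thesis using \<psi>(3)[of a] \<theta>(3)[of a] that by (simp add: g_def)
    qed
    ultimately show ?case
      by (intro exI[of _ "\<lambda>n x. 1 * \<psi> n x + 1 * g n x"]) simp
  qed
qed

text \<open>Products of approximating test functions approximate the product in \<open>W12\<close>.
  On each part of the boundary their norm factorises into one factor that tends to zero, by the
  trace condition on one of the functions, and one that stays bounded.\<close>

lemma tensor_form_domain:
  assumes f: "f \<in> dirichlet_domain I (frontier I)" and g: "g \<in> dirichlet_domain {0<..<1} {0}"
  shows "tensor f g \<in> form_domain I"
    and "AE x in M. d1 (tensor f g) x = tensor (weak_deriv I 1 f) g x"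
    and "AE x in M. d2 (tensor f g) x = tensor f (weak_deriv {0<..<1} 1 g) x"
proof -
  have B: "(1::real) \<in> Basis" by simp
  have op: "open {0<..<1::real}" by simp
  obtain \<psi> where \<psi>: "\<And>n. \<psi> n \<in> test_functions UNIV" "W12_conv I \<psi> f" "(\<lambda>n. L2_norm (count_space (frontier I)) (\<psi> n)) \<longlonglongrightarrow> 0"
    using f unfolding dirichlet_domain_def W12_zero_def by (auto simp: zero_trace_iff[OF open_I])
  obtain \<eta> where \<eta>: "\<And>n. \<eta> n \<in> test_functions UNIV" "W12_conv {0<..<1} \<eta> g" "(\<lambda>n. L2_norm (count_space {0}) (\<eta> n)) \<longlonglongrightarrow> 0"
    using g unfolding dirichlet_domain_def W12_zero_def by (auto simp: zero_trace_iff[OF op])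
  note fW = dirichlet_domain_W12[OF f] and gW = dirichlet_domain_W12[OF g]
  have L: "f \<in> L2 M1" "weak_deriv I 1 f \<in> L2 M1" "g \<in> L2 UI" "weak_deriv {0<..<1} 1 g \<in> L2 UI"
    by (intro W12_L2 fW gW weak_deriv_spec B)+
  have c: "L2_conv M1 \<psi> f" "L2_conv M1 (\<lambda>n. dir_deriv 1 (\<psi> n)) (weak_deriv I 1 f)"
    "L2_conv UI \<eta> g" "L2_conv UI (\<lambda>n. dir_deriv 1 (\<eta> n)) (weak_deriv {0<..<1} 1 g)"
    using \<psi>(2) \<eta>(2) W12_conv_test[OF open_I \<psi>(1) fW \<psi>(2) B] W12_conv_test[OF op \<eta>(1) gW \<eta>(2) B] by (auto simp: W12_conv_def)
  have tl: "\<psi> n \<in> L2 M1" "dir_deriv 1 (\<psi> n) \<in> L2 M1" "\<eta> n \<in> L2 UI" "dir_deriv 1 (\<eta> n) \<in> L2 UI" for n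
    by (rule test_L2[OF \<psi>(1) open_I] test_L2[OF test_dir_deriv[OF \<psi>(1)] open_I] test_UI[OF \<eta>(1)]
        test_UI[OF test_dir_deriv[OF \<eta>(1)]])+
  define D where "D e = (if e = (1, 0) then tensor (weak_deriv I 1 f) g else tensor f (weak_deriv {0<..<1} 1 g))" for e :: "real \<times> real"
  have t: "tensor (\<psi> n) (\<eta> n) \<in> test_functions UNIV" for n by (intro tensor_test \<psi> \<eta>)
  note dd = dir_deriv_tensor[OF test_smooth[OF \<psi>(1)] test_smooth[OF \<eta>(1)]]
  have tc: "L2_conv M (\<lambda>n. tensor (\<psi> n) (\<eta> n)) (tensor f g)" by (intro tensor_conv tl L c)
  have D: "D (1, 0) = tensor (weak_deriv I 1 f) g" "D (0, 1) = tensor f (weak_deriv {0<..<1} 1 g)"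
    by (simp_all add: D_def)
  have "L2_conv M (\<lambda>n. dir_deriv e (tensor (\<psi> n) (\<eta> n))) (D e)" "D e \<in> L2 M" if e: "e \<in> Basis" for e :: "real \<times> real"
  proof -
    consider "e = (1, 0)" | "e = (0, 1)" using e by (auto simp: Basis_real_prod)
    then have "L2_conv M (\<lambda>n. dir_deriv e (tensor (\<psi> n) (\<eta> n))) (D e) \<and> D e \<in> L2 M"
    proof cases
      case 1
      show ?thesis unfolding 1 D dd
        by (intro conjI tensor_L2 L tensor_conv[OF tl(2) L(2) c(2) tl(3) L(3) c(3)])
    next
      case 2
      show ?thesis unfolding 2 D dd
        by (intro conjI tensor_L2 L tensor_conv[OF tl(1) L(1) c(1) tl(4) L(4) c(4)])
    qed
    then show "L2_conv M (\<lambda>n. dir_deriv e (tensor (\<psi> n) (\<eta> n))) (D e)" "D e \<in> L2 M" by blast+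
  qed
  then have lim: "tensor f g \<in> W12 (strip I)" "W12_conv (strip I) (\<lambda>n. tensor (\<psi> n) (\<eta> n)) (tensor f g)"
    "\<And>e. e \<in> Basis \<Longrightarrow> AE x in M. weak_deriv (strip I) e (tensor f g) x = D e x"
    using W12_test_limit[where g=D, OF open_strip t tensor_L2[OF L(1,3)] tc] by blast+
  show "AE x in M. d1 (tensor f g) x = tensor (weak_deriv I 1 f) g x"
    using lim(3)[OF Basis2(1)] by (simp add: D_def)
  show "AE x in M. d2 (tensor f g) x = tensor f (weak_deriv {0<..<1} 1 g) x"
    using lim(3)[OF Basis2(2)] by (simp add: D_def)
  have "(\<lambda>n. L2_norm bottom (tensor (\<psi> n) (\<eta> n))) \<longlonglongrightarrow> 0"
  proof -
    have "L2_norm bottom (tensor (\<psi> n) (\<eta> n)) = L2_norm (count_space {0}) (\<eta> n) * L2_norm M1 (\<psi> n)" for n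
    proof -
      have "L2_norm M1 (\<lambda>s. \<psi> n s * \<eta> n 0) = norm (\<eta> n 0) * L2_norm M1 (\<psi> n)"
        using L2_norm_scale[of M1 "\<eta> n 0" "\<psi> n"] by (simp add: mult.commute)
      then show ?thesis by (simp add: L2_bottom[OF test_measurable[OF t]]) 
          (simp add: L2_norm_def[of "count_space {0}"] lebesgue_integral_count_space_finite)
    qed
    then show ?thesis using tendsto_mult[OF \<eta>(3) L2_conv_norm[OF tl(1) L(1) c(1)]] by simp
  qed
  moreover have "(\<lambda>n. L2_norm (side a) (tensor (\<psi> n) (\<eta> n))) \<longlonglongrightarrow> 0" if a: "a \<in> frontier I" for a
  proof -
    have "L2_norm (side a) (tensor (\<psi> n) (\<eta> n)) = norm (\<psi> n a) * L2_norm UI (\<eta> n)" for n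
      by (simp add: L2_side[OF test_measurable[OF t]] L2_norm_scale)
    moreover have "(\<lambda>n. norm (\<psi> n a)) \<longlonglongrightarrow> 0"
    proof (rule Lim_null_comparison[OF always_eventually[OF allI] \<psi>(3)])
      fix n
      have "(norm (\<psi> n a))\<^sup>2 \<le> (\<Sum>a\<in>frontier I. (norm (\<psi> n a))\<^sup>2)"
        by (rule member_le_sum) (auto simp: a finite_frontier)
      then show "norm (norm (\<psi> n a)) \<le> L2_norm (count_space (frontier I)) (\<psi> n)"
        by (auto simp: L2_norm_def lebesgue_integral_count_space_finite finite_frontier intro!: real_le_rsqrt)
    qed
    ultimately show ?thesis using tendsto_mult[OF _ L2_conv_norm[OF tl(3) L(3) c(3)]] by force
  qed
  ultimately have "(\<lambda>n. L2_norm \<nu> (tensor (\<psi> n) (\<eta> n))) \<longlonglongrightarrow> 0" if "\<nu> \<in> boundary_measures" for \<nu>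
    using that unfolding boundary_measures_def by blast
  then have "has_trace (strip I) \<nu> (tensor f g) (\<lambda>_. 0)" if "\<nu> \<in> boundary_measures" for \<nu>
    unfolding zero_trace_iff[OF open_strip] using that lim(1,2) t
    by (intro conjI exI[of _ "\<lambda>n. tensor (\<psi> n) (\<eta> n)"]) auto
  then show "tensor f g \<in> form_domain I"
    unfolding form_domain_eq W12_zero_def using lim(1) by simp
qed

text \<open>For fixed \<open>t\<close> the slice of a test function need not vanish at the ends of
  \<open>I\<close>, so the one-dimensional equation is applied with its boundary terms. Integrated
  against \<open>g\<close>, these are controlled by traces on the sides, which tend to zero along a
  single sequence that serves all ends.\<close>

lemma tensor_neg_laplacian_fst:
  assumes f: "(f, F) \<in> neg_laplacian_1d I (frontier I)" and g: "g \<in> L2 UI" and v: "v \<in> form_domain I"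
  shows "L2_inner M (tensor (weak_deriv I 1 f) g) (d1 v) = L2_inner M (tensor F g) v"
proof -
  obtain l where l: "\<And>\<zeta>. \<zeta> \<in> test_functions UNIV \<Longrightarrow>
    L2_inner M1 (weak_deriv I 1 f) (dir_deriv 1 \<zeta>) = L2_inner M1 F \<zeta> + (\<Sum>a\<in>frontier I. l a * cnj (\<zeta> a))"
    using neg_laplacian_1d_test[OF open_I finite_frontier f] by blast
  have L: "weak_deriv I 1 f \<in> L2 M1" "F \<in> L2 M1"
    using f dirichlet_domain_W12 weak_deriv_spec(1)[of f I 1] by (auto simp: neg_laplacian_1d_iff)
  obtain \<psi> where \<psi>: "\<And>n. \<psi> n \<in> test_functions UNIV" "W12_conv (strip I) \<psi> v"
    "\<And>a. a \<in> frontier I \<Longrightarrow> (\<lambda>n. L2_norm UI (\<lambda>t. \<psi> n (a, t))) \<longlonglongrightarrow> 0"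
    using form_domain_sides[OF v order_refl] by blast
  note c = form_domain_conv[OF \<psi>(1) v \<psi>(2)] and vL = form_domain_L2[OF v]
  have sl: "L2_inner M (tensor h g) w = (LINT t|UI. g t * L2_inner M1 h (\<lambda>s. w (s, t)))" if "h \<in> L2 M1" "w \<in> L2 M" for h w
  proof -
    have "L2_inner M1 (\<lambda>s. tensor h g (s, t)) (\<lambda>s. w (s, t)) = g t * L2_inner M1 h (\<lambda>s. w (s, t))" for t
      by (simp add: L2_inner_def mult_ac flip: integral_mult_right_zero)
    then show ?thesis by (simp add: L2_inner_snd[OF tensor_L2[OF that(1) g] that(2)])
  qed
  have id: "L2_inner M (tensor (weak_deriv I 1 f) g) (dir_deriv (1, 0) (\<psi> n)) = L2_inner M (tensor F g) (\<psi> n)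
      + (\<Sum>a\<in>frontier I. l a * L2_inner UI g (\<lambda>t. \<psi> n (a, t)))" for n
  proof -
    note td = test_M[OF test_dir_deriv[OF \<psi>(1)[of n], of "(1, 0)"]]
    have e: "L2_inner M1 (weak_deriv I 1 f) (\<lambda>s. dir_deriv (1, 0) (\<psi> n) (s, t))
        = L2_inner M1 F (\<lambda>s. \<psi> n (s, t)) + (\<Sum>a\<in>frontier I. l a * cnj (\<psi> n (a, t)))" for t
      using l[OF test_slice_fst[OF \<psi>(1)[of n], of t]]
      unfolding dir_deriv_slice(1)[OF test_smooth[OF \<psi>(1)]] .
    have i1: "integrable UI (\<lambda>t. g t * L2_inner M1 F (\<lambda>s. \<psi> n (s, t)))"
    proof -
      have "integrable UI (\<lambda>t. LINT s|M1. tensor F g (s, t) * cnj (\<psi> n (s, t)))"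
      proof (rule P.integrable_snd)
        show "integrable (M1 \<Otimes>\<^sub>M UI) (\<lambda>(s, t). tensor F g (s, t) * cnj (\<psi> n (s, t)))"
          unfolding prod_measure case_prod_beta' prod.collapse
          by (rule L2_inner_integrable[OF tensor_L2[OF L(2) g] test_M[OF \<psi>(1)]])
      qed
      moreover have "(LINT s|M1. tensor F g (s, t) * cnj (\<psi> n (s, t))) = g t * L2_inner M1 F (\<lambda>s. \<psi> n (s, t))" for t
        by (simp add: L2_inner_def mult_ac flip: integral_mult_right_zero)
      ultimately show ?thesis by simp
    qed
    have i2: "integrable UI (\<lambda>t. l a * (g t * cnj (\<psi> n (a, t))))" for a
      by (intro integrable_mult_right L2_inner_integrable g test_UI test_slice_snd \<psi>)
    have "L2_inner M (tensor (weak_deriv I 1 f) g) (dir_deriv (1, 0) (\<psi> n))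
      = (LINT t|UI. g t * L2_inner M1 F (\<lambda>s. \<psi> n (s, t)) + (\<Sum>a\<in>frontier I. l a * (g t * cnj (\<psi> n (a, t)))))"
      unfolding sl[OF L(1) td] e by (simp add: distrib_left sum_distrib_left mult_ac)
    also have "\<dots> = (LINT t|UI. g t * L2_inner M1 F (\<lambda>s. \<psi> n (s, t))) + (LINT t|UI. (\<Sum>a\<in>frontier I. l a * (g t * cnj (\<psi> n (a, t)))))"
      by (intro Bochner_Integration.integral_add i1 Bochner_Integration.integrable_sum i2)
    also have "(LINT t|UI. (\<Sum>a\<in>frontier I. l a * (g t * cnj (\<psi> n (a, t))))) = (\<Sum>a\<in>frontier I. (LINT t|UI. l a * (g t * cnj (\<psi> n (a, t)))))"
      by (intro Bochner_Integration.integral_sum i2)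
    finally show ?thesis unfolding sl[OF L(2) test_M[OF \<psi>(1)]] by (simp add: L2_inner_def)
  qed
  have "(\<lambda>n. L2_inner M (tensor (weak_deriv I 1 f) g) (dir_deriv (1, 0) (\<psi> n))) \<longlonglongrightarrow> L2_inner M (tensor (weak_deriv I 1 f) g) (d1 v)"
    by (intro L2_conv_inner[OF _ _ L2_conv_const _ _ c(2)] tensor_L2 L g test_M test_dir_deriv \<psi> vL)
  moreover have "(\<lambda>n. L2_inner M (tensor F g) (\<psi> n) + (\<Sum>a\<in>frontier I. l a * L2_inner UI g (\<lambda>t. \<psi> n (a, t))))
      \<longlonglongrightarrow> L2_inner M (tensor F g) v + (\<Sum>a\<in>frontier I. l a * 0)"
  proof (intro tendsto_add tendsto_sum tendsto_mult_left)
    show "(\<lambda>n. L2_inner M (tensor F g) (\<psi> n)) \<longlonglongrightarrow> L2_inner M (tensor F g) v"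
      by (intro L2_conv_inner[OF _ _ L2_conv_const _ _ c(1)] tensor_L2 L g test_M \<psi> vL)
    fix a assume a: "a \<in> frontier I"
    have "(\<lambda>n. L2_norm UI g * L2_norm UI (\<lambda>t. \<psi> n (a, t))) \<longlonglongrightarrow> 0"
      by (rule tendsto_mult_right_zero[OF \<psi>(3)[OF a]])
    then show "(\<lambda>n. L2_inner UI g (\<lambda>t. \<psi> n (a, t))) \<longlonglongrightarrow> 0"
      by (rule Lim_null_comparison[rotated])
         (intro always_eventually allI L2_cauchy_schwarz g test_UI test_slice_snd \<psi>)
  qed
  ultimately show ?thesis unfolding id using LIMSEQ_unique by fastforce
qed

text \<open>The transversal counterpart. The only boundary term sits at \<open>t = 0\<close>,
  because the Neumann end does not belong to the Dirichlet set \<open>{0}\<close>.\<close>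

lemma tensor_neg_laplacian_snd:
  assumes g: "(g, G) \<in> neg_laplacian_1d {0<..<1} {0}" and f: "f \<in> L2 M1" and v: "v \<in> form_domain I"
  shows "L2_inner M (tensor f (weak_deriv {0<..<1} 1 g)) (d2 v) = L2_inner M (tensor f G) v"
proof -
  have op: "open {0<..<1::real}" and fin: "finite {0::real}" by auto
  obtain l where l: "\<And>\<zeta>. \<zeta> \<in> test_functions UNIV \<Longrightarrow>
    L2_inner UI (weak_deriv {0<..<1} 1 g) (dir_deriv 1 \<zeta>) = L2_inner UI G \<zeta> + l * cnj (\<zeta> 0)"
    using neg_laplacian_1d_test[OF op fin g] by auto
  have L: "weak_deriv {0<..<1} 1 g \<in> L2 UI" "G \<in> L2 UI"
    using g dirichlet_domain_W12 weak_deriv_spec(1)[of g "{0<..<1}" 1] by (auto simp: neg_laplacian_1d_iff)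
  obtain \<psi> where \<psi>: "\<And>n. \<psi> n \<in> test_functions UNIV" "W12_conv (strip I) \<psi> v"
    "(\<lambda>n. L2_norm M1 (\<lambda>s. \<psi> n (s, 0))) \<longlonglongrightarrow> 0"
    using form_domain_bottom[OF v] by blast
  note c = form_domain_conv[OF \<psi>(1) v \<psi>(2)] and vL = form_domain_L2[OF v]
  have sl: "L2_inner M (tensor f h) w = (LINT s|M1. f s * L2_inner UI h (\<lambda>t. w (s, t)))" if "h \<in> L2 UI" "w \<in> L2 M" for h w
  proof -
    have "L2_inner UI (\<lambda>t. tensor f h (s, t)) (\<lambda>t. w (s, t)) = f s * L2_inner UI h (\<lambda>t. w (s, t))" for s
      by (simp add: L2_inner_def mult_ac flip: integral_mult_right_zero)
    then show ?thesis by (simp add: L2_inner_fst[OF tensor_L2[OF f that(1)] that(2)])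
  qed
  have t0: "(\<lambda>s. \<psi> n (s, 0)) \<in> L2 M1" for n by (intro test_L2[OF test_slice_fst[OF \<psi>(1)] open_I])
  have id: "L2_inner M (tensor f (weak_deriv {0<..<1} 1 g)) (dir_deriv (0, 1) (\<psi> n)) = L2_inner M (tensor f G) (\<psi> n)
      + l * L2_inner M1 f (\<lambda>s. \<psi> n (s, 0))" for n
  proof -
    note td = test_M[OF test_dir_deriv[OF \<psi>(1)[of n], of "(0, 1)"]]
    have e: "L2_inner UI (weak_deriv {0<..<1} 1 g) (\<lambda>t. dir_deriv (0, 1) (\<psi> n) (s, t))
        = L2_inner UI G (\<lambda>t. \<psi> n (s, t)) + l * cnj (\<psi> n (s, 0))" for s
      using l[OF test_slice_snd[OF \<psi>(1)[of n], of s]]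
      unfolding dir_deriv_slice(2)[OF test_smooth[OF \<psi>(1)]] .
    have i1: "integrable M1 (\<lambda>s. f s * L2_inner UI G (\<lambda>t. \<psi> n (s, t)))"
    proof -
      have "integrable M1 (\<lambda>s. LINT t|UI. tensor f G (s, t) * cnj (\<psi> n (s, t)))"
        using P.integrable_fst'[of "\<lambda>x. tensor f G x * cnj (\<psi> n x)"]
          L2_inner_integrable[OF tensor_L2[OF f L(2)] test_M[OF \<psi>(1)]] by (simp add: prod_measure)
      moreover have "(LINT t|UI. tensor f G (s, t) * cnj (\<psi> n (s, t))) = f s * L2_inner UI G (\<lambda>t. \<psi> n (s, t))" for s
        by (simp add: L2_inner_def mult_ac flip: integral_mult_right_zero)
      ultimately show ?thesis by simp
    qed
    have i2: "integrable M1 (\<lambda>s. l * (f s * cnj (\<psi> n (s, 0))))"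
      by (intro integrable_mult_right L2_inner_integrable f t0)
    have "L2_inner M (tensor f (weak_deriv {0<..<1} 1 g)) (dir_deriv (0, 1) (\<psi> n))
      = (LINT s|M1. f s * L2_inner UI G (\<lambda>t. \<psi> n (s, t)) + l * (f s * cnj (\<psi> n (s, 0))))"
      unfolding sl[OF L(1) td] e by (simp add: distrib_left mult_ac)
    also have "\<dots> = (LINT s|M1. f s * L2_inner UI G (\<lambda>t. \<psi> n (s, t))) + (LINT s|M1. l * (f s * cnj (\<psi> n (s, 0))))"
      by (intro Bochner_Integration.integral_add i1 i2)
    finally show ?thesis unfolding sl[OF L(2) test_M[OF \<psi>(1)]] by (simp add: L2_inner_def)
  qed
  have "(\<lambda>n. L2_inner M (tensor f (weak_deriv {0<..<1} 1 g)) (dir_deriv (0, 1) (\<psi> n))) \<longlonglongrightarrow> L2_inner M (tensor f (weak_deriv {0<..<1} 1 g)) (d2 v)"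
    by (intro L2_conv_inner[OF _ _ L2_conv_const _ _ c(3)] tensor_L2 L f test_M test_dir_deriv \<psi> vL)
  moreover have "(\<lambda>n. L2_inner M (tensor f G) (\<psi> n) + l * L2_inner M1 f (\<lambda>s. \<psi> n (s, 0)))
      \<longlonglongrightarrow> L2_inner M (tensor f G) v + l * 0"
  proof (intro tendsto_add tendsto_mult_left)
    show "(\<lambda>n. L2_inner M (tensor f G) (\<psi> n)) \<longlonglongrightarrow> L2_inner M (tensor f G) v"
      by (intro L2_conv_inner[OF _ _ L2_conv_const _ _ c(1)] tensor_L2 L f test_M \<psi> vL)
    have "(\<lambda>n. L2_norm M1 f * L2_norm M1 (\<lambda>s. \<psi> n (s, 0))) \<longlonglongrightarrow> 0"
      by (rule tendsto_mult_right_zero[OF \<psi>(3)])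
    then show "(\<lambda>n. L2_inner M1 f (\<lambda>s. \<psi> n (s, 0))) \<longlonglongrightarrow> 0"
      by (rule Lim_null_comparison[rotated]) (intro always_eventually allI L2_cauchy_schwarz f t0)
  qed
  ultimately show ?thesis unfolding id using LIMSEQ_unique by fastforce
qed

end

lemma L2_inner_lower:
  assumes wu: "(\<lambda>x. complex_of_real (w x) * u x) \<in> L2 M" and u: "u \<in> L2 M" and m: "\<And>x. x \<in> space M \<Longrightarrow> m \<le> w x"
  shows "m * (L2_norm M u)\<^sup>2 \<le> Re (L2_inner M (\<lambda>x. of_real (w x) * u x) u)"
proof -
  have eq: "(of_real (w x) * u x) * cnj (u x) = complex_of_real (w x * (norm (u x))\<^sup>2)" for x
    by (simp add: mult.assoc complex_norm_square[symmetric] del: of_real_power)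
  have "Re (L2_inner M (\<lambda>x. of_real (w x) * u x) u) = (LINT x|M. w x * (norm (u x))\<^sup>2)"
    unfolding L2_inner_def eq integral_complex_of_real by simp
  moreover have "(LINT x|M. m * (norm (u x))\<^sup>2) \<le> (LINT x|M. w x * (norm (u x))\<^sup>2)"
    using L2_inner_integrable[OF wu u] unfolding eq complex_of_real_integrable_eq
    by (intro integral_mono integrable_mult_right L2_integrable u mult_right_mono m) auto
  ultimately show ?thesis by (simp add: L2_norm_sq)
qed

text \<open>The crude bound \<pi> < 4 makes the gap constant at most 1/4 and keeps
  \<open>2 - pi\<^sup>2 / 8\<close> positive.\<close>

lemma pi_sq_bound: "pi\<^sup>2 < 16" "1/2 - 4 / pi\<^sup>2 \<le> 1/4" "0 < pi\<^sup>2"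
proof -
  have "pi\<^sup>2 < 4\<^sup>2" by (rule power_strict_mono[OF pi_less_4]) auto
  then show a: "pi\<^sup>2 < 16" by simp
  show b: "0 < pi\<^sup>2" by simp
  show "1/2 - 4 / pi\<^sup>2 \<le> 1/4" using a b by (simp add: field_simps)
qed

section \<open>Splitting off the first transversal mode on the strip\<close>

context strip_domain
begin

lemma partial_inner_conv:
  assumes "\<And>n. U n \<in> L2 M" "u \<in> L2 M" "L2_conv M U u" and g: "g \<in> L2 UI"
  shows "L2_conv M1 (\<lambda>n. partial_inner UI g (U n)) (partial_inner UI g u)"
proof (rule Lim_null_comparison[OF always_eventually[OF allI]])
  fix n
  have "L2_norm M1 (\<lambda>x. partial_inner UI g (U n) x - partial_inner UI g u x) = L2_norm M1 (partial_inner UI g (\<lambda>x. U n x - u x))"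
  proof (rule L2_norm_AE_cong)
    show "AE x in M1. partial_inner UI g (U n) x - partial_inner UI g u x = partial_inner UI g (\<lambda>x. U n x - u x) x"
      using partial_inner_lincomb[OF assms(1)[of n] assms(2) g, of 1 "-1"] by eventually_elim simp
  qed (intro L2_measurable L2_diff partial_inner_L2(1)[OF _ g] assms)+
  then show "norm (L2_norm M1 (\<lambda>x. partial_inner UI g (U n) x - partial_inner UI g u x)) \<le> L2_norm M (\<lambda>x. U n x - u x) * L2_norm UI g"
    using partial_inner_L2(2)[OF L2_diff[OF assms(1,2)] g] by simp
  show "(\<lambda>n. L2_norm M (\<lambda>x. U n x - u x) * L2_norm UI g) \<longlonglongrightarrow> 0"
    by (rule tendsto_mult_left_zero[OF assms(3)])
qed

definition amp :: "(real \<times> real \<Rightarrow> complex) \<Rightarrow> real \<Rightarrow> complex" where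
  "amp = partial_inner UI ground"

lemma amp_L2: "u \<in> L2 M \<Longrightarrow> amp u \<in> L2 M1" and amp_norm: "u \<in> L2 M \<Longrightarrow> L2_norm M1 (amp u) \<le> L2_norm M u"
  using partial_inner_L2[OF _ ground_L2(1)] by (simp_all add: amp_def ground_norm)

text \<open>Both claims are the one-dimensional statements on slices, integrated over
  \<open>I\<close>. They are first proved for approximating test functions minus their values on the
  bottom side: the correction \<open>b n\<close> is constant in \<open>t\<close>, so the transversal
  derivative is unchanged, and it tends to zero because the trace vanishes.\<close>

lemma ground_amplitude:
  assumes u: "u \<in> form_domain I"
  shows "AE s in M1. partial_inner UI ground' (d2 u) s = of_real (pi\<^sup>2 / 4) * amp u s" (is ?A)
    and "(L2_norm M u)\<^sup>2 - (L2_norm M1 (amp u))\<^sup>2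
      \<le> (1/2 - 4 / pi\<^sup>2) * ((L2_norm M (d2 u))\<^sup>2 - pi\<^sup>2 / 4 * (L2_norm M1 (amp u))\<^sup>2)" (is ?B)
proof -
  obtain \<psi> where \<psi>: "\<And>n. \<psi> n \<in> test_functions UNIV" "W12_conv (strip I) \<psi> u"
    "(\<lambda>n. L2_norm M1 (\<lambda>s. \<psi> n (s, 0))) \<longlonglongrightarrow> 0"
    using form_domain_bottom[OF u] by blast
  note c = form_domain_conv[OF \<psi>(1) u \<psi>(2)] and uL = form_domain_L2[OF u]
  define b where "b n = tensor (\<lambda>s. \<psi> n (s, 0)) (\<lambda>_::real. 1)" for n
  define V where "V n x = 1 * \<psi> n x + (-1) * b n x" for n x
  define D where "D n = dir_deriv (0, 1) (\<psi> n)" for n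
  have t0: "(\<lambda>s. \<psi> n (s, 0)) \<in> L2 M1" for n by (intro test_L2[OF test_slice_fst[OF \<psi>(1)] open_I])
  have bL: "b n \<in> L2 M" for n unfolding b_def by (intro tensor_L2 t0 UI_const)
  have "L2_conv M b (\<lambda>_. 0)"
    using \<psi>(3) by (simp add: b_def tensor_norm t0 UI_const UI_const_norm)
  from L2_conv_lincomb[OF test_M[OF \<psi>(1)] uL(1) c(1) bL L2_zero this, of 1 "-1"]
  have Vc: "L2_conv M V u" by (simp add: V_def[abs_def])
  have VL: "V n \<in> L2 M" for n unfolding V_def[abs_def] by (intro L2_lincomb test_M \<psi> bL)
  have DL: "D n \<in> L2 M" for n unfolding D_def by (intro test_M test_dir_deriv \<psi>)
  have Dc: "L2_conv M D (d2 u)" using c(3) by (simp add: D_def)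
  have sl: "(\<lambda>t. V n (s, t)) = (\<lambda>t. \<psi> n (s, t) - \<psi> n (s, 0))" "(\<lambda>t. D n (s, t)) = dir_deriv 1 (\<lambda>t. \<psi> n (s, t))" for n s
    unfolding D_def dir_deriv_slice(2)[OF test_smooth[OF \<psi>(1)]] by (auto simp: V_def b_def)
  have A: "partial_inner UI ground' (D n) s = of_real (pi\<^sup>2 / 4) * amp (V n) s" for n s
    unfolding partial_inner_def amp_def sl by (rule ground_ibp[OF test_slice_snd[OF \<psi>(1)]])
  have ac: "L2_conv M1 (\<lambda>n. amp (V n)) (amp u)"
    unfolding amp_def by (rule partial_inner_conv[OF VL uL(1) Vc ground_L2(1)])
  have pc: "L2_conv M1 (\<lambda>n. partial_inner UI ground' (D n)) (partial_inner UI ground' (d2 u))"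
    by (rule partial_inner_conv[OF DL uL(3) Dc ground_L2(2)])
  have pc2: "L2_conv M1 (\<lambda>n. partial_inner UI ground' (D n)) (\<lambda>s. of_real (pi\<^sup>2 / 4) * amp u s)"
    using L2_conv_lincomb[OF amp_L2[OF VL] amp_L2[OF uL(1)] ac L2_zero L2_zero L2_conv_const, of "of_real (pi\<^sup>2 / 4)" 0]
    by (simp add: A)
  show ?A
    by (rule L2_conv_unique[OF _ _ _ pc pc2]) (intro partial_inner_L2 DL uL ground_L2 L2_scale amp_L2)+
  have B: "(L2_norm M (V n))\<^sup>2 - (L2_norm M1 (amp (V n)))\<^sup>2
      \<le> (1/2 - 4 / pi\<^sup>2) * ((L2_norm M (D n))\<^sup>2 - pi\<^sup>2 / 4 * (L2_norm M1 (amp (V n)))\<^sup>2)" for n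
  proof -
    note i = L2_norm_slices(2)[OF VL[of n]] L2_integrable[OF amp_L2[OF VL[of n]]] L2_norm_slices(2)[OF DL[of n]]
    have "(LINT s|M1. (L2_norm UI (\<lambda>t. V n (s, t)))\<^sup>2 - (norm (amp (V n) s))\<^sup>2)
      \<le> (LINT s|M1. (1/2 - 4 / pi\<^sup>2) * ((L2_norm UI (\<lambda>t. D n (s, t)))\<^sup>2 - pi\<^sup>2 / 4 * (norm (amp (V n) s))\<^sup>2))"
    proof (rule integral_mono)
      fix s
      show "(L2_norm UI (\<lambda>t. V n (s, t)))\<^sup>2 - (norm (amp (V n) s))\<^sup>2
         \<le> (1/2 - 4 / pi\<^sup>2) * ((L2_norm UI (\<lambda>t. D n (s, t)))\<^sup>2 - pi\<^sup>2 / 4 * (norm (amp (V n) s))\<^sup>2)"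
        unfolding amp_def partial_inner_def sl by (rule unit_gap[OF test_slice_snd[OF \<psi>(1)]])
    qed (intro Bochner_Integration.integrable_diff integrable_mult_right i)+
    then show ?thesis
      using i by (simp add: L2_norm_slices(1)[OF VL] L2_norm_slices(1)[OF DL] L2_norm_sq[of M1])
  qed
  show ?B
  proof (rule LIMSEQ_le)
    show "(\<lambda>n. (L2_norm M (V n))\<^sup>2 - (L2_norm M1 (amp (V n)))\<^sup>2) \<longlonglongrightarrow> (L2_norm M u)\<^sup>2 - (L2_norm M1 (amp u))\<^sup>2"
      by (intro tendsto_intros L2_conv_norm VL uL Vc amp_L2 ac)
    show "(\<lambda>n. (1/2 - 4 / pi\<^sup>2) * ((L2_norm M (D n))\<^sup>2 - pi\<^sup>2 / 4 * (L2_norm M1 (amp (V n)))\<^sup>2))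
      \<longlonglongrightarrow> (1/2 - 4 / pi\<^sup>2) * ((L2_norm M (d2 u))\<^sup>2 - pi\<^sup>2 / 4 * (L2_norm M1 (amp u))\<^sup>2)"
      by (intro tendsto_intros L2_conv_norm VL uL Vc amp_L2 ac DL Dc)
  qed (use B in blast)
qed

definition u_perp :: "(real \<times> real \<Rightarrow> complex) \<Rightarrow> real \<times> real \<Rightarrow> complex" where
  "u_perp u x = 1 * u x + (-1) * tensor (amp u) ground x"

text \<open>Morally the transversal derivative of \<open>u_perp u\<close>. It is defined directly
  because \<open>amp u\<close> is only known to be square integrable, so \<open>u_perp u\<close> is
  not known to lie in \<open>W12\<close>.\<close>

definition d_perp :: "(real \<times> real \<Rightarrow> complex) \<Rightarrow> real \<times> real \<Rightarrow> complex" where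
  "d_perp u x = 1 * d2 u x + (-1) * tensor (amp u) ground' x"

lemma perp_L2: "u \<in> form_domain I \<Longrightarrow> u_perp u \<in> L2 M" "u \<in> form_domain I \<Longrightarrow> d_perp u \<in> L2 M"
  unfolding u_perp_def[abs_def] d_perp_def[abs_def]
  by (intro L2_lincomb tensor_L2 amp_L2 form_domain_L2 ground_L2; assumption)+

lemma u_perp_norm:
  assumes u: "u \<in> form_domain I"
  shows "(L2_norm M (u_perp u))\<^sup>2 = (L2_norm M u)\<^sup>2 - (L2_norm M1 (amp u))\<^sup>2"
proof -
  note uL = form_domain_L2[OF u] and aL = amp_L2[OF form_domain_L2(1)[OF u]]
  have "L2_inner M u (tensor (amp u) ground) = of_real ((L2_norm M1 (amp u))\<^sup>2)"
    using inner_partial_inner[OF uL(1) ground_L2(1) aL] by (simp add: amp_def L2_inner_self)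
  moreover have "L2_inner M (tensor (amp u) ground) (tensor (amp u) ground) = of_real ((L2_norm M1 (amp u))\<^sup>2)"
    by (simp add: L2_inner_self tensor_norm[OF aL ground_L2(1)] ground_norm)
  moreover have "(L2_norm M (u_perp u))\<^sup>2 = Re (L2_inner M (u_perp u) (u_perp u))" by (simp add: L2_inner_self)
  ultimately show ?thesis
    unfolding u_perp_def[abs_def] L2.Re_expand[OF uL(1) tensor_L2[OF aL ground_L2(1)]]
    by (simp add: L2_inner_self del: of_real_power)
qed

text \<open>The splitting stays orthogonal for the derivatives because the coefficient of
  \<open>d2 u\<close> along \<open>ground'\<close> is \<open>pi\<^sup>2 / 4\<close> times
  \<open>amp u\<close>.\<close>

lemma d_perp_norm:
  assumes u: "u \<in> form_domain I"
  shows "(L2_norm M (d_perp u))\<^sup>2 = (L2_norm M (d2 u))\<^sup>2 - pi\<^sup>2 / 4 * (L2_norm M1 (amp u))\<^sup>2"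
proof -
  note uL = form_domain_L2[OF u] and aL = amp_L2[OF form_domain_L2(1)[OF u]]
  have "L2_inner M (d2 u) (tensor (amp u) ground') = L2_inner M1 (partial_inner UI ground' (d2 u)) (amp u)"
    by (rule inner_partial_inner[OF uL(3) ground_L2(2) aL])
  also have "\<dots> = L2_inner M1 (\<lambda>s. of_real (pi\<^sup>2 / 4) * amp u s) (amp u)"
    by (rule L2_inner_AE_cong[OF ground_amplitude(1)[OF u] AE_I2[OF refl]])
       (intro L2_measurable partial_inner_L2 uL ground_L2 aL L2_scale)+
  also have "\<dots> = of_real (pi\<^sup>2 / 4 * (L2_norm M1 (amp u))\<^sup>2)"
    using L2.q_lincomb[OF aL aL aL, of "of_real (pi\<^sup>2 / 4)" 0] by (simp add: L2_inner_self)
  finally have 1: "L2_inner M (d2 u) (tensor (amp u) ground') = of_real (pi\<^sup>2 / 4 * (L2_norm M1 (amp u))\<^sup>2)" .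
  have 2: "L2_inner M (tensor (amp u) ground') (tensor (amp u) ground') = of_real (pi\<^sup>2 / 4 * (L2_norm M1 (amp u))\<^sup>2)"
    unfolding tensor_inner[OF aL ground_L2(2) aL ground_L2(2)] ground'_inner
    unfolding L2_inner_self of_real_mult by (rule mult.commute)
  have "(L2_norm M (d_perp u))\<^sup>2 = Re (L2_inner M (d_perp u) (d_perp u))" by (simp add: L2_inner_self)
  then show ?thesis
    unfolding d_perp_def[abs_def] L2.Re_expand[OF uL(3) tensor_L2[OF aL ground_L2(2)]] 1 2
    by (simp add: L2_inner_self del: of_real_power of_real_mult of_real_divide)
qed

text \<open>Pythagoras for \<open>u\<close> and for \<open>d2 u\<close> turns the right-hand side of
  the second claim into the squared norm of \<open>d_perp u\<close> minus
  \<open>pi\<^sup>2 / 4\<close> times that of \<open>u_perp u\<close>. The constant results from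
  \<open>pi\<^sup>2 / 4 * (1/2 - 4 / pi\<^sup>2) = pi\<^sup>2 / 8 - 1\<close>.\<close>

lemma transversal_gap:
  assumes u: "u \<in> form_domain I"
  shows "L2_norm M (u_perp u) \<le> L2_norm M (d_perp u)"
    and "(2 - pi\<^sup>2 / 8) * (L2_norm M (d_perp u))\<^sup>2 \<le> (L2_norm M (d2 u))\<^sup>2 - pi\<^sup>2 / 4 * (L2_norm M u)\<^sup>2"
proof -
  let ?p = "(L2_norm M (d_perp u))\<^sup>2"
  have g: "(L2_norm M (u_perp u))\<^sup>2 \<le> (1/2 - 4 / pi\<^sup>2) * ?p"
    using ground_amplitude(2)[OF u] by (simp only: u_perp_norm[OF u] d_perp_norm[OF u])
  also have "\<dots> \<le> 1 * ?p" by (rule mult_right_mono[OF order_trans[OF pi_sq_bound(2)]]) simp_all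
  finally show "L2_norm M (u_perp u) \<le> L2_norm M (d_perp u)" by (simp add: power_mono_iff)
  have "pi\<^sup>2 / 4 * (L2_norm M (u_perp u))\<^sup>2 \<le> pi\<^sup>2 / 4 * ((1/2 - 4 / pi\<^sup>2) * ?p)"
    by (rule mult_left_mono[OF g]) simp
  also have "\<dots> = (pi\<^sup>2 / 8 - 1) * ?p" using pi_sq_bound(3) by (simp add: field_simps)
  finally have "pi\<^sup>2 / 4 * ((L2_norm M u)\<^sup>2 - (L2_norm M1 (amp u))\<^sup>2) \<le> (pi\<^sup>2 / 8 - 1) * ?p"
    unfolding u_perp_norm[OF u] .
  moreover have "(2 - pi\<^sup>2 / 8) * ?p = ?p - (pi\<^sup>2 / 8 - 1) * ?p" by (simp add: algebra_simps)
  ultimately show "(2 - pi\<^sup>2 / 8) * ?p \<le> (L2_norm M (d2 u))\<^sup>2 - pi\<^sup>2 / 4 * (L2_norm M u)\<^sup>2"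
    using d_perp_norm[OF u] unfolding right_diff_distrib[of "pi\<^sup>2 / 4"] by linarith
qed

definition winner :: "(real \<times> real \<Rightarrow> real) \<Rightarrow> (real \<times> real \<Rightarrow> complex) \<Rightarrow> (real \<times> real \<Rightarrow> complex) \<Rightarrow> complex" where
  "winner w u v = L2_inner M (\<lambda>x. of_real (w x) * u x) v"

text \<open>Unlike in \<open>bounded_coef\<close>, the bound is an argument, because powers of
  \<epsilon> in the estimates are read off from it.\<close>

definition coef_bound :: "(real \<times> real \<Rightarrow> real) \<Rightarrow> real \<Rightarrow> bool" where
  "coef_bound w B \<longleftrightarrow> w \<in> borel_measurable M \<and> 0 \<le> B \<and> (\<forall>x\<in>strip I. \<bar>w x\<bar> \<le> B)"

lemma coef_bound_bounded_coef: "coef_bound w B \<Longrightarrow> bounded_coef (strip I) w"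
  by (auto simp: coef_bound_def bounded_coef_def)

lemma coef_bound_L2:
  assumes "coef_bound w B" "u \<in> L2 M"
  shows "(\<lambda>x. complex_of_real (w x) * u x) \<in> L2 M" "L2_norm M (\<lambda>x. complex_of_real (w x) * u x) \<le> B * L2_norm M u"
proof -
  have "w \<in> borel_measurable M" using assms by (simp add: coef_bound_def)
  then have "(\<lambda>x. complex_of_real (w x)) \<in> borel_measurable M" by simp
  then show "(\<lambda>x. complex_of_real (w x) * u x) \<in> L2 M" "L2_norm M (\<lambda>x. complex_of_real (w x) * u x) \<le> B * L2_norm M u"
    using assms by (auto intro!: L2_bounded_mult[of _ _ _ B] L2_norm_bounded_mult simp: coef_bound_def)
qed

lemma winner_bound:
  assumes "coef_bound w B" "u \<in> L2 M" "v \<in> L2 M"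
  shows "norm (winner w u v) \<le> B * (L2_norm M u * L2_norm M v)"
proof -
  have "norm (winner w u v) \<le> L2_norm M (\<lambda>x. complex_of_real (w x) * u x) * L2_norm M v"
    unfolding winner_def by (intro L2_cauchy_schwarz coef_bound_L2[OF assms(1)] assms)
  also have "\<dots> \<le> (B * L2_norm M u) * L2_norm M v"
    by (intro mult_right_mono coef_bound_L2[OF assms(1)] assms) simp
  finally show ?thesis by (simp add: mult.assoc)
qed

lemma winner_coef_lincomb:
  assumes "coef_bound w B" "coef_bound z C" "u \<in> L2 M" "v \<in> L2 M"
  shows "winner (\<lambda>x. a * w x + b * z x) u v = of_real a * winner w u v + of_real b * winner z u v"
  unfolding winner_def
  using L2_inner_lincomb_left[OF coef_bound_L2(1)[OF assms(1,3)] coef_bound_L2(1)[OF assms(2,3)] assms(4), of "of_real a" "of_real b"]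
  by (simp add: algebra_simps)

lemma winner_add_left:
  assumes "coef_bound w B" "u \<in> L2 M" "v \<in> L2 M" "z \<in> L2 M"
  shows "winner w (\<lambda>x. u x + v x) z = winner w u z + winner w v z"
  unfolding winner_def
  using L2_inner_lincomb_left[OF coef_bound_L2(1)[OF assms(1,2)] coef_bound_L2(1)[OF assms(1,3)] assms(4), of 1 1]
  by (simp add: algebra_simps)

lemma winner_add_right:
  assumes "coef_bound w B" "u \<in> L2 M" "v \<in> L2 M" "z \<in> L2 M"
  shows "winner w z (\<lambda>x. u x + v x) = winner w z u + winner w z v"
  unfolding winner_def
  using L2.q_lincomb_right[OF assms(2,3) coef_bound_L2(1)[OF assms(1,4)], of 1 1] by simp

lemma winner_lower:
  assumes w: "coef_bound w B" and u: "u \<in> L2 M" and m: "\<And>x. x \<in> strip I \<Longrightarrow> m \<le> w x"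
  shows "m * (L2_norm M u)\<^sup>2 \<le> Re (winner w u u)"
  unfolding winner_def using L2_inner_lower[OF coef_bound_L2(1)[OF w u] u] m by simp

lemma coef_form_winner:
  "coef_form (strip I) A B u v = winner (A (1, 0)) (d1 u) (d1 v) + winner (A (0, 1)) (d2 u) (d2 v) + winner B u v"
  by (simp add: coef_form_def winner_def Basis_real_prod)

end

section \<open>The two forms on the curved strip and their difference\<close>

locale curved_strip = strip_domain +
  fixes \<kappa> :: "real \<Rightarrow> real" and K m k \<epsilon> :: real
  assumes kappa_meas: "\<kappa> \<in> borel_measurable (lebesgue_on_open I)"
    and kappa_bound: "\<And>s. s \<in> I \<Longrightarrow> \<bar>\<kappa> s\<bar> \<le> K" and kappa_lower: "\<And>s. s \<in> I \<Longrightarrow> m \<le> \<kappa> s"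
    and K_nonneg: "0 \<le> K" and k_gt: "k > - m"
    and eps_pos: "0 < \<epsilon>" and eps_le_1: "\<epsilon> \<le> 1" and eps_K: "\<epsilon> * K \<le> 1/2"
begin

abbreviation \<tau> :: "real \<times> real \<Rightarrow> real" where
  "\<tau> \<equiv> \<lambda>x. \<kappa> (fst x) * snd x"

abbreviation h :: "real \<times> real \<Rightarrow> real" where
  "h \<equiv> h_eps \<kappa> \<epsilon>"

definition shift :: real where
  "shift = - (pi / (2 * \<epsilon>))\<^sup>2 + k / \<epsilon>"

lemma h_eq: "h x = 1 - \<epsilon> * \<tau> x"
  by (simp add: h_eps_def case_prod_beta)

lemma tau_bound: "x \<in> strip I \<Longrightarrow> \<bar>\<tau> x\<bar> \<le> K"
proof -
  assume "x \<in> strip I"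
  then have "\<bar>\<kappa> (fst x)\<bar> * \<bar>snd x\<bar> \<le> K * 1" by (intro mult_mono kappa_bound K_nonneg) auto
  then show ?thesis by (simp add: abs_mult)
qed

text \<open>The assumption \<open>\<epsilon> * K \<le> 1/2\<close> of the locale keeps
  \<open>h\<close> near 1, so all weights are bounded above and away from zero uniformly in
  \<epsilon>.\<close>

lemma h_bounds:
  assumes "x \<in> strip I" shows "\<bar>h x - 1\<bar> \<le> \<epsilon> * K" "1/2 \<le> h x" "h x \<le> 3/2" "0 < h x"
proof -
  have "\<bar>h x - 1\<bar> = \<epsilon> * \<bar>\<tau> x\<bar>" using eps_pos unfolding h_eq by (simp add: abs_mult)
  also have "\<dots> \<le> \<epsilon> * K" using tau_bound[OF assms] eps_pos by (intro mult_left_mono) auto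
  finally show "\<bar>h x - 1\<bar> \<le> \<epsilon> * K" .
  then show "1/2 \<le> h x" "h x \<le> 3/2" "0 < h x" using eps_K by linarith+
qed

lemma kappa_fst_meas: "(\<lambda>x. \<kappa> (fst x)) \<in> borel_measurable M"
proof -
  have "(\<lambda>x. \<kappa> (fst x)) \<in> borel_measurable (M1 \<Otimes>\<^sub>M UI)"
    using measurable_compose[OF measurable_fst kappa_meas] .
  then show ?thesis by (simp only: prod_measure)
qed

lemma tau_meas: "\<tau> \<in> borel_measurable M"
  using kappa_fst_meas by (intro borel_measurable_times measurable_restrict_space1[of snd]) (auto intro!: borel_measurable_continuous_onI continuous_intros)

lemma h_meas: "h \<in> borel_measurable M"
  unfolding h_eq[abs_def] using tau_meas by simp

lemma coef_kappa: "coef_bound (\<lambda>x. \<kappa> (fst x)) K"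
  using kappa_fst_meas K_nonneg kappa_bound by (auto simp: coef_bound_def)

lemma coef_tau: "coef_bound \<tau> K"
  using tau_meas K_nonneg tau_bound by (auto simp: coef_bound_def)

lemma coef_one: "coef_bound (\<lambda>_. 1) 1"
  by (simp add: coef_bound_def)

lemma coef_h: "coef_bound h 2"
proof -
  have "\<bar>h x\<bar> \<le> 2" if "x \<in> strip I" for x using h_bounds(2,3)[OF that] by linarith
  then show ?thesis using h_meas by (simp add: coef_bound_def)
qed

lemma coef_sqrt_h: "coef_bound (\<lambda>x. sqrt (h x)) 2"
proof -
  have "sqrt (h x) \<le> 2" "0 \<le> h x" if "x \<in> strip I" for x
    using h_bounds(2,3)[OF that] real_le_lsqrt[of 2 "h x"] by auto
  then show ?thesis using h_meas by (auto simp: coef_bound_def)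
qed

text \<open>\<open>sqrt h - 1\<close> is \<open>(h - 1) / (sqrt h + 1)\<close>, with a denominator
  of at least 1.\<close>

lemma coef_sqrt_h_minus_1: "coef_bound (\<lambda>x. sqrt (h x) - 1) (\<epsilon> * K)"
proof -
  have "\<bar>sqrt (h x) - 1\<bar> \<le> \<epsilon> * K" if "x \<in> strip I" for x
  proof -
    note b = h_bounds[OF that]
    have "\<bar>sqrt (h x) - 1\<bar> * 1 \<le> \<bar>sqrt (h x) - 1\<bar> * (sqrt (h x) + 1)"
      using b by (intro mult_left_mono) auto
    also have "\<dots> = \<bar>(sqrt (h x) - 1) * (sqrt (h x) + 1)\<bar>" using b(4) by (simp add: abs_mult)
    also have "(sqrt (h x) - 1) * (sqrt (h x) + 1) = h x - 1" using b(4) by (simp add: algebra_simps)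
    finally show ?thesis using b(1) by simp
  qed
  then show ?thesis using h_meas eps_pos K_nonneg by (auto simp: coef_bound_def)
qed

lemma coef_inv_h: "coef_bound (\<lambda>x. 1 / h x) 2"
proof -
  have "\<bar>1 / h x\<bar> \<le> 2" if "x \<in> strip I" for x
    using h_bounds(2)[OF that] by (simp add: field_simps)
  then show ?thesis using h_meas by (auto simp: coef_bound_def)
qed

text \<open>The coefficient is left in the shape that \<open>winner_coef_lincomb\<close> produces
  with the factors 1 and -1.\<close>

lemma coef_one_minus_inv_h: "coef_bound (\<lambda>x. 1 * 1 + (-1) * (1 / h x)) (2 * K * \<epsilon>)"
proof -
  have "\<bar>1 * 1 + (-1) * (1 / h x)\<bar> \<le> 2 * K * \<epsilon>" if "x \<in> strip I" for x
  proof -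
    note b = h_bounds[OF that]
    have "\<bar>1 * 1 + (-1) * (1 / h x)\<bar> = \<bar>h x - 1\<bar> * \<bar>1 / h x\<bar>" using b(4) by (simp add: field_simps flip: abs_mult)
    also have "\<dots> \<le> (\<epsilon> * K) * 2"
      using b eps_pos K_nonneg by (intro mult_mono) (auto simp: field_simps)
    finally show ?thesis by (simp add: mult_ac)
  qed
  then show ?thesis using h_meas eps_pos K_nonneg by (auto simp: coef_bound_def)
qed

definition q0 :: "(real \<times> real \<Rightarrow> complex) \<Rightarrow> (real \<times> real \<Rightarrow> complex) \<Rightarrow> complex" where
  "q0 u v = L2_inner M (d1 u) (d1 v) + of_real (1 / \<epsilon>\<^sup>2) * L2_inner M (d2 u) (d2 v)
     + of_real (1 / \<epsilon>) * winner (\<lambda>x. \<kappa> (fst x)) u v + of_real shift * L2_inner M u v"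

text \<open>The shifted form of the weighted problem; \<open>h\<close> also multiplies the shift
  because it belongs to the inner product of the weighted space.\<close>

definition q1 :: "(real \<times> real \<Rightarrow> complex) \<Rightarrow> (real \<times> real \<Rightarrow> complex) \<Rightarrow> complex" where
  "q1 u v = winner (\<lambda>x. 1 / h x) (d1 u) (d1 v) + of_real (1 / \<epsilon>\<^sup>2) * winner h (d2 u) (d2 v)
     + of_real shift * winner h u v"

text \<open>The part of \<open>q0 - q1\<close> that carries the factor 1 / \<epsilon>: it stems from
  \<open>h = 1 - \<epsilon> * \<tau>\<close> in the transversal term and the shift term, and from
  the potential \<open>\<kappa> / \<epsilon>\<close> of the comparison operator.\<close>

definition bracket :: "(real \<times> real \<Rightarrow> complex) \<Rightarrow> (real \<times> real \<Rightarrow> complex) \<Rightarrow> complex" where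
  "bracket u v = winner \<tau> (d2 u) (d2 v) + winner (\<lambda>x. \<kappa> (fst x)) u v - of_real (pi\<^sup>2 / 4) * winner \<tau> u v"

lemma winner_h:
  assumes "u \<in> L2 M" "v \<in> L2 M"
  shows "winner h u v = L2_inner M u v - of_real \<epsilon> * winner \<tau> u v"
  using winner_coef_lincomb[OF coef_one coef_tau assms, of 1 "- \<epsilon>"] by (simp add: h_eq[abs_def] winner_def)

lemma q0_minus_q1:
  assumes u: "u \<in> form_domain I" and v: "v \<in> form_domain I"
  shows "q0 u v - q1 u v = winner (\<lambda>x. 1 * 1 + (-1) * (1 / h x)) (d1 u) (d1 v)
    + of_real (1 / \<epsilon>) * bracket u v + of_real k * winner \<tau> u v"
proof -
  note uL = form_domain_L2[OF u] and vL = form_domain_L2[OF v]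
  have 1: "winner (\<lambda>x. 1 * 1 + (-1) * (1 / h x)) (d1 u) (d1 v) = L2_inner M (d1 u) (d1 v) - winner (\<lambda>x. 1 / h x) (d1 u) (d1 v)"
    using winner_coef_lincomb[OF coef_one coef_inv_h uL(2) vL(2), of 1 "-1"] by (simp add: winner_def)
  have 2: "shift * \<epsilon> = k - pi\<^sup>2 / 4 * (1 / \<epsilon>)" "1 / \<epsilon>\<^sup>2 * \<epsilon> = 1 / \<epsilon>"
    using eps_pos by (simp_all add: shift_def field_simps power2_eq_square)
  have 3: "complex_of_real shift * of_real \<epsilon> = of_real (k - pi\<^sup>2 / 4 * (1 / \<epsilon>))" "complex_of_real (1 / \<epsilon>\<^sup>2) * of_real \<epsilon> = of_real (1 / \<epsilon>)"
    by (simp_all only: of_real_mult[symmetric] 2)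
  have "q0 u v - q1 u v = L2_inner M (d1 u) (d1 v) - winner (\<lambda>x. 1 / h x) (d1 u) (d1 v)
    + (complex_of_real (1 / \<epsilon>\<^sup>2) * of_real \<epsilon>) * winner \<tau> (d2 u) (d2 v) + of_real (1 / \<epsilon>) * winner (\<lambda>x. \<kappa> (fst x)) u v
    + (complex_of_real shift * of_real \<epsilon>) * winner \<tau> u v"
    unfolding q0_def q1_def winner_h[OF uL(3) vL(3)] winner_h[OF uL(1) vL(1)] by (simp add: algebra_simps)
  also have "\<dots> = L2_inner M (d1 u) (d1 v) - winner (\<lambda>x. 1 / h x) (d1 u) (d1 v)
    + of_real (1 / \<epsilon>) * bracket u v + of_real k * winner \<tau> u v"
    unfolding 3 bracket_def of_real_diff of_real_mult by (simp add: algebra_simps)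
  finally show ?thesis unfolding 1 .
qed

lemma split_bound:
  assumes w: "coef_bound w K" and X: "X \<in> L2 M" "X' \<in> L2 M" and Y: "Y \<in> L2 M" "Y' \<in> L2 M"
  shows "norm (winner w (\<lambda>x. X x + X' x) (\<lambda>x. Y x + Y' x) - winner w X Y)
    \<le> K * (L2_norm M X * L2_norm M Y' + L2_norm M X' * L2_norm M (\<lambda>x. Y x + Y' x))"
proof -
  have "winner w (\<lambda>x. X x + X' x) (\<lambda>x. Y x + Y' x) - winner w X Y = winner w X Y' + winner w X' (\<lambda>x. Y x + Y' x)"
    by (simp add: winner_add_left[OF w X L2_add[OF Y]] winner_add_right[OF w Y X(1)])
  then show ?thesis
    using norm_triangle_mono[OF winner_bound[OF w X(1) Y(2)] winner_bound[OF w X(2) L2_add[OF Y]]]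
    by (simp add: algebra_simps)
qed

text \<open>Everything factorises: each term is the same integral over \<open>I\<close>, weighted by
  \<kappa>, times a moment on the unit interval, and by \<open>ground_moment\<close> these moments
  add up to zero.\<close>

lemma ground_cancel:
  assumes "a \<in> L2 M1" "b \<in> L2 M1"
  shows "winner \<tau> (tensor a ground') (tensor b ground') + winner (\<lambda>x. \<kappa> (fst x)) (tensor a ground) (tensor b ground)
    - of_real (pi\<^sup>2 / 4) * winner \<tau> (tensor a ground) (tensor b ground) = 0"
proof -
  have ka: "(\<lambda>s. of_real (\<kappa> s) * a s) \<in> L2 M1"
    using kappa_meas by (intro L2_bounded_mult[OF assms(1), of _ K]) (auto simp: kappa_bound)
  have tg: "(\<lambda>t. of_real t * ground t) \<in> L2 UI" "(\<lambda>t. of_real t * ground' t) \<in> L2 UI"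
    by (intro L2_bounded_mult[of _ _ _ 1] ground_L2 measurable_restrict_space1; auto)+
  have e: "winner \<tau> (tensor a g) (tensor b f) = L2_inner M (tensor (\<lambda>s. of_real (\<kappa> s) * a s) (\<lambda>t. of_real t * g t)) (tensor b f)"
    "winner (\<lambda>x. \<kappa> (fst x)) (tensor a g) (tensor b f) = L2_inner M (tensor (\<lambda>s. of_real (\<kappa> s) * a s) g) (tensor b f)" for f g
    unfolding winner_def by (simp_all add: tensor_def[abs_def] mult_ac)
  have "winner \<tau> (tensor a ground') (tensor b ground') + winner (\<lambda>x. \<kappa> (fst x)) (tensor a ground) (tensor b ground)
    - of_real (pi\<^sup>2 / 4) * winner \<tau> (tensor a ground) (tensor b ground)
    = L2_inner M1 (\<lambda>s. of_real (\<kappa> s) * a s) b * (L2_inner UI (\<lambda>t. of_real t * ground' t) ground' + L2_inner UI ground ground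
     - of_real (pi\<^sup>2 / 4) * L2_inner UI (\<lambda>t. of_real t * ground t) ground)"
    unfolding e tensor_inner[OF ka tg(2) assms(2) ground_L2(2)] tensor_inner[OF ka ground_L2(1) assms(2) ground_L2(1)]
      tensor_inner[OF ka tg(1) assms(2) ground_L2(1)]
    by (simp add: algebra_simps)
  then show ?thesis unfolding ground_moment by simp
qed

text \<open>By \<open>ground_cancel\<close> the contribution of the first mode alone may be
  subtracted, so that each remaining term contains a factor \<open>u_perp\<close> or
  \<open>d_perp\<close>; \<open>transversal_gap\<close> bounds the former by the latter.\<close>

lemma bracket_bound:
  assumes u: "u \<in> form_domain I" and v: "v \<in> form_domain I"
  shows "norm (bracket u v) \<le> 7 * K * (L2_norm M u * L2_norm M (d_perp v) + L2_norm M (d_perp u) * L2_norm M v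
    + L2_norm M (d_perp u) * L2_norm M (d_perp v))"
proof -
  note uL = form_domain_L2[OF u] and vL = form_domain_L2[OF v] and pu = perp_L2[OF u] and pv = perp_L2[OF v]
  have a: "amp u \<in> L2 M1" "amp v \<in> L2 M1" by (intro amp_L2 uL vL)+
  note t = tensor_L2[OF a(1) ground_L2(1)] tensor_L2[OF a(1) ground_L2(2)] tensor_L2[OF a(2) ground_L2(1)] tensor_L2[OF a(2) ground_L2(2)]
  have dec: "z = (\<lambda>x. tensor (amp z) ground x + u_perp z x)" "d2 z = (\<lambda>x. tensor (amp z) ground' x + d_perp z x)" for z
    by (simp_all add: u_perp_def d_perp_def fun_eq_iff)
  define U V P Q where "U = L2_norm M u" and "V = L2_norm M v" and "P = L2_norm M (d_perp u)" and "Q = L2_norm M (d_perp v)"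
  have nn: "0 \<le> U" "0 \<le> V" "0 \<le> P" "0 \<le> Q" by (auto simp: U_def V_def P_def Q_def)
  have n1: "L2_norm M (tensor (amp z) ground) \<le> L2_norm M z" if "z \<in> L2 M" for z
    using amp_norm[OF that] by (simp add: tensor_norm[OF amp_L2[OF that] ground_L2(1)] ground_norm)
  have g2: "L2_norm UI ground' \<le> 2"
  proof (rule power2_le_imp_le)
    show "(L2_norm UI ground')\<^sup>2 \<le> 2\<^sup>2" unfolding ground'_norm_sq using pi_sq_bound(1) by simp
  qed simp
  have n2: "L2_norm M (tensor (amp z) ground') \<le> 2 * L2_norm M z" if "z \<in> L2 M" for z
    using mult_mono[OF amp_norm[OF that] g2] by (simp add: tensor_norm[OF amp_L2[OF that] ground_L2(2)] mult.commute)
  have n3: "L2_norm M (d2 v) \<le> 2 * V + Q"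
    using L2_norm_add[OF t(4) pv(2)] n2[OF vL(1)] by (simp add: dec(2)[symmetric] V_def Q_def)
  have b1: "norm (winner \<tau> (d2 u) (d2 v) - winner \<tau> (tensor (amp u) ground') (tensor (amp v) ground')) \<le> K * (2 * U * Q + P * (2 * V + Q))"
  proof -
    have "norm (winner \<tau> (d2 u) (d2 v) - winner \<tau> (tensor (amp u) ground') (tensor (amp v) ground'))
        \<le> K * (L2_norm M (tensor (amp u) ground') * L2_norm M (d_perp v) + L2_norm M (d_perp u) * L2_norm M (d2 v))"
      using split_bound[OF coef_tau t(2) pu(2) t(4) pv(2)] by (simp only: dec(2)[symmetric])
    also have "\<dots> \<le> K * ((2 * U) * Q + P * (2 * V + Q))"
      using n2[OF uL(1)] n3 nn K_nonneg unfolding U_def[symmetric] P_def[symmetric] Q_def[symmetric]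
      by (intro mult_left_mono add_mono mult_mono) auto
    finally show ?thesis .
  qed
  have b2: "norm (winner w u v - winner w (tensor (amp u) ground) (tensor (amp v) ground)) \<le> K * (U * Q + P * V)"
    if w: "coef_bound w K" for w
  proof -
    have "norm (winner w u v - winner w (tensor (amp u) ground) (tensor (amp v) ground))
        \<le> K * (L2_norm M (tensor (amp u) ground) * L2_norm M (u_perp v) + L2_norm M (u_perp u) * L2_norm M v)"
      using split_bound[OF w t(1) pu(1) t(3) pv(1)] by (simp only: dec(1)[symmetric])
    also have "\<dots> \<le> K * (U * Q + P * V)"
      using n1[OF uL(1)] transversal_gap(1)[OF u] transversal_gap(1)[OF v] nn K_nonneg
      unfolding U_def[symmetric] P_def[symmetric] Q_def[symmetric] V_def[symmetric]
      by (intro mult_left_mono add_mono mult_mono) auto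
    finally show ?thesis .
  qed
  define T1 T2 T3 where "T1 = winner \<tau> (d2 u) (d2 v) - winner \<tau> (tensor (amp u) ground') (tensor (amp v) ground')"
    and "T2 = winner (\<lambda>x. \<kappa> (fst x)) u v - winner (\<lambda>x. \<kappa> (fst x)) (tensor (amp u) ground) (tensor (amp v) ground)"
    and "T3 = winner \<tau> u v - winner \<tau> (tensor (amp u) ground) (tensor (amp v) ground)"
  have "bracket u v = bracket u v - (winner \<tau> (tensor (amp u) ground') (tensor (amp v) ground') + winner (\<lambda>x. \<kappa> (fst x)) (tensor (amp u) ground) (tensor (amp v) ground)
    - of_real (pi\<^sup>2 / 4) * winner \<tau> (tensor (amp u) ground) (tensor (amp v) ground))"
    unfolding ground_cancel[OF a] by simp
  also have "\<dots> = T1 + T2 - of_real (pi\<^sup>2 / 4) * T3"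
    unfolding bracket_def T1_def T2_def T3_def by (simp add: algebra_simps)
  finally have "norm (bracket u v) \<le> norm T1 + norm T2 + pi\<^sup>2 / 4 * norm T3"
    using norm_triangle_ineq4[of "T1 + T2" "of_real (pi\<^sup>2 / 4) * T3"] norm_triangle_ineq[of T1 T2]
    by (simp add: norm_mult norm_divide norm_power)
  \<comment> \<open>The 2 bounds the norm of \<open>ground'\<close> and the 4 bounds
    \<open>pi\<^sup>2 / 4\<close>; with the middle term they add up to 7 in front of each mixed
    product.\<close>
  also have "\<dots> \<le> K * (2 * U * Q + P * (2 * V + Q)) + K * (U * Q + P * V) + 4 * (K * (U * Q + P * V))"
    using b1 b2[OF coef_kappa] b2[OF coef_tau] pi_sq_bound(1) nn K_nonneg unfolding T1_def T2_def T3_def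
    by (intro add_mono mult_mono) auto
  also have "\<dots> \<le> 7 * K * (U * Q + P * V + P * Q)"
    using K_nonneg nn by (simp add: algebra_simps)
  finally show ?thesis by (simp add: U_def V_def P_def Q_def)
qed

end

section \<open>Resolvents\<close>

lemma L2_Cauchy_dominated:
  assumes "L2_Cauchy M Y" "\<And>m n. L2_norm N (\<lambda>x. G m x - G n x) \<le> C * L2_norm M (\<lambda>x. Y m x - Y n x)"
  shows "L2_Cauchy N G"
  unfolding L2_Cauchy_def
proof safe
  fix e :: real assume e: "e > 0"
  obtain n0 where n0: "\<And>m n. m \<ge> n0 \<Longrightarrow> n \<ge> n0 \<Longrightarrow> L2_norm M (\<lambda>x. Y m x - Y n x) < e / (\<bar>C\<bar> + 1)"
    using assms(1) e unfolding L2_Cauchy_def by (meson abs_ge_zero divide_pos_pos less_add_one order_le_less_trans)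
  have "L2_norm N (\<lambda>x. G m x - G n x) < e" if "m \<ge> n0" "n \<ge> n0" for m n
  proof -
    let ?y = "L2_norm M (\<lambda>x. Y m x - Y n x)"
    have "C * ?y \<le> (\<bar>C\<bar> + 1) * ?y" by (rule mult_right_mono) auto
    also have "\<dots> < (\<bar>C\<bar> + 1) * (e / (\<bar>C\<bar> + 1))" by (rule mult_strict_left_mono[OF n0[OF that]]) simp
    also have "\<dots> = e"
    proof -
      have "\<bar>C\<bar> + 1 \<noteq> 0" using abs_ge_zero[of C] by linarith
      then show ?thesis by simp
    qed
    finally show ?thesis using assms(2)[of m n] by linarith
  qed
  then show "\<exists>N0. \<forall>m\<ge>N0. \<forall>n\<ge>N0. L2_norm N (\<lambda>x. G m x - G n x) < e" by blast
qed

lemma op_closure_lincomb: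
  assumes T: "T \<subseteq> L2 M \<times> L2 M"
    and lin: "\<And>u f v g a b. (u, f) \<in> T \<Longrightarrow> (v, g) \<in> T \<Longrightarrow> (\<lambda>x. a * u x + b * v x, \<lambda>x. a * f x + b * g x) \<in> T"
    and u: "(u, f) \<in> op_closure M T" and v: "(v, g) \<in> op_closure M T"
  shows "(\<lambda>x. a * u x + b * v x, \<lambda>x. a * f x + b * g x) \<in> op_closure M T"
proof -
  obtain U F where U: "\<And>n. (U n, F n) \<in> T" "L2_conv M U u" "L2_conv M F f" and uL: "u \<in> L2 M" "f \<in> L2 M"
    using u unfolding op_closure_def by blast
  obtain V G where V: "\<And>n. (V n, G n) \<in> T" "L2_conv M V v" "L2_conv M G g" and vL: "v \<in> L2 M" "g \<in> L2 M"
    using v unfolding op_closure_def by blast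
  have L: "U n \<in> L2 M" "F n \<in> L2 M" "V n \<in> L2 M" "G n \<in> L2 M" for n using U(1) V(1) T by blast+
  show ?thesis unfolding op_closure_def
    using L2_lincomb[OF uL(1) vL(1)] L2_lincomb[OF uL(2) vL(2)] lin[OF U(1) V(1)]
      L2_conv_lincomb[OF L(1) uL(1) U(2) L(3) vL(1) V(2)] L2_conv_lincomb[OF L(2) uL(2) U(3) L(4) vL(2) V(3)]
    by (intro CollectI case_prodI conjI exI[of _ "\<lambda>n x. a * U n x + b * V n x"] exI[of _ "\<lambda>n x. a * F n x + b * G n x"]) auto
qed

text \<open>Diagonal choice: the pair with index \<open>n\<close> is replaced by a pair of
  \<open>T\<close> within distance 1 / (n + 1) in both components.\<close>

lemma op_closure_closed:
  assumes T: "T \<subseteq> L2 M \<times> L2 M" and u: "\<And>n. (U n, F n) \<in> op_closure M T" and uL: "u \<in> L2 M" "f \<in> L2 M"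
    and c: "L2_conv M U u" "L2_conv M F f"
  shows "(u, f) \<in> op_closure M T"
proof -
  have "\<forall>n. \<exists>p. p \<in> T \<and> L2_norm M (\<lambda>x. fst p x - U n x) < inverse (Suc n) \<and> L2_norm M (\<lambda>x. snd p x - F n x) < inverse (Suc n)"
  proof
    fix n
    obtain V G where V: "\<And>k. (V k, G k) \<in> T" "L2_conv M V (U n)" "L2_conv M G (F n)"
      using u[of n] unfolding op_closure_def by blast
    have p: "0 < inverse (real (Suc n))" by simp
    have "\<forall>\<^sub>F k in sequentially. L2_norm M (\<lambda>x. V k x - U n x) < inverse (Suc n) \<and> L2_norm M (\<lambda>x. G k x - F n x) < inverse (Suc n)"
      using eventually_conj[OF order_tendstoD(2)[OF V(2) p] order_tendstoD(2)[OF V(3) p]] .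
    then obtain k where "L2_norm M (\<lambda>x. V k x - U n x) < inverse (Suc n) \<and> L2_norm M (\<lambda>x. G k x - F n x) < inverse (Suc n)"
      using eventually_happens'[OF sequentially_bot] by blast
    then show "\<exists>p. p \<in> T \<and> L2_norm M (\<lambda>x. fst p x - U n x) < inverse (Suc n) \<and> L2_norm M (\<lambda>x. snd p x - F n x) < inverse (Suc n)"
      using V(1)[of k] by (intro exI[of _ "(V k, G k)"]) auto
  qed
  from choice[OF this] obtain p where p: "\<And>n. p n \<in> T" "\<And>n. L2_norm M (\<lambda>x. fst (p n) x - U n x) < inverse (Suc n)"
    "\<And>n. L2_norm M (\<lambda>x. snd (p n) x - F n x) < inverse (Suc n)" by blast
  have L: "fst (p n) \<in> L2 M" "snd (p n) \<in> L2 M" "U n \<in> L2 M" "F n \<in> L2 M" for n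
    using p(1)[of n] T u[of n] by (auto simp: op_closure_def)
  have comb: "L2_conv M A z" if "\<And>n. A n \<in> L2 M" "\<And>n. Z n \<in> L2 M" "z \<in> L2 M"
    "\<And>n. L2_norm M (\<lambda>x. A n x - Z n x) < inverse (Suc n)" "L2_conv M Z z" for A Z z
  proof (rule Lim_null_comparison[OF always_eventually[OF allI]])
    show "norm (L2_norm M (\<lambda>x. A n x - z x)) \<le> inverse (Suc n) + L2_norm M (\<lambda>x. Z n x - z x)" for n
      using L2_norm_triangle[OF that(1)[of n] that(2)[of n] that(3)] that(4)[of n] by simp
    show "(\<lambda>n. inverse (real (Suc n)) + L2_norm M (\<lambda>x. Z n x - z x)) \<longlonglongrightarrow> 0"
      using tendsto_add[OF LIMSEQ_inverse_real_of_nat that(5)] by simp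
  qed
  show ?thesis unfolding op_closure_def
    using uL p(1) comb[OF L(1,3) uL(1) p(2) c(1)] comb[OF L(2,4) uL(2) p(3) c(2)]
    by (intro CollectI case_prodI conjI exI[of _ "\<lambda>n. fst (p n)"] exI[of _ "\<lambda>n. snd (p n)"]) auto
qed

lemma shifted_inverse_iff:
  "(f, u) \<in> shifted_inverse k \<epsilon> H \<longleftrightarrow>
    (u, \<lambda>x. f x - of_real (- (pi / (2 * \<epsilon>))\<^sup>2 + k / \<epsilon>) * u x) \<in> H"
proof
  assume "(f, u) \<in> shifted_inverse k \<epsilon> H"
  then obtain g where "(u, g) \<in> H" "f = (\<lambda>x. g x + of_real (- (pi / (2 * \<epsilon>))\<^sup>2 + k / \<epsilon>) * u x)"
    by (auto simp: shifted_inverse_def op_add_mult_def)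
  then show "(u, \<lambda>x. f x - of_real (- (pi / (2 * \<epsilon>))\<^sup>2 + k / \<epsilon>) * u x) \<in> H" by simp
next
  assume "(u, \<lambda>x. f x - of_real (- (pi / (2 * \<epsilon>))\<^sup>2 + k / \<epsilon>) * u x) \<in> H"
  then show "(f, u) \<in> shifted_inverse k \<epsilon> H"
    unfolding shifted_inverse_def op_add_mult_def by (intro converseI) force
qed

lemma sum_lessThan_add: "(\<Sum>i<n + n'. c i) = (\<Sum>i<n. c i) + (\<Sum>i<n'. c (n + i))" for n n' :: nat
  by (induction n') (simp_all add: add.assoc)

text \<open>The two finite sums are concatenated and the scalars are absorbed in the first factors,
  so closure under scaling is only asked of \<open>A\<close>.\<close>

lemma algebraic_tensor_sum_lincomb:
  assumes A: "\<And>f F a. (f, F) \<in> A \<Longrightarrow> (\<lambda>x. a * f x, \<lambda>x. a * F x) \<in> A"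
    and T: "(u, f) \<in> algebraic_tensor_sum A B" "(v, g) \<in> algebraic_tensor_sum A B"
  shows "(\<lambda>x. a * u x + b * v x, \<lambda>x. a * f x + b * g x) \<in> algebraic_tensor_sum A B"
proof -
  obtain n :: nat and p P q Q where 1: "u = (\<lambda>(s, t). \<Sum>i<n. p i s * q i t)" "f = (\<lambda>(s, t). \<Sum>i<n. P i s * q i t + p i s * Q i t)"
    "\<And>i. i < n \<Longrightarrow> (p i, P i) \<in> A" "\<And>i. i < n \<Longrightarrow> (q i, Q i) \<in> B"
    using T(1) unfolding algebraic_tensor_sum_def by blast
  obtain n' :: nat and p' P' q' Q' where 2: "v = (\<lambda>(s, t). \<Sum>i<n'. p' i s * q' i t)" "g = (\<lambda>(s, t). \<Sum>i<n'. P' i s * q' i t + p' i s * Q' i t)"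
    "\<And>i. i < n' \<Longrightarrow> (p' i, P' i) \<in> A" "\<And>i. i < n' \<Longrightarrow> (q' i, Q' i) \<in> B"
    using T(2) unfolding algebraic_tensor_sum_def by blast
  define r R where "r i = (if i < n then (\<lambda>x. a * p i x) else (\<lambda>x. b * p' (i - n) x))"
    and "R i = (if i < n then (\<lambda>x. a * P i x) else (\<lambda>x. b * P' (i - n) x))" for i
  define z Z where "z i = (if i < n then q i else q' (i - n))" and "Z i = (if i < n then Q i else Q' (i - n))" for i
  have "(\<lambda>x. a * u x + b * v x) = (\<lambda>(s, t). \<Sum>i<n + n'. r i s * z i t)"
    "(\<lambda>x. a * f x + b * g x) = (\<lambda>(s, t). \<Sum>i<n + n'. R i s * z i t + r i s * Z i t)"
  proof -
    have lo: "r i = (\<lambda>x. a * p i x)" "R i = (\<lambda>x. a * P i x)" "z i = q i" "Z i = Q i" if "i < n" for i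
      using that by (simp_all add: r_def R_def z_def Z_def)
    have hi: "r (n + i) = (\<lambda>x. b * p' i x)" "R (n + i) = (\<lambda>x. b * P' i x)" "z (n + i) = q' i" "Z (n + i) = Q' i" for i
      by (simp_all add: r_def R_def z_def Z_def)
    show "(\<lambda>x. a * u x + b * v x) = (\<lambda>(s, t). \<Sum>i<n + n'. r i s * z i t)"
      "(\<lambda>x. a * f x + b * g x) = (\<lambda>(s, t). \<Sum>i<n + n'. R i s * z i t + r i s * Z i t)"
      by (simp_all add: 1 2 fun_eq_iff sum_lessThan_add hi lo sum_distrib_left distrib_left mult.assoc cong: sum.cong_simp)
  qed
  moreover have "\<forall>i<n + n'. (r i, R i) \<in> A" "\<forall>i<n + n'. (z i, Z i) \<in> B"
    using A[OF 1(3)] A[OF 2(3)] 1(4) 2(4) by (auto simp: r_def R_def z_def Z_def)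
  ultimately show ?thesis unfolding algebraic_tensor_sum_def by blast
qed

section \<open>Energy estimates and the graph of the comparison operator\<close>

context curved_strip
begin

definition energy :: "(real \<times> real \<Rightarrow> complex) \<Rightarrow> real" where
  "energy u = sqrt ((L2_norm M (d1 u))\<^sup>2 + (L2_norm M (d_perp u))\<^sup>2 / \<epsilon>\<^sup>2 + (L2_norm M u)\<^sup>2 / \<epsilon>)"

lemma energy_sq: "(energy u)\<^sup>2 = (L2_norm M (d1 u))\<^sup>2 + (L2_norm M (d_perp u))\<^sup>2 / \<epsilon>\<^sup>2 + (L2_norm M u)\<^sup>2 / \<epsilon>"
  using eps_pos by (simp add: energy_def)

lemma energy_nonneg [simp]: "0 \<le> energy u"
  using eps_pos by (simp add: energy_def)

lemma energy_bounds:
  "L2_norm M (d1 u) \<le> energy u" "L2_norm M (d_perp u) \<le> \<epsilon> * energy u" "L2_norm M u \<le> sqrt \<epsilon> * energy u"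
proof -
  have nn: "0 \<le> (L2_norm M (d_perp u))\<^sup>2 / \<epsilon>\<^sup>2" "0 \<le> (L2_norm M u)\<^sup>2 / \<epsilon>" "0 \<le> (L2_norm M (d1 u))\<^sup>2"
    using eps_pos by auto
  show "L2_norm M (d1 u) \<le> energy u"
    by (rule power2_le_imp_le) (use nn energy_sq[of u] in linarith, simp)
  have "(L2_norm M (d_perp u))\<^sup>2 / \<epsilon>\<^sup>2 \<le> (energy u)\<^sup>2" using nn energy_sq[of u] by linarith
  then have "(L2_norm M (d_perp u))\<^sup>2 \<le> (\<epsilon> * energy u)\<^sup>2"
    using eps_pos by (simp add: power_mult_distrib divide_le_eq mult.commute)
  then show "L2_norm M (d_perp u) \<le> \<epsilon> * energy u" by (rule power2_le_imp_le) (use eps_pos in simp)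
  have "(L2_norm M u)\<^sup>2 / \<epsilon> \<le> (energy u)\<^sup>2" using nn energy_sq[of u] by linarith
  then have "(L2_norm M u)\<^sup>2 \<le> (sqrt \<epsilon> * energy u)\<^sup>2"
    using eps_pos by (simp add: power_mult_distrib divide_le_eq mult.commute)
  then show "L2_norm M u \<le> sqrt \<epsilon> * energy u" by (rule power2_le_imp_le) (use eps_pos in simp)
qed

lemma eps_sqrt: "\<epsilon> \<le> sqrt \<epsilon>" "sqrt \<epsilon> * sqrt \<epsilon> = \<epsilon>" "0 \<le> sqrt \<epsilon>" "sqrt \<epsilon> \<le> 1"
proof -
  show s: "sqrt \<epsilon> * sqrt \<epsilon> = \<epsilon>" "0 \<le> sqrt \<epsilon>" "sqrt \<epsilon> \<le> 1" using eps_pos eps_le_1 by auto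
  show "\<epsilon> \<le> sqrt \<epsilon>" using mult_left_mono[OF s(3) s(2)] s(1) by simp
qed

text \<open>23 = 2 + 21: the 2 comes from the longitudinal term and 21, three times 7, from the
  bracket; \<open>\<bar>k\<bar>\<close> comes from the shift.\<close>

definition form_const :: real where
  "form_const = (23 + \<bar>k\<bar>) * K"

text \<open>In units of the two energies, the longitudinal term and the term with \<open>k\<close>
  have size \<epsilon>. A mixed product in the bracket has size \<epsilon> sqrt \<epsilon>, which
  the prefactor 1 / \<epsilon> turns into sqrt \<epsilon>; this term decides the rate.\<close>

lemma form_difference:
  assumes u: "u \<in> form_domain I" and v: "v \<in> form_domain I"
  shows "norm (q0 u v - q1 u v) \<le> form_const * sqrt \<epsilon> * (energy u * energy v)"
proof -
  note uL = form_domain_L2[OF u] and vL = form_domain_L2[OF v]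
  define e where "e = energy u * energy v"
  have e0: "0 \<le> e" by (simp add: e_def)
  have r: "0 \<le> \<epsilon>" "0 \<le> sqrt \<epsilon>" using eps_pos by auto
  have uu: "L2_norm M u * L2_norm M v \<le> \<epsilon> * e"
  proof -
    have "L2_norm M u * L2_norm M v \<le> (sqrt \<epsilon> * energy u) * (sqrt \<epsilon> * energy v)"
      by (intro mult_mono energy_bounds mult_nonneg_nonneg r energy_nonneg L2_norm_nonneg)
    also have "\<dots> = (sqrt \<epsilon> * sqrt \<epsilon>) * e" by (simp only: e_def mult_ac)
    finally show ?thesis unfolding eps_sqrt(2) .
  qed
  have t1: "norm (winner (\<lambda>x. 1 * 1 + (-1) * (1 / h x)) (d1 u) (d1 v)) \<le> 2 * K * sqrt \<epsilon> * e"
  proof -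
    have "norm (winner (\<lambda>x. 1 * 1 + (-1) * (1 / h x)) (d1 u) (d1 v)) \<le> 2 * K * \<epsilon> * (L2_norm M (d1 u) * L2_norm M (d1 v))"
      by (rule winner_bound[OF coef_one_minus_inv_h uL(2) vL(2)])
    also have "\<dots> \<le> 2 * K * sqrt \<epsilon> * e" unfolding e_def
      using K_nonneg r by (intro mult_mono energy_bounds mult_nonneg_nonneg eps_sqrt(1)) auto
    finally show ?thesis .
  qed
  have t2: "norm (of_real (1 / \<epsilon>) * bracket u v) \<le> 21 * K * sqrt \<epsilon> * e"
  proof -
    have a: "L2_norm M u * L2_norm M (d_perp v) \<le> (sqrt \<epsilon> * energy u) * (\<epsilon> * energy v)"
      "L2_norm M (d_perp u) * L2_norm M v \<le> (\<epsilon> * energy u) * (sqrt \<epsilon> * energy v)"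
      "L2_norm M (d_perp u) * L2_norm M (d_perp v) \<le> (\<epsilon> * energy u) * (\<epsilon> * energy v)"
      by (intro mult_mono energy_bounds mult_nonneg_nonneg r energy_nonneg L2_norm_nonneg)+
    have a3: "(\<epsilon> * energy u) * (\<epsilon> * energy v) \<le> (\<epsilon> * energy u) * (sqrt \<epsilon> * energy v)"
      using eps_sqrt(1) r by (intro mult_left_mono mult_right_mono) auto
    have "norm (bracket u v) \<le> 7 * K * (L2_norm M u * L2_norm M (d_perp v) + L2_norm M (d_perp u) * L2_norm M v
        + L2_norm M (d_perp u) * L2_norm M (d_perp v))"
      by (rule bracket_bound[OF u v])
    also have "\<dots> \<le> 7 * K * ((sqrt \<epsilon> * energy u) * (\<epsilon> * energy v) + (\<epsilon> * energy u) * (sqrt \<epsilon> * energy v)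
        + (\<epsilon> * energy u) * (sqrt \<epsilon> * energy v))"
      using a a3 K_nonneg by (intro mult_left_mono add_mono) auto
    also have "\<dots> = \<epsilon> * (21 * K * sqrt \<epsilon> * e)" by (simp add: e_def algebra_simps)
    finally have "norm (bracket u v) / \<epsilon> \<le> 21 * K * sqrt \<epsilon> * e"
      using eps_pos by (simp add: divide_le_eq mult.commute)
    then show ?thesis using eps_pos by (simp add: norm_divide)
  qed
  have t3: "norm (of_real k * winner \<tau> u v) \<le> \<bar>k\<bar> * K * sqrt \<epsilon> * e"
  proof -
    have "norm (winner \<tau> u v) \<le> K * (L2_norm M u * L2_norm M v)" by (rule winner_bound[OF coef_tau uL(1) vL(1)])
    also have "\<dots> \<le> K * (\<epsilon> * e)" by (rule mult_left_mono[OF uu K_nonneg])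
    also have "\<dots> \<le> K * (sqrt \<epsilon> * e)" by (intro mult_left_mono mult_right_mono eps_sqrt(1) e0 K_nonneg)
    finally have "\<bar>k\<bar> * norm (winner \<tau> u v) \<le> \<bar>k\<bar> * (K * (sqrt \<epsilon> * e))" by (rule mult_left_mono) simp
    then show ?thesis by (simp add: norm_mult mult_ac)
  qed
  have "norm (q0 u v - q1 u v) \<le> 2 * K * sqrt \<epsilon> * e + 21 * K * sqrt \<epsilon> * e + \<bar>k\<bar> * K * sqrt \<epsilon> * e"
    unfolding q0_minus_q1[OF u v] by (intro norm_triangle_mono t1 t2 t3)
  also have "\<dots> = form_const * sqrt \<epsilon> * e" by (simp add: form_const_def algebra_simps)
  finally show ?thesis by (simp add: e_def)
qed

text \<open>One constant for each summand of the energy: 1 for \<open>d1 u\<close>, the gap constant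
  for \<open>d_perp u\<close>, and \<open>k + m\<close> for \<open>u\<close>.\<close>

definition coerc :: real where
  "coerc = min (min 1 (2 - pi\<^sup>2 / 8)) (k + m)"

lemma coerc: "0 < coerc" "coerc \<le> 1" "coerc \<le> 2 - pi\<^sup>2 / 8" "coerc \<le> k + m"
  using pi_sq_bound(1) k_gt by (auto simp: coerc_def)

text \<open>The two parts of the shift go to different places: \<open>pi\<^sup>2 / 4\<close> over
  the square of \<epsilon> is taken out of the transversal energy, which leaves the gap, and k /
  \<epsilon> is added to the potential, which becomes at least (k + m) / \<epsilon>.\<close>

lemma q0_coercive:
  assumes u: "u \<in> form_domain I"
  shows "coerc * (energy u)\<^sup>2 \<le> Re (q0 u u)"
proof -
  note uL = form_domain_L2[OF u]
  define N1 N2 P N where "N1 = (L2_norm M (d1 u))\<^sup>2" and "N2 = (L2_norm M (d2 u))\<^sup>2"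
    and "P = (L2_norm M (d_perp u))\<^sup>2" and "N = (L2_norm M u)\<^sup>2"
  have nn: "0 \<le> N1" "0 \<le> P" "0 \<le> N" by (auto simp: N1_def P_def N_def)
  define W where "W = Re (winner (\<lambda>x. \<kappa> (fst x)) u u)"
  have W: "m * N \<le> W" unfolding W_def N_def by (rule winner_lower[OF coef_kappa uL(1)]) (auto intro: kappa_lower)
  have G: "(2 - pi\<^sup>2 / 8) * P \<le> N2 - pi\<^sup>2 / 4 * N" unfolding P_def N2_def N_def by (rule transversal_gap(2)[OF u])
  have "Re (q0 u u) = N1 + 1 / \<epsilon>\<^sup>2 * N2 + 1 / \<epsilon> * W + shift * N"
    unfolding q0_def L2_inner_self N1_def N2_def W_def N_def by simp
  also have "\<dots> = N1 + (N2 - pi\<^sup>2 / 4 * N) / \<epsilon>\<^sup>2 + (W + k * N) / \<epsilon>"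
    using eps_pos by (simp add: shift_def field_simps power2_eq_square)
  also have "\<dots> \<ge> coerc * N1 + coerc * (P / \<epsilon>\<^sup>2) + coerc * (N / \<epsilon>)"
  proof (intro add_mono)
    show "coerc * N1 \<le> N1" using mult_right_mono[OF coerc(2) nn(1)] by simp
    have "coerc * P \<le> N2 - pi\<^sup>2 / 4 * N" using mult_right_mono[OF coerc(3) nn(2)] G by linarith
    then show "coerc * (P / \<epsilon>\<^sup>2) \<le> (N2 - pi\<^sup>2 / 4 * N) / \<epsilon>\<^sup>2" using divide_right_mono[of _ _ "\<epsilon>\<^sup>2"] by fastforce
    have "coerc * N \<le> W + k * N" using mult_right_mono[OF coerc(4) nn(3)] W by (simp add: distrib_right)
    then show "coerc * (N / \<epsilon>) \<le> (W + k * N) / \<epsilon>" using divide_right_mono[of _ _ "\<epsilon>"] eps_pos by fastforce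
  qed
  finally show ?thesis unfolding energy_sq N1_def P_def N_def by (simp add: algebra_simps)
qed

lemma shift_coef: "coef_bound (\<lambda>x. 1 / \<epsilon> * \<kappa> (fst x) + shift * 1) (\<bar>1 / \<epsilon>\<bar> * K + \<bar>shift\<bar>)"
proof -
  have "\<bar>1 / \<epsilon> * \<kappa> (fst x) + shift * 1\<bar> \<le> \<bar>1 / \<epsilon>\<bar> * K + \<bar>shift\<bar>" if "x \<in> strip I" for x
  proof -
    have "\<bar>1 / \<epsilon> * \<kappa> (fst x)\<bar> \<le> \<bar>1 / \<epsilon>\<bar> * K" unfolding abs_mult
      by (rule mult_left_mono) (use that kappa_bound in auto)
    then show ?thesis using abs_triangle_ineq[of "1 / \<epsilon> * \<kappa> (fst x)" "shift * 1"] by simp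
  qed
  then show ?thesis using kappa_fst_meas K_nonneg by (auto simp: coef_bound_def)
qed

lemma winner_scale: "winner (\<lambda>x. c * w x) u v = of_real c * winner w u v"
  unfolding winner_def L2_inner_def by (simp add: mult.assoc)

lemma winner_1: "winner (\<lambda>_. 1) u v = L2_inner M u v"
  by (simp add: winner_def)

definition A0 :: "real \<times> real \<Rightarrow> real \<times> real \<Rightarrow> real" where
  "A0 e x = (if e = (1, 0) then 1 else 1 / \<epsilon>\<^sup>2 * 1)"

definition A1 :: "real \<times> real \<Rightarrow> real \<times> real \<Rightarrow> real" where
  "A1 e x = (if e = (1, 0) then 1 / h x else 1 / \<epsilon>\<^sup>2 * h x)"

lemma bounded_coef_scale: "bounded_coef U w \<Longrightarrow> bounded_coef U (\<lambda>x. c * w x)"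
proof -
  assume w: "bounded_coef U w"
  then obtain B where B: "0 \<le> B" "\<And>x. x \<in> U \<Longrightarrow> \<bar>w x\<bar> \<le> B" using bounded_coefE by blast
  have "\<bar>c * w x\<bar> \<le> \<bar>c\<bar> * B" if "x \<in> U" for x unfolding abs_mult by (rule mult_left_mono[OF B(2)[OF that]]) simp
  then show ?thesis using w unfolding bounded_coef_def by auto
qed

lemma bounded_coefs:
  "bounded_coef (strip I) (A0 e)" "bounded_coef (strip I) (A1 e)"
  "bounded_coef (strip I) (\<lambda>x. 1 / \<epsilon> * \<kappa> (fst x) + shift * 1)" "bounded_coef (strip I) (\<lambda>x. shift * h x)"
proof -
  note b = coef_bound_bounded_coef
  show "bounded_coef (strip I) (A0 e)" unfolding A0_def[abs_def]
    using b[OF coef_one] bounded_coef_scale[OF b[OF coef_one], of "1 / \<epsilon>\<^sup>2"] by (cases "e = (1, 0)") simp_all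
  show "bounded_coef (strip I) (A1 e)" unfolding A1_def[abs_def]
    using b[OF coef_inv_h] bounded_coef_scale[OF b[OF coef_h], of "1 / \<epsilon>\<^sup>2"] by (cases "e = (1, 0)") simp_all
qed (intro coef_bound_bounded_coef[OF shift_coef] bounded_coef_scale coef_bound_bounded_coef[OF coef_h])+

lemma q0_coef_form:
  assumes "u \<in> form_domain I" "v \<in> form_domain I"
  shows "q0 u v = coef_form (strip I) A0 (\<lambda>x. 1 / \<epsilon> * \<kappa> (fst x) + shift * 1) u v"
proof -
  have "winner (A0 (0, 1)) (d2 u) (d2 v) = of_real (1 / \<epsilon>\<^sup>2) * L2_inner M (d2 u) (d2 v)"
    using winner_scale[of "1 / \<epsilon>\<^sup>2" "\<lambda>_. 1"] by (simp add: A0_def[abs_def] winner_1)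
  moreover have "winner (A0 (1, 0)) (d1 u) (d1 v) = L2_inner M (d1 u) (d1 v)"
    by (simp add: A0_def[abs_def] winner_1)
  ultimately show ?thesis
    unfolding coef_form_winner q0_def
      winner_coef_lincomb[OF coef_kappa coef_one form_domain_L2(1)[OF assms(1)] form_domain_L2(1)[OF assms(2)]] winner_1
    by simp
qed

lemma q1_coef_form: "q1 u v = coef_form (strip I) A1 (\<lambda>x. shift * h x) u v"
proof -
  have "winner (A1 (0, 1)) (d2 u) (d2 v) = of_real (1 / \<epsilon>\<^sup>2) * winner h (d2 u) (d2 v)"
    using winner_scale[of "1 / \<epsilon>\<^sup>2" h] by (simp add: A1_def[abs_def])
  moreover have "winner (A1 (1, 0)) (d1 u) (d1 v) = winner (\<lambda>x. 1 / h x) (d1 u) (d1 v)"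
    by (simp add: A1_def[abs_def])
  ultimately show ?thesis unfolding coef_form_winner q1_def winner_scale by simp
qed

lemma q0_lincomb:
  assumes "u \<in> form_domain I" "v \<in> form_domain I" "w \<in> form_domain I"
  shows "q0 (\<lambda>x. a * u x + b * v x) w = a * q0 u w + b * q0 v w"
  unfolding q0_coef_form[OF form_domain_lincomb(1)[OF assms(1,2)] assms(3)] q0_coef_form[OF assms(1,3)] q0_coef_form[OF assms(2,3)]
  by (rule coef_form_lincomb[OF open_strip bounded_coefs(1,3) assms[THEN form_domain_W12]])

lemma q1_lincomb:
  assumes "u \<in> form_domain I" "v \<in> form_domain I" "w \<in> form_domain I"
  shows "q1 (\<lambda>x. a * u x + b * v x) w = a * q1 u w + b * q1 v w"
  unfolding q1_coef_form
  by (rule coef_form_lincomb[OF open_strip bounded_coefs(2,4) assms[THEN form_domain_W12]])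

definition solves0 :: "(real \<times> real \<Rightarrow> complex) \<Rightarrow> (real \<times> real \<Rightarrow> complex) \<Rightarrow> bool" where
  "solves0 f u \<longleftrightarrow> u \<in> form_domain I \<and> f \<in> L2 M \<and> (\<forall>v\<in>form_domain I. q0 u v = L2_inner M f v)"

text \<open>Here \<open>f\<close> is the datum after conjugation. In the weighted space it
  corresponds to \<open>f / sqrt h\<close>, and the weight \<open>h\<close> of the inner product
  turns this into \<open>sqrt h * f\<close>.\<close>

definition solves1 :: "(real \<times> real \<Rightarrow> complex) \<Rightarrow> (real \<times> real \<Rightarrow> complex) \<Rightarrow> bool" where
  "solves1 f u \<longleftrightarrow> u \<in> form_domain I \<and> f \<in> L2 M \<and>
     (\<forall>v\<in>form_domain I. q1 u v = winner (\<lambda>x. sqrt (h x)) f v)"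

lemma solves0_lincomb:
  assumes "solves0 f u" "solves0 g v"
  shows "solves0 (\<lambda>x. a * f x + b * g x) (\<lambda>x. a * u x + b * v x)"
  using assms unfolding solves0_def
  by (simp add: form_domain_lincomb L2_lincomb q0_lincomb L2_inner_lincomb_left form_domain_L2)

lemma solves1_lincomb:
  assumes "solves1 f u" "solves1 g v"
  shows "solves1 (\<lambda>x. a * f x + b * g x) (\<lambda>x. a * u x + b * v x)"
proof -
  have "winner (\<lambda>x. sqrt (h x)) (\<lambda>x. a * f x + b * g x) z = a * winner (\<lambda>x. sqrt (h x)) f z + b * winner (\<lambda>x. sqrt (h x)) g z"
    if z: "z \<in> form_domain I" for z
    using L2_inner_lincomb_left[OF coef_bound_L2(1)[OF coef_sqrt_h] coef_bound_L2(1)[OF coef_sqrt_h] form_domain_L2(1)[OF z], of f g a b] assms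
    unfolding winner_def solves1_def by (simp add: algebra_simps)
  then show ?thesis using assms unfolding solves1_def
    by (simp add: form_domain_lincomb L2_lincomb q1_lincomb)
qed

text \<open>Testing with \<open>u\<close> itself; the factor sqrt \<epsilon> is gained because the
  energy contains the squared norm of \<open>u\<close> divided by \<epsilon>.\<close>

lemma solves0_energy:
  assumes "solves0 f u"
  shows "energy u \<le> sqrt \<epsilon> / coerc * L2_norm M f"
proof (cases "energy u = 0")
  case True
  then show ?thesis using coerc(1) eps_pos by simp
next
  case False
  have u: "u \<in> form_domain I" and f: "f \<in> L2 M" and q: "q0 u u = L2_inner M f u" using assms by (auto simp: solves0_def)
  have "coerc * (energy u)\<^sup>2 \<le> L2_norm M f * L2_norm M u"
    using q0_coercive[OF u] complex_Re_le_cmod[of "L2_inner M f u"] L2_cauchy_schwarz[OF f form_domain_L2(1)[OF u]]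
    unfolding q by linarith
  also have "\<dots> \<le> L2_norm M f * (sqrt \<epsilon> * energy u)" by (intro mult_left_mono energy_bounds) simp
  finally have "coerc * energy u \<le> L2_norm M f * sqrt \<epsilon>"
    using False energy_nonneg[of u] by (simp add: power2_eq_square mult_le_cancel_right flip: mult.assoc)
  then show ?thesis using coerc(1) by (simp add: field_simps)
qed

text \<open>The energy lacks the first-mode part of \<open>d2 u\<close>, which is recovered from the
  norm of \<open>amp u\<close>; the 3 is a crude root of 1 + 4. With \<epsilon> \<le> 1 the
  constants do not depend on \<epsilon>.\<close>

lemma energy_controls:
  assumes u: "u \<in> form_domain I"
  shows "L2_norm M u \<le> energy u" "L2_norm M (d1 u) \<le> energy u" "L2_norm M (d2 u) \<le> 3 * energy u"
proof -
  have 1: "sqrt \<epsilon> * energy u \<le> 1 * energy u" "\<epsilon> * energy u \<le> 1 * energy u"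
    using eps_sqrt(4) eps_le_1 by (intro mult_right_mono; simp)+
  then show "L2_norm M u \<le> energy u" using energy_bounds(3)[of u] by simp
  show "L2_norm M (d1 u) \<le> energy u" by (rule energy_bounds)
  have "(L2_norm M (d2 u))\<^sup>2 = (L2_norm M (d_perp u))\<^sup>2 + pi\<^sup>2 / 4 * (L2_norm M1 (amp u))\<^sup>2"
    using d_perp_norm[OF u] by simp
  also have "\<dots> \<le> (energy u)\<^sup>2 + 4 * (energy u)\<^sup>2"
    using energy_bounds(2,3)[of u] 1 amp_norm[OF form_domain_L2(1)[OF u]] pi_sq_bound(1)
    by (intro add_mono mult_mono power_mono) auto
  also have "\<dots> \<le> (3 * energy u)\<^sup>2" by (simp add: power_mult_distrib)
  finally show "L2_norm M (d2 u) \<le> 3 * energy u" by (rule power2_le_imp_le) simp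
qed

text \<open>This carries the variational equation from the algebraic tensor graph to its closure.
  The energy estimate for differences makes the derivatives Cauchy, so the limit stays in the form
  domain and the forms converge.\<close>

lemma solves0_limit:
  assumes s: "\<And>n. solves0 (Y n) (U n)" and y: "y \<in> L2 M" "L2_conv M Y y" and u: "u \<in> L2 M" "L2_conv M U u"
  shows "solves0 y u"
proof -
  have UD: "U n \<in> form_domain I" and YL: "Y n \<in> L2 M" for n using s by (auto simp: solves0_def)
  have YC: "L2_Cauchy M Y" by (rule L2_conv_Cauchy[OF YL y])
  let ?X = "\<lambda>m n x. U m x - U n x"
  have XD: "?X m n \<in> form_domain I" for m n by (rule form_domain_diff[OF UD UD])
  have en: "energy (?X m n) \<le> sqrt \<epsilon> / coerc * L2_norm M (\<lambda>x. Y m x - Y n x)" for m n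
    using solves0_energy[OF solves0_lincomb[OF s[of m] s[of n], of 1 "-1"]] by simp
  note UW = form_domain_W12[OF UD]
  have C: "L2_Cauchy M (\<lambda>n. weak_deriv (strip I) e (U n))" if e: "e \<in> Basis" for e :: "real \<times> real"
  proof (rule L2_Cauchy_dominated[OF YC, of _ _ "3 * (sqrt \<epsilon> / coerc)"])
    fix m n
    have "L2_norm M (weak_deriv (strip I) e (?X m n)) \<le> 3 * energy (?X m n)"
    proof -
      consider "e = (1, 0)" | "e = (0, 1)" using e by (auto simp: Basis_real_prod)
      then show ?thesis
      proof cases
        case 1
        show ?thesis unfolding 1 using energy_controls(2)[OF XD[of m n]] energy_nonneg[of "?X m n"] by linarith
      next
        case 2
        show ?thesis unfolding 2 by (rule energy_controls(3)[OF XD[of m n]])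
      qed
    qed
    also have "\<dots> \<le> 3 * (sqrt \<epsilon> / coerc * L2_norm M (\<lambda>x. Y m x - Y n x))" by (rule mult_left_mono[OF en]) simp
    finally show "L2_norm M (\<lambda>x. weak_deriv (strip I) e (U m) x - weak_deriv (strip I) e (U n) x)
        \<le> 3 * (sqrt \<epsilon> / coerc) * L2_norm M (\<lambda>x. Y m x - Y n x)"
      unfolding L2_norm_weak_deriv_diff[OF open_strip UW UW e] by (simp only: mult.assoc)
  qed
  note cl = W12_zero_closed[OF open_strip UD[unfolded form_domain_eq] u C]
  have uD: "u \<in> form_domain I" using cl(1) by (simp add: form_domain_eq)
  have c: "L2_conv M U u" "L2_conv M (\<lambda>n. d1 (U n)) (d1 u)" "L2_conv M (\<lambda>n. d2 (U n)) (d2 u)"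
    using cl(2) Basis2 by (auto simp: W12_conv_def)
  have "q0 u v = L2_inner M y v" if v: "v \<in> form_domain I" for v
  proof -
    note UL = form_domain_L2[OF UD] and uL = form_domain_L2[OF uD] and vL = form_domain_L2[OF v]
    have kc: "L2_conv M (\<lambda>n x. of_real (\<kappa> (fst x)) * U n x) (\<lambda>x. of_real (\<kappa> (fst x)) * u x)"
      by (rule L2_conv_bounded_mult[OF UL(1) uL(1) c(1), of _ K]) (use kappa_fst_meas kappa_bound K_nonneg in auto)
    have "(\<lambda>n. q0 (U n) v) \<longlonglongrightarrow> q0 u v"
      unfolding q0_def winner_def
      by (intro tendsto_add tendsto_mult_left L2_conv_inner[OF UL(2) uL(2) c(2) vL(2) vL(2) L2_conv_const]
           L2_conv_inner[OF UL(3) uL(3) c(3) vL(3) vL(3) L2_conv_const]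
           L2_conv_inner[OF UL(1) uL(1) c(1) vL(1) vL(1) L2_conv_const]
           L2_conv_inner[OF coef_bound_L2(1)[OF coef_kappa UL(1)] coef_bound_L2(1)[OF coef_kappa uL(1)] kc vL(1) vL(1) L2_conv_const])
    moreover have "q0 (U n) v = L2_inner M (Y n) v" for n using s[of n] v by (simp add: solves0_def)
    moreover have "(\<lambda>n. L2_inner M (Y n) v) \<longlonglongrightarrow> L2_inner M y v"
      by (rule L2_conv_inner[OF YL y vL(1) vL(1) L2_conv_const])
    ultimately show ?thesis using LIMSEQ_unique by fastforce
  qed
  then show ?thesis using uD y by (simp add: solves0_def)
qed

definition tensor_graph :: "(real \<times> real) operator" where
  "tensor_graph = algebraic_tensor_sum (op_add_mult (neg_laplacian_1d I (frontier I)) (\<lambda>s. \<kappa> s / \<epsilon>))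
     (op_scale (1 / \<epsilon>\<^sup>2) (neg_laplacian_1d {0<..<1} {0}))"

lemma H_hat_0_eq: "H_hat_0 I \<kappa> \<epsilon> = op_closure M tensor_graph"
  by (simp add: H_hat_0_def tensor_sum_def tensor_graph_def strip_measure_def)

lemma kappa_mult_L2: "f \<in> L2 M1 \<Longrightarrow> (\<lambda>s. of_real (\<kappa> s / \<epsilon>) * f s) \<in> L2 M1"
proof (rule L2_bounded_mult[of _ _ _ "K / \<epsilon>"])
  show "(\<lambda>s. complex_of_real (\<kappa> s / \<epsilon>)) \<in> borel_measurable M1" using kappa_meas by simp
qed (use kappa_bound eps_pos in \<open>auto simp: norm_divide divide_right_mono\<close>)

text \<open>The four summands of the datum match the four terms of \<open>q0\<close>; the two
  derivative terms are the one-dimensional equations tensored with the other factor.\<close>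

lemma elementary_tensor_solves0:
  assumes f: "(f, F) \<in> neg_laplacian_1d I (frontier I)" and g: "(g, G) \<in> neg_laplacian_1d {0<..<1} {0}"
  shows "solves0 (\<lambda>x. tensor F g x + tensor (\<lambda>s. of_real (\<kappa> s / \<epsilon>) * f s) g x
      + of_real (1 / \<epsilon>\<^sup>2) * tensor f G x + of_real shift * tensor f g x) (tensor f g)"
  unfolding solves0_def
proof (intro conjI ballI)
  have fd: "f \<in> dirichlet_domain I (frontier I)" and gd: "g \<in> dirichlet_domain {0<..<1} {0}"
    and FL: "F \<in> L2 M1" and GL: "G \<in> L2 UI" using f g by (auto simp: neg_laplacian_1d_iff)
  have fL: "f \<in> L2 M1" "weak_deriv I 1 f \<in> L2 M1" and gL: "g \<in> L2 UI" "weak_deriv {0<..<1} 1 g \<in> L2 UI"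
    using W12_L2[OF dirichlet_domain_W12[OF fd]] W12_L2[OF dirichlet_domain_W12[OF gd]]
      weak_deriv_spec(1)[OF dirichlet_domain_W12[OF fd], of 1] weak_deriv_spec(1)[OF dirichlet_domain_W12[OF gd], of 1]
    by simp_all
  note t = tensor_form_domain[OF fd gd]
  show tD: "tensor f g \<in> form_domain I" by (rule t)
  have L: "tensor F g \<in> L2 M" "tensor (\<lambda>s. of_real (\<kappa> s / \<epsilon>) * f s) g \<in> L2 M" "tensor f G \<in> L2 M" "tensor f g \<in> L2 M"
    by (intro tensor_L2 FL GL fL gL kappa_mult_L2)+
  show "(\<lambda>x. tensor F g x + tensor (\<lambda>s. of_real (\<kappa> s / \<epsilon>) * f s) g x
      + of_real (1 / \<epsilon>\<^sup>2) * tensor f G x + of_real shift * tensor f g x) \<in> L2 M"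
    by (intro L2_add L2_scale L)
  fix v assume v: "v \<in> form_domain I"
  note vL = form_domain_L2[OF v]
  have 1: "L2_inner M (d1 (tensor f g)) (d1 v) = L2_inner M (tensor F g) v"
  proof -
    have "L2_inner M (d1 (tensor f g)) (d1 v) = L2_inner M (tensor (weak_deriv I 1 f) g) (d1 v)"
      by (rule L2_inner_AE_cong[OF t(2) AE_I2[OF refl]])
         (intro L2_measurable form_domain_L2 tD v tensor_L2 fL gL)+
    then show ?thesis using tensor_neg_laplacian_fst[OF f gL(1) v] by simp
  qed
  have 2: "L2_inner M (d2 (tensor f g)) (d2 v) = L2_inner M (tensor f G) v"
  proof -
    have "L2_inner M (d2 (tensor f g)) (d2 v) = L2_inner M (tensor f (weak_deriv {0<..<1} 1 g)) (d2 v)"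
      by (rule L2_inner_AE_cong[OF t(3) AE_I2[OF refl]])
         (intro L2_measurable form_domain_L2 tD v tensor_L2 fL gL)+
    then show ?thesis using tensor_neg_laplacian_snd[OF g fL(1) v] by simp
  qed
  have 3: "of_real (1 / \<epsilon>) * winner (\<lambda>x. \<kappa> (fst x)) (tensor f g) v = L2_inner M (tensor (\<lambda>s. of_real (\<kappa> s / \<epsilon>) * f s) g) v"
    unfolding winner_scale[symmetric] unfolding winner_def by (simp add: tensor_def[abs_def] mult_ac)
  have "L2_inner M (\<lambda>x. tensor F g x + tensor (\<lambda>s. of_real (\<kappa> s / \<epsilon>) * f s) g x
      + of_real (1 / \<epsilon>\<^sup>2) * tensor f G x + of_real shift * tensor f g x) v
    = L2_inner M (tensor F g) v + L2_inner M (tensor (\<lambda>s. of_real (\<kappa> s / \<epsilon>) * f s) g) v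
      + of_real (1 / \<epsilon>\<^sup>2) * L2_inner M (tensor f G) v + of_real shift * L2_inner M (tensor f g) v"
    using L2.q_lincomb[OF L2_add[OF L2_add[OF L(1,2)] L2_scale[OF L(3)]] L(4) vL(1), of 1 "of_real (1 / \<epsilon>\<^sup>2)" "of_real shift"]
      L2.q_lincomb[OF L2_add[OF L(1,2)] L(3) vL(1), of 1 "of_real (1 / \<epsilon>\<^sup>2)"]
      L2.q_lincomb[OF L(1,2) vL(1), of 1 1] by simp
  then show "q0 (tensor f g) v = L2_inner M (\<lambda>x. tensor F g x + tensor (\<lambda>s. of_real (\<kappa> s / \<epsilon>) * f s) g x
      + of_real (1 / \<epsilon>\<^sup>2) * tensor f G x + of_real shift * tensor f g x) v"
    unfolding q0_def 1 2 3 by simp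
qed

lemma solves0_sum:
  fixes n :: nat
  assumes "\<And>i. i < n \<Longrightarrow> solves0 (f i) (u i)"
  shows "solves0 (\<lambda>x. \<Sum>i<n. f i x) (\<lambda>x. \<Sum>i<n. u i x)"
  using assms
proof (induction n)
  case 0
  have z: "(\<lambda>_. 0) \<in> form_domain I"
  proof -
    \<comment> \<open>Any element of the domain will do: scaled by 0 it gives the zero
      function.\<close>
    obtain v where "v \<in> form_domain I"
      using tensor_form_domain(1)[OF test_dirichlet_domain[OF open_I finite_frontier test_zero] test_dirichlet_domain[OF _ _ test_zero]] by fastforce
    from form_domain_lincomb(1)[OF this this, of 0 0] show ?thesis by simp
  qed
  have "q0 (\<lambda>_. 0) v = 0" if "v \<in> form_domain I" for v using q0_lincomb[OF z z that, of 0 0] by simp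
  then show ?case using z by (simp add: solves0_def L2_inner_def)
next
  case (Suc n)
  show ?case using solves0_lincomb[OF Suc.IH Suc.prems[of n], of 1 1] Suc.prems by simp
qed

lemma tensor_graph_solves0:
  assumes "(u, F) \<in> tensor_graph"
  shows "solves0 (\<lambda>x. F x + of_real shift * u x) u"
proof -
  obtain n :: nat and f P g Q where 1: "u = (\<lambda>(s, t). \<Sum>i<n. f i s * g i t)" "F = (\<lambda>(s, t). \<Sum>i<n. P i s * g i t + f i s * Q i t)"
    "\<And>i. i < n \<Longrightarrow> (f i, P i) \<in> op_add_mult (neg_laplacian_1d I (frontier I)) (\<lambda>s. \<kappa> s / \<epsilon>)"
    "\<And>i. i < n \<Longrightarrow> (g i, Q i) \<in> op_scale (1 / \<epsilon>\<^sup>2) (neg_laplacian_1d {0<..<1} {0})"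
    using assms unfolding tensor_graph_def algebraic_tensor_sum_def by blast
  have "\<exists>F'. i < n \<longrightarrow> (f i, F') \<in> neg_laplacian_1d I (frontier I) \<and> P i = (\<lambda>s. F' s + of_real (\<kappa> s / \<epsilon>) * f i s)" for i
    using 1(3)[of i] unfolding op_add_mult_def by (cases "i < n") auto
  then obtain F' where F': "\<And>i. i < n \<Longrightarrow> (f i, F' i) \<in> neg_laplacian_1d I (frontier I)"
    "\<And>i. i < n \<Longrightarrow> P i = (\<lambda>s. F' i s + of_real (\<kappa> s / \<epsilon>) * f i s)" by metis
  have "\<exists>G'. i < n \<longrightarrow> (g i, G') \<in> neg_laplacian_1d {0<..<1} {0} \<and> Q i = (\<lambda>s. of_real (1 / \<epsilon>\<^sup>2) * G' s)" for i
    using 1(4)[of i] unfolding op_scale_def by (cases "i < n") auto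
  then obtain G' where G': "\<And>i. i < n \<Longrightarrow> (g i, G' i) \<in> neg_laplacian_1d {0<..<1} {0}"
    "\<And>i. i < n \<Longrightarrow> Q i = (\<lambda>s. of_real (1 / \<epsilon>\<^sup>2) * G' i s)" by metis
  have e: "(\<lambda>x. \<Sum>i<n. tensor (f i) (g i) x) = u"
    by (simp add: 1(1) fun_eq_iff)
  have "tensor (F' i) (g i) x + tensor (\<lambda>s. of_real (\<kappa> s / \<epsilon>) * f i s) (g i) x
      + of_real (1 / \<epsilon>\<^sup>2) * tensor (f i) (G' i) x + of_real shift * tensor (f i) (g i) x
    = P i (fst x) * g i (snd x) + f i (fst x) * Q i (snd x) + of_real shift * tensor (f i) (g i) x" if "i < n" for i x
    unfolding F'(2)[OF that] G'(2)[OF that] tensor_def by (simp add: algebra_simps)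
  then have "(\<Sum>i<n. tensor (F' i) (g i) x + tensor (\<lambda>s. of_real (\<kappa> s / \<epsilon>) * f i s) (g i) x
      + of_real (1 / \<epsilon>\<^sup>2) * tensor (f i) (G' i) x + of_real shift * tensor (f i) (g i) x) = F x + of_real shift * u x" for x
    unfolding 1(2) by (simp add: sum.distrib sum_distrib_left case_prod_beta' flip: e)
  moreover have "solves0 (\<lambda>x. \<Sum>i<n. tensor (F' i) (g i) x + tensor (\<lambda>s. of_real (\<kappa> s / \<epsilon>) * f i s) (g i) x
      + of_real (1 / \<epsilon>\<^sup>2) * tensor (f i) (G' i) x + of_real shift * tensor (f i) (g i) x) (\<lambda>x. \<Sum>i<n. tensor (f i) (g i) x)"
    by (intro solves0_sum elementary_tensor_solves0 F'(1) G'(1))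
  ultimately show ?thesis unfolding e by (simp only:)
qed

lemma tensor_graph_L2: "tensor_graph \<subseteq> L2 M \<times> L2 M"
proof safe
  fix u F assume "(u, F) \<in> tensor_graph"
  then have s: "solves0 (\<lambda>x. F x + of_real shift * u x) u" by (rule tensor_graph_solves0)
  then show u: "u \<in> L2 M" by (auto simp: solves0_def form_domain_L2)
  show "F \<in> L2 M" using L2_diff[of "\<lambda>x. F x + of_real shift * u x" M "\<lambda>x. of_real shift * u x"] L2_scale[OF u] s
    by (auto simp: solves0_def)
qed

lemma tensor_graph_lincomb:
  assumes "(u, F) \<in> tensor_graph" "(v, G) \<in> tensor_graph"
  shows "(\<lambda>x. a * u x + b * v x, \<lambda>x. a * F x + b * G x) \<in> tensor_graph"
  unfolding tensor_graph_def
proof (rule algebraic_tensor_sum_lincomb)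
  fix f F a assume "(f, F) \<in> op_add_mult (neg_laplacian_1d I (frontier I)) (\<lambda>s. \<kappa> s / \<epsilon>)"
  then obtain F' where F': "(f, F') \<in> neg_laplacian_1d I (frontier I)" "F = (\<lambda>s. F' s + of_real (\<kappa> s / \<epsilon>) * f s)"
    by (auto simp: op_add_mult_def)
  have "(\<lambda>x. a * f x, \<lambda>x. a * F' x) \<in> neg_laplacian_1d I (frontier I)"
    using neg_laplacian_1d_lincomb[OF open_I finite_frontier F'(1) F'(1), of a 0] by simp
  then have "(\<lambda>(u, f). (u, \<lambda>x. f x + of_real (\<kappa> x / \<epsilon>) * u x)) (\<lambda>x. a * f x, \<lambda>x. a * F' x) \<in> op_add_mult (neg_laplacian_1d I (frontier I)) (\<lambda>s. \<kappa> s / \<epsilon>)"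
    unfolding op_add_mult_def by (rule imageI)
  then show "(\<lambda>x. a * f x, \<lambda>x. a * F x) \<in> op_add_mult (neg_laplacian_1d I (frontier I)) (\<lambda>s. \<kappa> s / \<epsilon>)"
    by (simp add: F'(2) algebra_simps)
qed (use assms in \<open>simp_all add: tensor_graph_def\<close>)

text \<open>The inclusion on which the resolvent estimate rests: in the closure both the functions
  and their images converge, which is what \<open>solves0_limit\<close> asks for.\<close>

lemma H_hat_0_solves0:
  assumes "(u, F) \<in> H_hat_0 I \<kappa> \<epsilon>"
  shows "solves0 (\<lambda>x. F x + of_real shift * u x) u"
proof -
  obtain U G where U: "\<And>n. (U n, G n) \<in> tensor_graph" "L2_conv M U u" "L2_conv M G F" and L: "u \<in> L2 M" "F \<in> L2 M"
    using assms unfolding H_hat_0_eq op_closure_def by blast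
  have UL: "U n \<in> L2 M" "G n \<in> L2 M" for n using U(1) tensor_graph_L2 by blast+
  have "L2_conv M (\<lambda>n x. 1 * G n x + of_real shift * U n x) (\<lambda>x. 1 * F x + of_real shift * u x)"
    by (rule L2_conv_lincomb[OF UL(2) L(2) U(3) UL(1) L(1) U(2)])
  then show ?thesis
    using solves0_limit[OF tensor_graph_solves0[OF U(1)] L2_lincomb[OF L(2,1), of 1 "of_real shift"] _ L(1) U(2)] by simp
qed

end

section \<open>Surjectivity of the shifted comparison operator; the resolvents as variational
  problems\<close>

context curved_strip
begin

lemma mode_freq_lower: "pi\<^sup>2 / 4 \<le> (mode_freq j)\<^sup>2"
proof -
  have "(pi / 2)\<^sup>2 \<le> (mode_freq j)\<^sup>2"
    by (rule power_mono) (auto simp: mode_freq_def algebra_simps)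
  then show ?thesis by (simp add: power_divide)
qed

text \<open>Separation of variables: for the datum \<open>g\<close> times the mode \<open>j\<close>
  the equation reduces to one on \<open>I\<close> whose potential is
  \<open>\<kappa> / \<epsilon>\<close> plus a constant. Since every mode frequency is at least \<pi>
  / 2, this potential is at least (k + m) / \<epsilon>, and the one-dimensional form is
  coercive.\<close>

lemma longitudinal_solution:
  assumes g: "g \<in> L2 M1"
  obtains u where "(u, \<lambda>s. g s - of_real (\<kappa> s / \<epsilon> + ((mode_freq j)\<^sup>2 / \<epsilon>\<^sup>2 + shift)) * u s) \<in> neg_laplacian_1d I (frontier I)"
proof -
  let ?c = "(mode_freq j)\<^sup>2 / \<epsilon>\<^sup>2 + shift"
  define B where "B s = \<kappa> s / \<epsilon> + ?c" for s
  define c where "c = min 1 ((k + m) / \<epsilon>)"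
  have c: "0 < c" "c \<le> 1" "c \<le> (k + m) / \<epsilon>" using k_gt eps_pos by (auto simp: c_def)
  have Bm: "B \<in> borel_measurable M1" unfolding B_def[abs_def] using kappa_meas by simp
  have "\<bar>B s\<bar> \<le> K / \<epsilon> + \<bar>?c\<bar>" if "s \<in> I" for s
    using kappa_bound[OF that] eps_pos divide_right_mono[of "\<bar>\<kappa> s\<bar>" K \<epsilon>] abs_triangle_ineq[of "\<kappa> s / \<epsilon>" ?c]
    by (simp add: B_def abs_divide)
  then have Bb: "bounded_coef I B" unfolding bounded_coef_def using Bm by blast
  have B_low: "c \<le> B s" if "s \<in> I" for s
  proof -
    have "(pi\<^sup>2 / 4) / \<epsilon>\<^sup>2 \<le> (mode_freq j)\<^sup>2 / \<epsilon>\<^sup>2" by (rule divide_right_mono[OF mode_freq_lower]) simp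
    moreover have "m / \<epsilon> \<le> \<kappa> s / \<epsilon>" using kappa_lower[OF that] eps_pos by (intro divide_right_mono) auto
    moreover have "shift = k / \<epsilon> - (pi\<^sup>2 / 4) / \<epsilon>\<^sup>2" by (simp add: shift_def power_divide power_mult_distrib)
    ultimately show ?thesis using c(3) unfolding B_def add_divide_distrib by linarith
  qed
  have one: "bounded_coef I (\<lambda>_. 1)" by (auto simp: bounded_coef_def)
  have cf: "coef_form I (\<lambda>_ _. 1) B u v = L2_inner M1 (weak_deriv I 1 u) (weak_deriv I 1 v) + L2_inner M1 (\<lambda>s. of_real (B s) * u s) v" for u v
    by (simp add: coef_form_def)
  have "\<exists>u\<in>W12_zero I {count_space (frontier I)}. \<forall>v\<in>W12_zero I {count_space (frontier I)}.
      coef_form I (\<lambda>_ _. 1) B u v = L2_inner M1 g v"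
  proof (rule lax_milgram[OF open_I _ one Bb c(1) _ g])
    show "test_functions UNIV \<subseteq> L2 \<nu>" if "\<nu> \<in> {count_space (frontier I)}" for \<nu>
      using that test_L2_count_space[OF finite_frontier] by simp
    fix u assume "u \<in> W12_zero I {count_space (frontier I)}"
    then have u: "u \<in> L2 M1" by (intro W12_L2 W12_zero_W12)
    have "c * (L2_norm M1 u)\<^sup>2 \<le> Re (L2_inner M1 (\<lambda>s. of_real (B s) * u s) u)"
      by (rule L2_inner_lower[OF bounded_coef_L2[OF Bb u] u]) (simp add: B_low)
    moreover have "c * (L2_norm M1 (weak_deriv I 1 u))\<^sup>2 \<le> (L2_norm M1 (weak_deriv I 1 u))\<^sup>2"
      using mult_right_mono[OF c(2), of "(L2_norm M1 (weak_deriv I 1 u))\<^sup>2"] by simp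
    ultimately show "c * ((L2_norm M1 u)\<^sup>2 + (\<Sum>e\<in>Basis. (L2_norm M1 (weak_deriv I e u))\<^sup>2)) \<le> Re (coef_form I (\<lambda>_ _. 1) B u u)"
      unfolding cf by (simp add: L2_inner_self distrib_left)
  qed
  then obtain u where u: "u \<in> dirichlet_domain I (frontier I)"
    "\<And>v. v \<in> dirichlet_domain I (frontier I) \<Longrightarrow> L2_inner M1 (weak_deriv I 1 u) (weak_deriv I 1 v) + L2_inner M1 (\<lambda>s. of_real (B s) * u s) v = L2_inner M1 g v"
    unfolding cf dirichlet_domain_def by blast
  have BuL: "(\<lambda>s. of_real (B s) * u s) \<in> L2 M1" by (rule bounded_coef_L2[OF Bb W12_L2[OF dirichlet_domain_W12[OF u(1)]]])
  have "(u, \<lambda>s. g s - of_real (B s) * u s) \<in> neg_laplacian_1d I (frontier I)"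
    unfolding neg_laplacian_1d_iff
  proof (intro conjI ballI u(1) L2_diff g BuL)
    fix v assume v: "v \<in> dirichlet_domain I (frontier I)"
    show "L2_inner M1 (weak_deriv I 1 u) (weak_deriv I 1 v) = L2_inner M1 (\<lambda>s. g s - of_real (B s) * u s) v"
      unfolding L2.q_diff[OF g BuL W12_L2[OF dirichlet_domain_W12[OF v]]] eq_diff_eq by (rule u(2)[OF v])
  qed
  then show ?thesis using that by (simp add: B_def)
qed

definition range0 :: "(real \<times> real \<Rightarrow> complex) set" where
  "range0 = {f \<in> L2 M. \<exists>u. (u, \<lambda>x. f x - of_real shift * u x) \<in> op_closure M tensor_graph}"

text \<open>The solution is a single product, so it already lies in the algebraic tensor
  graph.\<close>

lemma tensor_mode_range0:
  assumes g: "g \<in> L2 M1"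
  shows "tensor g (unit_mode j) \<in> range0"
proof -
  let ?l = "(mode_freq j)\<^sup>2"
  obtain u where u: "(u, \<lambda>s. g s - of_real (\<kappa> s / \<epsilon> + (?l / \<epsilon>\<^sup>2 + shift)) * u s) \<in> neg_laplacian_1d I (frontier I)"
    using longitudinal_solution[OF g] by blast
  define P where "P s = g s - of_real (?l / \<epsilon>\<^sup>2 + shift) * u s" for s
  define Q where "Q t = of_real (1 / \<epsilon>\<^sup>2) * (of_real ?l * unit_mode j t)" for t
  have 1: "(u, P) \<in> op_add_mult (neg_laplacian_1d I (frontier I)) (\<lambda>s. \<kappa> s / \<epsilon>)"
  proof -
    have "(\<lambda>(u, f). (u, \<lambda>x. f x + of_real (\<kappa> x / \<epsilon>) * u x)) (u, \<lambda>s. g s - of_real (\<kappa> s / \<epsilon> + (?l / \<epsilon>\<^sup>2 + shift)) * u s)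
        \<in> op_add_mult (neg_laplacian_1d I (frontier I)) (\<lambda>s. \<kappa> s / \<epsilon>)"
      unfolding op_add_mult_def by (rule imageI[OF u])
    also have "(\<lambda>(u, f). (u, \<lambda>x. f x + of_real (\<kappa> x / \<epsilon>) * u x)) (u, \<lambda>s. g s - of_real (\<kappa> s / \<epsilon> + (?l / \<epsilon>\<^sup>2 + shift)) * u s) = (u, P)"
      unfolding prod.case P_def[abs_def] of_real_add by (simp add: fun_eq_iff algebra_simps)
    finally show ?thesis .
  qed
  have 2: "(unit_mode j, Q) \<in> op_scale (1 / \<epsilon>\<^sup>2) (neg_laplacian_1d {0<..<1} {0})"
    using imageI[OF unit_mode_neg_laplacian[of j], of "\<lambda>(u, f). (u, \<lambda>x. of_real (1 / \<epsilon>\<^sup>2) * f x)"]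
    unfolding op_scale_def Q_def[abs_def] by simp
  have "(\<lambda>(s, t). \<Sum>i<(1::nat). u s * unit_mode j t, \<lambda>(s, t). \<Sum>i<(1::nat). P s * unit_mode j t + u s * Q t) \<in> tensor_graph"
    unfolding tensor_graph_def algebraic_tensor_sum_def using 1 2
    by (intro CollectI exI[of _ "1::nat"] exI[of _ "\<lambda>_. u"] exI[of _ "\<lambda>_. P"] exI[of _ "\<lambda>_. unit_mode j"] exI[of _ "\<lambda>_. Q"]) simp
  also have "(\<lambda>(s, t). \<Sum>i<(1::nat). u s * unit_mode j t) = tensor u (unit_mode j)" by (simp add: fun_eq_iff)
  also have "(\<lambda>(s, t). \<Sum>i<(1::nat). P s * unit_mode j t + u s * Q t) = (\<lambda>x. tensor g (unit_mode j) x - of_real shift * tensor u (unit_mode j) x)"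
    by (simp add: fun_eq_iff P_def Q_def algebra_simps)
  finally have "(tensor u (unit_mode j), \<lambda>x. tensor g (unit_mode j) x - of_real shift * tensor u (unit_mode j) x) \<in> tensor_graph" .
  then have "(tensor u (unit_mode j), \<lambda>x. tensor g (unit_mode j) x - of_real shift * tensor u (unit_mode j) x) \<in> op_closure M tensor_graph"
    unfolding op_closure_def using tensor_graph_L2
    by (intro CollectI case_prodI conjI exI[of _ "\<lambda>_. tensor u (unit_mode j)"]
        exI[of _ "\<lambda>_ x. tensor g (unit_mode j) x - of_real shift * tensor u (unit_mode j) x"]) auto
  then show ?thesis unfolding range0_def using tensor_L2[OF g test_UI[OF unit_mode_test]] by blast
qed

text \<open>The coefficient functions \<open>b j\<close> vanish almost everywhere, as testing with
  \<open>b j\<close> itself shows. There are countably many of them, so almost every slice is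
  orthogonal to all modes and vanishes by \<open>unit_mode_complete\<close>.\<close>

lemma tensor_modes_total:
  assumes w: "w \<in> L2 M" and orth: "\<And>g j. g \<in> L2 M1 \<Longrightarrow> L2_inner M w (tensor g (unit_mode j)) = 0"
  shows "AE x in M. w x = 0"
proof -
  define b where "b j = partial_inner UI (unit_mode j) w" for j
  have mL: "unit_mode j \<in> L2 UI" for j by (rule test_UI[OF unit_mode_test])
  have bL: "b j \<in> L2 M1" for j unfolding b_def by (rule partial_inner_L2[OF w mL])
  have "AE s in M1. b j s = 0" for j
  proof -
    have "L2_inner M1 (b j) (b j) = 0"
      using orth[OF bL, of j j] inner_partial_inner[OF w mL bL, of j j] by (simp add: b_def)
    then show ?thesis using L2_norm_eq_0_iff[OF bL] by (simp add: L2_inner_self)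
  qed
  then have "AE s in M1. \<forall>j. b j s = 0" by (subst AE_all_countable) blast
  then have "AE s in M1. (L2_norm UI (\<lambda>t. w (s, t)))\<^sup>2 = 0"
    using AE_slice_L2[OF w]
  proof eventually_elim
    case (elim s)
    have "AE t in UI. w (s, t) = 0"
      by (rule unit_mode_complete[OF elim(2)]) (use elim(1) in \<open>simp add: b_def partial_inner_def\<close>)
    then show ?case using L2_norm_eq_0_iff[OF elim(2)] by simp
  qed
  then have "(L2_norm M w)\<^sup>2 = 0"
    unfolding L2_norm_slices(1)[OF w] by (rule integral_eq_zero_AE)
  then show ?thesis using L2_norm_eq_0_iff[OF w] by simp
qed

lemma range0_solution:
  assumes "(u, \<lambda>x. f x - of_real shift * u x) \<in> op_closure M tensor_graph"
  shows "solves0 f u"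
  using H_hat_0_solves0[unfolded H_hat_0_eq, OF assms] by simp

text \<open>The range is closed by coercivity and dense by completeness of the transversal modes.\<close>

lemma range0_eq: "range0 = L2 M"
proof
  show "range0 \<subseteq> L2 M" by (auto simp: range0_def)
  have lin: "(\<lambda>x. a * f x + b * g x) \<in> range0" if f: "f \<in> range0" and g: "g \<in> range0" for f g a b
  proof -
    obtain u where u: "(u, \<lambda>x. f x - of_real shift * u x) \<in> op_closure M tensor_graph" using f by (auto simp: range0_def)
    obtain v where v: "(v, \<lambda>x. g x - of_real shift * v x) \<in> op_closure M tensor_graph" using g by (auto simp: range0_def)
    have "(\<lambda>x. a * u x + b * v x, \<lambda>x. a * (f x - of_real shift * u x) + b * (g x - of_real shift * v x)) \<in> op_closure M tensor_graph"
      by (rule op_closure_lincomb[OF tensor_graph_L2 tensor_graph_lincomb u v])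
    moreover have "a * (f x - of_real shift * u x) + b * (g x - of_real shift * v x)
       = (a * f x + b * g x) - of_real shift * (a * u x + b * v x)" for x by (simp add: algebra_simps)
    ultimately show ?thesis using f g L2_lincomb unfolding range0_def by auto
  qed
  interpret V: semi_inner range0 "L2_inner M"
  proof
    show "(\<lambda>x. a * u x + b * v x) \<in> range0" if "u \<in> range0" "v \<in> range0" for u v a b by (rule lin[OF that])
    show "L2_inner M v u = cnj (L2_inner M u v)" for u v by (rule L2_inner_commute)
  qed (auto simp: range0_def L2_inner_lincomb_left L2_inner_self)
  show "L2 M \<subseteq> range0"
  proof
    fix f assume f: "f \<in> L2 M"
    \<comment> \<open>The Riesz representative is the orthogonal projection of \<open>f\<close> on
      the range; its existence is where closedness enters.\<close>
    have "\<exists>p\<in>range0. \<forall>v\<in>range0. L2_inner M v p = L2_inner M v f"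
    proof (rule V.riesz)
      show "(\<lambda>_. 0) \<in> range0" using tensor_mode_range0[OF L2_zero, of 0] by (simp add: tensor_def[abs_def])
      show "L2_inner M (\<lambda>x. a * u x + b * v x) f = a * L2_inner M u f + b * L2_inner M v f"
        if "u \<in> range0" "v \<in> range0" for u v a b
        using that f by (intro L2_inner_lincomb_left) (auto simp: range0_def)
      show "norm (L2_inner M u f) \<le> L2_norm M f * sqrt (Re (L2_inner M u u))" if "u \<in> range0" for u
        using L2_cauchy_schwarz[of u M f] that f by (simp add: range0_def L2_inner_self mult.commute)
      fix U :: "nat \<Rightarrow> real \<times> real \<Rightarrow> complex" assume U: "\<And>n. U n \<in> range0"
        and C: "\<And>e. 0 < e \<Longrightarrow> \<exists>N. \<forall>m\<ge>N. \<forall>n\<ge>N. Re (L2_inner M (\<lambda>x. U m x - U n x) (\<lambda>x. U m x - U n x)) < e"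
      have UL: "U n \<in> L2 M" for n using U by (simp add: range0_def)
      have UC: "L2_Cauchy M U" unfolding L2_Cauchy_def
      proof safe
        fix e :: real assume e: "0 < e"
        then obtain N where N: "\<And>m n. m \<ge> N \<Longrightarrow> n \<ge> N \<Longrightarrow> (L2_norm M (\<lambda>x. U m x - U n x))\<^sup>2 < e\<^sup>2"
          using C[of "e\<^sup>2"] by (auto simp: L2_inner_self)
        have "L2_norm M (\<lambda>x. U m x - U n x) < e" if "m \<ge> N" "n \<ge> N" for m n
          using power2_less_imp_less[OF N[OF that]] e by simp
        then show "\<exists>N. \<forall>m\<ge>N. \<forall>n\<ge>N. L2_norm M (\<lambda>x. U m x - U n x) < e" by blast
      qed
      obtain y where y: "y \<in> L2 M" "L2_conv M U y" using L2_complete[OF UL UC] by blast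
      have "\<forall>n. \<exists>u. (u, \<lambda>x. U n x - of_real shift * u x) \<in> op_closure M tensor_graph" using U by (auto simp: range0_def)
      from choice[OF this] obtain u where u: "\<And>n. (u n, \<lambda>x. U n x - of_real shift * u n x) \<in> op_closure M tensor_graph" by blast
      have s: "solves0 (U n) (u n)" for n by (rule range0_solution[OF u])
      have uL: "u n \<in> L2 M" for n using s[of n] by (auto simp: solves0_def form_domain_L2)
      have "L2_Cauchy M u"
      proof (rule L2_Cauchy_dominated[OF UC, of _ _ "sqrt \<epsilon> / coerc"])
        fix m n
        have d: "solves0 (\<lambda>x. U m x - U n x) (\<lambda>x. u m x - u n x)"
          using solves0_lincomb[OF s[of m] s[of n], of 1 "-1"] by simp
        then have "L2_norm M (\<lambda>x. u m x - u n x) \<le> energy (\<lambda>x. u m x - u n x)"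
          by (intro energy_controls) (simp add: solves0_def)
        also have "\<dots> \<le> sqrt \<epsilon> / coerc * L2_norm M (\<lambda>x. U m x - U n x)" by (rule solves0_energy[OF d])
        finally show "L2_norm M (\<lambda>x. u m x - u n x) \<le> sqrt \<epsilon> / coerc * L2_norm M (\<lambda>x. U m x - U n x)" .
      qed
      from L2_complete[OF uL this] obtain z where z: "z \<in> L2 M" "L2_conv M u z" by blast
      have "L2_conv M (\<lambda>n x. 1 * U n x + (- of_real shift) * u n x) (\<lambda>x. 1 * y x + (- of_real shift) * z x)"
        by (rule L2_conv_lincomb[OF UL y uL z])
      then have c: "L2_conv M (\<lambda>n x. U n x - of_real shift * u n x) (\<lambda>x. y x - of_real shift * z x)" by simp
      have "(z, \<lambda>x. y x - of_real shift * z x) \<in> op_closure M tensor_graph"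
        by (rule op_closure_closed[OF tensor_graph_L2 u z(1) L2_diff[OF y(1) L2_scale[OF z(1)]] z(2) c])
      then have "y \<in> range0" using y by (auto simp: range0_def)
      then show "\<exists>y\<in>range0. (\<lambda>n. Re (L2_inner M (\<lambda>x. U n x - y x) (\<lambda>x. U n x - y x))) \<longlonglongrightarrow> 0"
        using tendsto_power[OF y(2), of 2] by (auto simp: L2_inner_self simp del: of_real_power)
    qed
    then obtain p where p: "p \<in> range0" "\<And>v. v \<in> range0 \<Longrightarrow> L2_inner M v p = L2_inner M v f" by blast
    have pL: "p \<in> L2 M" using p(1) by (simp add: range0_def)
    have "AE x in M. p x - f x = 0"
    proof (rule tensor_modes_total[OF L2_diff[OF pL f]])
      fix g j assume "g \<in> L2 M1"
      then have t: "tensor g (unit_mode j) \<in> range0" by (rule tensor_mode_range0)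
      then have tL: "tensor g (unit_mode j) \<in> L2 M" by (simp add: range0_def)
      show "L2_inner M (\<lambda>x. p x - f x) (tensor g (unit_mode j)) = 0"
        unfolding L2.q_diff[OF pL f tL] using p(2)[OF t] L2_inner_commute[of M p] L2_inner_commute[of M f] by simp
    qed
    then have n0: "L2_norm M (\<lambda>x. p x - f x) = 0" using L2_norm_eq_0_iff[OF L2_diff[OF pL f]] by blast
    obtain u where u: "(u, \<lambda>x. p x - of_real shift * u x) \<in> op_closure M tensor_graph" using p(1) by (auto simp: range0_def)
    then have uL: "u \<in> L2 M" by (auto simp: op_closure_def)
    \<comment> \<open>\<open>p\<close> and \<open>f\<close> agree only almost everywhere; the
      closure contains all representatives, as a constant sequence shows.\<close>
    have "(u, \<lambda>x. f x - of_real shift * u x) \<in> op_closure M tensor_graph"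
      by (rule op_closure_closed[OF tensor_graph_L2 u uL L2_diff[OF f L2_scale[OF uL]] L2_conv_const]) (simp add: n0)
    then show "f \<in> range0" using f by (auto simp: range0_def)
  qed
qed

lemma resolvent0_iff:
  "(f, u) \<in> shifted_inverse k \<epsilon> (H_hat_0 I \<kappa> \<epsilon>) \<longleftrightarrow> (u, \<lambda>x. f x - of_real shift * u x) \<in> op_closure M tensor_graph"
  unfolding shifted_inverse_iff H_hat_0_eq shift_def ..

lemma bounded_resolvent0: "bounded_operator M (shifted_inverse k \<epsilon> (H_hat_0 I \<kappa> \<epsilon>))"
proof -
  let ?R = "shifted_inverse k \<epsilon> (H_hat_0 I \<kappa> \<epsilon>)"
  have s: "solves0 f u" if "(f, u) \<in> ?R" for f u
    using that unfolding resolvent0_iff by (rule range0_solution)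
  have sub: "?R \<subseteq> L2 M \<times> L2 M" using s by (fastforce simp: solves0_def form_domain_L2)
  have dom: "Domain ?R = L2 M"
  proof
    show "Domain ?R \<subseteq> L2 M" using sub by blast
    show "L2 M \<subseteq> Domain ?R" unfolding range0_eq[symmetric] by (auto simp: range0_def Domain_iff resolvent0_iff)
  qed
  have lin: "(\<lambda>x. a * f x + b * g x, \<lambda>x. a * u x + b * v x) \<in> ?R" if "(f, u) \<in> ?R" "(g, v) \<in> ?R" for f u g v a b
  proof -
    have "(\<lambda>x. a * u x + b * v x, \<lambda>x. a * (f x - of_real shift * u x) + b * (g x - of_real shift * v x)) \<in> op_closure M tensor_graph"
      by (rule op_closure_lincomb[OF tensor_graph_L2 tensor_graph_lincomb that[unfolded resolvent0_iff]])
    moreover have "a * (f x - of_real shift * u x) + b * (g x - of_real shift * v x)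
       = (a * f x + b * g x) - of_real shift * (a * u x + b * v x)" for x by (simp add: algebra_simps)
    ultimately show ?thesis unfolding resolvent0_iff by simp
  qed
  have "L2_norm M u \<le> sqrt \<epsilon> / coerc * L2_norm M f" if "(f, u) \<in> ?R" for f u
    using solves0_energy[OF s[OF that]] energy_controls(1)[of u] s[OF that] by (auto simp: solves0_def)
  then show ?thesis unfolding bounded_operator_def using sub dom lin by blast
qed

lemma winner_lincomb_left:
  assumes "coef_bound w B" "u \<in> L2 M" "v \<in> L2 M" "z \<in> L2 M"
  shows "winner w (\<lambda>x. a * u x + b * v x) z = a * winner w u z + b * winner w v z"
  unfolding winner_def
  using L2_inner_lincomb_left[OF coef_bound_L2(1)[OF assms(1,2)] coef_bound_L2(1)[OF assms(1,3)] assms(4), of a b]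
  by (simp add: algebra_simps)

lemma Q_form_eq: "Q_form I \<kappa> \<epsilon> u v = q1 u v - of_real shift * winner h u v"
proof -
  have 1: "(LINT x|M. d1 u x * cnj (d1 v x) / of_real (h x)) = winner (\<lambda>x. 1 / h x) (d1 u) (d1 v)"
    unfolding winner_def L2_inner_def by (simp add: field_simps)
  have 2: "(LINT x|M. d2 u x * cnj (d2 v x) / of_real (\<epsilon>\<^sup>2) * of_real (h x)) = of_real (1 / \<epsilon>\<^sup>2) * winner h (d2 u) (d2 v)"
  proof -
    have "(LINT x|M. d2 u x * cnj (d2 v x) / of_real (\<epsilon>\<^sup>2) * of_real (h x))
        = (LINT x|M. of_real (1 / \<epsilon>\<^sup>2) * ((of_real (h x) * d2 u x) * cnj (d2 v x)))"
      by (rule Bochner_Integration.integral_cong) (auto simp: field_simps)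
    then show ?thesis unfolding winner_def L2_inner_def by simp
  qed
  show ?thesis unfolding Q_form_def strip_measure_def 1 2 q1_def by simp
qed

abbreviation Mh :: "(real \<times> real) measure" where
  "Mh \<equiv> weighted_strip_measure I \<kappa> \<epsilon>"

lemma weighted_inner:
  assumes "f \<in> borel_measurable M" "v \<in> borel_measurable M"
  shows "L2_inner Mh f v = winner h f v"
proof -
  have "L2_inner Mh f v = (LINT x|M. h x *\<^sub>R (f x * cnj (v x)))"
    unfolding L2_inner_def weighted_strip_measure_def strip_measure_def
    by (rule integral_density) (use assms h_meas h_bounds(4) in \<open>auto intro!: AE_I2 less_imp_le\<close>)
  then show ?thesis unfolding winner_def L2_inner_def by (simp add: scaleR_conv_of_real mult.assoc)
qed

lemma winner_sqrt_cong:
  assumes a: "AE x in M. g x = of_real (sqrt (h x)) * f x" and m: "f \<in> borel_measurable M" "g \<in> borel_measurable M" "v \<in> borel_measurable M"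
  shows "winner h f v = winner (\<lambda>x. sqrt (h x)) g v"
  unfolding winner_def L2_inner_def
proof (rule integral_cong_AE)
  show "AE x in M. of_real (h x) * f x * cnj (v x) = of_real (sqrt (h x)) * g x * cnj (v x)"
    using a AE_space
  proof eventually_elim
    case (elim x)
    then have "0 < h x" using h_bounds(4) by simp
    then have "complex_of_real (h x) = of_real (sqrt (h x)) * of_real (sqrt (h x))"
      by (simp flip: of_real_mult)
    then show ?case using elim(1) by (simp add: mult.assoc)
  qed
qed (use m h_meas in auto)

text \<open>The conjugation is undone by \<open>w = u / sqrt h\<close>. The shift moves from the
  datum into the form, because weighting \<open>w\<close> by \<open>h\<close> amounts to weighting
  \<open>u\<close> by \<open>sqrt h\<close>.\<close>

lemma resolvent1_iff:
  "(f, u) \<in> shifted_inverse k \<epsilon> (H_hat_eps I \<kappa> \<epsilon>) \<longleftrightarrow>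
    f \<in> L2 M \<and> u \<in> L2 M \<and> (\<exists>w. solves1 f w \<and> (AE x in M. u x = of_real (sqrt (h x)) * w x))"
  (is "?L \<longleftrightarrow> ?R")
proof -
  define g where "g x = f x - of_real shift * u x" for x
  have f_eq: "f = (\<lambda>x. 1 * g x + of_real shift * u x)" by (simp add: g_def fun_eq_iff)
  have L_iff: "?L \<longleftrightarrow> (u, g) \<in> H_hat_eps I \<kappa> \<epsilon>"
    unfolding shifted_inverse_iff g_def[abs_def] shift_def ..
  have key: "q1 w v - of_real shift * winner h w v = L2_inner Mh p v
      \<longleftrightarrow> q1 w v = winner (\<lambda>x. sqrt (h x)) f v"
    if gu: "g \<in> L2 M" "u \<in> L2 M" and w: "w \<in> form_domain I" and p: "p \<in> borel_measurable M"
      and AE1: "AE x in M. u x = of_real (sqrt (h x)) * w x" and AE2: "AE x in M. g x = of_real (sqrt (h x)) * p x"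
      and v: "v \<in> form_domain I" for w p v
  proof -
    note vL = form_domain_L2(1)[OF v]
    have "L2_inner Mh p v = winner (\<lambda>x. sqrt (h x)) g v"
      using weighted_inner[OF p L2_measurable[OF vL]] winner_sqrt_cong[OF AE2 p L2_measurable[OF gu(1)] L2_measurable[OF vL]] by simp
    moreover have "winner h w v = winner (\<lambda>x. sqrt (h x)) u v"
      by (rule winner_sqrt_cong[OF AE1 L2_measurable[OF form_domain_L2(1)[OF w]] L2_measurable[OF gu(2)] L2_measurable[OF vL]])
    moreover have "winner (\<lambda>x. sqrt (h x)) f v = winner (\<lambda>x. sqrt (h x)) g v + of_real shift * winner (\<lambda>x. sqrt (h x)) u v"
      using winner_lincomb_left[OF coef_sqrt_h gu vL, of 1 "of_real shift"] unfolding f_eq by simp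
    ultimately show ?thesis by (auto simp: algebra_simps)
  qed
  have meas_iff: "p \<in> borel_measurable Mh \<longleftrightarrow> p \<in> borel_measurable M" for p :: "real \<times> real \<Rightarrow> complex"
    by (simp add: weighted_strip_measure_def strip_measure_def)
  show ?thesis
  proof
    assume ?L
    then have "(u, g) \<in> H_hat_eps I \<kappa> \<epsilon>" unfolding L_iff .
    then obtain w p where wp: "(w, p) \<in> H_eps I \<kappa> \<epsilon>" "AE x in M. u x = of_real (sqrt (h x)) * w x"
      "AE x in M. g x = of_real (sqrt (h x)) * p x" and gu: "g \<in> L2 M" "u \<in> L2 M"
      unfolding H_hat_eps_def strip_measure_def by blast
    have w: "w \<in> form_domain I" and p: "p \<in> L2 Mh" and q: "\<And>v. v \<in> form_domain I \<Longrightarrow> Q_form I \<kappa> \<epsilon> w v = L2_inner Mh p v"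
      using wp(1) by (auto simp: H_eps_def form_operator_def)
    have pm: "p \<in> borel_measurable M" using L2_measurable[OF p] meas_iff by blast
    have fL: "f \<in> L2 M" unfolding f_eq by (rule L2_lincomb[OF gu])
    have "solves1 f w" unfolding solves1_def
      using w fL q key[OF gu w pm wp(2,3)] unfolding Q_form_eq by blast
    then show ?R using fL gu(2) wp(2) by blast
  next
    assume ?R
    then obtain w where fL: "f \<in> L2 M" and uL: "u \<in> L2 M" and s: "solves1 f w" and AE1: "AE x in M. u x = of_real (sqrt (h x)) * w x" by blast
    have gL: "g \<in> L2 M" unfolding g_def[abs_def] by (intro L2_diff fL L2_scale uL)
    have w: "w \<in> form_domain I" using s by (simp add: solves1_def)
    \<comment> \<open>The preimage of \<open>g\<close> under the conjugation; it lies in the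
      weighted space because \<open>h\<close> times its squared modulus is that of
      \<open>g\<close>.\<close>
    define p where "p x = g x / of_real (sqrt (h x))" for x
    have pm: "p \<in> borel_measurable M" unfolding p_def[abs_def] using L2_measurable[OF gL] h_meas by simp
    have AE2: "AE x in M. g x = of_real (sqrt (h x)) * p x"
      by (rule AE_I2) (use h_bounds(4) in \<open>force simp: p_def\<close>)
    have "integrable M (\<lambda>x. h x *\<^sub>R (norm (p x))\<^sup>2) \<longleftrightarrow> integrable M (\<lambda>x. (norm (g x))\<^sup>2)"
    proof (rule Bochner_Integration.integrable_cong[OF refl])
      fix x assume "x \<in> space M"
      then have "0 < h x" using h_bounds(4) by simp
      then show "h x *\<^sub>R (norm (p x))\<^sup>2 = (norm (g x))\<^sup>2" by (simp add: p_def norm_divide power_divide)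
    qed
    then have "integrable Mh (\<lambda>x. (norm (p x))\<^sup>2)"
      unfolding weighted_strip_measure_def strip_measure_def using L2_integrable[OF gL]
      by (subst integrable_density) (use pm h_meas h_bounds(4) in \<open>auto intro!: AE_I2 less_imp_le\<close>)
    then have pL: "p \<in> L2 Mh" unfolding L2_def using pm meas_iff by simp
    have "(w, p) \<in> H_eps I \<kappa> \<epsilon>"
      unfolding H_eps_def form_operator_def using w pL key[OF gL uL w pm AE1 AE2] s
      by (auto simp: Q_form_eq solves1_def)
    then have "(u, g) \<in> H_hat_eps I \<kappa> \<epsilon>" unfolding H_hat_eps_def strip_measure_def using uL gL AE1 AE2 by blast
    then show ?L unfolding L_iff .
  qed
qed

end

section \<open>The resolvent estimate for small \<epsilon>\<close>

locale small_strip = curved_strip +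
  assumes small: "form_const * sqrt \<epsilon> \<le> coerc / 2"
begin

text \<open>The assumption of the locale bounds the form difference by half of the coercivity of
  \<open>q0\<close>; the other half remains.\<close>

lemma q1_coercive:
  assumes u: "u \<in> form_domain I"
  shows "coerc / 2 * (energy u)\<^sup>2 \<le> Re (q1 u u)"
proof -
  have "Re (q0 u u - q1 u u) \<le> form_const * sqrt \<epsilon> * (energy u * energy u)"
    using form_difference[OF u u] complex_Re_le_cmod order_trans by blast
  also have "\<dots> \<le> coerc / 2 * (energy u * energy u)" by (rule mult_right_mono[OF small]) simp
  finally show ?thesis using q0_coercive[OF u] by (simp add: power2_eq_square)
qed

text \<open>Compared with \<open>solves0_energy\<close>, one factor 2 comes from the halved
  coercivity and another from the bound 2 on \<open>sqrt h\<close>.\<close>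

lemma solves1_energy:
  assumes "solves1 f u"
  shows "energy u \<le> 4 * sqrt \<epsilon> / coerc * L2_norm M f"
proof (cases "energy u = 0")
  case True
  then show ?thesis using coerc(1) eps_pos by simp
next
  case False
  have u: "u \<in> form_domain I" and f: "f \<in> L2 M" and q: "q1 u u = winner (\<lambda>x. sqrt (h x)) f u" using assms by (auto simp: solves1_def)
  have "coerc / 2 * (energy u)\<^sup>2 \<le> 2 * (L2_norm M f * L2_norm M u)"
    using q1_coercive[OF u] complex_Re_le_cmod[of "winner (\<lambda>x. sqrt (h x)) f u"] winner_bound[OF coef_sqrt_h f form_domain_L2(1)[OF u]]
    unfolding q by linarith
  also have "\<dots> \<le> 2 * (L2_norm M f * (sqrt \<epsilon> * energy u))" by (intro mult_left_mono energy_bounds) auto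
  finally have "(coerc * energy u) * energy u \<le> (4 * sqrt \<epsilon> * L2_norm M f) * energy u"
    by (simp add: power2_eq_square mult_ac)
  then have "coerc * energy u \<le> 4 * sqrt \<epsilon> * L2_norm M f"
    using False energy_nonneg[of u] by (simp add: mult_le_cancel_right)
  then show ?thesis using coerc(1) by (simp add: field_simps)
qed

text \<open>The first summand bounds the difference of the two variational solutions, with
  \<open>K\<close> from \<open>sqrt h - 1\<close> on the datum and \<open>form_const / coerc\<close>
  from the form difference. The second accounts for the factor \<open>sqrt h\<close> in front of the
  solution.\<close>

definition rate :: real where
  "rate = 2 / coerc * (K + form_const / coerc) + 4 * K / coerc"

lemma rate_nonneg: "0 \<le> rate"
  using coerc(1) K_nonneg by (simp add: rate_def form_const_def)

text \<open>Both solutions are tested with their difference \<open>u - w\<close>; the factor \<open>sqrt h\<close> only acts in \<open>L2\<close>,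
  so it is never differentiated.\<close>

lemma resolvent_difference:
  assumes s1: "solves1 g u" and s0: "solves0 g w"
  shows "L2_norm M (\<lambda>x. of_real (sqrt (h x)) * u x - w x) \<le> rate * (\<epsilon> * sqrt \<epsilon>) * L2_norm M g"
proof -
  have u: "u \<in> form_domain I" and w: "w \<in> form_domain I" and g: "g \<in> L2 M" using s1 s0 by (auto simp: solves1_def solves0_def)
  define e where "e x = u x - w x" for x
  have e: "e \<in> form_domain I" unfolding e_def[abs_def] by (rule form_domain_diff[OF u w])
  note uL = form_domain_L2(1)[OF u] and eL = form_domain_L2(1)[OF e]
  define G where "G = L2_norm M g"
  have G0: "0 \<le> G" by (simp add: G_def)
  \<comment> \<open>Error equation: \<open>w\<close> solves the problem of \<open>q0\<close>, so
    inserting it in \<open>q1\<close> leaves the form difference as a defect, besides the mismatch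
    of the data.\<close>
  have "q1 e e = q1 u e - q1 w e" using q1_lincomb[OF u w e, of 1 "-1"] by (simp add: e_def[abs_def])
  also have "\<dots> = winner (\<lambda>x. sqrt (h x)) g e - L2_inner M g e + (q0 w e - q1 w e)"
    using s1 s0 e by (simp add: solves1_def solves0_def)
  also have "winner (\<lambda>x. sqrt (h x)) g e - L2_inner M g e = winner (\<lambda>x. sqrt (h x) - 1) g e"
    using winner_coef_lincomb[OF coef_sqrt_h coef_one g eL, of 1 "-1"] by (simp add: winner_1)
  finally have q: "q1 e e = winner (\<lambda>x. sqrt (h x) - 1) g e + (q0 w e - q1 w e)" .
  have ew: "energy w \<le> sqrt \<epsilon> / coerc * G" unfolding G_def by (rule solves0_energy[OF s0])
  have "coerc / 2 * (energy e)\<^sup>2 \<le> norm (q1 e e)"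
    using q1_coercive[OF e] complex_Re_le_cmod order_trans by blast
  also have "\<dots> \<le> \<epsilon> * K * (G * L2_norm M e) + form_const * sqrt \<epsilon> * (energy w * energy e)"
    unfolding q G_def by (intro norm_triangle_mono winner_bound[OF coef_sqrt_h_minus_1 g eL] form_difference[OF w e])
  also have "\<dots> \<le> \<epsilon> * K * (G * energy e) + form_const * sqrt \<epsilon> * ((sqrt \<epsilon> / coerc * G) * energy e)"
    using energy_controls(1)[OF e] ew G0 eps_pos K_nonneg
    by (intro add_mono mult_left_mono mult_right_mono) (auto simp: form_const_def)
  also have "\<dots> = (\<epsilon> * (K + form_const / coerc) * G) * energy e"
    using eps_sqrt(2) by (simp add: algebra_simps)
  finally have *: "coerc / 2 * (energy e * energy e) \<le> (\<epsilon> * (K + form_const / coerc) * G) * energy e"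
    by (simp add: power2_eq_square)
  have ee: "energy e \<le> 2 / coerc * (K + form_const / coerc) * \<epsilon> * G"
  proof (cases "energy e = 0")
    case True
    then show ?thesis using coerc(1) K_nonneg eps_pos G0 by (simp add: form_const_def)
  next
    case False
    have "(coerc / 2 * energy e) * energy e \<le> (\<epsilon> * (K + form_const / coerc) * G) * energy e"
      using * by (simp only: mult.assoc)
    then have "coerc / 2 * energy e \<le> \<epsilon> * (K + form_const / coerc) * G"
      using False energy_nonneg[of e] by (simp add: mult_le_cancel_right)
    then show ?thesis using coerc(1) by (simp add: field_simps)
  qed
  have E: "L2_norm M e \<le> 2 / coerc * (K + form_const / coerc) * (\<epsilon> * sqrt \<epsilon>) * G"
  proof -
    have "L2_norm M e \<le> sqrt \<epsilon> * (2 / coerc * (K + form_const / coerc) * \<epsilon> * G)"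
      using energy_bounds(3)[of e] mult_left_mono[OF ee eps_sqrt(3)] by linarith
    then show ?thesis by (simp add: mult_ac)
  qed
  have "L2_norm M (\<lambda>x. of_real (sqrt (h x) - 1) * u x) \<le> \<epsilon> * K * L2_norm M u"
    by (rule coef_bound_L2(2)[OF coef_sqrt_h_minus_1 uL])
  also have "\<dots> \<le> \<epsilon> * K * (sqrt \<epsilon> * (4 * sqrt \<epsilon> / coerc * G))"
    using energy_bounds(3)[of u] mult_left_mono[OF solves1_energy[OF s1] eps_sqrt(3)] eps_pos K_nonneg
    unfolding G_def by (intro mult_left_mono) auto
  \<comment> \<open>This term is even of second order in \<epsilon>; a factor sqrt \<epsilon> is
    given up to match the other one.\<close>
  also have "\<dots> \<le> \<epsilon> * K * (sqrt \<epsilon> * (4 * 1 / coerc * G))"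
    using eps_sqrt(3,4) coerc(1) G0 eps_pos K_nonneg
    by (intro mult_left_mono mult_right_mono divide_right_mono) auto
  finally have F: "L2_norm M (\<lambda>x. of_real (sqrt (h x) - 1) * u x) \<le> 4 * K / coerc * (\<epsilon> * sqrt \<epsilon>) * G"
    by (simp add: mult_ac)
  have "L2_norm M (\<lambda>x. of_real (sqrt (h x)) * u x - w x) = L2_norm M (\<lambda>x. e x + of_real (sqrt (h x) - 1) * u x)"
    by (rule L2_norm_cong) (simp add: e_def algebra_simps)
  also have "\<dots> \<le> L2_norm M e + L2_norm M (\<lambda>x. of_real (sqrt (h x) - 1) * u x)"
    by (rule L2_norm_add[OF eL coef_bound_L2(1)[OF coef_sqrt_h_minus_1 uL]])
  also have "\<dots> \<le> rate * (\<epsilon> * sqrt \<epsilon>) * G" using E F by (simp add: rate_def distrib_right)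
  finally show ?thesis by (simp add: G_def)
qed

lemma solves1_exists:
  assumes f: "f \<in> L2 M"
  shows "\<exists>u. solves1 f u"
proof -
  have "\<exists>u\<in>W12_zero (strip I) boundary_measures. \<forall>v\<in>W12_zero (strip I) boundary_measures.
     coef_form (strip I) A1 (\<lambda>x. shift * h x) u v = L2_inner M (\<lambda>x. of_real (sqrt (h x)) * f x) v"
  \<comment> \<open>22 is twice 11: the 2 is the one in \<open>q1_coercive\<close>, and 11 = 1 + 1 +
    9 adds the squared constants of \<open>energy_controls\<close>.\<close>
  proof (rule lax_milgram[OF open_strip test_boundary bounded_coefs(2,4), where c="coerc / 22"])
    fix u assume "u \<in> W12_zero (strip I) boundary_measures"
    then have u: "u \<in> form_domain I" by (simp add: form_domain_eq)
    note c = energy_controls[OF u]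
    have "(L2_norm M u)\<^sup>2 + (\<Sum>e\<in>Basis. (L2_norm M (weak_deriv (strip I) e u))\<^sup>2) = (L2_norm M u)\<^sup>2 + ((L2_norm M (d1 u))\<^sup>2 + (L2_norm M (d2 u))\<^sup>2)"
      by (simp add: Basis_real_prod)
    also have "\<dots> \<le> (energy u)\<^sup>2 + ((energy u)\<^sup>2 + (3 * energy u)\<^sup>2)"
      by (intro add_mono power_mono c) auto
    also have "\<dots> = 11 * (energy u)\<^sup>2" by (simp add: power_mult_distrib)
    finally have "coerc / 22 * ((L2_norm M u)\<^sup>2 + (\<Sum>e\<in>Basis. (L2_norm M (weak_deriv (strip I) e u))\<^sup>2)) \<le> coerc / 22 * (11 * (energy u)\<^sup>2)"
      using coerc(1) by (intro mult_left_mono) auto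
    also have "\<dots> = coerc / 2 * (energy u)\<^sup>2" by simp
    also have "\<dots> \<le> Re (q1 u u)" by (rule q1_coercive[OF u])
    finally show "coerc / 22 * ((L2_norm M u)\<^sup>2 + (\<Sum>e\<in>Basis. (L2_norm M (weak_deriv (strip I) e u))\<^sup>2))
        \<le> Re (coef_form (strip I) A1 (\<lambda>x. shift * h x) u u)" by (simp add: q1_coef_form)
  qed (use coerc(1) coef_bound_L2(1)[OF coef_sqrt_h f] in auto)
  then show ?thesis unfolding solves1_def q1_coef_form form_domain_eq winner_def using f by blast
qed

lemma bounded_resolvent1: "bounded_operator M (shifted_inverse k \<epsilon> (H_hat_eps I \<kappa> \<epsilon>))"
proof -
  let ?R = "shifted_inverse k \<epsilon> (H_hat_eps I \<kappa> \<epsilon>)"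
  have sub: "?R \<subseteq> L2 M \<times> L2 M" by (auto simp: resolvent1_iff)
  have L: "(\<lambda>x. of_real (sqrt (h x)) * w x) \<in> L2 M" if "solves1 f w" for f w
    using that by (intro coef_bound_L2(1)[OF coef_sqrt_h] form_domain_L2) (simp add: solves1_def)
  have dom: "Domain ?R = L2 M"
  proof
    show "Domain ?R \<subseteq> L2 M" using sub by blast
    show "L2 M \<subseteq> Domain ?R"
    proof
      fix f assume f: "f \<in> L2 M"
      then obtain w where w: "solves1 f w" using solves1_exists by blast
      have "(f, \<lambda>x. of_real (sqrt (h x)) * w x) \<in> ?R" unfolding resolvent1_iff using f L[OF w] w by auto
      then show "f \<in> Domain ?R" by blast
    qed
  qed
  have lin: "(\<lambda>x. a * f x + b * g x, \<lambda>x. a * u x + b * v x) \<in> ?R" if fu: "(f, u) \<in> ?R" and gv: "(g, v) \<in> ?R" for f u g v a b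
  proof -
    obtain w where w: "solves1 f w" "AE x in M. u x = of_real (sqrt (h x)) * w x" using fu by (auto simp: resolvent1_iff)
    obtain z where z: "solves1 g z" "AE x in M. v x = of_real (sqrt (h x)) * z x" using gv by (auto simp: resolvent1_iff)
    have "AE x in M. a * u x + b * v x = of_real (sqrt (h x)) * (a * w x + b * z x)"
      using w(2) z(2) by eventually_elim (simp add: algebra_simps)
    then show ?thesis unfolding resolvent1_iff
      using solves1_lincomb[OF w(1) z(1)] fu gv L2_lincomb by (auto simp: resolvent1_iff)
  qed
  have "L2_norm M u \<le> 2 * (4 * sqrt \<epsilon> / coerc) * L2_norm M f" if fu: "(f, u) \<in> ?R" for f u
  proof -
    obtain w where w: "solves1 f w" "AE x in M. u x = of_real (sqrt (h x)) * w x" and uL: "u \<in> L2 M" using fu by (auto simp: resolvent1_iff)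
    have wD: "w \<in> form_domain I" using w(1) by (simp add: solves1_def)
    have "L2_norm M u = L2_norm M (\<lambda>x. of_real (sqrt (h x)) * w x)"
      by (rule L2_norm_AE_cong[OF w(2) L2_measurable[OF uL] L2_measurable[OF L[OF w(1)]]])
    also have "\<dots> \<le> 2 * L2_norm M w" by (rule coef_bound_L2(2)[OF coef_sqrt_h form_domain_L2(1)[OF wD]])
    also have "\<dots> \<le> 2 * (4 * sqrt \<epsilon> / coerc * L2_norm M f)"
      using energy_controls(1)[OF wD] solves1_energy[OF w(1)] by linarith
    finally show ?thesis by (simp add: mult.assoc)
  qed
  then show ?thesis unfolding bounded_operator_def using sub dom lin by blast
qed

lemma operator_norm_difference:
  "operator_norm M (op_diff (shifted_inverse k \<epsilon> (H_hat_eps I \<kappa> \<epsilon>)) (shifted_inverse k \<epsilon> (H_hat_0 I \<kappa> \<epsilon>)))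
    \<le> ennreal (rate * (\<epsilon> * sqrt \<epsilon>))"
  unfolding operator_norm_def
proof (rule SUP_least, clarify)
  fix f z assume "(f, z) \<in> op_diff (shifted_inverse k \<epsilon> (H_hat_eps I \<kappa> \<epsilon>)) (shifted_inverse k \<epsilon> (H_hat_0 I \<kappa> \<epsilon>))"
    and f1: "L2_norm M f \<le> 1"
  then obtain u v where u: "(f, u) \<in> shifted_inverse k \<epsilon> (H_hat_eps I \<kappa> \<epsilon>)" and v: "(f, v) \<in> shifted_inverse k \<epsilon> (H_hat_0 I \<kappa> \<epsilon>)"
    and z: "z = (\<lambda>x. u x - v x)" by (auto simp: op_diff_def)
  obtain w where w: "solves1 f w" "AE x in M. u x = of_real (sqrt (h x)) * w x" and uL: "u \<in> L2 M" using u by (auto simp: resolvent1_iff)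
  have s0: "solves0 f v" using v unfolding resolvent0_iff by (rule range0_solution)
  have vL: "v \<in> L2 M" and wL: "w \<in> L2 M" using s0 w(1) by (auto simp: solves0_def solves1_def form_domain_L2)
  have "L2_norm M z = L2_norm M (\<lambda>x. of_real (sqrt (h x)) * w x - v x)"
    unfolding z by (rule L2_norm_AE_cong, use w(2) in eventually_elim, simp)
      (intro L2_measurable L2_diff uL vL coef_bound_L2(1)[OF coef_sqrt_h] wL)+
  also have "\<dots> \<le> rate * (\<epsilon> * sqrt \<epsilon>) * L2_norm M f" by (rule resolvent_difference[OF w(1) s0])
  also have "\<dots> \<le> rate * (\<epsilon> * sqrt \<epsilon>) * 1"
    using rate_nonneg eps_pos by (intro mult_left_mono f1) auto
  finally show "ennreal (L2_norm M z) \<le> ennreal (rate * (\<epsilon> * sqrt \<epsilon>))" by (simp add: ennreal_leI)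
qed

end

section \<open>Choice of the constants and conclusion\<close>

lemma admissible_curvature:
  assumes "admissible_curve I \<gamma> \<kappa>'"
  shows "open I" "is_interval I" "I \<noteq> {}"
    and "curvature I \<gamma> \<in> borel_measurable (lebesgue_on_open I)"
    and "bdd_above ((\<lambda>s. \<bar>curvature I \<gamma> s\<bar>) ` I)" "bdd_below (curvature I \<gamma> ` I)"
proof -
  show I: "open I" "is_interval I" "I \<noteq> {}" using assms by (auto simp: admissible_curve_def)
  have "curvature I \<gamma> \<in> borel_measurable (restrict_space borel I)"
    using assms by (intro borel_measurable_continuous_on_restrict uniformly_continuous_imp_continuous) (simp add: admissible_curve_def)
  moreover have "sets (restrict_space borel I) = sets (lebesgue_on_open I)" by (simp add: sets_restrict_space)
  ultimately show "curvature I \<gamma> \<in> borel_measurable (lebesgue_on_open I)"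
    using measurable_cong_sets by blast
  have "bounded (curvature I \<gamma> ` I)" using assms by (simp add: admissible_curve_def)
  then obtain b where "\<And>s. s \<in> I \<Longrightarrow> \<bar>curvature I \<gamma> s\<bar> \<le> b" by (auto simp: bounded_iff)
  then show "bdd_above ((\<lambda>s. \<bar>curvature I \<gamma> s\<bar>) ` I)" by (intro bdd_aboveI2)
  show "bdd_below (curvature I \<gamma> ` I)" using \<open>bounded _\<close> by (rule bounded_imp_bdd_below)
qed

theorem theorem3p1:
  fixes k m K K' :: real
  assumes "k > - m"
  shows "\<exists>\<epsilon>\<^sub>0>0. \<exists>C\<^sub>0>0. \<forall>(I :: real set) (\<gamma> :: real \<Rightarrow> real \<times> real) (\<kappa>' :: real \<Rightarrow> real).
    admissible_curve I \<gamma> \<kappa>' \<and>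
    m \<le> (INF s\<in>I. curvature I \<gamma> s) \<and>
    (SUP s\<in>I. \<bar>curvature I \<gamma> s\<bar>) = K \<and>
    esssup (lebesgue_on_open I) (\<lambda>s. ereal \<bar>\<kappa>' s\<bar>) = ereal K' \<longrightarrow>
    (\<forall>\<epsilon>. 0 < \<epsilon> \<and> \<epsilon> < \<epsilon>\<^sub>0 \<and> \<epsilon> * K < 1 \<and> inj_on (strip_map I \<gamma> \<epsilon>) (closure I \<times> {0..1}) \<longrightarrow>
      (let M = strip_measure I;
           R = shifted_inverse k \<epsilon> (H_hat_eps I (curvature I \<gamma>) \<epsilon>);
           R\<^sub>0 = shifted_inverse k \<epsilon> (H_hat_0 I (curvature I \<gamma>) \<epsilon>)
       in bounded_operator M R \<and> bounded_operator M R\<^sub>0 \<and>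
          operator_norm M (op_diff R R\<^sub>0) \<le> ennreal (C\<^sub>0 * \<epsilon> powr (3/2))))"
proof -
  \<comment> \<open>The constants are fixed before any curve is given, when \<open>K\<close> could
    still be negative; once a curve is present, \<open>L = K\<close>.\<close>
  define L where "L = max K 0"
  \<comment> \<open>\<open>c\<close> and \<open>B\<close> anticipate the values of
    \<open>coerc\<close> and \<open>form_const\<close>, which are only available inside the
    locale.\<close>
  define c where "c = min (min 1 (2 - pi\<^sup>2 / 8)) (k + m)"
  define B where "B = (23 + \<bar>k\<bar>) * L"
  \<comment> \<open>The three bounds provide \<open>\<epsilon> \<le> 1\<close>,
    \<open>\<epsilon> * K \<le> 1/2\<close> and \<open>B * sqrt \<epsilon> \<le> c / 2\<close>; the
    added 1 avoids division by zero.\<close>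
  define \<epsilon>0 where "\<epsilon>0 = min 1 (min (1 / (2 * (L + 1))) ((c / (2 * (B + 1)))\<^sup>2))"
  \<comment> \<open>The value of \<open>rate\<close>, increased by 1 so that it is positive even for
    \<open>K = 0\<close>.\<close>
  define C0 where "C0 = 2 / c * (L + B / c) + 4 * L / c + 1"
  have c0: "0 < c" using pi_sq_bound(1) assms by (simp add: c_def)
  have L0: "0 \<le> L" and B0: "0 \<le> B" by (simp_all add: L_def B_def)
  have pos: "0 < \<epsilon>0" "0 < C0"
    using c0 L0 B0 by (auto simp: \<epsilon>0_def C0_def intro!: add_nonneg_pos add_nonneg_nonneg)
  show ?thesis
  proof (rule exI[of _ \<epsilon>0], intro conjI pos(1), rule exI[of _ C0], intro conjI pos(2) allI impI)
    fix I :: "real set" and \<gamma> \<kappa>' \<epsilon>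
    assume "admissible_curve I \<gamma> \<kappa>' \<and> m \<le> (INF s\<in>I. curvature I \<gamma> s) \<and> (SUP s\<in>I. \<bar>curvature I \<gamma> s\<bar>) = K \<and>
      esssup (lebesgue_on_open I) (\<lambda>s. ereal \<bar>\<kappa>' s\<bar>) = ereal K'"
    then have adm: "admissible_curve I \<gamma> \<kappa>'" and m: "m \<le> (INF s\<in>I. curvature I \<gamma> s)"
      and K: "(SUP s\<in>I. \<bar>curvature I \<gamma> s\<bar>) = K" by auto
    assume "0 < \<epsilon> \<and> \<epsilon> < \<epsilon>0 \<and> \<epsilon> * K < 1 \<and> inj_on (strip_map I \<gamma> \<epsilon>) (closure I \<times> {0..1})"
    then have e: "0 < \<epsilon>" "\<epsilon> < 1" "\<epsilon> < 1 / (2 * (L + 1))" "\<epsilon> < (c / (2 * (B + 1)))\<^sup>2" by (auto simp: \<epsilon>0_def)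
    note a = admissible_curvature[OF adm]
    have bound: "\<bar>curvature I \<gamma> s\<bar> \<le> K" if "s \<in> I" for s
      unfolding K[symmetric] using that a(5) by (rule cSUP_upper)
    then have "0 \<le> K" using a(3) abs_ge_zero order_trans by blast
    then have LK: "L = K" by (simp add: L_def)
    have "\<epsilon> * (2 * (L + 1)) < 1" using e(3) L0 by (simp add: pos_less_divide_eq)
    then have eK: "\<epsilon> * K \<le> 1/2" using e(1) by (simp add: LK distrib_left)
    have "sqrt \<epsilon> \<le> c / (2 * (B + 1))" using e(4) c0 B0 by (intro real_le_lsqrt) auto
    then have "B * sqrt \<epsilon> \<le> B * (c / (2 * (B + 1)))" by (rule mult_left_mono[OF _ B0])
    also have "\<dots> \<le> c / 2" using c0 B0 by (simp add: field_simps)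
    finally have Be: "B * sqrt \<epsilon> \<le> c / 2" .
    interpret curved_strip I "curvature I \<gamma>" K m k \<epsilon>
      by unfold_locales (use a bound \<open>0 \<le> K\<close> assms e eK m cINF_lower[OF a(6)] in \<open>auto intro: order_trans\<close>)
    have cB: "coerc = c" "form_const = B" by (simp_all add: coerc_def form_const_def c_def B_def LK)
    interpret small_strip I "curvature I \<gamma>" K m k \<epsilon> by unfold_locales (unfold cB, rule Be)
    have "\<epsilon> powr (3/2) = \<epsilon> powr (1 + 1/2)" by simp
    also have "\<dots> = \<epsilon> * sqrt \<epsilon>" unfolding powr_add using e(1) by (simp add: powr_half_sqrt)
    finally have "rate * (\<epsilon> * sqrt \<epsilon>) \<le> C0 * \<epsilon> powr (3/2)"
      using e(1) by (simp add: rate_def cB LK C0_def mult_right_mono)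
    then show "let M = strip_measure I; R = shifted_inverse k \<epsilon> (H_hat_eps I (curvature I \<gamma>) \<epsilon>);
        R\<^sub>0 = shifted_inverse k \<epsilon> (H_hat_0 I (curvature I \<gamma>) \<epsilon>)
       in bounded_operator M R \<and> bounded_operator M R\<^sub>0 \<and>
          operator_norm M (op_diff R R\<^sub>0) \<le> ennreal (C0 * \<epsilon> powr (3/2))"
      using bounded_resolvent1 bounded_resolvent0 order_trans[OF operator_norm_difference ennreal_leI]
      by (simp add: strip_measure_def)
  qed
qed

end
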